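(* Let $\alpha,\lambda>-1$, $r>0$, $1\le p<\infty$, and suppose $p(\alpha+1)>\lambda+1$. Let $f\in L^p_\lambda(T_B)$. Then the following conditions are equivalent: (a) $f\in BMO^p_r$. (b) $f=f_1+f_2$ with $f_1\in BO$ and $f_2\in BA^p$. (c) $H^{(\alpha)}_f$ and $H^{(\alpha)}_{\overline f}$ are both bounded on $A^p_\lambda(T_B)$.
   Context: Let $n$ be a positive integer. For $z=(z_1,\dots,z_n)=x+iy\in\mathbb C^n$ write $z'=(z_1,\dots,z_{n-1})$, $y'=(y_1,\dots,y_{n-1})$. The tubular domain is $T_B=\{z=x+iy\in\mathbb C^n: x\in\mathbb R^n,\ y\in\mathbb R^n,\ |y'|^2<y_n\}$. Put $\rho(z,w)=\frac14\big(\sum_{j=1}^{n-1}(z_j-\overline{w_j})^2-2i(z_n-\overline{w_n})\big)$ for $z,w\in T_B$ (it has positive real part; powers are principal branches), and $\rho(z)=\rho(z,z)=y_n-|y'|^2$. For $s>-1$ let $dV_s(z)=\rho(z)^s\,dV(z)$, where $dV$ is Lebesgue measure on $\mathbb C^n$. $L^p_s(T_B)$ is the space of measurable $f$ on $T_B$ with $\|f\|_{L^p_s}^p=\int_{T_B}|f|^p\,dV_s<\infty$, and $A^p_s(T_B)$ is its subspace of holomorphic functions. Projection: $P_\alpha f(z)=\int_{T_B}K_\alpha(z,w)f(w)\,dV_\alpha(w)$, with Bergman kernel $K_\alpha(z,w)=\frac{\Gamma(n+1+\alpha)}{2^{n+1}\pi^n\Gamma(\alpha+1)}\rho(z,w)^{-(n+1+\alpha)}$.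 When $p(\alpha+1)>\lambda+1$, $P_\alpha$ is a bounded projection of $L^p_\lambda(T_B)$ onto $A^p_\lambda(T_B)$. Hankel operators: $H^{(\alpha)}_f=(I-P_\alpha)M_fP_\alpha$, where $M_f$ is multiplication by $f$. For $f\in L^p_\lambda(T_B)$ it is defined on bounded functions $g\in A^p_\lambda(T_B)$ (for which $fg\in L^p_\lambda(T_B)$) by $H^{(\alpha)}_fg=fg-P_\alpha(fg)$; these $g$ are dense in $A^p_\lambda(T_B)$. "Bounded on $A^p_\lambda(T_B)$" means that there is a constant $C$ with $\|H^{(\alpha)}_fg\|_{L^p_\lambda}\le C\|g\|_{L^p_\lambda}$ for all such $g$, i.e. $H^{(\alpha)}_f$ extends to a bounded operator $A^p_\lambda(T_B)\to L^p_\lambda(T_B)$. Bergman metric: $b_{ij}(z)=\frac1{n+1+\alpha}\frac{\partial^2}{\partial\bar z_i\partial z_j}\log K_\alpha(z,z)=-\frac{\partial^2}{\partial\bar z_i\partial z_j}\log\rho(z)$ and $\mathbf B(z)=(b_{ij}(z))$ (positive definite Hermitian). For a $C^1$ curve $\gamma:[0,1]\to T_B$, $l(\gamma)=\int_0^1\langle\mathbf B(\gamma(t))\gamma'(t),\gamma'(t)\rangle^{1/2}dt$; $\beta(z,w)=\inf\{l(\gamma):\gamma(0)=z,\gamma(1)=w\}$; $D(z,r)=\{w\in T_B:\beta(z,w)<r\}$; $|D(z,r)|=V_\lambda(D(z,r))$. Function classes (averages with respect to $dV_\lambda$): $\widehat f_r(z)=\frac1{|D(z,r)|}\int_{D(z,r)}f\,dV_\lambda$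 and $$MO_r(f)(z)=\Big(\frac1{|D(z,r)|}\int_{D(z,r)}|f(w)-\widehat f_r(z)|^p\,dV_\lambda(w)\Big)^{1/p}.$$ $BMO^p_r$ is the set of $f\in L^p_\lambda(T_B)$ with $\sup_{z\in T_B}MO_r(f)(z)<\infty$. $BO=BO_r$ is the set of continuous $f$ on $T_B$ with $\sup_{z\in T_B}\sup_{w\in D(z,r)}|f(z)-f(w)|<\infty$ (independent of $r>0$). $BA^p=BA^p_r$ is the set of measurable $f$ on $T_B$ such that $z\mapsto\frac1{|D(z,r)|}\int_{D(z,r)}|f|^p\,dV_\lambda$ is bounded on $T_B$ (independent of $r>0$). *)

theory Defs
  imports "HOL-Analysis.Analysis"
begin

text \<open>
  Points of \<open>\<complex>\<^sup>n\<close> are elements of \<^typ>\<open>complex ^ 'n\<close> for a finite linearly ordered index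
  type of size \<open>n \<ge> 1\<close>, whose largest element plays the role of the index \<open>n\<close>.  Functions on the
  tubular domain are total functions of which only the values on the domain matter.
\<close>

type_synonym 'n cvec = "(complex, 'n) vec"

definition last_index :: "'n::{finite,linorder}" where
  "last_index = Max UNIV"

definition rho :: "'n::{finite,linorder} cvec \<Rightarrow> real" where
  "rho z = Im (z $ last_index) - (\<Sum>j\<in>UNIV - {last_index}. (Im (z $ j))\<^sup>2)"

definition tube :: "('n::{finite,linorder} cvec) set" where
  "tube = {z. (\<Sum>j\<in>UNIV - {last_index}. (Im (z $ j))\<^sup>2) < Im (z $ last_index)}"

definition rho_ker :: "'n::{finite,linorder} cvec \<Rightarrow> 'n cvec \<Rightarrow> complex" where
  "rho_ker z w =
     ((\<Sum>j\<in>UNIV - {last_index}. (z $ j - cnj (w $ j))\<^sup>2)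
        - 2 * \<i> * (z $ last_index - cnj (w $ last_index))) / 4"

lemma rho_ker_diag: "rho_ker z z = of_real (rho z)"
proof -
  have 1: "(z $ j - cnj (z $ j))\<^sup>2 = - 4 * of_real ((Im (z $ j))\<^sup>2)" for j
    by (simp add: complex_eq_iff power2_eq_square)
  have 2: "2 * \<i> * (z $ last_index - cnj (z $ last_index)) = - 4 * of_real (Im (z $ last_index))"
    by (simp add: complex_eq_iff)
  show ?thesis
    unfolding rho_ker_def 1 2 rho_def
    by (simp add: sum_negf flip: sum_distrib_left)
qed


subsection \<open>Weighted Lebesgue and Bergman spaces\<close>

definition V :: "real \<Rightarrow> ('n::{finite,linorder} cvec) measure" where
  "V s = density (lebesgue_on tube) (\<lambda>z. ennreal (rho z powr s))"

definition Lp :: "real \<Rightarrow> real \<Rightarrow> ('n::{finite,linorder} cvec \<Rightarrow> complex) set" where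
  "Lp s p = {f. f \<in> borel_measurable (V s) \<and> integrable (V s) (\<lambda>z. cmod (f z) powr p)}"

definition Lp_norm :: "real \<Rightarrow> real \<Rightarrow> ('n::{finite,linorder} cvec \<Rightarrow> complex) \<Rightarrow> real" where
  "Lp_norm s p f = (LINT z|V s. cmod (f z) powr p) powr (1 / p)"

definition holomorphic_Cn :: "('n::finite cvec \<Rightarrow> complex) \<Rightarrow> ('n cvec) set \<Rightarrow> bool" where
  "holomorphic_Cn f S \<longleftrightarrow>
     (\<forall>z\<in>S. \<exists>D. (f has_derivative D) (at z) \<and> (\<forall>c v. D (c *s v) = c * D v))"

definition Ap :: "real \<Rightarrow> real \<Rightarrow> ('n::{finite,linorder} cvec \<Rightarrow> complex) set" where
  "Ap s p = {f \<in> Lp s p. holomorphic_Cn f tube}"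


subsection \<open>Bergman projection and Hankel operators\<close>

definition bergman_kernel ::
    "real \<Rightarrow> 'n::{finite,linorder} cvec \<Rightarrow> 'n cvec \<Rightarrow> complex" where
  "bergman_kernel \<alpha> z w =
     of_real (Gamma (real CARD('n) + 1 + \<alpha>) /
              (2 ^ (CARD('n) + 1) * pi ^ CARD('n) * Gamma (\<alpha> + 1)))
     * rho_ker z w powr of_real (- (real CARD('n) + 1 + \<alpha>))"

definition bergman_proj ::
    "real \<Rightarrow> ('n::{finite,linorder} cvec \<Rightarrow> complex) \<Rightarrow> 'n cvec \<Rightarrow> complex" where
  "bergman_proj \<alpha> f z = (LINT w|V \<alpha>. bergman_kernel \<alpha> z w * f w)"

definition hankel ::
    "real \<Rightarrow> ('n::{finite,linorder} cvec \<Rightarrow> complex) \<Rightarrow>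
      ('n cvec \<Rightarrow> complex) \<Rightarrow> 'n cvec \<Rightarrow> complex" where
  "hankel \<alpha> f g z = f z * g z - bergman_proj \<alpha> (\<lambda>w. f w * g w) z"

definition hankel_bounded ::
    "real \<Rightarrow> real \<Rightarrow> real \<Rightarrow> ('n::{finite,linorder} cvec \<Rightarrow> complex) \<Rightarrow> bool" where
  "hankel_bounded \<alpha> s p f \<longleftrightarrow>
     (\<exists>C. \<forall>g\<in>Ap s p. bounded (g ` tube) \<longrightarrow>
        hankel \<alpha> f g \<in> Lp s p \<and> Lp_norm s p (hankel \<alpha> f g) \<le> C * Lp_norm s p g)"


subsection \<open>Bergman metric\<close>

definition dir_deriv :: "('n::finite cvec \<Rightarrow> complex) \<Rightarrow> 'n cvec \<Rightarrow> 'n cvec \<Rightarrow> complex"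
  where "dir_deriv f v z = vector_derivative (\<lambda>t. f (z + t *\<^sub>R v)) (at 0)"

text \<open>Wirtinger derivatives in the \<open>j\<close>-th variable and in its conjugate.\<close>

definition wirtinger :: "'n::finite \<Rightarrow> ('n cvec \<Rightarrow> complex) \<Rightarrow> 'n cvec \<Rightarrow> complex" where
  "wirtinger j f z = (dir_deriv f (axis j 1) z - \<i> * dir_deriv f (axis j \<i>) z) / 2"

definition wirtinger_bar :: "'n::finite \<Rightarrow> ('n cvec \<Rightarrow> complex) \<Rightarrow> 'n cvec \<Rightarrow> complex" where
  "wirtinger_bar j f z = (dir_deriv f (axis j 1) z + \<i> * dir_deriv f (axis j \<i>) z) / 2"

definition bergman_matrix :: "real \<Rightarrow> 'n::{finite,linorder} cvec \<Rightarrow> ('n cvec, 'n) vec" where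
  "bergman_matrix \<alpha> z =
     (\<chi> i j. wirtinger_bar i (wirtinger j (\<lambda>u. ln (bergman_kernel \<alpha> u u))) z
             / of_real (real CARD('n) + 1 + \<alpha>))"

text \<open>
  The Hermitian form \<open>\<langle>B v, v\<rangle>\<close> is real; the real part only changes the type.
\<close>

definition bergman_form :: "real \<Rightarrow> 'n::{finite,linorder} cvec \<Rightarrow> 'n cvec \<Rightarrow> real" where
  "bergman_form \<alpha> z v = Re (\<Sum>i\<in>UNIV. (bergman_matrix \<alpha> z *v v) $ i * cnj (v $ i))"

definition bergman_length :: "real \<Rightarrow> (real \<Rightarrow> 'n::{finite,linorder} cvec) \<Rightarrow> real" where
  "bergman_length \<alpha> \<gamma> =
     integral {0..1} (\<lambda>t. sqrt (bergman_form \<alpha> (\<gamma> t) (vector_derivative \<gamma> (at t))))"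

text \<open>
  \<open>C1_differentiable_on\<close> asks for two-sided derivatives at \<open>0\<close> and \<open>1\<close>; this is no restriction,
  since a \<open>C\<^sup>1\<close> curve on \<open>[0,1]\<close> extends affinely beyond its end points.
\<close>

definition bergman_dist ::
    "real \<Rightarrow> 'n::{finite,linorder} cvec \<Rightarrow> 'n cvec \<Rightarrow> real" where
  "bergman_dist \<alpha> z w =
     Inf {bergman_length \<alpha> \<gamma> | \<gamma>.
       \<gamma> C1_differentiable_on {0..1} \<and> \<gamma> ` {0..1} \<subseteq> tube \<and> \<gamma> 0 = z \<and> \<gamma> 1 = w}"

definition bergman_ball ::
    "real \<Rightarrow> 'n::{finite,linorder} cvec \<Rightarrow> real \<Rightarrow> ('n cvec) set" where
  "bergman_ball \<alpha> z r = {w \<in> tube. bergman_dist \<alpha> z w < r}"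


subsection \<open>Oscillation and averages\<close>

text \<open>
  The parameter \<open>\<alpha>\<close> enters only through the Bergman metric, where its contribution cancels:
  the metric is \<open>- \<partial>\<^sup>2 log \<rho>\<close>.
\<close>

definition ball_avg ::
    "real \<Rightarrow> real \<Rightarrow> real \<Rightarrow> ('n::{finite,linorder} cvec \<Rightarrow> complex) \<Rightarrow> 'n cvec \<Rightarrow> complex"
  where
  "ball_avg \<alpha> s r f z =
     (LINT w:bergman_ball \<alpha> z r|V s. f w) / of_real (measure (V s) (bergman_ball \<alpha> z r))"

definition MO ::
    "real \<Rightarrow> real \<Rightarrow> real \<Rightarrow> real \<Rightarrow> ('n::{finite,linorder} cvec \<Rightarrow> complex) \<Rightarrow> 'n cvec \<Rightarrow> real"
  where
  "MO \<alpha> s p r f z =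
     ((LINT w:bergman_ball \<alpha> z r|V s. cmod (f w - ball_avg \<alpha> s r f z) powr p)
        / measure (V s) (bergman_ball \<alpha> z r)) powr (1 / p)"

definition BMO ::
    "real \<Rightarrow> real \<Rightarrow> real \<Rightarrow> real \<Rightarrow> ('n::{finite,linorder} cvec \<Rightarrow> complex) set" where
  "BMO \<alpha> s p r = {f \<in> Lp s p. bdd_above (MO \<alpha> s p r f ` tube)}"

definition BO :: "real \<Rightarrow> real \<Rightarrow> ('n::{finite,linorder} cvec \<Rightarrow> complex) set" where
  "BO \<alpha> r = {f. continuous_on tube f \<and>
     (\<exists>M. \<forall>z\<in>tube. \<forall>w\<in>bergman_ball \<alpha> z r. cmod (f z - f w) \<le> M)}"

text \<open>
  A member of \<open>BA\<close> is not assumed to be in any \<open>L\<^sup>p\<close> space, so the average is taken in the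
  extended nonnegative reals (the Bochner integral of a non-integrable function is \<open>0\<close>).
\<close>

definition BA ::
    "real \<Rightarrow> real \<Rightarrow> real \<Rightarrow> real \<Rightarrow> ('n::{finite,linorder} cvec \<Rightarrow> complex) set" where
  "BA \<alpha> s p r = {f. f \<in> borel_measurable (V s) \<and>
     (\<exists>M::real. \<forall>z\<in>tube.
        (\<integral>\<^sup>+w\<in>bergman_ball \<alpha> z r. ennreal (cmod (f w) powr p) \<partial>V s)
          / emeasure (V s) (bergman_ball \<alpha> z r) \<le> ennreal M)}"

end

theory Submission
	imports Defs "HOL-Complex_Analysis.Complex_Analysis" "HOL-Probability.Distributions" "HOL-Probability.Sinc_Integral"
begin

text \<open>
	The automorphisms \<open>tube_aut\<close> act transitively and reduce every estimate to the point \<open>bpt\<close>; the Bergman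
	distance is explicit, \<open>cosh\<^sup>2\<close> of it being \<open>|rho(z,w)|\<^sup>2 / (rho(z) rho(w))\<close>.  All three conditions are equivalent
	to the oscillation of \<open>f\<close> about some constant in each ball being bounded.  Averaging against a bump splits such an \<open>f\<close>
	into a part of bounded oscillation, which grows at most like a small power of that quotient, and a part
	satisfying a Carleson condition; the reproducing formula and a Schur test then bound the Hankel
	operator.  Conversely, testing both operators on powers of \<open>rho(w,z)\<close> approximates \<open>f\<close> near \<open>z\<close> by
	a holomorphic \<open>h1\<close> and an antiholomorphic \<open>cnj h2\<close>; as \<open>h1 - cnj h2\<close> is small in the mean, \<open>h1\<close> is almost constant.
\<close>

text \<open>The hypothesis \<open>p * (\<alpha> + 1) > s + 1\<close> enters as slack: it leaves an
  open range of exponents in the Schur test, so a factor \<open>FF z w powr ep\<close> with small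
  \<open>ep > 0\<close> may multiply the kernel. A function of bounded oscillation grows at most
  linearly in the distance, hence logarithmically in \<open>FF\<close>, and is absorbed by that
  factor. In the converse, \<open>h1\<close> has to be controlled by \<open>h1 - cnj h2\<close>
  alone. A circle integral separates the two: a weight that extracts the derivative of
  \<open>h1\<close> annihilates \<open>cnj h2\<close>. Powers of \<open>rho_ker\<close> suit as test
  functions because they have no zeros: the projection of \<open>f * g\<close> times the inverse
  power approximates \<open>f\<close> itself. The exact constant of the kernel matters, because the
  Hankel estimate contains a term \<open>f1 z * (g z - P g z)\<close> that has to vanish. It is
  computed by averaging over rotations of the first \<open>n - 1\<close> variables and shifting
  lines in a half plane. A technical obstacle is that \<open>V s\<close> carries Lebesgue sets of
  the tube while kernels in two variables call for Fubini. Hence the estimates concern Borel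
  functions and \<open>W s\<close>, and representatives carry them over at the end.\<close>

abbreviation NI :: "'a measure => ('a => ennreal) => ennreal" where
	"NI == nn_integral"

abbreviation lx :: "'n::{finite,linorder}" where
	"lx == last_index"

abbreviation BM :: "('a::topological_space => 'b::topological_space) set" where
	"BM == borel_measurable borel"

section \<open>Invariance of Lebesgue measure on complex vectors\<close>

lemma nn_integral_lborel_translate:
	fixes f :: "'a::euclidean_space => ennreal"
	assumes [measurable]: "f : BM"
	shows "(NI lborel (%x. f (x + c))) = (NI lborel (%x. f x))"
proof -
	have "(NI lborel (%x. f x)) = (NI ((distr lborel borel ((+) c))) (%x. f x))"
		by (simp only: lborel_distr_plus)
	also have "... = (NI lborel (%x. f (x + c)))"
		by (subst nn_integral_distr) (auto simp: add.commute)
	finally show ?thesis ..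
qed

lemma nn_integral_lborel_uminus:
	fixes f :: "'a::euclidean_space => ennreal"
	assumes [measurable]: "f : BM"
	shows "(NI lborel (%x. f (- x))) = (NI lborel (%x. f x))"
proof -
	have "(lborel :: 'a measure) = distr lborel borel (%x. - x)"
		using lborel_affine[of "-1" "0::'a"] by (simp add: density_1)
	hence "(NI lborel (%x. f x)) = (NI ((distr lborel borel (%x. - x))) (%x. f x))"
		by simp
	also have "... = (NI lborel (%x. f (- x)))"
		by (subst nn_integral_distr) auto
	finally show ?thesis ..
qed

text \<open>Fubini applied to \<open>f (U x) \<one>\<^sub>B y\<close> with \<open>B\<close> the unit ball, which \<open>U\<close> preserves.\<close>

lemma nn_integral_lborel_isometry:
	fixes U :: "'a::euclidean_space => 'a" and f :: "'a => ennreal"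
	assumes U: "linear U" "!!x. norm (U x) = norm x" and [measurable]: "f : BM"
	shows "(NI lborel (%x. f (U x))) = (NI lborel (%x. f x))"
proof -
	interpret U: linear U by fact
	have inj: "inj U"
		unfolding linear_injective_0[OF U(1)] using U(2) by (metis norm_eq_zero)
	then obtain V where V: "linear V" "!!x. V (U x) = x" "!!x. U (V x) = x"
		using linear_injective_isomorphism[OF U(1)] by blast
	have nV: "norm (V x) = norm x" for x using U(2)[of "V x"] V by simp
	interpret V: linear V by (rule V(1))
	have [measurable]: "U : BM" "V : BM"
		using U(1) V(1) by (auto intro!: borel_measurable_continuous_onI linear_continuous_on linear_linear[THEN iffD2])
	define B where "B = (ball 0 1 :: 'a set)"
	have [measurable]: "B : sets borel" by (simp add: B_def)
	have B0: "emeasure lborel B ~= 0" "emeasure lborel B ~= \<infinity>"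
		unfolding B_def by (auto simp: emeasure_ball less_imp_neq[symmetric])
	have "(NI lborel (%x. f (U x))) * emeasure lborel B = (NI lborel (%x. (NI lborel (%y. f (U x) * indicator B y))))"
		by (simp add: nn_integral_cmult nn_integral_multc)
	also have "... = (NI lborel (%y. (NI lborel (%x. f (U x) * indicator B y))))"
		by (rule lborel_pair.Fubini') measurable
	\<comment> \<open>Shifting \<open>x\<close> by \<open>V y\<close> turns \<open>U x\<close> into
	  \<open>U x + y\<close>; after exchanging the order, shifting \<open>y\<close> by
	  \<open>- U x\<close> frees \<open>f\<close> of \<open>x\<close>. The remaining integral over
	  \<open>x\<close> is the measure of a translate of \<open>B\<close>, because \<open>V\<close> is
	  an isometry as well.\<close>
	also have "... = (NI lborel (%y. (NI lborel (%x. f (U (x + V y)) * indicator B y))))"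
		by (subst nn_integral_lborel_translate[where f="%x. f (U x) * indicator B y" for y]) auto
	also have "... = (NI lborel (%x. (NI lborel (%y. f (y + U x) * indicator B y))))"
		by (subst lborel_pair.Fubini') (auto simp: U.add V(3) add.commute)
	also have "... = (NI lborel (%x. (NI lborel (%y. f y * indicator B (y - U x)))))"
		by (subst nn_integral_lborel_translate[where f="%y. f y * indicator B (y - U x)" and c="U x" for x, symmetric]) auto
	also have "... = (NI lborel (%y. (NI lborel (%x. f y * indicator B (y - U x)))))"
		by (rule lborel_pair.Fubini') measurable
	also have "... = (NI lborel (%y. f y * (NI lborel (%x. indicator B (y - U x)))))"
		by (simp add: nn_integral_cmult)
	also have "... = (NI lborel (%y. f y * emeasure lborel B))"
	proof -
		have "(NI lborel (%x. indicator B (y - U x))) = emeasure lborel B" for y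
		proof -
			have "indicator B (y - U x) = (indicator B (x + - V y) :: ennreal)" for x
			proof -
				have "norm (y - U x) = norm (x - V y)"
					using nV[of "y - U x"] by (simp add: V.diff V(2) norm_minus_commute)
				thus ?thesis by (simp add: B_def indicator_def)
			qed
			hence "(NI lborel (%x. indicator B (y - U x))) = (NI (lborel::'a measure) (%x. indicator B (x + - V y)))"
				by simp
			also have "... = (NI (lborel::'a measure) (%x. indicator B x))"
				by (rule nn_integral_lborel_translate) measurable
			finally show ?thesis by simp
		qed
		thus ?thesis by simp
	qed
	also have "... = (NI lborel (%y. f y)) * emeasure lborel B"
		by (simp add: nn_integral_multc)
	finally show ?thesis
		using B0 by (simp add: mult.commute[of _ "emeasure lborel B"] ennreal_mult_cancel_left)
qed

lemma axis_measurable [measurable]: "(axis l :: complex => (complex,'n::finite) vec) : BM"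
proof (intro borel_measurable_continuous_onI)
	have "continuous_on UNIV (%x. if i = l then x else 0 :: complex)" for i
		by (cases "i = l") auto
	thus "continuous_on UNIV (axis l :: complex => (complex,'n) vec)"
		unfolding axis_def[abs_def] by (intro continuous_on_vec_lambda)
qed

lemma vec_nth_measurable [measurable (raw)]:
	fixes f :: "'a => (complex,'n::finite) vec"
	assumes "f : borel_measurable M"
	shows "(%x. f x $ j) : borel_measurable M"
	using measurable_compose[OF assms, of "%x. x $ j" borel]
	by (simp add: borel_measurable_continuous_onI continuous_on_component)

text \<open>
	Integration over the coordinate \<open>l\<close> first.  The density \<open>k\<close> in that coordinate is a normalisation
	which makes it possible to keep all coordinates in the outer integral.
\<close>

lemma nn_integral_cvec_coordinate:
	fixes f :: "'n::finite cvec => ennreal" and k :: "complex => ennreal"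
	assumes [measurable]: "f : BM" "k : BM"
		and k: "(NI lborel (%c. k c)) = 1"
	shows "(NI lborel (%u. f u)) = (NI lborel (%u. k (u $ l) * (NI lborel (%c. f (u + axis l (c - u $ l))))))"
proof -
	have k': "(NI lborel (%c. k (a - c))) = 1" for a
	proof -
		have "(NI lborel (%c. k (a - c))) = (NI lborel (%c. k (- (c + - a))))" by simp
		also have "... = 1"
			by (subst nn_integral_lborel_translate[where f="%c. k (- c)"])
				 (auto simp: nn_integral_lborel_uminus k)
		finally show ?thesis .
	qed
	\<comment> \<open>\<open>k\<close> integrates to 1 along every reflected translate, so an auxiliary
	  variable \<open>c\<close> can be introduced at no cost. Translating \<open>u\<close> by
	  \<open>axis l c\<close> moves it from \<open>k\<close> into \<open>f\<close>, where it takes over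
	  the role of the coordinate \<open>l\<close>.\<close>
	have "(NI lborel (%u. f u)) = (NI lborel (%u. (NI lborel (%c. f u * k (u $ l - c)))))"
		by (simp add: nn_integral_cmult k')
	also have "... = (NI lborel (%c. (NI lborel (%u. f u * k (u $ l - c)))))"
		by (rule lborel_pair.Fubini') measurable
	also have "... = (NI lborel (%c. (NI lborel (%u. f (u + axis l c) * k (u $ l)))))"
		by (subst nn_integral_lborel_translate[where f="%u. f u * k (u $ l - c)" and c="axis l c" for c, symmetric])
			 auto
	also have "... = (NI lborel (%u. (NI lborel (%c. f (u + axis l c) * k (u $ l)))))"
		by (rule lborel_pair.Fubini') measurable
	also have "... = (NI lborel (%u. k (u $ l) * (NI lborel (%c. f (u + axis l c)))))"
		by (subst nn_integral_multc) (auto simp: mult.commute)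
	also have "... = (NI lborel (%u. k (u $ l) * (NI lborel (%c. f (u + axis l (c - u $ l))))))"
		by (subst nn_integral_lborel_translate[where f="%c. f (u + axis l c)" and c="- u $ l" for u, symmetric])
			 auto
	finally show ?thesis .
qed

lemma ex_unit_density: "\<exists>k::complex => ennreal. k : BM \<and> (NI lborel (%c. k c)) = 1"
	by (rule exI[of _ "indicator (box 0 (Complex 1 1))"])
		 (auto simp: emeasure_lborel_box_eq Basis_complex_def)

text \<open>With the other coordinates fixed, \<open>h u\<close> is a constant, so the shear is a
  translation of the coordinate \<open>l\<close>. The automorphisms and the two changes of
  coordinates \<open>half_space_shear\<close> and \<open>siegel_inv\<close> all rely on it.\<close>

lemma nn_integral_cvec_shear:
	fixes f :: "'n::finite cvec => ennreal"
	assumes [measurable]: "f : BM" "h : BM"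
		and h: "!!u c. h (u + axis l c) = h u"
	shows "(NI lborel (%u. f (u + axis l (h u)))) = (NI lborel (%u. f u))"
proof -
	obtain k :: "complex => ennreal" where k[measurable]: "k : BM"
		and k1: "(NI lborel (%c. k c)) = 1"
		using ex_unit_density by blast
	have "(NI lborel (%u. f (u + axis l (h u))))
			= (NI lborel (%u. k (u $ l) * (NI lborel (%c. f (u + axis l (c - u $ l) + axis l (h u))))))"
		by (subst nn_integral_cvec_coordinate[OF _ k k1, of _ l]) (auto simp: h)
	also have "... = (NI lborel (%u. k (u $ l) * (NI lborel (%c. f (u + axis l (c - u $ l))))))"
	proof -
		have "(NI lborel (%c. f (u + axis l (c - u $ l) + axis l (h u))))
				= (NI lborel (%c. f (u + axis l (c - u $ l))))" for u
		proof -
			have "u + axis l (c - u $ l) + axis l (h u) = u + axis l (c + h u - u $ l)" for c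
				by (auto simp: axis_def vec_eq_iff)
			thus ?thesis
				using nn_integral_lborel_translate[where f="%c. f (u + axis l (c - u $ l))" and c="h u"]
				by (simp only:) simp
		qed
		thus ?thesis by simp
	qed
	also have "... = (NI lborel (%u. f u))"
		by (subst nn_integral_cvec_coordinate[OF _ k k1, of _ l]) auto
	finally show ?thesis .
qed

lemma prod_Basis_cvec:
	fixes g :: "'n::finite cvec => 'b::comm_monoid_mult"
	shows "(\<Prod>b\<in>Basis. g b) = (\<Prod>j\<in>UNIV. g (axis j 1) * g (axis j \<i>))"
proof -
	have "(\<Prod>b\<in>Basis. g b) = (\<Prod>b\<in>(%(j,u). axis j u) ` (UNIV \<times> (Basis::complex set)). g b)"
		by (rule prod.cong) (auto simp: Basis_vec_def)
	also have "... = (\<Prod>(j,u)\<in>UNIV \<times> (Basis::complex set). g (axis j u))"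
		by (subst prod.reindex) (auto simp: inj_on_def axis_eq_axis split_def)
	also have "... = (\<Prod>j\<in>UNIV. \<Prod>u\<in>(Basis::complex set). g (axis j u))"
		by (simp add: prod.cartesian_product)
	finally show ?thesis by (simp add: Basis_complex_def)
qed

text \<open>\<open>lborel_affine_euclidean\<close> presents a diagonal map as a sum over the real
  basis; this reads off its complex coordinates.\<close>

lemma cvec_sum_Basis:
	fixes u :: "'n::finite cvec"
	shows "(\<Sum>b\<in>Basis. (c b * (u \<bullet> b)) *\<^sub>R b) $ j
		 = Complex (c (axis j 1) * Re (u $ j)) (c (axis j \<i>) * Im (u $ j))"
proof -
	have "(\<Sum>b\<in>Basis. (c b * (u \<bullet> b)) *\<^sub>R b) =
		 (\<Sum>i\<in>UNIV. (c (axis i 1) * Re (u $ i)) *\<^sub>R axis i 1 + (c (axis i \<i>) * Im (u $ i)) *\<^sub>R axis i \<i>)"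
	proof -
		have "(\<Sum>b\<in>Basis. (c b * (u \<bullet> b)) *\<^sub>R b) = (\<Sum>b\<in>(%(j,u). axis j u) ` (UNIV \<times> (Basis::complex set)). (c b * (u \<bullet> b)) *\<^sub>R b)"
			by (rule sum.cong) (auto simp: Basis_vec_def)
		also have "... = (\<Sum>(i,v)\<in>UNIV \<times> (Basis::complex set). (c (axis i v) * (u \<bullet> axis i v)) *\<^sub>R axis i v)"
			by (subst sum.reindex) (auto simp: inj_on_def axis_eq_axis split_def)
		also have "... = (\<Sum>i\<in>UNIV. \<Sum>v\<in>(Basis::complex set). (c (axis i v) * (u \<bullet> axis i v)) *\<^sub>R axis i v)"
			by (simp add: sum.cartesian_product)
		finally show ?thesis by (simp add: Basis_complex_def inner_axis inner_complex_def)
	qed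
	hence "(\<Sum>b\<in>Basis. (c b * (u \<bullet> b)) *\<^sub>R b) $ j
			= (\<Sum>i\<in>UNIV. ((c (axis i 1) * Re (u $ i)) *\<^sub>R axis i 1 + (c (axis i \<i>) * Im (u $ i)) *\<^sub>R axis i \<i>) $ j)"
		by simp
	also have "... = (\<Sum>i\<in>UNIV. if i = j then Complex (c (axis i 1) * Re (u $ i)) (c (axis i \<i>) * Im (u $ i)) else 0)"
	proof (rule sum.cong)
		fix i
		have "(axis i a :: 'n cvec) $ j = (if i = j then a else 0)" for a
			by (auto simp: axis_def)
		thus "((c (axis i 1) * Re (u $ i)) *\<^sub>R axis i 1 + (c (axis i \<i>) * Im (u $ i)) *\<^sub>R axis i \<i>) $ j
				= (if i = j then Complex (c (axis i 1) * Re (u $ i)) (c (axis i \<i>) * Im (u $ i)) else 0)"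
			by (auto simp: complex_eq_iff)
	qed simp
	finally have "(\<Sum>b\<in>Basis. (c b * (u \<bullet> b)) *\<^sub>R b) $ j
			= (\<Sum>i\<in>UNIV. if i = j then Complex (c (axis i 1) * Re (u $ i)) (c (axis i \<i>) * Im (u $ i)) else 0)" .
	thus ?thesis by simp
qed

section \<open>The tube, its affine automorphisms and the kernel function\<close>

definition bpt :: "'n::{finite,linorder} cvec" where
	"bpt = axis lx \<i>"

text \<open>The affine automorphism of the tube which maps \<open>bpt\<close> to \<open>p\<close>.\<close>

definition tube_aut_lin :: "'n::{finite,linorder} cvec => 'n cvec => 'n cvec" where
	"tube_aut_lin p w = (\<chi> j. if j = lx
			then of_real (rho p) * w $ j
				+ 2 * of_real (sqrt (rho p)) * (\<Sum>i\<in>UNIV - {lx}. of_real (Im (p $ i)) * w $ i)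
			else of_real (sqrt (rho p)) * w $ j)"

definition tube_aut :: "'n::{finite,linorder} cvec => 'n cvec => 'n cvec" where
	"tube_aut p w = tube_aut_lin p w + (p - of_real (rho p) *s bpt)"

lemma tube_iff: "z : tube \<longleftrightarrow> 0 < rho z"
	by (auto simp: tube_def rho_def)

lemma bpt_nth: "bpt $ j = (if j = lx then \<i> else 0)"
	by (auto simp: bpt_def axis_def)

lemma rho_bpt [simp]: "rho bpt = 1"
	by (simp add: rho_def bpt_nth)

lemma bpt_in_tube [simp]: "bpt : tube"
	by (simp add: tube_iff)

lemma tube_aut_nth:
	"tube_aut p w $ j = (if j = lx
			then of_real (rho p) * w $ j
				+ 2 * of_real (sqrt (rho p)) * (\<Sum>i\<in>UNIV - {lx}. of_real (Im (p $ i)) * w $ i)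
				+ p $ j - \<i> * of_real (rho p)
			else of_real (sqrt (rho p)) * w $ j + p $ j)"
	by (simp add: tube_aut_def tube_aut_lin_def bpt_nth mult.commute)

lemma tube_aut_lin_add: "tube_aut_lin p (v + w) = tube_aut_lin p v + tube_aut_lin p w"
	by (simp add: tube_aut_lin_def vec_eq_iff algebra_simps sum.distrib)

lemma tube_aut_lin_scale: "tube_aut_lin p (c *s v) = c *s tube_aut_lin p v"
	by (simp add: tube_aut_lin_def vec_eq_iff algebra_simps sum_distrib_left)

lemma tube_aut_lin_scaleR: "tube_aut_lin p (c *\<^sub>R v) = c *\<^sub>R tube_aut_lin p v"
proof -
	have *: "c *\<^sub>R x = of_real c *s x" for x :: "'a cvec"
		by (simp add: vec_eq_iff scaleR_conv_of_real[where 'a=complex])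
	show ?thesis unfolding * by (rule tube_aut_lin_scale)
qed

lemma tube_aut_add: "tube_aut p (w + v) = tube_aut p w + tube_aut_lin p v"
	by (simp add: tube_aut_def tube_aut_lin_add)

lemma linear_tube_aut_lin: "linear (tube_aut_lin p)"
	by (rule linearI) (simp_all add: tube_aut_lin_add tube_aut_lin_scaleR)

lemma bounded_linear_tube_aut_lin: "bounded_linear (tube_aut_lin p)"
	by (simp add: linear_linear linear_tube_aut_lin)

lemma continuous_tube_aut [continuous_intros]:
	"continuous_on S f ==> continuous_on S (%x. tube_aut p (f x))"
	unfolding tube_aut_def
	by (intro continuous_intros bounded_linear.continuous_on[OF bounded_linear_tube_aut_lin])

lemma rho_ker_add_sum:
	"4 * rho_ker z w = (\<Sum>j\<in>UNIV - {lx}. (z $ j - cnj (w $ j))^2)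
			- 2 * \<i> * (z $ lx - cnj (w $ lx))"
	by (simp add: rho_ker_def)

text \<open>The squares over the first \<open>n - 1\<close> coordinates leave a cross term
  \<open>4 * \<i> * d * B\<close> and the constant -4 times the sum of all
  \<open>(Im (p $ j))^2\<close>. The linear term and the translation in the last coordinate of
  \<open>tube_aut\<close> are chosen to cancel exactly these two.\<close>

lemma rho_ker_tube_aut:
	assumes "p : tube"
	shows "rho_ker (tube_aut p z) (tube_aut p w) = of_real (rho p) * rho_ker z w"
proof -
	define d where "d = (of_real (sqrt (rho p)) :: complex)"
	have d2: "d\<^sup>2 = of_real (rho p)"
		using assms unfolding d_def tube_iff by (metis less_imp_le of_real_power real_sqrt_pow2)
	define B where "B = (\<Sum>i\<in>UNIV - {lx}. of_real (Im (p $ i)) * (z $ i - cnj (w $ i)))"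
	define J where "J = (UNIV - {lx} :: 'a set)"
	have B1: "(\<Sum>i\<in>J. of_real (Im (p $ i)) * z $ i) - cnj (\<Sum>i\<in>J. of_real (Im (p $ i)) * w $ i) = B"
		by (simp add: B_def J_def sum_subtractf algebra_simps)
	have 1: "(\<Sum>j\<in>J. (tube_aut p z $ j - cnj (tube_aut p w $ j))^2)
			= d\<^sup>2 * (\<Sum>j\<in>J. (z $ j - cnj (w $ j))^2) + 4 * \<i> * d * B - 4 * (\<Sum>j\<in>J. of_real ((Im (p $ j))^2))"
	proof -
		have "(tube_aut p z $ j - cnj (tube_aut p w $ j))^2
				= d\<^sup>2 * (z $ j - cnj (w $ j))^2 + 4 * \<i> * d * (of_real (Im (p $ j)) * (z $ j - cnj (w $ j))) - 4 * of_real ((Im (p $ j))^2)"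
			if "j : J" for j
		proof -
			have "tube_aut p z $ j - cnj (tube_aut p w $ j) = d * (z $ j - cnj (w $ j)) + 2 * \<i> * of_real (Im (p $ j))"
				using that by (simp add: tube_aut_nth J_def d_def algebra_simps complex_eq_iff)
			note eq = this
			show ?thesis unfolding eq by (simp add: power2_eq_square algebra_simps)
		qed
		thus ?thesis
			by (simp add: sum.distrib sum_subtractf sum_distrib_left B_def J_def)
	qed
	have 2: "tube_aut p z $ lx - cnj (tube_aut p w $ lx)
			= d\<^sup>2 * (z $ lx - cnj (w $ lx)) + 2 * d * B + 2 * \<i> * of_real (Im (p $ lx) - rho p)"
		unfolding tube_aut_nth if_P[OF refl] J_def[symmetric] B1[symmetric] d_def[symmetric] d2[symmetric]
		using assms by (simp add: complex_eq_iff algebra_simps d_def d2 tube_iff)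
	have 3: "of_real (Im (p $ lx) - rho p) = (\<Sum>j\<in>J. of_real ((Im (p $ j))^2))"
		by (simp add: rho_def J_def)
	have "4 * rho_ker (tube_aut p z) (tube_aut p w) = 4 * (d\<^sup>2 * rho_ker z w)"
		unfolding rho_ker_add_sum J_def[symmetric] 1 2 3
		by (simp add: rho_ker_def J_def algebra_simps)
	thus ?thesis by (simp add: d2)
qed

lemma rho_tube_aut:
	assumes "p : tube"
	shows "rho (tube_aut p w) = rho p * rho w"
	using rho_ker_tube_aut[OF assms, of w w] unfolding rho_ker_diag
	by (metis of_real_eq_iff of_real_mult)

lemma tube_aut_in_tube [simp]:
	assumes "p : tube"
	shows "tube_aut p w : tube \<longleftrightarrow> w : tube"
	using assms by (simp add: tube_iff rho_tube_aut zero_less_mult_iff)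

lemma tube_aut_bpt [simp]: "p : tube ==> tube_aut p bpt = p"
	by (simp add: vec_eq_iff tube_aut_nth bpt_nth)

lemma tube_aut_surj:
	assumes "p : tube"
	obtains w where "tube_aut p w = z"
proof -
	have p: "rho p > 0" using assms by (simp add: tube_iff)
	\<comment> \<open>The first coordinates determine \<open>w0\<close>; only then can the last one be
	  solved, since it contains their sum.\<close>
	define w0 where "w0 = (%j. (z $ j - p $ j) / of_real (sqrt (rho p)))"
	define w :: "'a cvec" where "w = (\<chi> j. if j = lx then
		 (z $ j - p $ j + \<i> * of_real (rho p) - 2 * of_real (sqrt (rho p)) * (\<Sum>i\<in>UNIV - {lx}. of_real (Im (p $ i)) * w0 i)) / of_real (rho p)
		 else w0 j)"
	have "tube_aut p w = z"
	proof -
		have "(\<Sum>i\<in>UNIV - {lx}. of_real (Im (p $ i)) * w $ i) = (\<Sum>i\<in>UNIV - {lx}. of_real (Im (p $ i)) * w0 i)"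
			by (rule sum.cong) (auto simp: w_def)
		thus ?thesis
			using p by (simp add: vec_eq_iff tube_aut_nth w_def) (simp add: w0_def)
	qed
	thus thesis ..
qed

lemma rho_ker_commute: "rho_ker w z = cnj (rho_ker z w)"
proof -
	have "(w $ j - cnj (z $ j))^2 = cnj ((z $ j - cnj (w $ j))^2)" for j
		by (simp add: power2_commute)
	thus ?thesis by (simp add: rho_ker_def algebra_simps cong: sum.cong)
qed

lemma cmod_rho_ker_commute: "cmod (rho_ker w z) = cmod (rho_ker z w)"
	by (subst rho_ker_commute) simp

text \<open>\<open>Re ((a - cnj b)^2) = |a - b|^2 - 2 (Im a)^2 - 2 (Im b)^2\<close>. On the tube
  every term on the right is nonnegative, so the kernel function stays in the right half plane,
  where principal powers are holomorphic, and it dominates both \<open>rho z\<close> and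
  \<open>rho w\<close> up to a factor 2.\<close>

lemma Re_rho_ker:
	"Re (rho_ker z w) = (\<Sum>j\<in>UNIV - {lx}. (cmod (z $ j - w $ j))^2) / 4 + (rho z + rho w) / 2"
proof -
	have "Re ((z $ j - cnj (w $ j))^2) = (cmod (z $ j - w $ j))^2 - 2 * (Im (z $ j))^2 - 2 * (Im (w $ j))^2" for j
		unfolding cmod_power2 by (simp add: power2_eq_square algebra_simps)
	hence "(\<Sum>j\<in>UNIV - {lx}. Re ((z $ j - cnj (w $ j))^2))
			= (\<Sum>j\<in>UNIV - {lx}. (cmod (z $ j - w $ j))^2)
				- 2 * (\<Sum>j\<in>UNIV - {lx}. (Im (z $ j))^2) - 2 * (\<Sum>j\<in>UNIV - {lx}. (Im (w $ j))^2)"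
		by (simp only: sum_subtractf sum_distrib_left)
	thus ?thesis
		by (simp add: rho_ker_def rho_def field_simps)
qed

lemma Re_rho_ker_ge: "(rho z + rho w) / 2 <= Re (rho_ker z w)"
	unfolding Re_rho_ker by (simp add: sum_nonneg)

lemma cmod_rho_ker_ge: "(rho z + rho w) / 2 <= cmod (rho_ker z w)"
	using Re_rho_ker_ge[of z w] complex_Re_le_cmod[of "rho_ker z w"] by linarith

lemma cmod_rho_ker_pos: "z : tube ==> w : tube ==> 0 < cmod (rho_ker z w)"
	using order.strict_trans2[OF _ cmod_rho_ker_ge[of z w], of 0] by (simp add: tube_iff)

lemma Re_rho_ker_pos: "z : tube ==> w : tube ==> 0 < Re (rho_ker z w)"
	using Re_rho_ker_ge[of z w] by (simp add: tube_iff)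

lemma rho_ker_base: "rho_ker w bpt
		= (w $ lx + (\<i> / 2) * (\<Sum>j\<in>UNIV - {lx}. (w $ j)^2) + \<i>) / (2 * \<i>)"
	by (simp add: rho_ker_def bpt_nth field_simps)

lemma continuous_rho [continuous_intros]:
	"continuous_on S f ==> continuous_on S (%x. rho (f x))"
	unfolding rho_def by (intro continuous_intros continuous_on_component)

lemma continuous_rho_ker [continuous_intros]:
	"continuous_on S f ==> continuous_on S g ==> continuous_on S (%x. rho_ker (f x) (g x))"
	unfolding rho_ker_def by (intro continuous_intros continuous_on_component) auto

lemma open_tube [simp]: "open tube"
proof -
	have "(tube :: 'a cvec set) = rho -` {0<..}" by (auto simp: tube_iff)
	moreover have "open (rho -` {0<..} :: 'a cvec set)"
		by (intro open_vimage continuous_intros open_greaterThan)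
	ultimately show ?thesis by simp
qed

lemma tube_measurable [measurable]: "tube : sets borel"
	by simp

lemma rho_measurable [measurable]: "rho : BM"
	by (intro borel_measurable_continuous_onI continuous_intros)

lemma rho_ker_measurable [measurable (raw)]:
	assumes "f : borel_measurable M" "g : borel_measurable M"
	shows "(%x. rho_ker (f x) (g x)) : borel_measurable M"
	using borel_measurable_continuous_Pair[OF assms, of rho_ker]
	by (simp add: continuous_rho_ker continuous_on_fst continuous_on_snd)

lemma tube_aut_measurable [measurable]: "tube_aut p : BM"
	by (intro borel_measurable_continuous_onI continuous_intros)

text \<open>The automorphism is a shear of the last coordinate followed by a diagonal map
  \<open>D\<close>. Of the \<open>2 * n\<close> real stretching factors two equal
  \<open>rho p\<close> and the others \<open>sqrt (rho p)\<close>, which gives \<open>rho p\<close>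
  to the power \<open>2 + (n - 1)\<close>.\<close>

lemma nn_integral_tube_aut:
	fixes f :: "'n::{finite,linorder} cvec => ennreal"
	assumes p: "p : tube" and [measurable]: "f : BM"
	shows "(NI lborel (%u. f u)) = ennreal (rho p powr (real CARD('n) + 1)) * (NI lborel (%u. f (tube_aut p u)))"
proof -
	have r: "rho p > 0" using p by (simp add: tube_iff)
	define t where "t = p - of_real (rho p) *s bpt"
	define c where "c = (%b::'n cvec. if b : {axis lx 1, axis lx \<i>} then rho p else sqrt (rho p))"
	define D where "D = (%u::'n cvec. t + (\<Sum>b\<in>Basis. (c b * (u \<bullet> b)) *\<^sub>R b))"
	\<comment> \<open>The shear acts before \<open>D\<close>, which multiplies the last coordinate by
	  \<open>rho p\<close>; hence the factor \<open>2 / sqrt (rho p)\<close> in place of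
	  \<open>2 * sqrt (rho p)\<close>.\<close>
	define h where "h = (%u::'n cvec. 2 / of_real (sqrt (rho p)) * (\<Sum>i\<in>UNIV - {lx}. of_real (Im (p $ i)) * u $ i) :: complex)"
	have [measurable]: "D : BM" unfolding D_def by measurable
	have [measurable]: "h : BM" unfolding h_def by measurable
	have ax: "(axis j a :: 'n cvec) : {axis lx 1, axis lx \<i>} \<longleftrightarrow> j = lx" if "a : {1,\<i>}" for j a
		using that by (auto simp: axis_eq_axis)
	have cc: "c (axis j 1) = (if j = lx then rho p else sqrt (rho p))"
			"c (axis j \<i>) = (if j = lx then rho p else sqrt (rho p))" for j
		unfolding c_def by (subst ax; simp)+
	have hh: "h (u + axis lx x) = h u" for u x
		unfolding h_def by (auto simp: axis_def intro!: arg_cong2[where f="(*)"] sum.cong)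
	have Dn: "D u $ j = (if j = lx then of_real (rho p) * u $ j else of_real (sqrt (rho p)) * u $ j) + t $ j" for u j
		unfolding D_def vector_add_component cvec_sum_Basis cc by (auto simp: complex_eq_iff)
	have aut: "tube_aut p u = D (u + axis lx (h u))" for u
		using r
		by (auto simp: vec_eq_iff Dn tube_aut_nth t_def bpt_nth h_def axis_def field_simps
				 simp flip: of_real_mult real_sqrt_mult)
	have prodc: "(\<Prod>b\<in>Basis. \<bar>c b\<bar>) = rho p powr (real CARD('n) + 1)"
	proof -
		have "(\<Prod>b\<in>Basis. \<bar>c b\<bar>) = (\<Prod>j\<in>UNIV. \<bar>c (axis j 1)\<bar> * \<bar>c (axis j \<i>)\<bar>)"
			by (rule prod_Basis_cvec)
		also have "... = (\<Prod>j\<in>(UNIV::'n set). if j = lx then rho p * rho p else rho p)"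
			using r by (intro prod.cong) (auto simp: cc)
		also have "... = rho p * rho p * (\<Prod>j\<in>(UNIV::'n set) - {lx}. rho p)"
			by (subst prod.remove[of _ lx]) auto
		also have "... = rho p ^ (CARD('n) + 1)"
			using power_Suc[of "rho p" "CARD('n) - 1"] by (simp add: card_Diff_singleton_if)
		also have "... = rho p powr (real CARD('n) + 1)"
			using r by (subst powr_realpow[symmetric]) (auto simp: add.commute)
		finally show ?thesis .
	qed
	have "(lborel :: 'n cvec measure) = density (distr lborel borel D) (%_. (\<Prod>b\<in>Basis. \<bar>c b\<bar>))"
		unfolding D_def by (rule lborel_affine_euclidean) (use r in \<open>auto simp: c_def\<close>)
	hence "(NI lborel (%u. f u)) = (NI (density (distr lborel borel D) (%_. (\<Prod>b\<in>Basis. \<bar>c b\<bar>))) (%u. f u))"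
		by simp
	also have "... = (NI lborel (%u. ennreal (rho p powr (real CARD('n) + 1)) * f (D u)))"
		by (simp add: nn_integral_density nn_integral_distr prodc)
	also have "... = ennreal (rho p powr (real CARD('n) + 1)) * (NI lborel (%u. f (D u)))"
		by (subst nn_integral_cmult) auto
	also have "(NI lborel (%u. f (D u))) = (NI lborel (%u. f (tube_aut p u)))"
		unfolding aut by (rule nn_integral_cvec_shear[symmetric]) (auto simp: hh)
	finally show ?thesis .
qed

subsection \<open>The weighted measures on Borel sets\<close>

text \<open>A Borel counterpart of \<open>V s\<close> on the whole space. As a density of
  \<open>lborel\<close> it is sigma-finite on the Borel sets, so product measurability and Fubini
  apply to kernels in two variables.\<close>

definition W :: "real => ('n::{finite,linorder} cvec) measure" where
	"W s = density lborel (%z. ennreal (indicator tube z * rho z powr s))"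

lemma sets_W [simp, measurable_cong]: "sets (W s) = sets borel"
	by (simp add: W_def)

lemma space_W [simp]: "space (W s) = UNIV"
	by (simp add: W_def)

lemma nn_integral_W:
	assumes [measurable]: "f : BM"
	shows "(NI (W s) (%z. f z)) = (NI lborel (%z. ennreal (indicator tube z * rho z powr s) * f z))"
	unfolding W_def by (subst nn_integral_density) auto

lemma AE_W_tube: "AE z in W s. z : tube"
	unfolding W_def by (subst AE_density) (auto simp: indicator_def)

lemma AE_W_iff:
	assumes [measurable]: "Measurable.pred borel P"
	shows "(AE z in W s. P z) \<longleftrightarrow> (AE z in lborel. z : tube --> P z)"
	unfolding W_def by (subst AE_density) (auto simp: indicator_def tube_iff intro!: AE_cong)

lemma sigma_finite_W: "sigma_finite_measure (W s)"
	unfolding W_def by (rule sigma_finite_measure.sigma_finite_iff_density_finite[THEN iffD2]) (auto intro: sigma_finite_lborel)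

lemma borel_measurable_W: "borel_measurable (W s) = BM"
	by (rule measurable_cong_sets) auto

lemma space_V [simp]: "space (V s) = tube"
	by (simp add: V_def space_restrict_space)

lemma sets_V: "sets (V s) = sets (lebesgue_on tube)"
	by (simp add: V_def)

lemma measurable_id_V: "(%z. z) : V s \<rightarrow>\<^sub>M borel"
	by (rule measurableI)
		 (auto simp: sets_V sets_restrict_space intro!: image_eqI[where f="%A. tube \<inter> A"])

lemma rho_powr_measurable_lebesgue_on:
	"(%z. ennreal (rho z powr s)) : borel_measurable (lebesgue_on tube)"
proof -
	have "(%z. ennreal (rho z powr s)) : borel_measurable lborel" by measurable
	hence "(%z. ennreal (rho z powr s)) : borel_measurable lebesgue" by (rule measurable_completion)
	thus ?thesis by (rule measurable_restrict_space1)
qed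

lemma emeasure_V_lborel:
	assumes [measurable]: "f : BM"
	shows "(NI (V s) (%z. f z)) = (NI (W s) (%z. f z))"
proof -
	have f[measurable]: "f : borel_measurable lebesgue" by (rule measurable_completion) simp
	have "(NI (V s) (%z. f z)) = (NI (lebesgue_on tube) (%z. ennreal (rho z powr s) * f z))"
		unfolding V_def
		by (rule nn_integral_density[OF rho_powr_measurable_lebesgue_on])
			 (rule measurable_restrict_space1[OF f])
	also have "... = (NI lebesgue (%z. ennreal (rho z powr s) * f z * indicator tube z))"
		by (rule nn_integral_restrict_space) auto
	also have "... = (NI lborel (%z. ennreal (indicator tube z * rho z powr s) * f z))"
		unfolding nn_integral_completion by (intro nn_integral_cong) (auto simp: indicator_def)
	finally show ?thesis by (simp add: nn_integral_W)
qed

text \<open>The identity forgets the completion: it is measurable from \<open>V s\<close> to the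
  Borel sets, and the two measures give every Borel set the same size. Integrals of Borel functions
  can therefore be exchanged.\<close>

lemma distr_V: "distr (V s) borel (%z. z) = W s"
proof (rule measure_eqI)
	fix A assume "A : sets (distr (V s) borel (%z. z))"
	hence A[measurable]: "A : sets borel" by simp
	have "emeasure (distr (V s) borel (%z. z)) A = (NI (distr (V s) borel (%z. z)) (%z. indicator A z))"
		by simp
	also have "... = (NI (V s) (%z. indicator A z))"
		by (subst nn_integral_distr) (auto intro: measurable_id_V)
	also have "... = (NI (W s) (%z. indicator A z))"
		by (rule emeasure_V_lborel) auto
	finally show "emeasure (distr (V s) borel (%z. z)) A = emeasure (W s) A" by simp
qed simp

lemma integral_V:
	fixes f :: "'n::{finite,linorder} cvec => 'b::{banach,second_countable_topology}"
	assumes "f : BM"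
	shows "integral\<^sup>L (V s) f = integral\<^sup>L (W s) f"
		and "integrable (V s) f \<longleftrightarrow> integrable (W s) f"
	unfolding distr_V[symmetric]
	by (simp_all add: integral_distr integrable_distr_eq assms measurable_id_V)

text \<open>\<open>rho (tube_aut p w) = rho p * rho w\<close> adds the exponent \<open>s\<close> of
  the weight to the exponent \<open>n + 1\<close> of the Jacobian.\<close>

lemma nn_integral_W_tube_aut:
	fixes f :: "'n::{finite,linorder} cvec => ennreal"
	assumes p: "p : tube" and [measurable]: "f : BM"
	shows "(NI (W s) (%u. f u)) = ennreal (rho p powr (real CARD('n) + 1 + s)) * (NI (W s) (%u. f (tube_aut p u)))"
proof -
	have r: "rho p > 0" using p by (simp add: tube_iff)
	have "(NI (W s) (%u. f u)) = ennreal (rho p powr (real CARD('n) + 1)) *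
			(NI lborel (%u. ennreal (indicator tube (tube_aut p u) * rho (tube_aut p u) powr s) * f (tube_aut p u)))"
		by (subst nn_integral_W, simp, rule nn_integral_tube_aut[OF p], measurable)
	also have "(%u. ennreal (indicator tube (tube_aut p u) * rho (tube_aut p u) powr s) * f (tube_aut p u))
			= (%u. ennreal (rho p powr s) * (ennreal (indicator tube u * rho u powr s) * f (tube_aut p u)))"
		using p r by (auto simp: fun_eq_iff indicator_def rho_tube_aut powr_mult ennreal_mult mult.assoc)
	also have "(NI lborel (%u. ennreal (rho p powr s) * (ennreal (indicator tube u * rho u powr s) * f (tube_aut p u))))
		 = ennreal (rho p powr s) * (NI (W s) (%u. f (tube_aut p u)))"
		by (simp add: nn_integral_cmult nn_integral_W)
	finally show ?thesis
		by (simp add: mult.assoc[symmetric] ennreal_mult[symmetric] powr_add)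
qed

subsection \<open>The Bergman metric\<close>

abbreviation init_idx :: "'n::{finite,linorder} set" where
	"init_idx \<equiv> UNIV - {lx}"

text \<open>\<open>drho j\<close> is the Wirtinger derivative of \<open>rho\<close> in the \<open>j\<close>-th variable.\<close>

definition drho :: "'n::{finite,linorder} => 'n cvec => complex" where
	"drho j z = (if j = lx then - \<i> / 2 else \<i> * of_real (Im (z $ j)))"

text \<open>Up to the factor \<open>\<i>\<close> this is the complex differential of
  \<open>rho\<close> at \<open>z\<close> applied to \<open>v\<close>, that is, the sum of all
  \<open>drho j z * v $ j\<close>.\<close>

definition form_pairing :: "'n::{finite,linorder} cvec => 'n cvec => complex" where
	"form_pairing z v = (\<Sum>j\<in>init_idx. of_real (Im (z $ j)) * v $ j) - v $ lx / 2"

text \<open>Minus the complex Hessian of \<open>log rho\<close>: the Hessian of \<open>- rho\<close>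
  divided by \<open>rho\<close>, plus the squared modulus of the differential divided by
  \<open>rho^2\<close>. The factor \<open>1 / 2\<close> is the mixed derivative of
  \<open>(Im (z $ j))^2\<close>.\<close>

definition tube_form :: "'n::{finite,linorder} cvec => 'n cvec => real" where
	"tube_form z v = (\<Sum>j\<in>init_idx. (cmod (v $ j))^2) / (2 * rho z) + (cmod (form_pairing z v))^2 / (rho z)^2"

lemma rho_axis:
	"rho (z + axis j c) = rho z + (if j = lx then Im c else - 2 * Im (z $ j) * Im c - (Im c)\<^sup>2)"
proof (cases "j = lx")
	case True
	have "(\<Sum>i\<in>init_idx. (Im (z $ i + axis j c $ i))^2) = (\<Sum>i\<in>init_idx. (Im (z $ i))^2)"
		by (rule sum.cong) (auto simp: axis_def True)
	thus ?thesis by (simp add: rho_def True)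
next
	case False
	have "(\<Sum>i\<in>init_idx. (Im (z $ i + axis j c $ i))^2)
			= (Im (z $ j + c))^2 + (\<Sum>i\<in>init_idx - {j}. (Im (z $ i + axis j c $ i))^2)"
		using False by (subst sum.remove[of _ j]) auto
	also have "(\<Sum>i\<in>init_idx - {j}. (Im (z $ i + axis j c $ i))^2) = (\<Sum>i\<in>init_idx - {j}. (Im (z $ i))^2)"
		by (rule sum.cong) (auto simp: axis_def)
	also have "... = (\<Sum>i\<in>init_idx. (Im (z $ i))^2) - (Im (z $ j))\<^sup>2"
		using False by (subst sum.remove[of init_idx j]) auto
	finally show ?thesis using False
		by (simp add: rho_def power2_eq_square algebra_simps axis_def)
qed

lemma scaleR_axis: "t *\<^sub>R (axis j c :: 'n::finite cvec) = axis j (of_real t * c)"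
	by (auto simp: vec_eq_iff axis_def scaleR_conv_of_real[where 'a=complex])

lemma rho_axis_of_real [simp]: "rho (z + axis j (of_real t)) = rho z"
	by (simp add: rho_axis)

lemma eventually_in_tube_line:
	fixes z v :: "'n::{finite,linorder} cvec"
	assumes "z : tube"
	shows "\<forall>\<^sub>F t in at (0::real). z + t *\<^sub>R v : tube"
proof -
	have "continuous (at 0) (%t::real. z + t *\<^sub>R v)" by (intro continuous_intros)
	hence "((%t::real. z + t *\<^sub>R v) \<longlongrightarrow> z) (at 0)" by (simp add: continuous_at)
	thus ?thesis using assms topological_tendstoD open_tube by blast
qed

text \<open>The line through \<open>z\<close> stays in the tube for small \<open>t\<close>, so
  closed formulas that hold on the tube only may be differentiated in place of the kernel.\<close>

lemma dir_deriv_cong: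
	assumes "!!u. u : tube ==> f u = g u" "z : tube"
		and "((%t. g (z + t *\<^sub>R v)) has_vector_derivative D) (at 0)"
	shows "dir_deriv f v z = D"
proof -
	have "\<forall>\<^sub>F t in at (0::real). g (z + t *\<^sub>R v) = f (z + t *\<^sub>R v)"
		using eventually_in_tube_line[OF assms(2), of v] by eventually_elim (simp add: assms)
	hence "((%t. f (z + t *\<^sub>R v)) has_vector_derivative D) (at 0)"
		using assms(3) unfolding has_vector_derivative_def
		using has_derivative_transform_eventually[of "%t. g (z + t *\<^sub>R v)" _ 0 UNIV "%t. f (z + t *\<^sub>R v)"]
			assms(1,2) by simp
	thus ?thesis by (simp add: dir_deriv_def vector_derivative_at)
qed

lemma ln_bergman_kernel_diag:
	fixes u :: "'n::{finite,linorder} cvec"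
	assumes "al > -1" "u : tube"
	shows "ln (bergman_kernel al u u) = of_real
		 (ln (Gamma (real CARD('n) + 1 + al) / (2 ^ (CARD('n) + 1) * pi ^ CARD('n) * Gamma (al + 1)))
			 - (real CARD('n) + 1 + al) * ln (rho u))"
proof -
	have r: "rho u > 0" using assms by (simp add: tube_iff)
	define c where "c = Gamma (real CARD('n) + 1 + al) / (2 ^ (CARD('n) + 1) * pi ^ CARD('n) * Gamma (al + 1))"
	have c: "c > 0"
		unfolding c_def using assms by (intro divide_pos_pos mult_pos_pos Gamma_real_pos) auto
	define N where "N = real CARD('n) + 1 + al"
	have "bergman_kernel al u u = of_real (c * rho u powr (- N))"
		unfolding bergman_kernel_def rho_ker_diag c_def N_def
		by (subst powr_of_real) (use r in auto)
	hence "ln (bergman_kernel al u u) = of_real (ln (c * rho u powr (- N)))"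
		using r c by (simp only:) (rule Ln_of_real, simp)
	also have "ln (c * rho u powr (- N)) = ln c - N * ln (rho u)"
		using r c by (simp add: ln_mult ln_powr)
	finally show ?thesis unfolding c_def N_def .
qed

lemma wirtinger_ln_kernel:
	fixes z :: "'n::{finite,linorder} cvec"
	assumes "al > -1" "z : tube"
	shows "wirtinger j (%u. ln (bergman_kernel al u u)) z
		 = - of_real (real CARD('n) + 1 + al) * drho j z / of_real (rho z)"
proof -
	define N where "N = real CARD('n) + 1 + al"
	define C where "C = ln (Gamma N / (2 ^ (CARD('n) + 1) * pi ^ CARD('n) * Gamma (al + 1)))"
	have r: "rho z > 0" using assms by (simp add: tube_iff)
	have eq: "ln (bergman_kernel al u u) = of_real (C - N * ln (rho u))" if "u : tube" for u :: "'n cvec"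
		using ln_bergman_kernel_diag[OF assms(1) that] by (simp add: C_def N_def)
	\<comment> \<open>\<open>rho\<close> does not depend on real parts, so only the direction
	  \<open>axis j \<i>\<close> contributes.\<close>
	have 1: "dir_deriv (%u. ln (bergman_kernel al u u)) (axis j 1) z = 0"
		by (rule dir_deriv_cong[OF eq assms(2)]) (simp_all add: scaleR_axis)
	have d: "((%t. C - N * ln (rho (z + t *\<^sub>R axis j \<i>))) has_real_derivative
			- N * (if j = lx then 1 else - 2 * Im (z $ j)) / rho z) (at 0)"
		using r by (cases "j = lx")
			(auto simp: scaleR_axis rho_axis field_simps intro!: derivative_eq_intros)
	have 2: "dir_deriv (%u. ln (bergman_kernel al u u)) (axis j \<i>) z =
			of_real (- N * (if j = lx then 1 else - 2 * Im (z $ j)) / rho z)"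
		by (rule dir_deriv_cong[OF eq assms(2)])
			 (assumption, rule has_vector_derivative_of_real, use d in \<open>simp add: has_real_derivative_iff_has_vector_derivative\<close>)
	show ?thesis unfolding wirtinger_def 1 2 N_def[symmetric] by (simp add: drho_def field_simps)
qed

lemma bergman_matrix_eq:
	fixes z :: "'n::{finite,linorder} cvec"
	assumes "al > -1" "z : tube"
	shows "bergman_matrix al z $ i $ j = (if i = j \<and> j ~= lx then 1 / of_real (2 * rho z) else 0)
		 + cnj (drho i z) * drho j z / of_real ((rho z)^2)"
proof -
	define N where "N = real CARD('n) + 1 + al"
	have N: "N > 0" using assms by (simp add: N_def)
	have r: "rho z > 0" using assms by (simp add: tube_iff)
	let ?f = "wirtinger j (%u. ln (bergman_kernel al u u))"
	have eq: "?f u = - of_real N * drho j u / of_real (rho u)" if "u : tube" for u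
		using wirtinger_ln_kernel[OF assms(1) that] by (simp add: N_def)
	have 1: "dir_deriv ?f (axis i 1) z = 0"
	proof (rule dir_deriv_cong[OF eq assms(2)])
		have "drho j (z + t *\<^sub>R axis i 1) = drho j z" for t
			by (auto simp: drho_def scaleR_axis axis_def)
		thus "((%t. - complex_of_real N * drho j (z + t *\<^sub>R axis i 1) / complex_of_real (rho (z + t *\<^sub>R axis i 1))) has_vector_derivative 0) (at 0)"
			by (simp add: scaleR_axis)
	qed
	\<comment> \<open>Along \<open>axis i \<i>\<close> the function \<open>rho\<close> has derivative
	  \<open>dr\<close>, and \<open>drho j\<close> is the constant \<open>k\<close> plus
	  \<open>\<i>\<close> times the affine function \<open>y + t * dl\<close>. This form covers the
	  last index and the others at once.\<close>
	define dr where "dr = (if i = lx then 1 else - 2 * Im (z $ i))"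
	define dl where "dl = (if i = j \<and> j ~= lx then 1 else 0 :: real)"
	define y where "y = (if j = lx then 0 else Im (z $ j))"
	define k where "k = (if j = lx then - \<i> / 2 else 0)"
	have 2: "dir_deriv ?f (axis i \<i>) z = - of_real N * (\<i> * of_real (dl * rho z - y * dr) - k * of_real dr) / of_real ((rho z)^2)"
	proof (rule dir_deriv_cong[OF eq assms(2)])
		have D: "drho j (z + t *\<^sub>R axis i \<i>) = k + \<i> * of_real (y + t * dl)" for t
			by (auto simp: drho_def scaleR_axis axis_def k_def y_def dl_def)
		have e: "(%t. - complex_of_real N * drho j (z + t *\<^sub>R axis i \<i>) / complex_of_real (rho (z + t *\<^sub>R axis i \<i>)))
			 = (%t. - of_real N * (k * of_real (1 / rho (z + t *\<^sub>R axis i \<i>)) + \<i> * of_real ((y + t * dl) / rho (z + t *\<^sub>R axis i \<i>))))"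
			by (auto simp: D fun_eq_iff divide_inverse algebra_simps)
		have d0: "((%t. rho (z + t *\<^sub>R axis i \<i>)) has_real_derivative dr) (at 0)"
			by (cases "i = lx") (auto simp: scaleR_axis rho_axis dr_def intro!: derivative_eq_intros)
		have d1: "((%t. 1 / rho (z + t *\<^sub>R axis i \<i>)) has_real_derivative - dr / (rho z)^2) (at 0)"
			using r by (auto intro!: derivative_eq_intros d0 simp: power2_eq_square)
		have d2: "((%t. (y + t * dl) / rho (z + t *\<^sub>R axis i \<i>)) has_real_derivative (dl * rho z - y * dr) / (rho z)^2) (at 0)"
			using r by (auto intro!: derivative_eq_intros d0 simp: power2_eq_square)
		have "((%t. - of_real N * (k * of_real (1 / rho (z + t *\<^sub>R axis i \<i>)) + \<i> * of_real ((y + t * dl) / rho (z + t *\<^sub>R axis i \<i>))))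
			 has_vector_derivative - of_real N * (k * of_real (- dr / (rho z)^2) + \<i> * of_real ((dl * rho z - y * dr) / (rho z)^2))) (at 0)"
			by (intro has_vector_derivative_mult_right has_vector_derivative_add has_vector_derivative_of_real)
				 (use d1 d2 in \<open>simp_all only: has_real_derivative_iff_has_vector_derivative\<close>)
		also have "- of_real N * (k * of_real (- dr / (rho z)^2) + \<i> * of_real ((dl * rho z - y * dr) / (rho z)^2))
			= - of_real N * (\<i> * of_real (dl * rho z - y * dr) - k * of_real dr) / of_real ((rho z)^2)"
			using r by (simp add: field_simps)
		finally show "((%t. - complex_of_real N * drho j (z + t *\<^sub>R axis i \<i>) / complex_of_real (rho (z + t *\<^sub>R axis i \<i>)))
			 has_vector_derivative - of_real N * (\<i> * of_real (dl * rho z - y * dr) - k * of_real dr) / of_real ((rho z)^2)) (at 0)"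
			unfolding e .
	qed
	have 3: "drho j z = k + \<i> * of_real y" "cnj (drho i z) = \<i> / 2 * of_real dr"
		by (auto simp: drho_def k_def y_def dr_def)
	have "bergman_matrix al z $ i $ j = wirtinger_bar i ?f z / of_real N"
		by (simp add: bergman_matrix_def N_def)
	also have "... = of_real dl / of_real (2 * rho z) + cnj (drho i z) * drho j z / of_real ((rho z)^2)"
		unfolding wirtinger_bar_def 1 2 3 using N r
		by (simp add: field_simps power2_eq_square)
	finally show ?thesis by (simp add: dl_def)
qed

text \<open>The matrix is a diagonal part plus a part of rank one; the latter contributes the
  squared modulus of \<open>S\<close>, the differential of \<open>rho\<close> applied to
  \<open>v\<close>.\<close>

lemma bergman_form_eq:
	fixes z :: "'n::{finite,linorder} cvec"
	assumes "al > -1" "z : tube"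
	shows "bergman_form al z v = tube_form z v"
proof -
	have r: "rho z > 0" using assms by (simp add: tube_iff)
	define S where "S = (\<Sum>j\<in>UNIV. drho j z * v $ j)"
	have S: "S = \<i> * form_pairing z v"
		unfolding S_def form_pairing_def
		by (subst sum.remove[of _ lx]) (simp_all add: drho_def algebra_simps sum_distrib_left)
	have "(\<Sum>i\<in>UNIV. (bergman_matrix al z *v v) $ i * cnj (v $ i))
			= (\<Sum>i\<in>UNIV. (if i ~= lx then v $ i * cnj (v $ i) / of_real (2 * rho z) else 0)
					+ cnj (drho i z * v $ i) * S / of_real ((rho z)^2))"
	proof (rule sum.cong)
		fix i
		have "(bergman_matrix al z *v v) $ i = (\<Sum>j\<in>UNIV. (if j = i then (if i ~= lx then v $ i / of_real (2 * rho z) else 0) else 0)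
				+ cnj (drho i z) / of_real ((rho z)^2) * (drho j z * v $ j))"
			unfolding matrix_vector_mult_def vec_lambda_beta bergman_matrix_eq[OF assms]
			by (rule sum.cong) (auto simp: algebra_simps)
		also have "... = (if i ~= lx then v $ i / of_real (2 * rho z) else 0) + cnj (drho i z) / of_real ((rho z)^2) * S"
			by (simp add: sum.distrib S_def sum_distrib_left)
		finally show "(bergman_matrix al z *v v) $ i * cnj (v $ i)
			= (if i ~= lx then v $ i * cnj (v $ i) / of_real (2 * rho z) else 0) + cnj (drho i z * v $ i) * S / of_real ((rho z)^2)"
			by (simp add: algebra_simps)
	qed simp
	also have "... = (\<Sum>i\<in>init_idx. v $ i * cnj (v $ i)) / of_real (2 * rho z) + cnj S * S / of_real ((rho z)^2)"
	proof -
		have "(\<Sum>i\<in>UNIV. if i ~= lx then v $ i * cnj (v $ i) / of_real (2 * rho z) else 0)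
				= (\<Sum>i\<in>init_idx. v $ i * cnj (v $ i) / of_real (2 * rho z))"
			by (subst sum.inter_filter[symmetric]) (auto intro!: sum.cong)
		moreover have "(\<Sum>i\<in>UNIV. cnj (drho i z * v $ i) * S / of_real ((rho z)^2)) = cnj S * S / of_real ((rho z)^2)"
			unfolding S_def by (simp add: sum_distrib_right sum_divide_distrib)
		ultimately show ?thesis by (simp only: sum.distrib sum_divide_distrib)
	qed
	also have "(\<Sum>i\<in>init_idx. v $ i * cnj (v $ i)) = of_real (\<Sum>i\<in>init_idx. (cmod (v $ i))^2)"
		by (simp only: of_real_sum complex_norm_square)
	also have "cnj S * S = of_real ((cmod (form_pairing z v))^2)"
		unfolding S by (simp add: complex_norm_square del: of_real_power) (simp add: algebra_simps)
	finally show ?thesis unfolding bergman_form_def tube_form_def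
		by (simp flip: of_real_divide of_real_add of_real_mult of_real_power del: of_real_sum)
qed

lemma tube_form_nonneg: "z : tube ==> 0 <= tube_form z v"
	by (simp add: tube_form_def tube_iff sum_nonneg)

text \<open>The sum of squares and the pairing are each multiplied by \<open>rho p\<close>, just
  like \<open>rho\<close> itself. For the pairing this holds because the cross term in the last row
  of \<open>tube_aut_lin\<close> cancels the shift of the imaginary parts by
  \<open>Im (p $ j)\<close>.\<close>

lemma tube_form_tube_aut:
	assumes "p : tube" "w : tube"
	shows "tube_form (tube_aut p w) (tube_aut_lin p v) = tube_form w v"
proof -
	define d where "d = sqrt (rho p)"
	have d: "d > 0" "rho p = d\<^sup>2" using assms by (auto simp: d_def tube_iff)
	have 1: "(\<Sum>j\<in>init_idx. (cmod (tube_aut_lin p v $ j))^2) = d\<^sup>2 * (\<Sum>j\<in>init_idx. (cmod (v $ j))^2)"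
		using d by (simp add: tube_aut_lin_def norm_mult power_mult_distrib sum_distrib_left flip: d_def)
	have "(\<Sum>j\<in>init_idx. of_real (Im (tube_aut p w $ j)) * tube_aut_lin p v $ j)
			= (\<Sum>j\<in>init_idx. of_real (d\<^sup>2) * (of_real (Im (w $ j)) * v $ j) + of_real d * (of_real (Im (p $ j)) * v $ j))"
		by (rule sum.cong) (auto simp: tube_aut_nth tube_aut_lin_def power2_eq_square algebra_simps simp flip: d_def)
	also have "... = of_real (d\<^sup>2) * (\<Sum>j\<in>init_idx. of_real (Im (w $ j)) * v $ j) + of_real d * (\<Sum>j\<in>init_idx. of_real (Im (p $ j)) * v $ j)"
		by (simp only: sum.distrib sum_distrib_left)
	finally have "form_pairing (tube_aut p w) (tube_aut_lin p v) = of_real (d\<^sup>2) * form_pairing w v"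
		unfolding form_pairing_def by (simp add: tube_aut_lin_def d(2) algebra_simps flip: d_def) (use d in simp)
	hence "cmod (form_pairing (tube_aut p w) (tube_aut_lin p v)) = d\<^sup>2 * cmod (form_pairing w v)"
		using d by (simp add: norm_mult norm_power)
	thus ?thesis using d assms
		unfolding tube_form_def rho_tube_aut[OF assms(1)] 1
		by (simp add: power_mult_distrib tube_iff field_simps)
qed

text \<open>\<open>cosh\<^sup>2\<close> of the Bergman distance.\<close>

definition FF :: "'n::{finite,linorder} cvec => 'n cvec => real" where
	"FF z w = (cmod (rho_ker z w))^2 / (rho z * rho w)"

text \<open>Introduced by its closed formula; that it is the infimum of curve lengths is
  \<open>bergman_dist_eq\<close>.\<close>

definition tdist :: "'n::{finite,linorder} cvec => 'n cvec => real" where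
	"tdist z w = arcosh (sqrt (FF z w))"

lemma FF_commute: "FF z w = FF w z"
	unfolding FF_def by (simp add: cmod_rho_ker_commute[of z w] mult.commute)

lemma tdist_commute: "tdist z w = tdist w z"
	unfolding tdist_def by (simp add: FF_commute)

lemma FF_tube_aut: "p : tube ==> FF (tube_aut p z) (tube_aut p w) = FF z w"
	unfolding FF_def rho_ker_tube_aut rho_tube_aut
	by (simp add: norm_mult power_mult_distrib tube_iff power2_eq_square)

lemma tdist_tube_aut: "p : tube ==> tdist (tube_aut p z) (tube_aut p w) = tdist z w"
	by (simp add: tdist_def FF_tube_aut)

lemma FF_self [simp]: "z : tube ==> FF z z = 1"
	by (simp add: FF_def rho_ker_diag tube_iff power2_eq_square)

lemma FF_ge_1:
	assumes "z : tube" "w : tube"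
	shows "1 <= FF z w"
proof -
	have r: "rho z > 0" "rho w > 0" using assms by (auto simp: tube_iff)
	have "rho z * rho w <= ((rho z + rho w) / 2)^2"
		using zero_le_power2[of "rho z - rho w"] by (simp add: power2_eq_square algebra_simps)
	also have "... <= (cmod (rho_ker z w))^2"
		using cmod_rho_ker_ge[of z w] r by (intro power_mono) auto
	finally show ?thesis using r by (simp add: FF_def)
qed

lemma rho_ker_has_vector_derivative:
	assumes "(ga has_vector_derivative v) (at t)"
	shows "((%t. rho_ker z (ga t)) has_vector_derivative
			(- (\<Sum>j\<in>init_idx. (z $ j - ga t $ j) * cnj (v $ j)) - 2 * \<i> * cnj (form_pairing (ga t) v)) / 2) (at t)"
proof -
	have c: "((%t. ga t $ j) has_vector_derivative v $ j) (at t)" for j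
		using bounded_linear.has_vector_derivative[OF bounded_linear_vec_nth assms] .
	have cc: "((%t. cnj (ga t $ j)) has_vector_derivative cnj (v $ j)) (at t)" for j
		by (rule has_vector_derivative_cnj[OF c])
	have d1: "((%t. (z $ j - cnj (ga t $ j))^2) has_vector_derivative
		 - 2 * ((z $ j - cnj (ga t $ j)) * cnj (v $ j))) (at t)" for j
		unfolding power2_eq_square
		by (auto intro!: derivative_eq_intros c simp: algebra_simps)
	have "((%t. rho_ker z (ga t)) has_vector_derivative
		 ((\<Sum>j\<in>init_idx. - 2 * ((z $ j - cnj (ga t $ j)) * cnj (v $ j))) - 2 * \<i> * (0 - cnj (v $ lx))) / 4) (at t)"
		unfolding rho_ker_def
		by (intro has_vector_derivative_divide has_vector_derivative_diff has_vector_derivative_sum d1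
				has_vector_derivative_mult_right has_vector_derivative_const cc)
	\<comment> \<open>Writing \<open>cnj x = x - 2 * \<i> * Im x\<close> splits off precisely the terms
	  that make up \<open>form_pairing\<close>.\<close>
	also have "(\<Sum>j\<in>init_idx. - 2 * ((z $ j - cnj (ga t $ j)) * cnj (v $ j)))
		 = (\<Sum>j\<in>init_idx. - 2 * ((z $ j - ga t $ j) * cnj (v $ j)) - 4 * \<i> * cnj (of_real (Im (ga t $ j)) * v $ j))"
	proof (rule sum.cong)
		fix j
		have "cnj (ga t $ j) = ga t $ j - 2 * \<i> * of_real (Im (ga t $ j))"
			by (simp add: complex_eq_iff)
		thus "- 2 * ((z $ j - cnj (ga t $ j)) * cnj (v $ j))
			= - 2 * ((z $ j - ga t $ j) * cnj (v $ j)) - 4 * \<i> * cnj (of_real (Im (ga t $ j)) * v $ j)"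
			by (simp only:) (simp add: algebra_simps)
	qed simp
	also have "... = - 2 * (\<Sum>j\<in>init_idx. (z $ j - ga t $ j) * cnj (v $ j))
			 - 4 * \<i> * cnj (\<Sum>j\<in>init_idx. of_real (Im (ga t $ j)) * v $ j)"
		by (simp only: sum_subtractf sum_distrib_left cnj_sum)
	also have "(... - 2 * \<i> * (0 - cnj (v $ lx))) / 4 =
		 (- (\<Sum>j\<in>init_idx. (z $ j - ga t $ j) * cnj (v $ j)) - 2 * \<i> * cnj (form_pairing (ga t) v)) / 2"
		unfolding form_pairing_def by (simp add: field_simps del: cnj_sum)
	finally show ?thesis .
qed

lemma rho_has_derivative_curve:
	assumes "(ga has_vector_derivative v) (at t)"
	shows "((%t. rho (ga t)) has_real_derivative - 2 * Im (form_pairing (ga t) v)) (at t)"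
proof -
	have c: "((%t. ga t $ j) has_vector_derivative v $ j) (at t)" for j
		using bounded_linear.has_vector_derivative[OF bounded_linear_vec_nth assms] .
	have i: "((%t. Im (ga t $ j)) has_real_derivative Im (v $ j)) (at t)" for j
		unfolding has_real_derivative_iff_has_vector_derivative
		using bounded_linear.has_vector_derivative[OF bounded_linear_Im c] .
	have "((%t. rho (ga t)) has_real_derivative Im (v $ lx) - (\<Sum>j\<in>init_idx. 2 * (Im (ga t $ j) * Im (v $ j)))) (at t)"
		unfolding rho_def by (auto intro!: derivative_eq_intros c simp: algebra_simps)
	also have "Im (v $ lx) - (\<Sum>j\<in>init_idx. 2 * (Im (ga t $ j) * Im (v $ j))) = - 2 * Im (form_pairing (ga t) v)"
		by (simp add: form_pairing_def sum_distrib_left)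
	finally show ?thesis .
qed

text \<open>Cauchy-Schwarz, with \<open>Re_rho_ker\<close> turning the second factor into \<open>4 (1 - 1 / FF z w)\<close>.\<close>

lemma FF_derivative_bound:
	assumes z: "z : tube" and w: "w : tube"
	shows "(2 * Re (((- (\<Sum>j\<in>init_idx. (z $ j - w $ j) * cnj (v $ j)) - 2 * \<i> * cnj (form_pairing w v)) / 2) / rho_ker z w)
			+ 2 * Im (form_pairing w v) / rho w)^2 <= 4 * (1 - 1 / FF z w) * tube_form w v"
proof -
	define a R s S where "a = rho w" and "R = rho_ker z w" and "s = form_pairing w v"
		and "S = (\<Sum>j\<in>init_idx. (z $ j - w $ j) * cnj (v $ j))"
	define A B where "A = L2_set (%j. cmod (z $ j - w $ j)) init_idx" and "B = L2_set (%j. cmod (v $ j)) init_idx"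
	have a: "a > 0" and rz: "rho z > 0" using z w by (auto simp: a_def tube_iff)
	have R: "cmod R > 0" "R ~= 0" using cmod_rho_ker_pos[OF z w] by (auto simp: R_def)
	have A2: "A\<^sup>2 = (\<Sum>j\<in>init_idx. (cmod (z $ j - w $ j))^2)" and B2: "B\<^sup>2 = (\<Sum>j\<in>init_idx. (cmod (v $ j))^2)"
		unfolding A_def B_def L2_set_def by (simp_all add: sum_nonneg)
	have AB: "A >= 0" "B >= 0" by (auto simp: A_def B_def)
	have S: "cmod S <= A * B"
	proof -
		have "cmod S <= (\<Sum>j\<in>init_idx. cmod ((z $ j - w $ j) * cnj (v $ j)))"
			unfolding S_def by (rule norm_sum)
		also have "... = (\<Sum>j\<in>init_idx. \<bar>cmod (z $ j - w $ j)\<bar> * \<bar>cmod (v $ j)\<bar>)"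
			by (simp add: norm_mult)
		also have "... <= A * B" unfolding A_def B_def by (rule L2_set_mult_ineq)
		finally show ?thesis .
	qed
	\<comment> \<open>\<open>Im s\<close> is the real part of \<open>\<i> * cnj s\<close>. Moving it
	  inside the real part collects both occurrences of \<open>s\<close> with the factor
	  \<open>(a - R) / (R * a)\<close>, which vanishes at \<open>w = z\<close>.\<close>
	have "2 * Re (((- S - 2 * \<i> * cnj s) / 2) / R) + 2 * Im s / a = Re (- S / R - 2 * \<i> * cnj s * ((a - R) / (R * a)))"
	proof -
		have "((- S - 2 * \<i> * cnj s) / 2) / R * 2 + 2 * \<i> * cnj s / a = - S / R - 2 * \<i> * cnj s * ((a - R) / (R * a))"
			using R a by (simp add: field_simps)
		note eq = this
		have Y: "Re (2 * \<i> * cnj s / a) = 2 * Im s / a"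
			using a by (simp add: Re_divide_of_real)
		have "2 * Re X + Re Y = Re (X * 2 + Y)" for X Y by simp
		note e = this
		show ?thesis unfolding Y[symmetric] e eq ..
	qed
	also have "\<bar>...\<bar> <= cmod (- S / R - 2 * \<i> * cnj s * ((a - R) / (R * a)))"
		by (rule abs_Re_le_cmod)
	also have "... <= cmod S / cmod R + 2 * cmod s * (cmod (a - R) / (cmod R * a))"
		using norm_triangle_ineq4[of "- S / R" "2 * \<i> * cnj s * ((a - R) / (R * a))"] a
		by (simp add: norm_mult norm_divide)
	also have "... <= A * B / cmod R + 2 * cmod s * (cmod (a - R) / (cmod R * a))"
		using S R by (simp add: divide_right_mono)
	also have "... = (A * B + 2 * (cmod s / a) * cmod (a - R)) / cmod R"
		using R a by (simp add: field_simps)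
	finally have le: "\<bar>2 * Re (((- S - 2 * \<i> * cnj s) / 2) / R) + 2 * Im s / a\<bar> <= (A * B + 2 * (cmod s / a) * cmod (a - R)) / cmod R" .
	have "(2 * Re (((- S - 2 * \<i> * cnj s) / 2) / R) + 2 * Im s / a)^2 <= ((A * B + 2 * (cmod s / a) * cmod (a - R)) / cmod R)^2"
		using le AB R a by (intro abs_le_square_iff[THEN iffD1]) (auto intro: order.trans[OF _ abs_ge_self])
	also have "... = (A * B + 2 * (cmod s / a) * cmod (a - R))^2 / (cmod R)^2"
		by (simp add: power_divide)
	also have "(A * B + 2 * (cmod s / a) * cmod (a - R))^2 <= (B\<^sup>2 / (2 * a) + (cmod s / a)^2) * (2 * a * A\<^sup>2 + 4 * (cmod (a - R))^2)"
	proof -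
		\<comment> \<open>The weight \<open>sqrt (2 * a)\<close> is placed so that one Cauchy-Schwarz
		  factor becomes \<open>tube_form w v\<close>.\<close>
		define p q P Q where "p = B / sqrt (2 * a)" and "q = cmod s / a" and "P = sqrt (2 * a) * A" and "Q = 2 * cmod (a - R)"
		have "p * P = A * B" using a by (simp add: p_def P_def)
		moreover have "p\<^sup>2 = B\<^sup>2 / (2 * a)" "P\<^sup>2 = 2 * a * A\<^sup>2" "Q\<^sup>2 = 4 * (cmod (a - R))^2"
			using a by (auto simp: p_def P_def Q_def power_divide power_mult_distrib)
		moreover have "(p * P + q * Q)^2 <= (p\<^sup>2 + q\<^sup>2) * (P\<^sup>2 + Q\<^sup>2)"
			using zero_le_power2[of "p * Q - q * P"] by (simp add: power2_eq_square algebra_simps)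
		ultimately show ?thesis by (simp add: q_def Q_def mult.commute mult.left_commute)
	qed
	also have "2 * a * A\<^sup>2 + 4 * (cmod (a - R))^2 = 4 * ((cmod R)^2 - a * rho z)"
	proof -
		have "A\<^sup>2 = 4 * Re R - 2 * rho z - 2 * a"
			using Re_rho_ker[of z w] by (simp add: A2 R_def a_def field_simps)
		note A = this
		show ?thesis unfolding cmod_power2 A by (simp add: power2_eq_square algebra_simps)
	qed
	also have "(B\<^sup>2 / (2 * a) + (cmod s / a)^2) = tube_form w v"
		unfolding tube_form_def B2 a_def s_def by (simp add: power_divide)
	also have "tube_form w v * (4 * ((cmod R)^2 - a * rho z)) / (cmod R)^2 = 4 * (1 - 1 / FF z w) * tube_form w v"
		using R a rz by (simp add: FF_def R_def[symmetric] a_def[symmetric] field_simps)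
	finally show ?thesis
		using R by (simp add: S_def s_def R_def a_def divide_right_mono)
qed

text \<open>For \<open>FF = cosh^2 d\<close> the inequality says that \<open>d\<close> has speed at
  most the square root of \<open>tube_form\<close>. In this polynomial form it also makes sense
  where \<open>FF = 1\<close> and \<open>d\<close> may fail to be differentiable.\<close>

lemma FF_curve_derivative:
	assumes z: "z : tube" and g: "ga t : tube" "(ga has_vector_derivative v) (at t)"
	obtains U where "((%t. FF z (ga t)) has_real_derivative U) (at t)"
		and "U\<^sup>2 <= 4 * FF z (ga t) * (FF z (ga t) - 1) * tube_form (ga t) v"
proof -
	define R a D where "R = rho_ker z (ga t)" and "a = rho (ga t)" and
		"D = (- (\<Sum>j\<in>init_idx. (z $ j - ga t $ j) * cnj (v $ j)) - 2 * \<i> * cnj (form_pairing (ga t) v)) / 2"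
	define s where "s = Im (form_pairing (ga t) v)"
	have a: "a > 0" and rz: "rho z > 0" using z g by (auto simp: a_def tube_iff)
	have R: "cmod R > 0" "R ~= 0" using cmod_rho_ker_pos[OF z g(1)] by (auto simp: R_def)
	have dR: "((%t. rho_ker z (ga t)) has_vector_derivative D) (at t)"
		unfolding D_def by (rule rho_ker_has_vector_derivative[OF g(2)])

	define U where "U = (2 * (Re R * Re D + Im R * Im D) * a + (cmod R)^2 * (2 * s)) / (rho z * a\<^sup>2)"
	have 1: "((%t. FF z (ga t)) has_real_derivative U) (at t)"
		unfolding FF_def cmod_power2 U_def
		using a rz by (auto intro!: derivative_eq_intros dR rho_has_derivative_curve[OF g(2)]
				simp: R_def[symmetric] a_def[symmetric] s_def[symmetric] divide_simps power2_eq_square) (simp add: algebra_simps)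
	have U: "U = FF z (ga t) * (2 * Re (D / R) + 2 * s / a)"
	proof -
		have "Re (D / R) = (Re R * Re D + Im R * Im D) / (cmod R)^2"
			by (simp add: Re_divide cmod_power2 mult.commute)
		hence e: "Re R * Re D + Im R * Im D = (cmod R)^2 * Re (D / R)"
			using R by simp
		show ?thesis using R a rz
			unfolding U_def FF_def R_def[symmetric] a_def[symmetric] e
			by (simp add: field_simps power2_eq_square)
	qed
	have F: "FF z (ga t) >= 1" by (rule FF_ge_1[OF z g(1)])
	have "U\<^sup>2 = (FF z (ga t))^2 * (2 * Re (D / R) + 2 * s / a)^2"
		by (simp add: U power_mult_distrib)
	also have "... <= (FF z (ga t))^2 * (4 * (1 - 1 / FF z (ga t)) * tube_form (ga t) v)"
		using FF_derivative_bound[OF z g(1), of v]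
		by (intro mult_left_mono) (simp_all add: D_def R_def a_def s_def)
	also have "... = 4 * FF z (ga t) * (FF z (ga t) - 1) * tube_form (ga t) v"
		using F by (simp add: field_simps power2_eq_square)
	finally show thesis using that 1 by blast
qed

lemma continuous_tube_form [continuous_intros]:
	assumes "continuous_on S f" "continuous_on S g" "!!x. x : S ==> f x : tube"
	shows "continuous_on S (%x. tube_form (f x) (g x))"
	unfolding tube_form_def form_pairing_def
	using assms by (auto intro!: continuous_intros continuous_on_component simp: tube_iff less_imp_neq[symmetric])


section \<open>Curves, lengths and geodesics\<close>

definition admissible :: "(real => 'n::{finite,linorder} cvec) => bool" where
	"admissible ga \<longleftrightarrow> ga C1_differentiable_on {0..1} \<and> ga ` {0..1} <= tube"

lemma admissible_ex:
	assumes "admissible ga"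
	shows "\<exists>D. (\<forall>t\<in>{0..1}. (ga has_vector_derivative D t) (at t)) \<and> (\<forall>t\<in>{0..1}. ga t : tube)
		\<and> (\<forall>al>-1. bergman_length al ga = integral {0..1} (%t. sqrt (tube_form (ga t) (D t))))
		\<and> continuous_on {0..1} (%t. sqrt (tube_form (ga t) (D t)))"
proof -
	obtain D where D: "!!t. t : {0..1} ==> (ga has_vector_derivative D t) (at t)" "continuous_on {0..1} D"
		using assms unfolding admissible_def C1_differentiable_on_def by blast
	have T: "!!t. t : {0..1} ==> ga t : tube" using assms by (auto simp: admissible_def)
	have C: "continuous_on {0..1} ga"
		by (intro continuous_at_imp_continuous_on ballI has_vector_derivative_continuous[OF D(1)])
	have L: "bergman_length al ga = integral {0..1} (%t. sqrt (tube_form (ga t) (D t)))" if "al > -1" for al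
		unfolding bergman_length_def
		by (rule integral_cong) (simp add: bergman_form_eq[OF that T] vector_derivative_at[OF D(1)])
	have S: "continuous_on {0..1} (%t. sqrt (tube_form (ga t) (D t)))"
		by (intro continuous_intros C D T)
	show ?thesis using D T L S by blast
qed

text \<open>Integrate the bound for the derivative of the distance to \<open>z\<close>. As
  \<open>arcosh\<close> is not differentiable at 1, a value that is reached when the curve meets
  \<open>z\<close>, the function \<open>u + e\<close> replaces \<open>u\<close> and \<open>e\<close>
  tends to 0. The point \<open>z\<close> is arbitrary rather than \<open>ga 0\<close>, which later
  yields the triangle inequality.\<close>

lemma tdist_le_length:
	assumes "al > -1" "z : tube" "admissible ga"
	shows "tdist z (ga 1) <= tdist z (ga 0) + bergman_length al ga"
proof -
	obtain D where D: "!!t. t : {0..1} ==> (ga has_vector_derivative D t) (at t)"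
		and T: "!!t. t : {0..1} ==> ga t : tube"
		and L: "bergman_length al ga = integral {0..1} (%t. sqrt (tube_form (ga t) (D t)))"
		and S: "continuous_on {0..1} (%t. sqrt (tube_form (ga t) (D t)))"
		using admissible_ex[OF assms(3)] assms(1) by blast
	define u where "u = (%t. FF z (ga t))"
	have u1: "u t >= 1" if "t : {0..1}" for t
		unfolding u_def using FF_ge_1[OF assms(2) T[OF that]] .
	have "\<forall>t\<in>{0..1}. \<exists>U. (u has_real_derivative U) (at t) \<and> U\<^sup>2 <= 4 * u t * (u t - 1) * tube_form (ga t) (D t)"
		unfolding u_def using FF_curve_derivative[OF assms(2) T D(1)] by metis
	then obtain U where U: "!!t. t : {0..1} ==> (u has_real_derivative U t) (at t)"
		 "!!t. t : {0..1} ==> (U t)\<^sup>2 <= 4 * u t * (u t - 1) * tube_form (ga t) (D t)"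
		by metis
	have key: "arcosh (sqrt (u 1 + e)) <= arcosh (sqrt (u 0 + e)) + bergman_length al ga" if e: "e > 0" for e
	proof -
		define G where "G = (%t. U t / (2 * sqrt ((u t + e) * (u t + e - 1))))"
		have "((%t. arcosh (sqrt (u t + e))) has_real_derivative G t) (at t)" if t: "t : {0..1}" for t
		proof -
			have gt: "u t + e > 1" using u1[OF t] e by simp
			hence s: "sqrt (u t + e) > 1" by simp
			have "((%t. arcosh (sqrt (u t + e))) has_real_derivative
				 1 / sqrt ((sqrt (u t + e))^2 - 1) * (inverse (sqrt (u t + e)) / 2 * U t)) (at t)"
				using gt by (intro DERIV_chain2[where f=arcosh] arcosh_real_has_field_derivative s
							DERIV_chain2[where f=sqrt] DERIV_real_sqrt) (auto intro!: derivative_eq_intros U t)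
			also have "1 / sqrt ((sqrt (u t + e))^2 - 1) * (inverse (sqrt (u t + e)) / 2 * U t) = G t"
			proof -
				have e1: "(sqrt (u t + e))^2 = u t + e" using gt by simp
				have "1 / B * (inverse A / 2 * x) = x / (2 * (A * B))" for A B x :: real
					by (cases "A = 0"; cases "B = 0"; simp add: field_simps)
				note * = this
				show ?thesis unfolding G_def real_sqrt_mult e1 by (rule *)
			qed
			finally show ?thesis .
		qed
		hence "(G has_integral (arcosh (sqrt (u 1 + e)) - arcosh (sqrt (u 0 + e)))) {0..1}"
			by (intro fundamental_theorem_of_calculus)
				 (auto simp: has_real_derivative_iff_has_vector_derivative[symmetric] intro: has_field_derivative_at_within)
		moreover have "((%t. sqrt (tube_form (ga t) (D t))) has_integral bergman_length al ga) {0..1}"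
			unfolding L using S by (simp add: integrable_continuous_interval integrable_integral)
		moreover have "G t <= sqrt (tube_form (ga t) (D t))" if t: "t : {0..1}" for t
		proof (rule real_le_rsqrt)
			have gt: "u t + e > 1" using u1[OF t] e by simp
			have "(G t)^2 = (U t)^2 / (4 * ((u t + e) * (u t + e - 1)))"
				using gt by (simp add: G_def power_divide power_mult_distrib)
			also have "... <= (4 * (u t * (u t - 1)) * tube_form (ga t) (D t)) / (4 * ((u t + e) * (u t + e - 1)))"
				using U(2)[OF t] gt by (intro divide_right_mono) auto
			also have "... = (u t * (u t - 1)) / ((u t + e) * (u t + e - 1)) * tube_form (ga t) (D t)"
				by simp
			also have "... <= 1 * tube_form (ga t) (D t)"
			proof (rule mult_right_mono)
				have "u t * (u t - 1) <= (u t + e) * (u t + e - 1)"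
					using u1[OF t] e by (intro mult_mono) auto
				thus "u t * (u t - 1) / ((u t + e) * (u t + e - 1)) <= 1"
					using gt by (simp add: divide_le_eq_1)
			qed (rule tube_form_nonneg[OF T[OF t]])
			finally show "(G t)^2 <= tube_form (ga t) (D t)" by simp
		qed
		ultimately have "arcosh (sqrt (u 1 + e)) - arcosh (sqrt (u 0 + e)) <= bergman_length al ga"
			by (rule has_integral_le)
		thus ?thesis by simp
	qed
	have lim: "((%e. arcosh (sqrt (u t + e))) \<longlongrightarrow> arcosh (sqrt (u t))) (at_right 0)" if t: "t : {0..1}" for t
	proof -
		have "((%e. sqrt (u t + e)) \<longlongrightarrow> sqrt (u t + 0)) (at_right 0)"
			by (intro tendsto_intros)
		moreover have "\<forall>\<^sub>F e in at_right 0. sqrt (u t + e) >= 1"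
			using u1[OF t] by (auto simp: eventually_at_right_field intro!: exI[of _ 1])
		ultimately show ?thesis using u1[OF t]
			by (intro tendsto_arcosh_strong) auto
	qed
	have "arcosh (sqrt (u 1)) <= arcosh (sqrt (u 0)) + bergman_length al ga"
	proof (rule tendsto_le[OF _ tendsto_add[OF lim tendsto_const] lim])
		show "\<forall>\<^sub>F e in at_right 0. arcosh (sqrt (u 1 + e)) <= arcosh (sqrt (u 0 + e)) + bergman_length al ga"
			using key by (auto simp: eventually_at_right_field intro!: exI[of _ 1])
	qed auto
	thus ?thesis by (simp add: tdist_def u_def)
qed

lemma has_vector_derivative_cvec:
	fixes f :: "real => 'n::finite cvec"
	assumes "!!j. ((%t. f t $ j) has_vector_derivative D $ j) (at t)"
	shows "(f has_vector_derivative D) (at t)"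
	unfolding has_vector_derivative_def
proof (subst has_derivative_componentwise_within, intro ballI)
	fix b :: "'n cvec" assume "b : Basis"
	then obtain j u where b: "b = axis j u" by (auto simp: Basis_vec_def)
	have "((%t. f t $ j \<bullet> u) has_derivative (%h. (h *\<^sub>R D $ j) \<bullet> u)) (at t)"
		using assms[of j] unfolding has_vector_derivative_def by (rule has_derivative_inner_left)
	thus "((%t. f t \<bullet> b) has_derivative (%h. (h *\<^sub>R D) \<bullet> b)) (at t)"
		by (simp add: b inner_axis)
qed

lemma tube_form_scaleR: "tube_form w (c *\<^sub>R v) = c\<^sup>2 * tube_form w v"
proof -
	have "form_pairing w (c *\<^sub>R v) = c *\<^sub>R form_pairing w v"
		by (simp add: form_pairing_def scaleR_conv_of_real[where 'a=complex] algebra_simps sum_distrib_left)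
	thus ?thesis
		by (simp add: tube_form_def power_mult_distrib algebra_simps sum_distrib_left)
qed

text \<open>
	The image of the ray \<open>ta \<mapsto> ta ze\<close> of the unit ball under the Cayley transform: a geodesic through
	\<open>bpt\<close>.
\<close>

definition cayley :: "'n::{finite,linorder} cvec => real => 'n cvec" where
	"cayley ze ta = (\<chi> j. if j = lx
		 then \<i> * (1 + of_real ta * ze $ j) / (1 - of_real ta * ze $ j)
			 - \<i> / 2 * (\<Sum>i\<in>init_idx. (of_real (sqrt 2 * ta) * ze $ i / (1 - of_real ta * ze $ lx))^2)
		 else of_real (sqrt 2 * ta) * ze $ j / (1 - of_real ta * ze $ lx))"

definition cayley_deriv :: "'n::{finite,linorder} cvec => real => 'n cvec" where
	"cayley_deriv ze ta = (\<chi> j. if j = lx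
		 then 2 * \<i> * ze $ j / (1 - of_real ta * ze $ j)^2
			 - \<i> * (\<Sum>i\<in>init_idx. (of_real (sqrt 2 * ta) * ze $ i / (1 - of_real ta * ze $ lx))
						 * (of_real (sqrt 2) * ze $ i / (1 - of_real ta * ze $ lx)^2))
		 else of_real (sqrt 2) * ze $ j / (1 - of_real ta * ze $ lx)^2)"

definition cvec_sq :: "'n::finite cvec => real" where
	"cvec_sq ze = (\<Sum>j\<in>UNIV. (cmod (ze $ j))^2)"

lemma cvec_sq_split:
	"cvec_sq ze = (cmod (ze $ lx))^2 + (\<Sum>j\<in>init_idx. (cmod (ze $ j))^2)"
	unfolding cvec_sq_def by (subst sum.remove[of _ lx]) auto

text \<open>The sum of squares subtracted in the last coordinate of \<open>cayley\<close> cancels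
  the quadratic term of \<open>rho_ker_base\<close>.\<close>

lemma cayley_rho_ker:
	assumes "1 - of_real ta * ze $ lx ~= 0"
	shows "rho_ker (cayley ze ta) bpt = 1 / (1 - of_real ta * ze $ lx)"
proof -
	have "(\<Sum>j\<in>init_idx. (cayley ze ta $ j)^2)
			= (\<Sum>i\<in>init_idx. (of_real (sqrt 2 * ta) * ze $ i / (1 - of_real ta * ze $ lx))^2)"
		by (rule sum.cong) (auto simp: cayley_def)
	note S = this
	define q where "q = 1 - of_real ta * ze $ lx"
	define T where "T = (\<Sum>i\<in>init_idx. (of_real (sqrt 2 * ta) * ze $ i / q)^2)"
	have L: "cayley ze ta $ lx = \<i> * (2 - q) / q - \<i> / 2 * T"
		by (simp add: cayley_def q_def T_def)
	show ?thesis using assms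
		unfolding rho_ker_base L S q_def[symmetric] T_def[symmetric] by (simp add: field_simps)
qed

text \<open>The real part of \<open>rho_ker\<close> at \<open>bpt\<close> is known from
  \<open>cayley_rho_ker\<close>, and \<open>Re_rho_ker\<close> can be solved for \<open>rho\<close>;
  the imaginary parts of the coordinates do not have to be computed.\<close>

lemma cayley_rho:
	assumes "1 - of_real ta * ze $ lx ~= 0"
	shows "rho (cayley ze ta) = (1 - ta\<^sup>2 * cvec_sq ze) / (cmod (1 - of_real ta * ze $ lx))^2"
proof -
	define q where "q = 1 - of_real ta * ze $ lx"
	have q: "cmod q > 0" using assms by (simp add: q_def)
	have s: "(\<Sum>j\<in>init_idx. (cmod (cayley ze ta $ j - bpt $ j))^2)
			= 2 * ta\<^sup>2 / (cmod q)^2 * (\<Sum>j\<in>init_idx. (cmod (ze $ j))^2)"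
		unfolding sum_distrib_left
		by (rule sum.cong) (auto simp: cayley_def bpt_nth q_def norm_mult norm_divide power_mult_distrib power_divide)
	have "Re (1 / q) = (\<Sum>j\<in>init_idx. (cmod (cayley ze ta $ j - bpt $ j))^2) / 4
			+ (rho (cayley ze ta) + rho bpt) / 2"
		using Re_rho_ker[of "cayley ze ta" bpt] cayley_rho_ker[OF assms] by (simp add: q_def)
	hence "rho (cayley ze ta) = 2 * Re (1 / q) - 1 - ta\<^sup>2 / (cmod q)^2 * (\<Sum>j\<in>init_idx. (cmod (ze $ j))^2)"
		unfolding s by (simp add: field_simps)
	also have "2 * Re (1 / q) = 2 * Re q / (cmod q)^2"
		by (simp add: Re_divide cmod_power2)
	also have "2 * Re q / (cmod q)^2 - 1 - ta\<^sup>2 / (cmod q)^2 * (\<Sum>j\<in>init_idx. (cmod (ze $ j))^2)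
		 = (2 * Re q - (cmod q)\<^sup>2 - ta\<^sup>2 * (\<Sum>j\<in>init_idx. (cmod (ze $ j))^2)) / (cmod q)^2"
		using q by (simp add: diff_divide_distrib)
	also have "2 * Re q - (cmod q)\<^sup>2 = 1 - ta\<^sup>2 * (cmod (ze $ lx))^2"
		unfolding q_def cmod_power2 by (simp add: power2_eq_square algebra_simps)
	finally show ?thesis by (simp add: q_def cvec_sq_split algebra_simps)
qed

lemma cayley_denom:
	assumes "cvec_sq ze < 1" "ta : {0..1}"
	shows "1 - of_real ta * ze $ lx ~= 0" and "ta\<^sup>2 * cvec_sq ze < 1"
proof -
	have t: "ta\<^sup>2 <= 1" "ta\<^sup>2 >= 0" using assms(2) by (auto simp: power_le_one)
	have p: "cvec_sq ze >= 0" by (simp add: cvec_sq_def sum_nonneg)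
	show lt: "ta\<^sup>2 * cvec_sq ze < 1"
		using mult_mono[OF t(1) order_refl[of "cvec_sq ze"]] p assms(1) by simp
	have "(cmod (ze $ lx))^2 <= cvec_sq ze"
		by (simp add: cvec_sq_split sum_nonneg)
	hence "ta\<^sup>2 * (cmod (ze $ lx))^2 < 1"
		using mult_left_mono[OF _ t(2)] lt by (smt (verit))
	moreover have "ta\<^sup>2 * (cmod (ze $ lx))^2 = 1" if "of_real ta * ze $ lx = 1"
		using arg_cong[OF that, of "%x. (cmod x)^2"] by (simp add: norm_mult power_mult_distrib)
	ultimately show "1 - of_real ta * ze $ lx ~= 0" by auto
qed

lemma cayley_in_tube:
	assumes "cvec_sq ze < 1" "ta : {0..1}"
	shows "cayley ze ta : tube"
	using cayley_denom[OF assms] by (simp add: tube_iff cayley_rho)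

lemma FF_cayley:
	assumes "cvec_sq ze < 1" "ta : {0..1}"
	shows "FF bpt (cayley ze ta) = 1 / (1 - ta\<^sup>2 * cvec_sq ze)"
	using cayley_denom[OF assms]
	by (simp add: FF_def cmod_rho_ker_commute[of bpt] cayley_rho cayley_rho_ker norm_divide power_divide)

lemma cayley_has_vector_derivative:
	assumes "1 - of_real ta * ze $ lx ~= 0"
	shows "(cayley ze has_vector_derivative cayley_deriv ze ta) (at ta)"
proof (rule has_vector_derivative_cvec)
	fix j
	have d: "((%ta. of_real (sqrt 2 * ta) * c / (1 - of_real ta * ze $ lx)) has_vector_derivative
			of_real (sqrt 2) * c / (1 - of_real ta * ze $ lx)^2) (at ta)" for c
	proof -
		have "((%z. of_real (sqrt 2) * z * c / (1 - z * ze $ lx)) has_field_derivative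
			 of_real (sqrt 2) * c / (1 - of_real ta * ze $ lx)^2) (at (of_real ta))"
			using assms by (auto intro!: derivative_eq_intros simp: divide_simps power2_eq_square) (simp add: algebra_simps)
		from has_vector_derivative_real_field[OF this] show ?thesis by simp
	qed
	have e: "((%ta. \<i> * (1 + of_real ta * c) / (1 - of_real ta * c)) has_vector_derivative
			2 * \<i> * c / (1 - of_real ta * c)^2) (at ta)" if "c = ze $ lx" for c
	proof -
		have "((%z. \<i> * (1 + z * c) / (1 - z * c)) has_field_derivative
			 2 * \<i> * c / (1 - of_real ta * c)^2) (at (of_real ta))"
			using assms that by (auto intro!: derivative_eq_intros simp: divide_simps power2_eq_square) (simp add: algebra_simps)
		from has_vector_derivative_real_field[OF this] show ?thesis by simp
	qed
	show "((%t. cayley ze t $ j) has_vector_derivative cayley_deriv ze ta $ j) (at ta)"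
	proof (cases "j = lx")
		case True
		have sq: "((%ta. (of_real (sqrt 2 * ta) * c / (1 - of_real ta * ze $ lx))^2) has_vector_derivative
			2 * ((of_real (sqrt 2 * ta) * c / (1 - of_real ta * ze $ lx)) *
			 (of_real (sqrt 2) * c / (1 - of_real ta * ze $ lx)^2))) (at ta)" for c
			unfolding power2_eq_square[of "_ / _"]
			by (rule has_vector_derivative_eq_rhs[OF has_vector_derivative_mult[OF d d]]) (simp add: algebra_simps)
		have "((%ta. \<i> * (1 + of_real ta * ze $ lx) / (1 - of_real ta * ze $ lx)
			 - \<i> / 2 * (\<Sum>i\<in>init_idx. (of_real (sqrt 2 * ta) * ze $ i / (1 - of_real ta * ze $ lx))^2))
			 has_vector_derivative
				2 * \<i> * ze $ lx / (1 - of_real ta * ze $ lx)^2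
			 - \<i> / 2 * (\<Sum>i\<in>init_idx. 2 * ((of_real (sqrt 2 * ta) * ze $ i / (1 - of_real ta * ze $ lx))
						 * (of_real (sqrt 2) * ze $ i / (1 - of_real ta * ze $ lx)^2)))) (at ta)"
			by (intro has_vector_derivative_diff has_vector_derivative_mult_right has_vector_derivative_sum sq e refl)
		moreover have "\<i> / 2 * (\<Sum>i\<in>init_idx. 2 * f i) = \<i> * sum f init_idx" for f :: "'a => complex"
			unfolding sum_distrib_left[symmetric] by simp
		ultimately show ?thesis
			by (simp only: True cayley_def cayley_deriv_def vec_lambda_beta if_True refl)
	next
		case False
		thus ?thesis using d[of "ze $ j"] by (simp add: cayley_def cayley_deriv_def)
	qed
qed

text \<open>The right side is the square of the derivative of
  \<open>artanh (ta * sqrt (cvec_sq ze))\<close> in \<open>ta\<close>, the radial speed in the unit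
  ball.\<close>

lemma cayley_form:
	assumes "cvec_sq ze < 1" "ta : {0..1}"
	shows "tube_form (cayley ze ta) (cayley_deriv ze ta) = cvec_sq ze / (1 - ta\<^sup>2 * cvec_sq ze)^2"
proof -
	define q where "q = 1 - of_real ta * ze $ lx"
	define Y where "Y = (\<Sum>j\<in>init_idx. (cmod (ze $ j))^2)"
	define Z where "Z = cvec_sq ze"
	define b where "b = ze $ lx"
	define m where "m = 1 - ta\<^sup>2 * Z"
	have q0: "q ~= 0" "cmod q > 0" and m: "m > 0" using cayley_denom[OF assms] by (auto simp: q_def m_def Z_def)
	have Z: "Z = (cmod b)^2 + Y" by (simp add: Z_def Y_def b_def cvec_sq_split)
	have rho: "rho (cayley ze ta) = m / (cmod q)^2"
		using cayley_rho[of ta ze] q0 by (simp add: q_def m_def Z_def)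
	have 1: "(\<Sum>j\<in>init_idx. (cmod (cayley_deriv ze ta $ j))^2) = 2 * Y / (cmod q) ^ 4"
		unfolding Y_def sum_distrib_left sum_divide_distrib
		by (rule sum.cong) (auto simp: cayley_deriv_def q_def[symmetric] norm_mult norm_divide norm_power power_mult_distrib power_divide)
	have "form_pairing (cayley ze ta) (cayley_deriv ze ta)
			= (\<Sum>j\<in>init_idx. \<i> / 2 * (cnj (cayley ze ta $ j) * cayley_deriv ze ta $ j)) - \<i> * b / q\<^sup>2"
	proof -
		have "cayley_deriv ze ta $ lx = 2 * \<i> * b / q\<^sup>2
			 - \<i> * (\<Sum>j\<in>init_idx. cayley ze ta $ j * cayley_deriv ze ta $ j)"
			by (auto simp: cayley_deriv_def cayley_def b_def q_def intro!: sum.cong)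
		note L = this
		have "form_pairing (cayley ze ta) (cayley_deriv ze ta)
			= (\<Sum>j\<in>init_idx. of_real (Im (cayley ze ta $ j)) * cayley_deriv ze ta $ j
					 + \<i> / 2 * (cayley ze ta $ j * cayley_deriv ze ta $ j)) - \<i> * b / q\<^sup>2"
			unfolding form_pairing_def sum.distrib sum_distrib_left[symmetric] L by (simp add: diff_divide_distrib)
		also have "(\<Sum>j\<in>init_idx. of_real (Im (cayley ze ta $ j)) * cayley_deriv ze ta $ j
					 + \<i> / 2 * (cayley ze ta $ j * cayley_deriv ze ta $ j))
				= (\<Sum>j\<in>init_idx. \<i> / 2 * (cnj (cayley ze ta $ j) * cayley_deriv ze ta $ j))"
		proof (rule sum.cong)
			fix j
			\<comment> \<open>This identity replaces the imaginary parts by conjugates, after which the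
			  squared moduli of \<open>ze $ j\<close> appear.\<close>
			have "of_real (Im x) + \<i> / 2 * x = \<i> / 2 * cnj x" for x by (simp add: complex_eq_iff)
			from arg_cong[OF this[of "cayley ze ta $ j"], of "%y. y * cayley_deriv ze ta $ j"]
			show "of_real (Im (cayley ze ta $ j)) * cayley_deriv ze ta $ j
					 + \<i> / 2 * (cayley ze ta $ j * cayley_deriv ze ta $ j) = \<i> / 2 * (cnj (cayley ze ta $ j) * cayley_deriv ze ta $ j)"
				by (simp add: algebra_simps)
		qed simp
		finally show ?thesis .
	qed
	also have "(\<Sum>j\<in>init_idx. \<i> / 2 * (cnj (cayley ze ta $ j) * cayley_deriv ze ta $ j))
			= (\<Sum>j\<in>init_idx. \<i> * of_real ta / (cnj q * q\<^sup>2) * of_real ((cmod (ze $ j))^2))"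
	proof (rule sum.cong)
		fix j :: 'a assume j: "j : init_idx"
		have "of_real (sqrt 2) * of_real (sqrt 2) = (2 :: complex)"
			by (simp flip: of_real_mult)
		hence "cnj (cayley ze ta $ j) * cayley_deriv ze ta $ j = 2 * (of_real ta * (ze $ j * cnj (ze $ j)) / (cnj q * q\<^sup>2))"
			using j by (simp add: cayley_def cayley_deriv_def flip: q_def)

		thus "\<i> / 2 * (cnj (cayley ze ta $ j) * cayley_deriv ze ta $ j) = \<i> * of_real ta / (cnj q * q\<^sup>2) * of_real ((cmod (ze $ j))^2)"
			unfolding complex_norm_square by simp
	qed simp
	also have "... = \<i> * of_real ta / (cnj q * q\<^sup>2) * of_real Y"
		by (simp only: Y_def of_real_sum sum_distrib_left)
	also have "... - \<i> * b / q\<^sup>2 = \<i> * (of_real ta * of_real Y - b * cnj q) / (cnj q * q\<^sup>2)"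
		using q0 by (simp add: field_simps)
	also have "of_real ta * of_real Y - b * cnj q = of_real (ta * Z) - b"
		unfolding Z q_def b_def by (simp add: algebra_simps complex_norm_square del: of_real_power)
	finally have "cmod (form_pairing (cayley ze ta) (cayley_deriv ze ta)) = cmod (of_real (ta * Z) - b) / cmod q ^ 3"
		using q0 by (simp add: norm_mult norm_divide norm_power power2_eq_square power3_eq_cube)
	hence "tube_form (cayley ze ta) (cayley_deriv ze ta) = (2 * Y / cmod q ^ 4) / (2 * (m / (cmod q)^2))
			+ (cmod (of_real (ta * Z) - b) / cmod q ^ 3)^2 / (m / (cmod q)^2)^2"
		by (simp only: tube_form_def 1 rho)
	also have "... = (Y * m + (cmod (of_real (ta * Z) - b))^2) / ((cmod q)^2 * m\<^sup>2)"
		using q0(2) m by (simp add: field_simps power2_eq_square power3_eq_cube power4_eq_xxxx)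
	also have "Y * m + (cmod (of_real (ta * Z) - b))^2 = Z * (cmod q)^2"
	proof -
		have "(cmod (of_real (ta * Z) - b))^2 = ta\<^sup>2 * Z\<^sup>2 - 2 * ta * Z * Re b + (cmod b)^2"
			unfolding cmod_power2 by (simp add: power2_eq_square algebra_simps)
		moreover have "(cmod q)^2 = 1 - 2 * ta * Re b + ta\<^sup>2 * (cmod b)^2"
			unfolding q_def b_def cmod_power2 by (simp add: power2_eq_square algebra_simps)
		moreover have Y: "Y = Z - (cmod b)\<^sup>2" by (simp add: Z)
		ultimately show ?thesis by (simp only: m_def Y) (simp add: power2_eq_square algebra_simps)
	qed
	finally show ?thesis using q0 by (simp add: m_def Z_def)
qed

lemma tdist_nonneg: "z : tube ==> w : tube ==> 0 <= tdist z w"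
	unfolding tdist_def using FF_ge_1[of z w] by simp

lemma tdist_self [simp]: "z : tube ==> tdist z z = 0"
	by (simp add: tdist_def)

lemma bergman_length_nonneg:
	assumes "al > -1" "admissible ga"
	shows "0 <= bergman_length al ga"
proof -
	have t: "ga 0 : tube" "ga 1 : tube" using assms(2) by (auto simp: admissible_def)
	show ?thesis using tdist_le_length[OF assms(1) t(1) assms(2)] tdist_nonneg[OF t] t by simp
qed

lemma bergman_dist_le_length:
	assumes "al > -1" "admissible ga"
	shows "bergman_dist al (ga 0) (ga 1) <= bergman_length al ga"
	unfolding bergman_dist_def
proof (rule cInf_lower)
	show "bdd_below {bergman_length al ga' |ga'. ga' C1_differentiable_on {0..1} \<and> ga' ` {0..1} <= tube \<and> ga' 0 = ga 0 \<and> ga' 1 = ga 1}"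
		using bergman_length_nonneg[OF assms(1)] by (intro bdd_belowI[of _ 0]) (auto simp: admissible_def)
qed (use assms(2) in \<open>auto simp: admissible_def\<close>)

text \<open>The given curve shows that the set of lengths is not empty, without which
  \<open>Inf\<close> would carry no information.\<close>

lemma tdist_le_bergman_dist:
	assumes "al > -1" "z : tube" "admissible ga" "ga 0 = w1" "ga 1 = w2"
	shows "tdist z w2 <= tdist z w1 + bergman_dist al w1 w2"
proof -
	have "tdist z w2 - tdist z w1 <= bergman_dist al w1 w2"
		unfolding bergman_dist_def
	proof (rule cInf_greatest)
		show "{bergman_length al ga |ga. ga C1_differentiable_on {0..1} \<and> ga ` {0..1} <= tube \<and> ga 0 = w1 \<and> ga 1 = w2} ~= {}"
			using assms by (auto simp: admissible_def)
		fix x assume "x : {bergman_length al ga |ga. ga C1_differentiable_on {0..1} \<and> ga ` {0..1} <= tube \<and> ga 0 = w1 \<and> ga 1 = w2}"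
		then obtain ga where "admissible ga" "x = bergman_length al ga" "ga 0 = w1" "ga 1 = w2"
			by (auto simp: admissible_def)
		thus "tdist z w2 - tdist z w1 <= x" using tdist_le_length[OF assms(1,2)] by force
	qed
	thus ?thesis by simp
qed

lemma admissible_tube_aut:
	assumes a: "al > -1" and g: "admissible ga" and p: "p : tube"
	shows "admissible (%t. tube_aut p (ga t))" and "bergman_length al (%t. tube_aut p (ga t)) = bergman_length al ga"
proof -
	have d: "((%t. tube_aut p (ga t)) has_vector_derivative tube_aut_lin p v) (at t)"
		if "(ga has_vector_derivative v) (at t)" for t v
		unfolding tube_aut_def
		using bounded_linear.has_vector_derivative[OF bounded_linear_tube_aut_lin that]
		by (auto intro!: derivative_eq_intros)
	obtain D where D: "!!t. t : {0..1} ==> (ga has_vector_derivative D t) (at t)" "continuous_on {0..1} D"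
		using g unfolding admissible_def C1_differentiable_on_def by blast
	have T: "!!t. t : {0..1} ==> ga t : tube" using g by (auto simp: admissible_def)
	show "admissible (%t. tube_aut p (ga t))"
		unfolding admissible_def C1_differentiable_on_def using T p D d
		by (auto intro!: exI[of _ "%t. tube_aut_lin p (D t)"] bounded_linear.continuous_on[OF bounded_linear_tube_aut_lin])
	show "bergman_length al (%t. tube_aut p (ga t)) = bergman_length al ga"
		unfolding bergman_length_def using T p a
		by (intro integral_cong) (simp add: bergman_form_eq vector_derivative_at[OF D(1)] vector_derivative_at[OF d[OF D(1)]] tube_form_tube_aut)
qed

lemma cayley_length:
	assumes Z: "cvec_sq ze < 1" and ab: "0 <= a" "a <= b" "b <= 1" and al: "al > -1"
	defines "ga \<equiv> %t. cayley ze (a + (b - a) * t)"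
	shows "admissible ga"
		and "bergman_length al ga = artanh (b * sqrt (cvec_sq ze)) - artanh (a * sqrt (cvec_sq ze))"
proof -
	define x where "x = sqrt (cvec_sq ze)"
	have x: "0 <= x" "x < 1" "x\<^sup>2 = cvec_sq ze"
		using Z by (auto simp: x_def cvec_sq_def sum_nonneg)
	have in01: "a + (b - a) * t : {0..1}" if t: "t : {0..1}" for t
	proof -
		have "(b - a) * t <= (b - a) * 1" using t ab by (intro mult_left_mono) auto
		thus ?thesis using t ab by auto
	qed
	have d: "(ga has_vector_derivative (b - a) *\<^sub>R cayley_deriv ze (a + (b - a) * t)) (at t)" if t: "t : {0..1}" for t
	proof -
		have "(cayley ze \<circ> (%t. a + (b - a) * t) has_vector_derivative (b - a) *\<^sub>R cayley_deriv ze (a + (b - a) * t)) (at t)"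
			by (rule vector_diff_chain_at) (auto intro!: derivative_eq_intros cayley_has_vector_derivative cayley_denom[OF Z in01[OF t]])
		thus ?thesis by (simp add: ga_def o_def)
	qed
	have c: "continuous_on {0..1} (cayley_deriv ze)"
	proof -
		have "continuous_on {0..1} (%ta. cayley_deriv ze ta $ j)" for j
			using cayley_denom(1)[OF Z]
			by (cases "j = lx") (auto simp: cayley_deriv_def intro!: continuous_intros)
		thus ?thesis
			using continuous_on_vec_lambda[of "{0..1}" "%j ta. cayley_deriv ze ta $ j"] by simp
	qed
	have T: "ga t : tube" if "t : {0..1}" for t
		unfolding ga_def by (rule cayley_in_tube[OF Z in01[OF that]])
	show "admissible ga"
		unfolding admissible_def C1_differentiable_on_def using T d
		by (auto intro!: exI[of _ "%t. (b - a) *\<^sub>R cayley_deriv ze (a + (b - a) * t)"] continuous_intros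
				continuous_on_compose2[OF c] dest: in01)
	have "bergman_length al ga = integral {0..1} (%t. (b - a) * x / (1 - ((a + (b - a) * t) * x)\<^sup>2))"
		unfolding bergman_length_def
	proof (rule integral_cong)
		fix t :: real assume t: "t : {0..1}"
		have m: "(a + (b - a) * t)^2 * cvec_sq ze < 1" using cayley_denom(2)[OF Z in01[OF t]] .
		have "bergman_form al (ga t) (vector_derivative ga (at t)) = ((b - a) * x / (1 - ((a + (b - a) * t) * x)\<^sup>2))^2"
			unfolding bergman_form_eq[OF al T[OF t]] vector_derivative_at[OF d[OF t]] tube_form_scaleR
			unfolding ga_def cayley_form[OF Z in01[OF t]] x(3)[symmetric]
			by (simp add: power_mult_distrib power_divide)
		thus "sqrt (bergman_form al (ga t) (vector_derivative ga (at t))) = (b - a) * x / (1 - ((a + (b - a) * t) * x)\<^sup>2)"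
			using ab x m by (simp add: power_mult_distrib)
	qed
	also have "((%t. (b - a) * x / (1 - ((a + (b - a) * t) * x)\<^sup>2)) has_integral
		 (artanh ((a + (b - a) * 1) * x) - artanh ((a + (b - a) * 0) * x))) {0..1}"
	proof (rule fundamental_theorem_of_calculus)
		fix t :: real assume t: "t : {0..1}"
		have "\<bar>(a + (b - a) * t) * x\<bar> < 1"
			using mult_mono[of "a + (b - a) * t" 1 x x] in01[OF t] x by (auto simp: abs_mult)
		moreover have "((%t. (a + (b - a) * t) * x) has_real_derivative (b - a) * x) (at t)"
			by (auto intro!: derivative_eq_intros)
		ultimately have "((%t. artanh ((a + (b - a) * t) * x)) has_real_derivative (b - a) * x / (1 - ((a + (b - a) * t) * x)\<^sup>2)) (at t)"
			using DERIV_chain2[OF artanh_real_has_field_derivative] by fastforce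
		thus "((%t. artanh ((a + (b - a) * t) * x)) has_vector_derivative (b - a) * x / (1 - ((a + (b - a) * t) * x)\<^sup>2)) (at t within {0..1})"
			by (simp add: has_real_derivative_iff_has_vector_derivative has_vector_derivative_at_within)
	qed simp
	hence "integral {0..1} (%t. (b - a) * x / (1 - ((a + (b - a) * t) * x)\<^sup>2)) = artanh (b * x) - artanh (a * x)"
		by (simp add: integral_unique)
	finally show "bergman_length al ga = artanh (b * sqrt (cvec_sq ze)) - artanh (a * sqrt (cvec_sq ze))"
		by (simp add: x_def)
qed

lemma tdist_base_cayley:
	assumes Z: "cvec_sq ze < 1" and b: "b : {0..1}"
	shows "tdist bpt (cayley ze b) = artanh (b * sqrt (cvec_sq ze))"
proof -
	define y where "y = tdist bpt (cayley ze b)"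
	have t: "cayley ze b : tube" by (rule cayley_in_tube[OF assms])
	have lt: "b\<^sup>2 * cvec_sq ze < 1" by (rule cayley_denom(2)[OF assms])
	have F: "FF bpt (cayley ze b) >= 1" by (rule FF_ge_1[OF bpt_in_tube t])
	have y0: "y >= 0" unfolding y_def by (rule tdist_nonneg[OF bpt_in_tube t])
	have "cosh y = sqrt (FF bpt (cayley ze b))"
		unfolding y_def tdist_def using F by simp
	hence "(cosh y)^2 = FF bpt (cayley ze b)"
		using F by simp
	hence c: "(cosh y)^2 = 1 / (1 - b\<^sup>2 * cvec_sq ze)"
		by (simp only: FF_cayley[OF assms])
	have "(tanh y)^2 = 1 - 1 / (cosh y)^2"
		using cosh_real_pos[of y] by (simp add: tanh_def power_divide sinh_square_eq field_simps)
	also have "... = (b * sqrt (cvec_sq ze))^2"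
		unfolding c using lt by (simp add: power_mult_distrib cvec_sq_def sum_nonneg)
	finally have "tanh y = b * sqrt (cvec_sq ze)"
		using y0 b by (simp add: power2_eq_iff_nonneg cvec_sq_def sum_nonneg)
	thus ?thesis using artanh_tanh_real[of y] by (simp add: y_def)
qed

lemma ex_cayley:
	assumes "w : tube"
	obtains ze where "cvec_sq ze < 1" "cayley ze 1 = w" "cayley ze 0 = bpt"
proof -
	define R where "R = rho_ker w bpt"
	have R: "R ~= 0" using cmod_rho_ker_pos[OF assms bpt_in_tube] by (auto simp: R_def)
	\<comment> \<open>The inverse Cayley transform: \<open>cayley_rho_ker\<close> forces
	  \<open>1 - ze $ lx = 1 / R\<close>, and the other coordinates follow.\<close>
	define ze :: "'a cvec" where "ze = (\<chi> j. if j = lx then 1 - 1 / R else w $ j / (of_real (sqrt 2) * R))"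
	have q: "1 - of_real 1 * ze $ lx = 1 / R" by (simp add: ze_def)
	have s: "(\<Sum>i\<in>init_idx. (of_real (sqrt 2 * 1) * ze $ i / (1 / R))^2) = (\<Sum>i\<in>init_idx. (w $ i)^2)"
		using R by (intro sum.cong) (auto simp: ze_def)
	have w: "cayley ze 1 = w"
	proof -
		have "cayley ze 1 $ j = w $ j" for j
		proof (cases "j = lx")
			case True
			have "\<i> * (1 + ze $ lx) / (1 / R) - \<i> / 2 * (\<Sum>i\<in>init_idx. (w $ i)^2) = w $ lx"
			proof -
				have wl: "w $ lx = 2 * \<i> * R - \<i> - \<i> / 2 * (\<Sum>i\<in>init_idx. (w $ i)^2)"
					using rho_ker_base[of w] by (simp add: R_def[symmetric] field_simps)
				have "\<i> * (1 + ze $ lx) / (1 / R) = 2 * \<i> * R - \<i>"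
					using R by (simp add: ze_def field_simps)
				thus ?thesis by (simp only: wl)
			qed
			thus ?thesis using q s by (simp add: cayley_def True)
		next
			case False
			thus ?thesis using q R by (simp add: cayley_def) (simp add: ze_def)
		qed
		thus ?thesis by (simp add: vec_eq_iff)
	qed
	have "rho (cayley ze 1) = (1 - cvec_sq ze) / (cmod (1 / R))^2"
	proof -
		have "1 - of_real 1 * ze $ lx ~= 0" unfolding q using R by simp
		from cayley_rho[OF this] show ?thesis unfolding q by simp
	qed
	hence "cvec_sq ze < 1"
		using assms R unfolding w tube_iff by (simp add: zero_less_mult_iff norm_divide power_divide)
	moreover have "cayley ze 0 = bpt"
		by (simp add: vec_eq_iff cayley_def bpt_nth)
	ultimately show thesis using that w by blast
qed

text \<open>\<open>tube_aut z\<close> moves the base point to \<open>z\<close>, and the ray to the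
  preimage of \<open>w\<close> to a curve realising the distance. The midpoint clause lets distances
  be halved later without a further appeal to curves.\<close>

lemma ex_geodesic:
	assumes "al > -1" "z : tube" "w : tube"
	obtains ga where "admissible ga" "ga 0 = z" "ga 1 = w" "bergman_length al ga = tdist z w"
		and "\<exists>m\<in>tube. tdist z m = tdist z w / 2 \<and> tdist m w <= tdist z w / 2"
proof -
	obtain w0 where w0: "tube_aut z w0 = w" using tube_aut_surj[OF assms(2)] .
	hence w0t: "w0 : tube" using assms tube_aut_in_tube by blast
	obtain ze where Z: "cvec_sq ze < 1" and c: "cayley ze 1 = w0" "cayley ze 0 = bpt"
		using ex_cayley[OF w0t] .
	define x where "x = sqrt (cvec_sq ze)"
	have t0: "tdist z w = tdist bpt w0"
		using tdist_tube_aut[OF assms(2), of bpt w0] assms(2) by (simp add: w0)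
	have tb: "tdist z (tube_aut z (cayley ze b)) = artanh (b * x)" if "b : {0..1}" for b
		using tdist_tube_aut[OF assms(2), of bpt "cayley ze b"] tdist_base_cayley[OF Z that] assms(2)
		by (simp add: x_def)
	define g where "g = (%a t. tube_aut z (cayley ze (a + (1 - a) * t)))"
	have g: "admissible (g a)" "bergman_length al (g a) = artanh x - artanh (a * x)" if "a : {0..1}" for a
		using admissible_tube_aut[OF assms(1) cayley_length(1)[OF Z, of a 1] assms(2)] that
			cayley_length[OF Z, of a 1] assms(1) by (auto simp: g_def x_def)
	have tx: "tdist z w = artanh x" using tb[of 1] by (simp add: c w0)
	have 1: "admissible (g 0)" "g 0 0 = z" "g 0 1 = w" "bergman_length al (g 0) = tdist z w"
		using g[of 0] assms(2) tx by (auto simp: g_def c w0)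
	define y where "y = tdist z w"
	have y: "y >= 0" unfolding y_def by (rule tdist_nonneg[OF assms(2,3)])
	have 2: "\<exists>m\<in>tube. tdist z m = y / 2 \<and> tdist m w <= y / 2"
	proof (cases "y = 0")
		case True
		thus ?thesis using assms by (intro bexI[of _ z]) (auto simp: y_def)
	next
		case False
		have x1: "0 <= x" "x < 1" using Z by (auto simp: x_def cvec_sq_def sum_nonneg)
		have txy: "tanh y = x"
		proof -
			have "y = arcosh (sqrt (FF bpt w0))" by (simp only: y_def t0) (simp only: tdist_def)
			hence "cosh y = sqrt (FF bpt w0)"
				using FF_ge_1[OF bpt_in_tube w0t] by simp
			hence "(cosh y)^2 = FF bpt w0"
				using FF_ge_1[OF bpt_in_tube w0t] by simp
			also have "... = 1 / (1 - x\<^sup>2)"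
				using FF_cayley[OF Z, of 1] by (simp add: c x_def cvec_sq_def sum_nonneg)
			finally have "(cosh y)^2 = 1 / (1 - x\<^sup>2)" .
			moreover have "(tanh y)^2 = 1 - 1 / (cosh y)^2"
				using cosh_real_pos[of y] by (simp add: tanh_def power_divide sinh_square_eq field_simps)
			ultimately have "(tanh y)^2 = x\<^sup>2" by simp
			thus ?thesis using y x1 by (simp add: power2_eq_iff_nonneg)
		qed
		hence xp: "x > 0" using False y by (metis tanh_real_pos_iff order_le_less)
		\<comment> \<open>Chosen so that \<open>artanh (a * x) = y / 2\<close>, half of the length of the
		  ray.\<close>
		define a where "a = tanh (y / 2) / x"
		have ax: "a * x = tanh (y / 2)" using xp by (simp add: a_def)
		have "tanh (y / 2) <= tanh y" using y by simp
		hence a: "a : {0..1}" using xp y txy by (simp add: a_def)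
		define m where "m = tube_aut z (cayley ze a)"
		have m: "m : tube" using cayley_in_tube[OF Z a] assms(2) by (simp add: m_def)
		have m1: "tdist z m = y / 2" unfolding m_def tb[OF a] ax by (rule artanh_tanh_real)
		have "tdist m w <= tdist m m + bergman_length al (g a)"
			using tdist_le_length[OF assms(1) m g(1)[OF a]] by (simp add: g_def m_def c w0)
		also have "... = y - y / 2"
			using m g(2)[OF a] ax tx by (simp add: y_def artanh_tanh_real)
		finally show ?thesis using m m1 by (intro bexI[of _ m]) auto
	qed
	show thesis using that[OF 1] 2 by (simp add: y_def)
qed

lemma bergman_dist_eq:
	assumes "al > -1" "z : tube" "w : tube"
	shows "bergman_dist al z w = tdist z w"
proof -
	obtain ga where g: "admissible ga" "ga 0 = z" "ga 1 = w" "bergman_length al ga = tdist z w"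
		using ex_geodesic[OF assms] by metis
	show ?thesis
		using bergman_dist_le_length[OF assms(1) g(1)] tdist_le_bergman_dist[OF assms(1,2) g(1-3)] assms g
		by simp
qed

lemma tdist_triangle:
	assumes "z : tube" "w : tube" "u : tube"
	shows "tdist z u <= tdist z w + tdist w u"
proof -
	\<comment> \<open>The Bergman metric is the same for every weight parameter, and 0 is a convenient
	  one.\<close>
	have a: "(0::real) > -1" by simp
	obtain ga where g: "admissible ga" "ga 0 = w" "ga 1 = u"
		using ex_geodesic[OF a assms(2,3)] by metis
	show ?thesis
		using tdist_le_bergman_dist[OF a assms(1) g] bergman_dist_eq[OF a assms(2,3)] by simp
qed

lemma tdist_midpoint:
	assumes "z : tube" "w : tube"
	obtains m where "m : tube" "tdist z m = tdist z w / 2" "tdist m w <= tdist z w / 2"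
proof (rule ex_geodesic[of 0 z w])
	assume "\<exists>m\<in>tube. tdist z m = tdist z w / 2 \<and> tdist m w <= tdist z w / 2"
	thus thesis using that by blast
qed (use assms in auto)

lemma bergman_ball_eq:
	assumes "al > -1" "z : tube"
	shows "bergman_ball al z r = {w : tube. tdist z w < r}"
	unfolding bergman_ball_def using bergman_dist_eq[OF assms] by auto

lemma tdist_less_iff:
	assumes "z : tube" "w : tube" "r > 0"
	shows "tdist z w < r \<longleftrightarrow> FF z w < (cosh r)^2"
proof -
	have F: "FF z w >= 1" by (rule FF_ge_1[OF assms(1,2)])
	have c: "cosh (tdist z w) = sqrt (FF z w)" unfolding tdist_def using F by simp
	have "tdist z w < r \<longleftrightarrow> cosh (tdist z w) < cosh r"
		using tdist_nonneg[OF assms(1,2)] assms(3) by (simp add: cosh_real_nonneg_less_iff)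
	also have "... \<longleftrightarrow> sqrt (FF z w) < sqrt ((cosh r)^2)"
		unfolding c using cosh_real_pos[of r] by simp
	finally show ?thesis unfolding real_sqrt_less_iff .
qed

subsection \<open>Integral estimates\<close>

lemma nn_integral_powr_to_inf_finite:
	assumes "(e::real) < -1"
	shows "(NI lborel (%x. ennreal (indicator {1..} x * x powr e))) < \<infinity>"
proof -
	have "((%x. indicator {1..} x * x powr e) has_integral (-(1 powr (e+1)) / (e+1))) UNIV"
	proof -
		have eq: "(%x. indicator {1..} x * x powr e) = (%x. if x : {1..} then x powr e else 0)"
			by (auto simp: indicator_def)
		show ?thesis unfolding eq has_integral_restrict_UNIV by (rule has_integral_powr_to_inf) (use assms in auto)
	qed
	hence "(NI lborel (%x. ennreal (indicator {1..} x * x powr e))) = ennreal (-(1 powr (e+1)) / (e+1))"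
		by (intro nn_integral_has_integral_lborel) auto
	thus ?thesis by simp
qed

lemma nn_integral_powr_from_0_finite:
	assumes "(a::real) > -1"
	shows "(NI lborel (%x. ennreal (indicator {0..1} x * x powr a))) < \<infinity>"
proof -
	have "((%x. indicator {0..1} x * x powr a) has_integral (1 powr (a+1) / (a+1))) UNIV"
	proof -
		have eq: "(%x. indicator {0..1} x * x powr a) = (%x. if x : {0..1} then x powr a else 0)"
			by (auto simp: indicator_def)
		show ?thesis unfolding eq has_integral_restrict_UNIV by (rule has_integral_powr_from_0) (use assms in auto)
	qed
	hence "(NI lborel (%x. ennreal (indicator {0..1} x * x powr a))) = ennreal (1 powr (a+1) / (a+1))"
		by (intro nn_integral_has_integral_lborel) auto
	thus ?thesis by simp
qed

lemma nn_integral_one_plus_abs_finite: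
	assumes "(k::real) > 0"
	shows "(NI lborel (%x. ennreal ((1 + \<bar>x\<bar>) powr (- 1 - k)))) < \<infinity>"
proof -
	let ?g = "%x::real. ennreal (indicator {1..} x * x powr (- 1 - k))"
	have le: "ennreal ((1 + \<bar>x\<bar>) powr (- 1 - k)) <= indicator {-1..1} x + ?g x + ?g (- x)" for x :: real
	proof -
		consider "\<bar>x\<bar> <= 1" | "x > 1" | "x < -1" by linarith
		thus ?thesis
		proof cases
			case 1
			have "(1 + \<bar>x\<bar>) powr (- 1 - k) <= 1"
				using powr_mono[of "- 1 - k" 0 "1 + \<bar>x\<bar>"] assms by (auto split: if_splits)
			hence "ennreal ((1 + \<bar>x\<bar>) powr (- 1 - k)) <= indicator {-1..1} x"
				using 1 by (simp add: indicator_def abs_le_iff minus_le_iff ennreal_le_1)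
			thus ?thesis by (simp add: add_increasing2 add.assoc)
		next
			case 2
			have "(1 + \<bar>x\<bar>) powr (- 1 - k) <= x powr (- 1 - k)"
				using 2 assms by (intro powr_mono2') auto
			hence "ennreal ((1 + \<bar>x\<bar>) powr (- 1 - k)) <= ?g x"
				using 2 by (simp add: ennreal_leI)
			thus ?thesis by (simp add: add_increasing add_increasing2)
		next
			case 3
			have "(1 + \<bar>x\<bar>) powr (- 1 - k) <= (- x) powr (- 1 - k)"
				using 3 assms by (intro powr_mono2') auto
			hence "ennreal ((1 + \<bar>x\<bar>) powr (- 1 - k)) <= ?g (- x)"
				using 3 by (simp add: ennreal_leI)
			thus ?thesis by (simp add: add_increasing)
		qed
	qed
	have "(NI lborel (%x. ennreal ((1 + \<bar>x\<bar>) powr (- 1 - k))))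
			<= (NI lborel (%x. indicator {-1..1} x + ?g x + ?g (- x)))"
		by (intro nn_integral_mono le)
	also have "... = (NI lborel (%x. indicator {-1..1::real} x)) + (NI lborel (%x. ?g x)) + (NI lborel (%x. ?g (- x)))"
		by (subst nn_integral_add; (subst nn_integral_add)?) auto
	also have "(NI lborel (%x. ?g (- x))) = (NI lborel (%x. ?g x))"
		by (rule nn_integral_lborel_uminus[of ?g]) measurable
	also have "(NI lborel (%x. indicator {-1..1::real} x)) + (NI lborel (%x. ?g x)) + (NI lborel (%x. ?g x)) < \<infinity>"
		using nn_integral_powr_to_inf_finite[of "- 1 - k"] assms by simp
	finally show ?thesis .
qed

lemma nn_integral_powr_one_plus_finite:
	assumes "(k::real) > 0" "a > -1"
	shows "(NI lborel (%x. ennreal (indicator {0<..} x * x powr a * (1 + x) powr (- (a + 1 + k))))) < \<infinity>"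
proof -
	have le: "ennreal (indicator {0<..} x * x powr a * (1 + x) powr (- (a + 1 + k)))
		 <= ennreal (indicator {0..1} x * x powr a) + ennreal (indicator {1..} x * x powr (- 1 - k))" for x :: real
	proof -
		consider "x <= 0" | "0 < x" "x <= 1" | "x > 1" by linarith
		thus ?thesis
		proof cases
			case 2
			have "(1 + x) powr (- (a + 1 + k)) <= (1 + x) powr 0"
				using 2 assms by (intro powr_mono) auto
			hence "x powr a * (1 + x) powr (- (a + 1 + k)) <= x powr a * 1"
				using 2 by (intro mult_left_mono) auto
			hence "ennreal (indicator {0<..} x * x powr a * (1 + x) powr (- (a + 1 + k))) <= ennreal (indicator {0..1} x * x powr a)"
				using 2 by (simp add: ennreal_leI)
			thus ?thesis by (simp add: add_increasing2)
		next
			case 3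
			have "(1 + x) powr (- (a + 1 + k)) <= x powr (- (a + 1 + k))"
				using 3 assms by (intro powr_mono2') auto
			hence "x powr a * (1 + x) powr (- (a + 1 + k)) <= x powr a * x powr (- (a + 1 + k))"
				using 3 by (intro mult_left_mono) auto
			also have "... = x powr (- 1 - k)" by (simp flip: powr_add)
			finally have "ennreal (indicator {0<..} x * x powr a * (1 + x) powr (- (a + 1 + k))) <= ennreal (indicator {1..} x * x powr (- 1 - k))"
				using 3 by (simp add: ennreal_leI)
			thus ?thesis by (simp add: add_increasing)
		qed simp
	qed
	have "(NI lborel (%x. ennreal (indicator {0<..} x * x powr a * (1 + x) powr (- (a + 1 + k)))))
		 <= (NI lborel (%x. ennreal (indicator {0..1} x * x powr a) + ennreal (indicator {1..} x * x powr (- 1 - k))))"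
		by (intro nn_integral_mono le)
	also have "... = (NI lborel (%x. ennreal (indicator {0..1} x * x powr a)))
			+ (NI lborel (%x. ennreal (indicator {1..} x * x powr (- 1 - k))))"
		by (subst nn_integral_add) auto
	also have "... < \<infinity>"
		using nn_integral_powr_to_inf_finite[of "- 1 - k"] nn_integral_powr_from_0_finite[of a] assms by simp
	finally show ?thesis .
qed

lemma powr_neg_le_cmult:
	fixes q X c e :: real
	assumes "0 < q" "q <= c * X" "c > 0" "e >= 0"
	shows "X powr (- e) <= c powr e * q powr (- e)"
proof -
	have "q / c <= X" using assms by (simp add: field_simps)
	hence "X powr (- e) <= (q / c) powr (- e)"
		using assms by (intro powr_mono2') auto
	also have "... = c powr e * q powr (- e)"
		using assms by (simp add: powr_divide powr_minus field_simps)
	finally show ?thesis .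
qed

text \<open>
	Coordinates in which \<open>rho\<close> is the imaginary part of the last variable: the tube becomes a half space.
\<close>

definition half_space_shear :: "'n::{finite,linorder} cvec => complex" where
	"half_space_shear v = \<i> / 2 * (\<Sum>j\<in>init_idx. of_real ((cmod (v $ j))^2) - (v $ j)\<^sup>2)"

lemma half_space_shear_measurable [measurable]: "half_space_shear : BM"
	unfolding half_space_shear_def by measurable

lemma half_space_shear_axis: "half_space_shear (v + axis lx c) = half_space_shear v"
	unfolding half_space_shear_def by (auto simp: axis_def intro!: arg_cong2[where f="(*)"] sum.cong)

lemma rho_half_space: "rho (v + axis lx (half_space_shear v)) = Im (v $ lx)"
proof -
	have 1: "(\<Sum>j\<in>init_idx. (Im ((v + axis lx c) $ j))^2) = (\<Sum>j\<in>init_idx. (Im (v $ j))^2)" for c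
		by (rule sum.cong) (auto simp: axis_def)
	have "Im (half_space_shear v) = (\<Sum>j\<in>init_idx. (Im (v $ j))^2)"
		unfolding half_space_shear_def cmod_power2
		by (auto simp: cmod_power2 sum_divide_distrib power2_eq_square algebra_simps intro!: sum.cong)
	thus ?thesis by (simp only: rho_def 1) (simp add: axis_def)
qed

lemma rho_ker_half_space:
	"rho_ker (v + axis lx (half_space_shear v)) bpt
		 = (v $ lx + \<i> * (1 + of_real (\<Sum>j\<in>init_idx. (cmod (v $ j))^2) / 2)) / (2 * \<i>)"
proof -
	have 1: "(\<Sum>j\<in>init_idx. ((v + axis lx c) $ j)^2) = (\<Sum>j\<in>init_idx. (v $ j)^2)" for c
		by (rule sum.cong) (auto simp: axis_def)
	show ?thesis unfolding rho_ker_base 1 half_space_shear_def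
		by (simp add: axis_def sum_subtractf field_simps)
qed

text \<open>In half space coordinates \<open>|rho_ker|\<close> dominates the modulus of the last
  real part, the last imaginary part plus 1, and the squares of the other coordinates, up to
  constants. Its power \<open>- b\<close> is distributed over all real variables so that the
  integrand is below a product whose one-dimensional factors are integrable.\<close>

lemma forelli_rudin_base_finite:
	fixes a b :: real
	assumes a: "a > -1" and b: "b > real CARD('n) + 1 + a"
	shows "(NI (W a :: 'n::{finite,linorder} cvec measure) (%w. ennreal (cmod (rho_ker w bpt) powr (- b)))) < \<infinity>"
proof -
	define n where "n = real CARD('n)"
	have n: "n >= 1" by (simp add: n_def Suc_leI)
	\<comment> \<open>The excess of \<open>b\<close> over the critical exponent, spread evenly over the
	  \<open>2 * n\<close> real variables.\<close>
	define k where "k = (b - n - 1 - a) / (2 * n)"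
	have k: "k > 0" using b n by (simp add: k_def n_def)
	define T where "T = (%v::'n cvec. v + axis lx (half_space_shear v))"
	define G where "G = (%w::'n cvec. ennreal (indicator tube w * rho w powr a) * ennreal (cmod (rho_ker w bpt) powr (- b)))"
	have [measurable]: "G : BM" unfolding G_def by measurable
	\<comment> \<open>The share of coordinate \<open>j\<close> in the exponent. For the last one it
	  splits as \<open>(1 + k) + (a + 1 + k)\<close>, where \<open>a\<close> compensates the weight
	  \<open>t powr a\<close>; for the others as \<open>1/2 + k\<close> twice, applied to
	  squares.\<close>
	define E where "E = (%j::'n. if j = lx then a + 2 + 2 * k else 1 + 2 * k)"
	define K where "K = (%j. (8::real) powr E j)"
	define f1 where "f1 = (%(j::'n) x::real. if j = lx then (1 + \<bar>x\<bar>) powr (- 1 - k) else (1 + \<bar>x\<bar>) powr (- 1 - 2 * k))"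
	define f2 where "f2 = (%(j::'n) x::real. if j = lx then indicator {0<..} x * x powr a * (1 + x) powr (- (a + 1 + k))
			else (1 + \<bar>x\<bar>) powr (- 1 - 2 * k))"
	have f_nonneg: "f1 j x >= 0" "f2 j x >= 0" for j x by (auto simp: f1_def f2_def)
	have E: "(\<Sum>j\<in>UNIV. E j) = b"
	proof -
		have "(\<Sum>j\<in>(UNIV::'n set). E j) = (a + 2 + 2 * k) + (\<Sum>j\<in>(init_idx::'n set). 1 + 2 * k)"
			by (subst sum.remove[of _ lx]) (auto simp: E_def)
		also have "... = (a + 2 + 2 * k) + (n - 1) * (1 + 2 * k)"
			by (simp add: n_def card_Diff_singleton_if of_nat_diff Suc_leI)
		also have "... = b" using n by (simp add: k_def field_simps)
		finally show ?thesis .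
	qed
	have key: "G (T v) <= ennreal (\<Prod>j\<in>UNIV. K j) * (\<Prod>j\<in>UNIV. ennreal (f1 j (Re (v $ j))) * ennreal (f2 j (Im (v $ j))))" for v
	proof (cases "Im (v $ lx) > 0")
		case False
		hence "T v \<notin> tube" by (simp add: tube_iff T_def rho_half_space)
		thus ?thesis by (simp add: G_def)
	next
		case True
		define t where "t = Im (v $ lx)"
		define S where "S = (\<Sum>j\<in>init_idx. (cmod (v $ j))^2)"
		define X where "X = cmod (rho_ker (T v) bpt)"
		have S0: "S >= 0" by (simp add: S_def sum_nonneg)
		have X: "2 * X = cmod (Complex (Re (v $ lx)) (t + 1 + S / 2))"
		proof -
			have "v $ lx + \<i> * (1 + of_real S / 2) = Complex (Re (v $ lx)) (t + 1 + S / 2)"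
				by (simp add: complex_eq_iff t_def)
			thus ?thesis unfolding X_def T_def rho_ker_half_space S_def[symmetric]
				by (simp add: norm_divide norm_mult)
		qed
		have X1: "\<bar>Re (v $ lx)\<bar> <= 2 * X" "t + 1 + S / 2 <= 2 * X"
			unfolding X using abs_Re_le_cmod[of "Complex (Re (v $ lx)) (t + 1 + S / 2)"]
				abs_Im_le_cmod[of "Complex (Re (v $ lx)) (t + 1 + S / 2)"] by auto
		have t: "t > 0" using True by (simp add: t_def)
		have X0: "X > 0" using X1 S0 t by linarith
		have coord: "(1 + \<bar>x\<bar>)^2 <= 8 * X" if "j : init_idx" "x\<^sup>2 <= (cmod (v $ j))^2" for j x
		proof -
			have "(cmod (v $ j))^2 <= S" unfolding S_def using that by (intro member_le_sum) auto
			hence "x\<^sup>2 <= S" using that by linarith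
			moreover have "(1 + \<bar>x\<bar>)^2 <= 2 + 2 * x\<^sup>2"
				using zero_le_power2[of "1 - \<bar>x\<bar>"] by (simp add: power2_eq_square algebra_simps)
			ultimately show ?thesis using X1 t by linarith
		qed
		have fac: "(if j = lx then t powr a else 1) * X powr (- E j) <= K j * (f1 j (Re (v $ j)) * f2 j (Im (v $ j)))" for j
		proof (cases "j = lx")
			case True
			have "X powr (- (1 + k)) <= 8 powr (1 + k) * (1 + \<bar>Re (v $ lx)\<bar>) powr (- (1 + k))"
				using X1 S0 t k by (intro powr_neg_le_cmult) auto
			moreover have "X powr (- (a + 1 + k)) <= 8 powr (a + 1 + k) * (1 + t) powr (- (a + 1 + k))"
				using X1 S0 t k a by (intro powr_neg_le_cmult) auto
			ultimately have "X powr (- (1 + k)) * X powr (- (a + 1 + k)) <=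
				 (8 powr (1 + k) * (1 + \<bar>Re (v $ lx)\<bar>) powr (- (1 + k))) * (8 powr (a + 1 + k) * (1 + t) powr (- (a + 1 + k)))"
				by (intro mult_mono) auto
			moreover have "X powr (- (1 + k)) * X powr (- (a + 1 + k)) = X powr (- E j)"
			proof -
				have "- (1 + k) + - (a + 1 + k) = - E j" by (simp add: True E_def)
				thus ?thesis by (simp only: powr_add[symmetric])
			qed
			moreover have k8: "K j = 8 powr (1 + k) * 8 powr (a + 1 + k)"
			proof -
				have "(1 + k) + (a + 1 + k) = E j" by (simp add: True E_def)
				thus ?thesis by (simp only: powr_add[symmetric] K_def)
			qed
			ultimately have "X powr (- E j) <= K j * ((1 + \<bar>Re (v $ lx)\<bar>) powr (- (1 + k)) * (1 + t) powr (- (a + 1 + k)))"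
				unfolding k8 by (simp add: mult_ac)
			hence "t powr a * X powr (- E j) <= t powr a * (K j * ((1 + \<bar>Re (v $ lx)\<bar>) powr (- (1 + k)) * (1 + t) powr (- (a + 1 + k))))"
				by (rule mult_left_mono) simp
			thus ?thesis using t
				by (simp add: True f1_def f2_def t_def[symmetric] algebra_simps)
		next
			case False
			have sq: "((1 + \<bar>x\<bar>)^2) powr (- (1/2 + k)) = (1 + \<bar>x\<bar>) powr (- 1 - 2 * k)" for x :: real
			proof -
				define c where "c = - (1/2 + k)"
				have "((1 + \<bar>x\<bar>)^2) powr c = ((1 + \<bar>x\<bar>) powr 2) powr c" by (subst powr_numeral) auto
				also have "... = (1 + \<bar>x\<bar>) powr (2 * c)" by (rule powr_powr)
				also have "2 * c = - 1 - 2 * k" by (simp add: c_def)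
				finally show ?thesis by (simp only: c_def)
			qed
			have "X powr (- (1/2 + k)) <= 8 powr (1/2 + k) * ((1 + \<bar>Re (v $ j)\<bar>)^2) powr (- (1/2 + k))"
				using coord[of j "Re (v $ j)"] False k by (intro powr_neg_le_cmult) (auto simp: cmod_power2)
			moreover have "X powr (- (1/2 + k)) <= 8 powr (1/2 + k) * ((1 + \<bar>Im (v $ j)\<bar>)^2) powr (- (1/2 + k))"
				using coord[of j "Im (v $ j)"] False k by (intro powr_neg_le_cmult) (auto simp: cmod_power2)
			ultimately have "X powr (- (1/2 + k)) * X powr (- (1/2 + k)) <=
				 (8 powr (1/2 + k) * (1 + \<bar>Re (v $ j)\<bar>) powr (- 1 - 2 * k)) * (8 powr (1/2 + k) * (1 + \<bar>Im (v $ j)\<bar>) powr (- 1 - 2 * k))"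
				unfolding sq by (intro mult_mono) auto
			moreover have "X powr (- (1/2 + k)) * X powr (- (1/2 + k)) = X powr (- E j)"
			proof -
				have "- (1/2 + k) + - (1/2 + k) = - E j" using False by (simp add: E_def)
				thus ?thesis by (simp only: powr_add[symmetric])
			qed
			moreover have k8: "K j = 8 powr (1/2 + k) * 8 powr (1/2 + k)"
			proof -
				have "(1/2 + k) + (1/2 + k) = E j" using False by (simp add: E_def)
				thus ?thesis by (simp only: powr_add[symmetric] K_def)
			qed
			ultimately show ?thesis using False
				unfolding k8 by (simp add: f1_def f2_def mult_ac)
		qed
		have "t powr a * X powr (- b) = (\<Prod>j\<in>UNIV. (if j = (lx::'n) then t powr a else 1) * X powr (- E j))"
		proof -
			have "(\<Prod>j\<in>UNIV. if j = (lx::'n) then t powr a else 1) = t powr a"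
				by (subst prod.remove[of _ lx]) auto
			moreover have "X powr (- b) = (\<Prod>j\<in>UNIV. X powr (- E j))"
				using X0 by (subst powr_sum[symmetric]) (auto simp: E sum_negf)
			ultimately show ?thesis by (simp add: prod.distrib)
		qed
		also have "... <= (\<Prod>j\<in>UNIV. K j * (f1 j (Re (v $ j)) * f2 j (Im (v $ j))))"
			by (intro prod_mono conjI fac) auto
		also have "... = (\<Prod>j\<in>UNIV. K j) * (\<Prod>j\<in>UNIV. f1 j (Re (v $ j)) * f2 j (Im (v $ j)))"
			by (simp add: prod.distrib)
		finally have "t powr a * X powr (- b) <= ..." .
		moreover have "G (T v) = ennreal (t powr a * X powr (- b))"
			using True by (simp add: G_def T_def tube_iff rho_half_space X_def t_def ennreal_mult)
		moreover have "ennreal ((\<Prod>j\<in>UNIV. K j) * (\<Prod>j\<in>UNIV. f1 j (Re (v $ j)) * f2 j (Im (v $ j))))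
			 = ennreal (\<Prod>j\<in>UNIV. K j) * (\<Prod>j\<in>UNIV. ennreal (f1 j (Re (v $ j))) * ennreal (f2 j (Im (v $ j))))"
			using f_nonneg
			by (subst ennreal_mult) (auto simp: K_def prod_nonneg prod_ennreal ennreal_mult[symmetric])
		ultimately show ?thesis using ennreal_leI by metis
	qed
	have "(NI (W a :: 'n cvec measure) (%w. ennreal (cmod (rho_ker w bpt) powr (- b)))) = (NI lborel (%w. G w))"
		unfolding G_def by (rule nn_integral_W) measurable
	also have "... = (NI lborel (%v. G (T v)))"
		unfolding T_def by (rule nn_integral_cvec_shear[symmetric]) (auto simp: half_space_shear_axis)
	also have "... <= (NI (lborel::'n cvec measure) (%v. ennreal (\<Prod>j\<in>UNIV. K j) * (\<Prod>j\<in>UNIV. ennreal (f1 j (Re (v $ j))) * ennreal (f2 j (Im (v $ j))))))"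
		by (intro nn_integral_mono key)
	also have "... = ennreal (\<Prod>j\<in>UNIV. K j) * (NI (lborel::'n cvec measure) (%v. (\<Prod>j\<in>UNIV. ennreal (f1 j (Re (v $ j))) * ennreal (f2 j (Im (v $ j))))))"
		by (rule nn_integral_cmult) (unfold f1_def f2_def, measurable)
	also have "(NI (lborel::'n cvec measure) (%v. (\<Prod>j\<in>UNIV. ennreal (f1 j (Re (v $ j))) * ennreal (f2 j (Im (v $ j))))))
		 = (\<Prod>j\<in>UNIV. (NI lborel (%x. ennreal (f1 j x))) * (NI lborel (%x. ennreal (f2 j x))))"
	proof -
		\<comment> \<open>The product formula for \<open>lborel\<close> indexes its factors by basis
		  vectors; \<open>THE\<close> recovers the coordinate to which a basis vector belongs.\<close>
		define g where "g = (%b::'n cvec. let j = (THE j. b = axis j 1 \<or> b = axis j \<i>) in if b = axis j 1 then f1 j else f2 j)"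
		have g: "g (axis j 1) = f1 j" "g (axis j \<i>) = f2 j" for j
		proof -
			have "(THE i. axis j (1::complex) = axis i 1 \<or> axis j 1 = axis i \<i>) = j"
					 "(THE i. axis j \<i> = axis i 1 \<or> axis j \<i> = axis i \<i>) = j"
				by (rule the_equality; auto simp: axis_eq_axis)+
			thus "g (axis j 1) = f1 j" "g (axis j \<i>) = f2 j"
				by (simp_all add: g_def Let_def axis_eq_axis)
		qed
		have "(NI (lborel::'n cvec measure) (%v. (\<Prod>j\<in>UNIV. ennreal (f1 j (Re (v $ j))) * ennreal (f2 j (Im (v $ j))))))
			 = (NI (lborel::'n cvec measure) (%v. (\<Prod>b\<in>Basis. ennreal (g b (v \<bullet> b)))))"
			unfolding prod_Basis_cvec by (simp add: g inner_axis inner_complex_def)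
		also have "... = (\<Prod>b\<in>Basis. (NI lborel (%x. ennreal (g b x))))"
		proof (rule nn_integral_lborel_prod)
			fix b :: "'n cvec" assume "b : Basis"
			then obtain j where "b = axis j 1 \<or> b = axis j \<i>"
				by (auto simp: Basis_vec_def Basis_complex_def)
			thus "(%x. ennreal (g b x)) : BM"
				by (auto simp: g f1_def f2_def)
		qed auto
		finally show ?thesis by (simp only: prod_Basis_cvec g)
	qed
	also have "ennreal (\<Prod>j\<in>UNIV. K j) * (\<Prod>j\<in>UNIV. (NI lborel (%x. ennreal (f1 j x))) * (NI lborel (%x. ennreal (f2 j x)))) < \<infinity>"
	proof -
		note fin = nn_integral_one_plus_abs_finite[of k] nn_integral_one_plus_abs_finite[of "2 * k"]
				nn_integral_powr_one_plus_finite[of k a]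
		have i1: "(NI lborel (%x. ennreal (f1 j x))) < \<infinity>" for j
			using fin k a unfolding f1_def by (cases "j = lx") simp_all
		have i2: "(NI lborel (%x. ennreal (f2 j x))) < \<infinity>" for j
			using fin k a unfolding f2_def by (cases "j = lx") simp_all
		have "(\<Prod>j\<in>A. (NI lborel (%x. ennreal (f1 j x))) * (NI lborel (%x. ennreal (f2 j x)))) < \<infinity>" if "finite A" for A
			using that by (induction A rule: finite_induct) (use i1 i2 in \<open>auto simp: ennreal_mult_less_top\<close>)
		thus ?thesis by (simp add: ennreal_mult_less_top)
	qed
	finally show ?thesis .
qed

lemma nn_integral_W_powr:
	assumes [measurable]: "f : BM"
	shows "(NI (W a) (%w. ennreal (rho w powr c) * f w)) = (NI (W (a + c)) (%w. f w))"
	by (simp add: nn_integral_W powr_add ennreal_mult[symmetric] mult.assoc[symmetric] flip: mult.assoc)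

text \<open>The automorphism that takes \<open>bpt\<close> to \<open>z\<close> scales the measure
  and \<open>|rho_ker|\<close> by powers of \<open>rho z\<close>, so the integral is an exact
  multiple of a power and not merely comparable to one.\<close>

lemma forelli_rudin:
	fixes a b :: real
	assumes a: "a > -1" and b: "b > real CARD('n) + 1 + a"
	obtains C where "C >= 0" "!!z::'n::{finite,linorder} cvec. z : tube ==>
		 (NI (W a) (%w. ennreal (cmod (rho_ker z w) powr (- b)))) = ennreal (C * rho z powr (real CARD('n) + 1 + a - b))"
proof -
	define I where "I = (NI (W a :: 'n cvec measure) (%w. ennreal (cmod (rho_ker w bpt) powr (- b))))"
	have I: "I = ennreal (enn2real I)"
		using forelli_rudin_base_finite[OF a b] by (simp add: I_def)
	show thesis
	proof (rule that[of "enn2real I"])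
		fix z :: "'n cvec" assume z: "z : tube"
		hence r: "rho z > 0" by (simp add: tube_iff)
		have "(NI (W a) (%w. ennreal (cmod (rho_ker z w) powr (- b)))) =
			 ennreal (rho z powr (real CARD('n) + 1 + a)) * (NI (W a) (%w. ennreal (cmod (rho_ker z (tube_aut z w)) powr (- b))))"
			by (rule nn_integral_W_tube_aut[OF z]) measurable
		also have "(%w. ennreal (cmod (rho_ker z (tube_aut z w)) powr (- b)))
			 = (%w. ennreal (rho z powr (- b)) * ennreal (cmod (rho_ker w bpt) powr (- b)))"
		proof
			fix w
			have "cmod (rho_ker z (tube_aut z w)) = rho z * cmod (rho_ker w bpt)"
				using rho_ker_tube_aut[OF z, of bpt w] z r by (simp add: norm_mult cmod_rho_ker_commute[of w])
			thus "ennreal (cmod (rho_ker z (tube_aut z w)) powr (- b)) = ennreal (rho z powr (- b)) * ennreal (cmod (rho_ker w bpt) powr (- b))"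
				using r by (simp add: powr_mult ennreal_mult)
		qed
		also have "(NI (W a :: 'n cvec measure) (%w. ennreal (rho z powr (- b)) * ennreal (cmod (rho_ker w bpt) powr (- b))))
			 = ennreal (rho z powr (- b)) * I"
			unfolding I_def by (rule nn_integral_cmult) measurable
		also have "ennreal (rho z powr (real CARD('n) + 1 + a)) * (ennreal (rho z powr (- b)) * I)
			 = ennreal (enn2real I * rho z powr (real CARD('n) + 1 + a - b))"
			by (subst I) (simp add: ennreal_mult[symmetric] mult_ac powr_diff powr_minus_divide)
		finally show "(NI (W a) (%w. ennreal (cmod (rho_ker z w) powr (- b)))) = ennreal (enn2real I * rho z powr (real CARD('n) + 1 + a - b))" .
	qed simp
qed

text \<open>The graph of \<open>h powr p\<close> lies above its tangent at \<open>m\<close>. This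
  form integrates to Jensen's inequality when \<open>m\<close> is the mean.\<close>

lemma young_powr:
	fixes h m p :: real
	assumes "p >= 1" "h >= 0" "m > 0"
	shows "p * m powr (p - 1) * h <= h powr p + (p - 1) * m powr p"
proof (cases "h = 0")
	case False
	have "(h powr p) powr (1 / p) * (m powr p) powr (1 - 1 / p) <= (1 / p) * h powr p + (1 - 1 / p) * m powr p"
		using assms False by (intro Youngs_inequality_0) auto
	also have "(h powr p) powr (1 / p) * (m powr p) powr (1 - 1 / p) = h * m powr (p - 1)"
		using assms False by (simp add: powr_powr right_diff_distrib)
	finally have "p * (h * m powr (p - 1)) <= p * ((1 / p) * h powr p + (1 - 1 / p) * m powr p)"
		using assms by (intro mult_left_mono) auto
	also have "p * ((1 / p) * h powr p + (1 - 1 / p) * m powr p) = h powr p + (p - 1) * m powr p"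
		using assms by (simp add: field_simps)
	finally show ?thesis by (simp add: mult_ac)
qed (use assms in auto)

text \<open>The tangent inequality at the mean \<open>m = B / K\<close> is integrated against
  \<open>k\<close>, so the weight need not be normalised to mass 1; \<open>K = 0\<close> would force
  \<open>B = 0\<close>.\<close>

lemma weighted_jensen_powr:
	fixes k h :: "'a => real"
	assumes p: "p >= 1" and [measurable]: "h : borel_measurable M"
		and k0: "!!x. k x >= 0" and h0: "!!x. h x >= 0"
		and k: "integrable M k" and kh: "integrable M (%x. k x * h x powr p)"
	shows "integrable M (%x. k x * h x)"
		and "(LINT x|M. k x * h x) powr p <= (LINT x|M. k x) powr (p - 1) * (LINT x|M. k x * h x powr p)"
proof -
	have [measurable]: "k : borel_measurable M" using k by simp
	show int: "integrable M (%x. k x * h x)"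
	proof (rule Bochner_Integration.integrable_bound)
		show "integrable M (%x. k x * h x powr p + (p - 1) * k x + k x)" using k kh by simp
		have "k x * h x <= k x * h x powr p + (p - 1) * k x + k x" for x
		proof -
			have "h x <= h x powr p + (p - 1) + 1"
				using young_powr[OF p h0, of 1 x] p h0[of x] mult_right_mono[of 1 p "h x"] by simp
			from mult_left_mono[OF this k0[of x]] show ?thesis by (simp add: algebra_simps)
		qed
		thus "AE x in M. norm (k x * h x) <= norm (k x * h x powr p + (p - 1) * k x + k x)"
			using k0 h0 p by (auto simp: abs_mult intro!: AE_I2)
	qed measurable
	define K A B where "K = (LINT x|M. k x)" and "A = (LINT x|M. k x * h x powr p)" and "B = (LINT x|M. k x * h x)"
	have nn: "K >= 0" "A >= 0" "B >= 0" unfolding K_def A_def B_def using k0 h0 by auto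
	have "B powr p <= K powr (p - 1) * A"
	proof (cases "B = 0")
		case True thus ?thesis using nn p by simp
	next
		case False
		have "K ~= 0"
		proof
			assume "K = 0"
			hence "AE x in M. k x = 0" unfolding K_def using integral_nonneg_eq_0_iff_AE[OF k] k0 by simp
			hence "B = (LINT x|M. 0)" unfolding B_def by (intro integral_cong_AE) auto
			thus False using False by simp
		qed
		hence K: "K > 0" and B: "B > 0" using nn False by auto
		define m where "m = B / K"
		have m: "m > 0" using K B by (simp add: m_def)
		have "p * m powr (p - 1) * B = (LINT x|M. p * m powr (p - 1) * (k x * h x))"
			unfolding B_def by simp
		also have "... <= (LINT x|M. k x * h x powr p + (p - 1) * m powr p * k x)"
		proof (rule integral_mono)
			fix x
			show "p * m powr (p - 1) * (k x * h x) <= k x * h x powr p + (p - 1) * m powr p * k x"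
				using mult_left_mono[OF young_powr[OF p h0 m] k0, of x x] by (simp add: algebra_simps)
		qed (use int k kh in auto)
		also have "... = A + (p - 1) * m powr p * K"
			using k kh by (simp add: A_def K_def)
		finally have "p * (m powr (p - 1) * m) * K <= A + (p - 1) * m powr p * K"
			using K by (simp add: m_def)
		also have "m powr (p - 1) * m = m powr p"
			using m by (simp add: powr_diff)
		finally have "m powr p * K <= A" by (simp add: algebra_simps)
		hence "K powr (p - 1) * (m powr p * K) <= K powr (p - 1) * A" by (intro mult_left_mono) auto
		also have "K powr (p - 1) * (m powr p * K) = B powr p"
			using K B by (simp add: m_def powr_divide powr_diff)
		finally show ?thesis .
	qed
	thus "(LINT x|M. k x * h x) powr p <= (LINT x|M. k x) powr (p - 1) * (LINT x|M. k x * h x powr p)"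
		by (simp add: K_def A_def B_def)
qed

section \<open>The Schur test\<close>

text \<open>\<open>si\<close> is the exponent of the test weight \<open>rho powr (- si)\<close>, and
  \<open>ep\<close> is the room left in all conditions. For \<open>p > 1\<close> the assumption
  \<open>p * (al + 1) > s + 1\<close> puts the lower bound \<open>(s - al) / (p - 1)\<close> below
  the upper bound \<open>al + 1\<close>; for \<open>p = 1\<close> it reads
  \<open>al > s\<close>.\<close>

lemma ex_schur_exponents:
	fixes al s p :: real
	assumes "al > -1" "s > -1" "1 <= p" "p * (al + 1) > s + 1"
	obtains si ep where "0 < ep" "ep < si" "si + ep < al + 1" "si * (p - 1) + ep < s + 1" "s - al + ep < si * (p - 1)"
proof -
	have "\<exists>si>0. si < al + 1 \<and> si * (p - 1) < s + 1 \<and> s - al < si * (p - 1)"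
	proof (cases "p = 1")
		case True
		thus ?thesis using assms by (intro exI[of _ "(al + 1) / 2"]) auto
	next
		case False
		hence p: "p - 1 > 0" using assms by simp
		define lo hi where "lo = max 0 ((s - al) / (p - 1))" and "hi = min (al + 1) ((s + 1) / (p - 1))"
		have "1 * (al + 1) < p * (al + 1)" using p assms by (intro mult_strict_right_mono) auto
		hence "lo < hi" using assms p by (auto simp: lo_def hi_def field_simps)
		then obtain si where "lo < si" "si < hi" using dense by blast
		thus ?thesis using p by (intro exI[of _ si]) (auto simp: lo_def hi_def field_simps)
	qed
	then obtain si where si: "si > 0" "si < al + 1" "si * (p - 1) < s + 1" "s - al < si * (p - 1)" by blast
	define g where "g = min (min si (al + 1 - si)) (min (s + 1 - si * (p - 1)) (si * (p - 1) - (s - al)))"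
	have "g > 0" using si by (simp add: g_def)
	moreover have "g <= si" "g <= al + 1 - si" "g <= s + 1 - si * (p - 1)" "g <= si * (p - 1) - (s - al)"
		by (auto simp: g_def)
	ultimately show thesis by (intro that[of "g / 2" si]) linarith+
qed

text \<open>The modulus of the Bergman kernel without its constant, enlarged by the factor that
  bounds the growth of functions of bounded oscillation.\<close>

definition schur_ker :: "real => real => 'n::{finite,linorder} cvec => 'n cvec => real" where
	"schur_ker al ep z w = cmod (rho_ker z w) powr (- (real CARD('n) + 1 + al)) * FF z w powr ep"

lemma schur_ker_nonneg [simp]: "0 <= schur_ker al ep z w"
	by (simp add: schur_ker_def)

lemma schur_ker_commute: "schur_ker al ep z w = schur_ker al ep w z"
	by (simp add: schur_ker_def FF_commute[of z w] cmod_rho_ker_commute[of z w])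

lemma FF_measurable [measurable (raw)]:
	assumes [measurable]: "f : borel_measurable M" "g : borel_measurable M"
	shows "(%x. FF (f x) (g x)) : borel_measurable M"
	unfolding FF_def by measurable

lemma schur_ker_measurable [measurable (raw)]:
	assumes [measurable]: "f : borel_measurable M" "g : borel_measurable M"
	shows "(%x. schur_ker al ep (f x) (g x)) : borel_measurable M"
	unfolding schur_ker_def by measurable

lemma schur_ker_eq:
	fixes z w :: "'n::{finite,linorder} cvec"
	assumes "z : tube" "w : tube"
	shows "schur_ker al ep z w
		= cmod (rho_ker z w) powr (- (real CARD('n) + 1 + al - 2 * ep)) * rho z powr (- ep) * rho w powr (- ep)"
proof -
	define X where "X = cmod (rho_ker z w)"
	have X: "X > 0" unfolding X_def by (rule cmod_rho_ker_pos[OF assms])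
	have r: "rho z > 0" "rho w > 0" using assms by (auto simp: tube_iff)
	have "(X\<^sup>2) powr ep = X powr (2 * ep)"
		using X powr_powr[of X 2 ep] by (simp add: powr_numeral)
	hence "FF z w powr ep = X powr (2 * ep) * rho z powr (- ep) * rho w powr (- ep)"
		using r X by (simp add: FF_def X_def[symmetric] powr_divide powr_mult powr_minus field_simps)
	moreover have "X powr (- (real CARD('n) + 1 + al)) * X powr (2 * ep) = X powr (- (real CARD('n) + 1 + al - 2 * ep))"
	proof -
		have "- (real CARD('n) + 1 + al) + 2 * ep = - (real CARD('n) + 1 + al - 2 * ep)" by simp
		thus ?thesis by (simp only: powr_add[symmetric])
	qed
	ultimately show ?thesis unfolding schur_ker_def X_def[symmetric] by (simp add: mult.assoc[symmetric])
qed

text \<open>\<open>FF powr ep\<close> is a product of powers of \<open>|rho_ker|\<close>,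
  \<open>rho z\<close> and \<open>rho w\<close>, hence it only shifts the exponents in
  \<open>forelli_rudin\<close>.\<close>

lemma schur_ker_integral:
	fixes al ep t c :: real
	assumes "t + c - ep > -1" "al - ep > t + c"
	obtains C where "C >= 0" "!!z::'n::{finite,linorder} cvec. z : tube ==>
		 (NI (W t) (%w. ennreal (schur_ker al ep z w * rho w powr c))) = ennreal (C * rho z powr (t + c - al))"
proof -
	define b where "b = real CARD('n) + 1 + al - 2 * ep"
	obtain C where C: "C >= 0" "!!z::'n cvec. z : tube ==>
		 (NI (W (t + (c - ep))) (%w. ennreal (cmod (rho_ker z w) powr (- b)))) = ennreal (C * rho z powr (real CARD('n) + 1 + (t + (c - ep)) - b))"
		by (rule forelli_rudin[where 'n='n, of "t + (c - ep)" b]) (use assms in \<open>auto simp: b_def\<close>)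
	show thesis
	proof (rule that[OF C(1)])
		fix z :: "'n cvec" assume z: "z : tube"
		have "(NI (W t) (%w. ennreal (schur_ker al ep z w * rho w powr c)))
			 = (NI (W t) (%w. ennreal (rho z powr (- ep)) * (ennreal (rho w powr (c - ep)) * ennreal (cmod (rho_ker z w) powr (- b)))))"
		proof (rule nn_integral_cong_AE, use AE_W_tube[of t] in eventually_elim)
			case (elim w)
			have "rho w powr (- ep) * rho w powr c = rho w powr (c - ep)" by (simp flip: powr_add)
			hence "schur_ker al ep z w * rho w powr c = rho z powr (- ep) * (rho w powr (c - ep) * cmod (rho_ker z w) powr (- b))"
				unfolding schur_ker_eq[OF z elim] b_def by (simp add: mult_ac)
			thus ?case by (simp add: ennreal_mult)
		qed
		also have "... = ennreal (rho z powr (- ep)) * (NI (W (t + (c - ep))) (%w. ennreal (cmod (rho_ker z w) powr (- b))))"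
			by (subst nn_integral_cmult) (auto simp: nn_integral_W_powr)
		also have "... = ennreal (rho z powr (- ep) * (C * rho z powr (real CARD('n) + 1 + (t + (c - ep)) - b)))"
			unfolding C(2)[OF z] using C(1) by (simp add: ennreal_mult)
		also have "rho z powr (- ep) * (C * rho z powr (real CARD('n) + 1 + (t + (c - ep)) - b)) = C * rho z powr (t + c - al)"
		proof -
			have "- ep + (real CARD('n) + 1 + (t + (c - ep)) - b) = t + c - al" by (simp add: b_def)
			hence "rho z powr (- ep) * rho z powr (real CARD('n) + 1 + (t + (c - ep)) - b) = rho z powr (t + c - al)"
				by (simp only: powr_add[symmetric])
			thus ?thesis by (simp add: mult_ac)
		qed
		finally show "(NI (W t) (%w. ennreal (schur_ker al ep z w * rho w powr c))) = ennreal (C * rho z powr (t + c - al))" .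
	qed
qed

text \<open>Jensen's inequality for the weight \<open>schur_ker * rho powr (- si)\<close>, whose
  mass is \<open>A * rho z powr (- si)\<close>, followed by Fubini and the second integral with
  constant \<open>B\<close>. Absolute convergence at every point of the tube is a separate claim,
  because the projection is later evaluated pointwise.\<close>

lemma schur_test:
	fixes al s p :: real
	assumes al: "al > -1" and s: "s > -1" and p: "1 <= p" and ps: "p * (al + 1) > s + 1"
	obtains ep C where "ep > 0" "C >= 0"
		"!!(h :: 'n::{finite,linorder} cvec => real) z. h : BM ==> (!!w. h w >= 0) ==>
			 integrable (W s) (%w. h w powr p) ==> z : tube ==> integrable (W al) (%w. schur_ker al ep z w * h w)"
		"!!(h :: 'n cvec => real). h : BM ==> (!!w. h w >= 0) ==>
			 integrable (W s) (%w. h w powr p) ==>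
			 (NI (W s) (%z. ennreal ((LINT w|W al. schur_ker al ep z w * h w) powr p))) <= ennreal C * (NI (W s) (%w. ennreal (h w powr p)))"
proof -
	obtain si ep where e: "0 < ep" "ep < si" "si + ep < al + 1" "si * (p - 1) + ep < s + 1" "s - al + ep < si * (p - 1)"
		using ex_schur_exponents[OF assms] .
	obtain A where A: "A >= 0" "!!z::'n cvec. z : tube ==>
		 (NI (W al) (%w. ennreal (schur_ker al ep z w * rho w powr (- si)))) = ennreal (A * rho z powr (al + - si - al))"
		by (rule schur_ker_integral[where 'n='n, of al "- si" ep al]) (use e in auto)
	obtain B where B: "B >= 0" "!!z::'n cvec. z : tube ==>
		 (NI (W s) (%w. ennreal (schur_ker al ep z w * rho w powr (- si * (p - 1))))) = ennreal (B * rho z powr (s + - si * (p - 1) - al))"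
		by (rule schur_ker_integral[where 'n='n, of s "- si * (p - 1)" ep al]) (use e in auto)
	interpret Wa: sigma_finite_measure "W al :: 'n cvec measure" by (rule sigma_finite_W)
	interpret Ws: sigma_finite_measure "W s :: 'n cvec measure" by (rule sigma_finite_W)
	interpret WW: pair_sigma_finite "W s :: 'n cvec measure" "W al :: 'n cvec measure" ..
	define k where "k = (%z w::'n cvec. schur_ker al ep z w * rho w powr (- si))"
	define kk where "kk = (%(h::'n cvec => real) z w. schur_ker al ep z w * (rho w powr (si * (p - 1)) * h w powr p))"
	have kk_nn: "0 <= kk h z w" for h z w by (simp add: kk_def)
	have kh: "k z w * (h w * rho w powr si) powr p = kk h z w" if "w : tube" "h w >= 0" for z w h
	proof -
		have "- si + si * p = si * (p - 1)" by (simp add: algebra_simps)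
		hence "rho w powr (- si) * (rho w powr si) powr p = rho w powr (si * (p - 1))"
			by (simp only: powr_powr powr_add[symmetric])
		thus ?thesis using that by (simp add: k_def kk_def powr_mult mult_ac)
	qed
	have kh1: "k z w * (h w * rho w powr si) = schur_ker al ep z w * h w" if "w : tube" for z w h
		using that by (simp add: k_def powr_minus tube_iff)
	have main: "integrable (W al) (%w. schur_ker al ep z w * h w) \<and> integrable (W al) (kk h z) \<and>
		 (LINT w|W al. schur_ker al ep z w * h w) powr p <= (A * rho z powr (- si)) powr (p - 1) * (LINT w|W al. kk h z w)"
		if [measurable]: "h : BM" and h0: "!!w. h w >= 0"
			and hi: "integrable (W s) (%w. h w powr p)" and z: "z : tube" for h z
	proof -
		have r: "rho z > 0" using z by (simp add: tube_iff)
		have k_int: "integrable (W al) (k z)" "(LINT w|W al. k z w) = A * rho z powr (- si)"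
		proof -
			have "(NI (W al) (%w. ennreal (k z w))) = ennreal (A * rho z powr (- si))"
				using A(2)[OF z] by (simp add: k_def)
			thus "integrable (W al) (k z)" "(LINT w|W al. k z w) = A * rho z powr (- si)"
				using A(1) by (intro integrableI_nn_integral_finite[where x="A * rho z powr (- si)"] integral_eq_nn_integral[THEN trans]; simp add: k_def borel_measurable_W)+
		qed
		\<comment> \<open>\<open>X powr (- N)\<close> is split so that the part with exponent
		  \<open>\<theta>\<close>, bounded by a power of \<open>rho w\<close>, completes the exponent of
		  \<open>rho w\<close> to \<open>s - al\<close>. That is the factor between the weights of
		  \<open>W al\<close> and \<open>W s\<close>.\<close>
		define \<theta> where "\<theta> = - ep + si * (p - 1) + al - s"
		define N where "N = real CARD('n) + 1 + al - 2 * ep"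
		have th: "0 < \<theta>" "\<theta> < N" using e s by (auto simp: \<theta>_def N_def)
		define D where "D = 2 powr \<theta> * (2 powr (N - \<theta>) * rho z powr (- (N - \<theta>))) * rho z powr (- ep)"
		have bound: "kk h z w <= D * (rho w powr (s - al) * h w powr p)" if w: "w : tube" for w
		proof -
			have rw: "rho w > 0" using w by (simp add: tube_iff)
			define X where "X = cmod (rho_ker z w)"
			have X: "rho z <= 2 * X" "rho w <= 2 * X" using cmod_rho_ker_ge[of z w] r rw by (auto simp: X_def)
			have "X powr (- N) = X powr (- \<theta>) * X powr (- (N - \<theta>))" by (simp flip: powr_add)
			also have "... <= (2 powr \<theta> * rho w powr (- \<theta>)) * (2 powr (N - \<theta>) * rho z powr (- (N - \<theta>)))"
				using X r rw th by (intro mult_mono powr_neg_le_cmult) auto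
			finally have "X powr (- N) * rho z powr (- ep) * (rho w powr (- ep) * rho w powr (si * (p - 1)) * h w powr p)
				<= (2 powr \<theta> * rho w powr (- \<theta>)) * (2 powr (N - \<theta>) * rho z powr (- (N - \<theta>))) * rho z powr (- ep) * (rho w powr (- ep) * rho w powr (si * (p - 1)) * h w powr p)"
				by (intro mult_right_mono) auto
			also have "... = D * ((rho w powr (- \<theta>) * rho w powr (- ep) * rho w powr (si * (p - 1))) * h w powr p)"
				by (simp add: D_def mult_ac)
			also have "rho w powr (- \<theta>) * rho w powr (- ep) * rho w powr (si * (p - 1)) = rho w powr (s - al)"
			proof -
				have "- \<theta> + - ep + si * (p - 1) = s - al" by (simp add: \<theta>_def)
				thus ?thesis by (simp only: powr_add[symmetric])
			qed
			finally show ?thesis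
				unfolding kk_def schur_ker_eq[OF z w] X_def N_def by (simp add: mult_ac)
		qed
		have kk_int: "integrable (W al) (kk h z)"
		proof (rule integrableI_nonneg)
			show "kk h z : borel_measurable (W al)" unfolding kk_def borel_measurable_W by measurable
			have "(NI (W al) (%w. ennreal (kk h z w))) <= (NI (W al) (%w. ennreal D * (ennreal (rho w powr (s - al)) * ennreal (h w powr p))))"
				by (rule nn_integral_mono_AE, use AE_W_tube[of al] in eventually_elim)
					 (use bound in \<open>auto simp: D_def ennreal_mult[symmetric] intro!: ennreal_leI\<close>)
			also have "... = ennreal D * (NI (W s) (%w. ennreal (h w powr p)))"
				by (subst nn_integral_cmult) (auto simp: nn_integral_W_powr)
			also have "... < \<infinity>"
				using hi nn_integral_eq_integral[OF hi] by (simp add: ennreal_mult_less_top)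
			finally show "(NI (W al) (%w. ennreal (kk h z w))) < \<infinity>" .
		qed (use kk_nn in auto)
		have kk_int': "integrable (W al) (%w. k z w * (h w * rho w powr si) powr p)"
			by (rule integrable_cong_AE_imp[OF kk_int])
				 (simp add: borel_measurable_W k_def, use AE_W_tube[of al] in eventually_elim, use kh h0 in auto)
		have J: "integrable (W al) (%w. k z w * (h w * rho w powr si))"
			"(LINT w|W al. k z w * (h w * rho w powr si)) powr p <= (LINT w|W al. k z w) powr (p - 1) * (LINT w|W al. k z w * (h w * rho w powr si) powr p)"
			by (rule weighted_jensen_powr[OF p _ _ _ k_int(1) kk_int']; simp add: borel_measurable_W k_def h0)+
		have 1: "integrable (W al) (%w. schur_ker al ep z w * h w)"
			by (rule integrable_cong_AE_imp[OF J(1)])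
				 (simp add: borel_measurable_W, use AE_W_tube[of al] in eventually_elim, use kh1 in auto)
		have 2: "(LINT w|W al. k z w * (h w * rho w powr si)) = (LINT w|W al. schur_ker al ep z w * h w)"
			by (rule integral_cong_AE) (simp_all add: borel_measurable_W k_def, use AE_W_tube[of al] in eventually_elim, use kh1 in \<open>auto simp: k_def\<close>)
		have 3: "(LINT w|W al. k z w * (h w * rho w powr si) powr p) = (LINT w|W al. kk h z w)"
			by (rule integral_cong_AE) (simp_all add: borel_measurable_W k_def kk_def, use AE_W_tube[of al] in eventually_elim, use kh h0 in \<open>auto simp: k_def kk_def\<close>)
		show ?thesis using 1 J(2) kk_int unfolding 2 3 k_int(2) by blast
	qed
	show thesis
	proof (rule that[of ep "A powr (p - 1) * B"])
		show "ep > 0" by fact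
		show "A powr (p - 1) * B >= 0" using B by simp
		fix h :: "'n cvec => real"
		assume h[measurable]: "h : BM" and h0: "!!w. h w >= 0" and hi: "integrable (W s) (%w. h w powr p)"
		show "integrable (W al) (%w. schur_ker al ep z w * h w)" if "z : tube" for z
			using main[OF h h0 hi that] by blast
		have "(NI (W s) (%z. ennreal ((LINT w|W al. schur_ker al ep z w * h w) powr p)))
			 <= (NI (W s) (%z. ennreal (A powr (p - 1) * rho z powr (- si * (p - 1))) * (NI (W al) (%w. ennreal (kk h z w)))))"
		proof (rule nn_integral_mono_AE, use AE_W_tube[of s] in eventually_elim)
			case (elim z)
			note m = main[OF h h0 hi elim]
			have "(NI (W al) (%w. ennreal (kk h z w))) = ennreal (LINT w|W al. kk h z w)"
				using m kk_nn by (intro nn_integral_eq_integral) auto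
			moreover have "(A * rho z powr (- si)) powr (p - 1) = A powr (p - 1) * rho z powr (- si * (p - 1))"
				using A(1) by (simp add: powr_mult powr_powr)
			ultimately show ?case using m kk_nn by (auto simp: ennreal_mult[symmetric] intro!: ennreal_leI)
		qed
		also have "... = (NI (W s) (%z. (NI (W al) (%w. ennreal (A powr (p - 1)) * (ennreal (rho w powr (si * (p - 1)) * h w powr p) * ennreal (schur_ker al ep w z * rho z powr (- si * (p - 1))))))))"
		proof (rule nn_integral_cong)
			fix z :: "'n cvec"
			have "ennreal (A powr (p - 1) * rho z powr (- si * (p - 1))) * (NI (W al) (%w. ennreal (kk h z w)))
				= (NI (W al) (%w. ennreal (A powr (p - 1) * rho z powr (- si * (p - 1))) * ennreal (kk h z w)))"
				by (rule nn_integral_cmult[symmetric]) (simp add: kk_def borel_measurable_W)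
			also have "... = (NI (W al) (%w. ennreal (A powr (p - 1)) * (ennreal (rho w powr (si * (p - 1)) * h w powr p) * ennreal (schur_ker al ep w z * rho z powr (- si * (p - 1))))))"
				by (intro nn_integral_cong) (simp add: kk_def schur_ker_commute[of _ _ z] ennreal_mult[symmetric] mult_ac)
			finally show "ennreal (A powr (p - 1) * rho z powr (- si * (p - 1))) * (NI (W al) (%w. ennreal (kk h z w)))
				= (NI (W al) (%w. ennreal (A powr (p - 1)) * (ennreal (rho w powr (si * (p - 1)) * h w powr p) * ennreal (schur_ker al ep w z * rho z powr (- si * (p - 1))))))" .
		qed
		also have "... = (NI (W al) (%w. (NI (W s) (%z. ennreal (A powr (p - 1)) * (ennreal (rho w powr (si * (p - 1)) * h w powr p) * ennreal (schur_ker al ep w z * rho z powr (- si * (p - 1))))))))"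
			by (rule WW.Fubini'[symmetric]) measurable
		also have "... = (NI (W al) (%w. ennreal (A powr (p - 1) * B) * (ennreal (rho w powr (s - al)) * ennreal (h w powr p))))"
		proof (rule nn_integral_cong_AE, use AE_W_tube[of al] in eventually_elim)
			case (elim w)
			have "(NI (W s) (%z. ennreal (A powr (p - 1)) * (ennreal (rho w powr (si * (p - 1)) * h w powr p) * ennreal (schur_ker al ep w z * rho z powr (- si * (p - 1))))))
				 = ennreal (A powr (p - 1)) * (ennreal (rho w powr (si * (p - 1)) * h w powr p) * ennreal (B * rho w powr (s + - si * (p - 1) - al)))"
				unfolding B(2)[OF elim, symmetric]
				by (subst nn_integral_cmult, simp add: borel_measurable_W, subst nn_integral_cmult) (simp_all add: borel_measurable_W)
			also have "... = ennreal (A powr (p - 1) * B * ((rho w powr (si * (p - 1)) * rho w powr (s + - si * (p - 1) - al)) * h w powr p))"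
				using B(1) by (simp add: ennreal_mult[symmetric] mult_ac)
			also have "rho w powr (si * (p - 1)) * rho w powr (s + - si * (p - 1) - al) = rho w powr (s - al)"
				by (simp flip: powr_add)
			finally show ?case using B(1) by (simp add: ennreal_mult)
		qed
		also have "... = ennreal (A powr (p - 1) * B) * (NI (W s) (%w. ennreal (h w powr p)))"
			by (subst nn_integral_cmult) (auto simp: nn_integral_W_powr)
		finally show "(NI (W s) (%z. ennreal ((LINT w|W al. schur_ker al ep z w * h w) powr p))) <= ennreal (A powr (p - 1) * B) * (NI (W s) (%w. ennreal (h w powr p)))" .
	qed
qed

subsection \<open>The Bergman kernel of the half plane\<close>

lemma inverse_one_plus_square:
	"integrable lborel (%x::real. 1 / (1 + x\<^sup>2))" "(LINT x|lborel. 1 / (1 + x\<^sup>2)) = pi"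
proof -
	have e: "einterval (-\<infinity>) \<infinity> = UNIV" by (auto simp: einterval_def)
	show "integrable lborel (%x::real. 1 / (1 + x\<^sup>2))"
		using integrable_inverse_1_plus_square unfolding e set_integrable_def by (simp add: inverse_eq_divide)
	show "(LINT x|lborel. 1 / (1 + x\<^sup>2)) = pi"
		using LBINT_inverse_1_plus_square
		by (simp add: interval_lebesgue_integral_def e set_lebesgue_integral_def inverse_eq_divide)
qed

lemma integral_truncate_tendsto:
	fixes f :: "real => complex"
	assumes f: "integrable lborel f"
	shows "((%R. (LINT x|lborel. indicator {-R..R} x *\<^sub>R f x)) \<longlongrightarrow> (LINT x|lborel. f x)) at_top"
proof (rule integral_dominated_convergence_at_top[where w="%x. norm (f x)"])
	show "AE x in lborel. ((%R. indicator {-R..R} x *\<^sub>R f x) \<longlongrightarrow> f x) at_top"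
	proof (rule AE_I2)
		fix x :: real
		have "\<forall>\<^sub>F R in at_top. indicator {-R..R} x *\<^sub>R f x = f x"
			using eventually_ge_at_top[of "\<bar>x\<bar>"] by eventually_elim (auto simp: indicator_def)
		thus "((%R. indicator {-R..R} x *\<^sub>R f x) \<longlongrightarrow> f x) at_top" by (rule tendsto_eventually)
	qed
qed (use f in \<open>auto simp: indicator_def\<close>)

text \<open>
	The primitive of \<open>F\<close> on the strip turns the difference of the two integrals over \<open>[-R, R]\<close> into
	increments over vertical segments, which tend to \<open>0\<close>.
\<close>

lemma integral_horizontal_line_shift:
	fixes F :: "complex => complex" and a b :: real
	assumes hol: "F holomorphic_on {u. a < Im u \<and> Im u < b}"
		and cd: "a < c" "c <= d" "d < b"
		and bd: "!!x y. c <= y ==> y <= d ==> cmod (F (Complex x y)) <= K / (1 + x\<^sup>2)"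
	shows "integrable lborel (%x. F (Complex x c))" "integrable lborel (%x. F (Complex x d))"
		"(LINT x|lborel. F (Complex x c)) = (LINT x|lborel. F (Complex x d))"
proof -
	define S where "S = {u. a < Im u \<and> Im u < b}"
	have S: "S = {u. a < Im u} \<inter> {u. Im u < b}" by (auto simp: S_def)
	have So: "open S" unfolding S by (intro open_Int open_halfspace_Im_gt open_halfspace_Im_lt)
	have Sc: "convex S" unfolding S by (intro convex_Int convex_halfspace_Im_gt convex_halfspace_Im_lt)
	obtain P where P: "!!x. x : S ==> (P has_field_derivative F x) (at x within S)"
		using holomorphic_convex_primitive'[OF Sc So hol[folded S_def]] by blast
	have P': "(P has_field_derivative F x) (at x)" if "x : S" for x
		using P[OF that] unfolding at_within_open[OF that So] .
	have cont: "continuous_on UNIV (%x. F (Complex x y))" if "a < y" "y < b" for y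
	proof (rule continuous_on_compose2[of S F])
		show "continuous_on S F" using hol holomorphic_on_imp_continuous_on by (simp add: S_def)
		show "continuous_on UNIV (%x. Complex x y)" unfolding Complex_eq by (intro continuous_intros)
	qed (use that in \<open>auto simp: S_def\<close>)
	have int: "integrable lborel (%x. F (Complex x y))" if y: "c <= y" "y <= d" for y
	proof (rule Bochner_Integration.integrable_bound)
		show "integrable lborel (%x. K * (1 / (1 + x\<^sup>2)))"
			using inverse_one_plus_square(1) by (rule integrable_mult_right)
		show "(%x. F (Complex x y)) : borel_measurable lborel"
			using cont[of y] y cd by (auto intro: borel_measurable_continuous_onI)
		show "AE x in lborel. norm (F (Complex x y)) <= norm (K * (1 / (1 + x\<^sup>2)))"
			using order.trans[OF bd[OF y] abs_ge_self]
			by (intro AE_I2) (simp only: real_norm_def times_divide_eq_right mult_1_right)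
	qed
	show i: "integrable lborel (%x. F (Complex x c))" "integrable lborel (%x. F (Complex x d))"
		using int cd by auto
	have ftc: "(LINT x|lborel. indicator {-R..R} x *\<^sub>R F (Complex x y)) = P (Complex R y) - P (Complex (-R) y)"
		if y: "c <= y" "y <= d" and R: "R >= 0" for R y
	proof -
		have "((%x. P (Complex x y)) has_vector_derivative F (Complex x y)) (at x)" for x
		proof -
			have "(P has_field_derivative F (Complex x y)) (at (Complex x y))"
				using y cd by (intro P') (auto simp: S_def)
			moreover have "((%x. Complex x y) has_vector_derivative 1) (at x)"
				unfolding Complex_eq by (auto intro!: derivative_eq_intros)
			ultimately have "((P \<circ> (%x. Complex x y)) has_vector_derivative (1 * F (Complex x y))) (at x)"
				by (intro field_vector_diff_chain_at) auto
			thus ?thesis by (simp add: o_def)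
		qed
		hence "(LINT x|lborel. indicator {-R..R} x *\<^sub>R F (Complex x y)) = P (Complex R y) - P (Complex (- R) y)"
			using R cont[of y] y cd
			by (intro integral_FTC_Icc) (auto intro: has_vector_derivative_at_within continuous_on_subset)
		thus ?thesis .
	qed
	have vert: "cmod (P (Complex x d) - P (Complex x c)) <= K / (1 + x\<^sup>2) * (d - c)" for x
	proof -
		have seg: "u : S \<and> cmod (F u) <= K / (1 + x\<^sup>2)" if "u : closed_segment (Complex x c) (Complex x d)" for u
		proof -
			from that[unfolded in_segment(1)]
			obtain t where t: "0 <= t" "t <= 1" "u = (1 - t) *\<^sub>R Complex x c + t *\<^sub>R Complex x d"
				by (elim exE conjE) (rule that)
			have u: "u = Complex x (c + t * (d - c))" unfolding t(3) by (simp add: complex_eq_iff algebra_simps)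
			have "t * (d - c) <= 1 * (d - c)" using t cd by (intro mult_right_mono) auto
			moreover have "0 <= t * (d - c)" using t cd by simp
			ultimately have "c <= c + t * (d - c)" "c + t * (d - c) <= d" by auto
			thus ?thesis unfolding u using bd cd by (auto simp: S_def)
		qed
		have "norm (P (Complex x d) - P (Complex x c)) <= (K / (1 + x\<^sup>2)) * norm (Complex x d - Complex x c)"
			by (rule field_differentiable_bound[of "closed_segment (Complex x c) (Complex x d)" P F])
				 (use seg P' in \<open>auto intro: has_field_derivative_at_within\<close>)
		also have "norm (Complex x d - Complex x c) = d - c"
			using cd by (simp add: cmod_def)
		finally show ?thesis .
	qed
	have lim0: "((%R. (LINT x|lborel. indicator {-R..R} x *\<^sub>R F (Complex x d)) - (LINT x|lborel. indicator {-R..R} x *\<^sub>R F (Complex x c))) \<longlongrightarrow> 0) at_top"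
	proof (rule Lim_null_comparison)
		show "\<forall>\<^sub>F R in at_top. norm ((LINT x|lborel. indicator {-R..R} x *\<^sub>R F (Complex x d)) - (LINT x|lborel. indicator {-R..R} x *\<^sub>R F (Complex x c)))
				<= 2 * (K * (d - c)) / (1 + R\<^sup>2)"
			using eventually_ge_at_top[of 0]
		proof eventually_elim
			case (elim R)
			have "(LINT x|lborel. indicator {-R..R} x *\<^sub>R F (Complex x d)) - (LINT x|lborel. indicator {-R..R} x *\<^sub>R F (Complex x c))
				 = (P (Complex R d) - P (Complex R c)) - (P (Complex (-R) d) - P (Complex (-R) c))"
				using ftc[of c R] ftc[of d R] cd elim by simp
			also have "norm ... <= norm (P (Complex R d) - P (Complex R c)) + norm (P (Complex (-R) d) - P (Complex (-R) c))"
				by (rule norm_triangle_ineq4)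
			also have "... <= K / (1 + R\<^sup>2) * (d - c) + K / (1 + (-R)^2) * (d - c)"
				by (intro add_mono vert)
			finally show ?case by simp
		qed
		have "filterlim (%R::real. 1 + R\<^sup>2) at_top at_top"
			by (intro filterlim_tendsto_add_at_top[OF tendsto_const] filterlim_pow_at_top filterlim_ident) simp
		thus "((%R. 2 * (K * (d - c)) / (1 + R\<^sup>2)) \<longlongrightarrow> 0) at_top"
			by (intro tendsto_divide_0[OF tendsto_const] filterlim_at_top_imp_at_infinity)
	qed
	have "((%R. (LINT x|lborel. indicator {-R..R} x *\<^sub>R F (Complex x d)) - (LINT x|lborel. indicator {-R..R} x *\<^sub>R F (Complex x c)))
		 \<longlongrightarrow> (LINT x|lborel. F (Complex x d)) - (LINT x|lborel. F (Complex x c))) at_top"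
		by (intro tendsto_diff integral_truncate_tendsto i)
	from tendsto_unique[OF _ this lim0] show "(LINT x|lborel. F (Complex x c)) = (LINT x|lborel. F (Complex x d))" by simp
qed

text \<open>
	Subtracting \<open>h(\<i>)\<close> times the model function \<open>2\<i> / (u + \<i>)\<close> removes the pole; what remains vanishes by
	shifting the line to \<open>+\<i>\<infinity>\<close>.
\<close>

lemma cauchy_formula_horizontal_line:
	fixes h :: "complex => complex"
	assumes hol: "h holomorphic_on {u. 0 < Im u}"
		and bd: "!!u. 0 < Im u ==> cmod (h u) <= K / (1 + (cmod u)^2)"
	shows "(LINT x|lborel. h (Complex x (1/2)) / (Complex x (1/2) - \<i>)) = 2 * of_real pi * \<i> * h \<i>"
		and "integrable lborel (%x. h (Complex x (1/2)) / (Complex x (1/2) - \<i>))"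
proof -
	let ?H = "{u. 0 < Im u}"
	have Ho: "open ?H" by (rule open_halfspace_Im_gt)
	have K: "K >= 0" using order.trans[OF norm_ge_zero bd[of \<i>]] by (simp add: zero_le_divide_iff)
	define f where "f = (%u. h u - h \<i> * (2 * \<i> / (u + \<i>)))"
	have ne: "u + \<i> ~= 0" if "0 < Im u" for u using that by (auto simp: complex_eq_iff)
	have fhol: "f holomorphic_on ?H"
		unfolding f_def by (intro holomorphic_intros hol) (use ne in auto)
	have fi: "f \<i> = 0" by (simp add: f_def complex_eq_iff)
	\<comment> \<open>The difference quotient of \<open>f\<close> at \<open>\<i>\<close>, holomorphic
	  across \<open>\<i>\<close>; as \<open>f \<i> = 0\<close> it equals
	  \<open>f u / (u - \<i>)\<close> elsewhere.\<close>
	define q where "q = (%u. if u = \<i> then deriv f \<i> else (f u - f \<i>) / (u - \<i>))"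
	have qhol: "q holomorphic_on ?H" unfolding q_def by (rule pole_lemma_open[OF fhol Ho])
	have nsum: "(cmod (u + \<i>))^2 >= 1 + (cmod u)^2" if "0 < Im u" for u
		using that unfolding cmod_power2 by (simp add: power2_eq_square algebra_simps)
	define K' where "K' = K + 2 * cmod (h \<i>)"
	have K': "K' >= 0" using K by (simp add: K'_def)
	have fbd: "cmod (f u) <= K' / sqrt (1 + (cmod u)^2)" if u: "0 < Im u" for u
	proof -
		have s: "1 <= sqrt (1 + (cmod u)^2)" by simp
		have "K / (1 + (cmod u)^2) <= K / sqrt (1 + (cmod u)^2)"
		proof (intro divide_left_mono K)
			show "sqrt (1 + (cmod u)^2) <= 1 + (cmod u)^2"
				using mult_left_mono[OF s, of "sqrt (1 + (cmod u)^2)"] by simp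
			show "0 < (1 + (cmod u)^2) * sqrt (1 + (cmod u)^2)"
				by (intro mult_pos_pos) (auto simp: add_pos_nonneg)
		qed
		moreover have "cmod (h \<i> * (2 * \<i> / (u + \<i>))) <= 2 * cmod (h \<i>) / sqrt (1 + (cmod u)^2)"
		proof -
			have "sqrt (1 + (cmod u)^2) <= cmod (u + \<i>)" using nsum[OF u] by (intro real_le_lsqrt) auto
			hence "2 * cmod (h \<i>) / cmod (u + \<i>) <= 2 * cmod (h \<i>) / sqrt (1 + (cmod u)^2)"
				using s ne[OF u] by (intro divide_left_mono mult_pos_pos) (auto simp: add_pos_nonneg)
			thus ?thesis by (simp add: norm_mult norm_divide mult.commute)
		qed
		moreover have "cmod (f u) <= cmod (h u) + cmod (h \<i> * (2 * \<i> / (u + \<i>)))"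
			unfolding f_def by (rule norm_triangle_ineq4)
		ultimately show ?thesis using bd[OF u] by (simp add: K'_def add_divide_distrib)
	qed
	have q_eq: "cmod (q u) = cmod (f u) / cmod (u - \<i>)" if "u ~= \<i>" for u
		using that by (simp add: q_def fi norm_divide)
	have sq_mono: "sqrt (1 + (Re u)^2) <= sqrt (1 + (cmod u)^2)" for u
		by (simp add: cmod_power2)
	\<comment> \<open>Near \<open>\<i>\<close> the quotient is bounded by compactness; away from it,
	  \<open>|u - \<i>|\<close> and the decay of \<open>f\<close> contribute one order each to the
	  quadratic decay in \<open>Re u\<close>.\<close>
	obtain Q where Q: "!!u. u : cball \<i> (1/4) ==> cmod (q u) <= Q"
	proof -
		have "cball \<i> (1/4) <= ?H"
		proof
			fix u assume "u : cball \<i> (1/4)"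
			hence "cmod (\<i> - u) <= 1/4" by (simp add: dist_norm)
			hence "\<bar>Im (\<i> - u)\<bar> <= 1/4" using abs_Im_le_cmod[of "\<i> - u"] by linarith
			thus "u : ?H" by (auto simp: abs_if split: if_splits)
		qed
		hence "continuous_on (cball \<i> (1/4)) q"
			using holomorphic_on_imp_continuous_on[OF qhol] continuous_on_subset by blast
		hence "bounded (q ` cball \<i> (1/4))"
			by (intro compact_imp_bounded compact_continuous_image) auto
		then obtain M where "\<forall>x\<in>q ` cball \<i> (1/4). norm x <= M" unfolding bounded_iff by blast
		thus thesis by (intro that[of M]) blast
	qed
	have Q0: "Q >= 0" using order.trans[OF norm_ge_zero Q[of \<i>]] by simp
	have qbd: "cmod (q u) <= (5 * K' + 2 * Q) / (1 + (Re u)^2)" if u: "0 < Im u" for u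
	proof (cases "u : cball \<i> (1/4)")
		case True
		have "\<bar>Re (\<i> - u)\<bar> <= 1/4" using True abs_Re_le_cmod[of "\<i> - u"] by (simp add: dist_norm)
		hence "(Re u)^2 <= 1\<^sup>2" by (subst abs_le_square_iff[symmetric]) auto
		hence le: "Q * (1 + (Re u)^2) <= Q * 2" using Q0 by (intro mult_left_mono) auto
		have "cmod (q u) * (1 + (Re u)^2) <= Q * (1 + (Re u)^2)"
			by (intro mult_right_mono Q True) auto
		also have "... <= 5 * K' + 2 * Q" using le K' by linarith
		finally show ?thesis by (subst pos_le_divide_eq) (auto simp: add_pos_nonneg)
	next
		case False
		hence d: "cmod (u - \<i>) > 1/4" by (simp add: dist_norm norm_minus_commute)
		hence ui: "u ~= \<i>" by auto
		have "(1/4)^2 <= (cmod (u - \<i>))^2" using d by (intro power_mono) auto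
		moreover have "(Re u)^2 <= (cmod (u - \<i>))^2" by (simp add: cmod_power2)
		ultimately have "1 + (Re u)^2 <= 25 * (cmod (u - \<i>))^2"
			by (simp add: power2_eq_square)
		hence "sqrt (1 + (Re u)^2) <= 5 * cmod (u - \<i>)"
			by (intro real_le_lsqrt) (auto simp: power_mult_distrib)
		hence "sqrt (1 + (Re u)^2) * sqrt (1 + (Re u)^2) <= (5 * cmod (u - \<i>)) * sqrt (1 + (cmod u)^2)"
			by (intro mult_mono sq_mono) auto
		hence le: "1 + (Re u)^2 <= 5 * (cmod (u - \<i>) * sqrt (1 + (cmod u)^2))" by simp
		have "cmod (q u) <= (K' / sqrt (1 + (cmod u)^2)) / cmod (u - \<i>)"
			unfolding q_eq[OF ui] by (intro divide_right_mono fbd u) auto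
		also have "... = 5 * K' / (5 * (cmod (u - \<i>) * sqrt (1 + (cmod u)^2)))"
			by (simp add: mult.commute)
		also have "... <= 5 * K' / (1 + (Re u)^2)"
			using le K' by (intro divide_left_mono mult_pos_pos) (auto simp: add_pos_nonneg intro: order.strict_trans2[rotated])
		also have "... <= (5 * K' + 2 * Q) / (1 + (Re u)^2)"
			using Q0 by (intro divide_right_mono) auto
		finally show ?thesis .
	qed
	have shift: "integrable lborel (%x. q (Complex x (1/2)))"
			"(LINT x|lborel. q (Complex x (1/2))) = (LINT x|lborel. q (Complex x y))" if y: "y >= 1/2" for y
	proof -
		have hs: "q holomorphic_on {u. 0 < Im u \<and> Im u < y + 1}"
			by (rule holomorphic_on_subset[OF qhol]) auto
		have b: "cmod (q (Complex x y')) <= (5 * K' + 2 * Q) / (1 + x\<^sup>2)" if "1/2 <= y'" "y' <= y" for x y'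
			using qbd[of "Complex x y'"] that by simp
		show "integrable lborel (%x. q (Complex x (1/2)))"
			by (rule integral_horizontal_line_shift(1)[OF hs _ y _ b]) auto
		show "(LINT x|lborel. q (Complex x (1/2))) = (LINT x|lborel. q (Complex x y))"
			by (rule integral_horizontal_line_shift(3)[OF hs _ y _ b]) auto
	qed
	have cont_line: "continuous_on UNIV (%x. g (Complex x y))" if "y > 0" "continuous_on ?H g" for g :: "complex => complex" and y
	proof (rule continuous_on_compose2[OF that(2)])
		show "continuous_on UNIV (%x. Complex x y)" unfolding Complex_eq by (intro continuous_intros)
	qed (use that in auto)
	have qc: "continuous_on ?H q" by (rule holomorphic_on_imp_continuous_on[OF qhol])
	\<comment> \<open>On these lines \<open>|u - \<i>|\<close> is at least \<open>n + 1\<close> and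
	  \<open>f\<close> is bounded, so the integrand tends to 0; the bound \<open>qbd\<close> does not
	  depend on the height and dominates it.\<close>
	have "(%n. (LINT x|lborel. q (Complex x (real n + 2)))) \<longlonglongrightarrow> (LINT x|(lborel :: real measure). 0)"
	proof (rule integral_dominated_convergence[where w="%x. (5 * K' + 2 * Q) * (1 / (1 + x\<^sup>2))"])
		show "integrable lborel (%x. (5 * K' + 2 * Q) * (1 / (1 + x\<^sup>2)))"
			using inverse_one_plus_square(1) by (rule integrable_mult_right)
		show "AE x in lborel. norm (q (Complex x (real n + 2))) <= (5 * K' + 2 * Q) * (1 / (1 + x\<^sup>2))" for n
			using qbd[of "Complex x (real n + 2)" for x] by (intro AE_I2) (simp add: add_pos_nonneg)
		show "AE x in lborel. (%n. q (Complex x (real n + 2))) \<longlonglongrightarrow> 0"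
		proof (rule AE_I2, rule Lim_null_comparison)
			fix x :: real
			show "\<forall>\<^sub>F n in sequentially. norm (q (Complex x (real n + 2))) <= K' / (real n + 1)"
			proof (intro always_eventually allI)
				fix n
				have ui: "Complex x (real n + 2) ~= \<i>" by (auto simp: complex_eq_iff)
				have "cmod (f (Complex x (real n + 2))) <= K' / sqrt (1 + (cmod (Complex x (real n + 2)))^2)" by (intro fbd) auto
				also have "... <= K' / 1" using K' by (intro divide_left_mono) (auto simp: add_pos_nonneg)
				finally have "cmod (f (Complex x (real n + 2))) <= K'" by simp
				moreover have "real n + 1 <= cmod (Complex x (real n + 2) - \<i>)"
					using abs_Im_le_cmod[of "Complex x (real n + 2) - \<i>"] by simp
				ultimately show "norm (q (Complex x (real n + 2))) <= K' / (real n + 1)" unfolding q_eq[OF ui]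
					using K' by (intro frac_le) auto
			qed
			show "(%n. K' / (real n + 1)) \<longlonglongrightarrow> 0" by real_asymp
		qed
		show "(%x. q (Complex x (real n + 2))) : borel_measurable lborel" for n
			using cont_line[OF _ qc, of "real n + 2"] by (auto intro: borel_measurable_continuous_onI)
	qed simp
	moreover have "(%n. (LINT x|lborel. q (Complex x (real n + 2)))) = (%n. (LINT x|lborel. q (Complex x (1/2))))"
		by (intro ext shift(2)[symmetric]) simp
	ultimately have q0: "(LINT x|lborel. q (Complex x (1/2))) = 0" by (simp add: LIMSEQ_const_iff)
	\<comment> \<open>The model function divided by \<open>u - \<i>\<close>. Its line can be moved down
	  to the real axis, where it becomes \<open>2 * \<i> / (1 + x^2)\<close> with integral
	  \<open>2 * pi * \<i>\<close>.\<close>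
	define m where "m = (%u. 2 * \<i> / ((u + \<i>) * (u - \<i>)))"
	have m_hol: "m holomorphic_on {u. -1 < Im u \<and> Im u < 1}"
		unfolding m_def by (intro holomorphic_intros) (simp only: mult_eq_0_iff, auto simp: complex_eq_iff)
	have m_bd: "cmod (m (Complex x y)) <= 8 / (1 + x\<^sup>2)" if y: "0 <= y" "y <= 1/2" for x y
	proof -
		have "(1 + x\<^sup>2) / 4 <= x\<^sup>2 + (1/2)^2" by (simp add: power2_eq_square)
		also have "(1/2)^2 <= (1 - y)^2" using y by (intro power_mono) auto
		finally have 1: "sqrt ((1 + x\<^sup>2) / 4) <= cmod (Complex x y - \<i>)"
			by (intro real_le_lsqrt) (auto simp: cmod_power2 power2_commute add_nonneg_nonneg)
		have "(1 + x\<^sup>2) / 4 <= x\<^sup>2 + 1\<^sup>2" by simp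
		also have "1\<^sup>2 <= (y + 1)^2" using y by (intro power_mono) auto
		finally have 2: "sqrt ((1 + x\<^sup>2) / 4) <= cmod (Complex x y + \<i>)"
			by (intro real_le_lsqrt) (auto simp: cmod_power2 add_nonneg_nonneg)
		have "sqrt ((1 + x\<^sup>2) / 4) * sqrt ((1 + x\<^sup>2) / 4) <= cmod (Complex x y + \<i>) * cmod (Complex x y - \<i>)"
			by (intro mult_mono 1 2) (auto simp: add_nonneg_nonneg)
		hence 3: "(1 + x\<^sup>2) / 4 <= cmod (Complex x y + \<i>) * cmod (Complex x y - \<i>)"
			by (simp add: add_nonneg_nonneg)
		have "cmod (m (Complex x y)) = 2 / (cmod (Complex x y + \<i>) * cmod (Complex x y - \<i>))"
			by (simp add: m_def norm_divide norm_mult)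
		also have "... <= 2 / ((1 + x\<^sup>2) / 4)"
		proof -
			have p: "1 + x\<^sup>2 > 0" by (simp add: add_pos_nonneg)
			have "0 < (1 + x\<^sup>2) / 4" using p by simp
			hence "0 < cmod (Complex x y + \<i>) * cmod (Complex x y - \<i>)" using 3 by (rule order.strict_trans2)
			thus ?thesis using 3 p by (intro divide_left_mono) auto
		qed
		finally show ?thesis by simp
	qed
	note m_shift = integral_horizontal_line_shift[OF m_hol, of 0 "1/2" 8, OF _ _ _ m_bd]
	have m0: "m (Complex x 0) = 2 * \<i> * of_real (1 / (1 + x\<^sup>2))" for x
	proof -
		have "(Complex x 0 + \<i>) * (Complex x 0 - \<i>) = of_real (1 + x\<^sup>2)"
			by (simp add: complex_eq_iff power2_eq_square)
		thus ?thesis by (simp add: m_def)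
	qed
	have m_int: "integrable lborel (%x. m (Complex x (1/2)))" using m_shift(2) by auto
	have m_val: "(LINT x|lborel. m (Complex x (1/2))) = 2 * of_real pi * \<i>"
	proof -
		have "(LINT x|lborel. m (Complex x (1/2))) = (LINT x|lborel. 2 * \<i> * of_real (1 / (1 + x\<^sup>2)))"
			using m_shift(3) by (simp add: m0)
		also have "... = 2 * \<i> * of_real (LINT x|lborel. 1 / (1 + x\<^sup>2))"
			using inverse_one_plus_square(1)
			by (subst integral_mult_right_zero) (simp only: integral_complex_of_real)
		finally show ?thesis using inverse_one_plus_square(2) by simp
	qed
	have dec: "h (Complex x (1/2)) / (Complex x (1/2) - \<i>) = q (Complex x (1/2)) + h \<i> * m (Complex x (1/2))" for x
	proof -
		have "Complex x (1/2) ~= \<i>" "Complex x (1/2) - \<i> ~= 0" "Complex x (1/2) + \<i> ~= 0" by (auto simp: complex_eq_iff)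
		thus ?thesis unfolding q_def m_def fi by (simp add: f_def divide_simps)
	qed
	show "integrable lborel (%x. h (Complex x (1/2)) / (Complex x (1/2) - \<i>))"
		unfolding dec using shift(1)[of 1] m_int by simp
	show "(LINT x|lborel. h (Complex x (1/2)) / (Complex x (1/2) - \<i>)) = 2 * of_real pi * \<i> * h \<i>"
		unfolding dec using shift(1)[of 1] m_int q0 m_val by simp
qed

lemma cmod_powr_of_real: "cmod (z powr of_real x) = cmod z powr x"
	by (simp add: norm_powr_real_powr')

text \<open>There is an explicit primitive, called \<open>F\<close> in the proof: it tends to 0 at 0
  and to \<open>1 / ((a + 1) * B)\<close> at infinity.\<close>

lemma integral_powr_power:
	fixes B :: complex and a :: real
	assumes B: "Re B > 0" and a: "a > -1"
	shows "integrable lborel (%y. (indicator {0<..} y * y powr a) *\<^sub>R (B + of_real y) powr of_real (- (a + 2)))"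
		and "(LINT y|lborel. (indicator {0<..} y * y powr a) *\<^sub>R (B + of_real y) powr of_real (- (a + 2)))
			= 1 / (of_real (a + 1) * B)"
proof -
	have e: "einterval 0 \<infinity> = {0<..}" by (auto simp: einterval_def zero_ereal_def)
	define g where "g = (%y. of_real (y powr a) * (B + of_real y) powr of_real (- (a + 2)))"
	have Re_pos: "Re (B + of_real y) > 0" if "y > 0" for y using B that by simp
	have nonpos: "B + of_real y \<notin> \<real>\<^sub>\<le>\<^sub>0" if "y > 0" for y
		using Re_pos[OF that] by (auto simp: complex_nonpos_Reals_iff)
	define b where "b = min (Re B) 1"
	have b: "b > 0" "b <= 1" "b <= Re B" using B by (auto simp: b_def)
	have bd: "cmod ((B + of_real y) powr of_real (- (a + 2))) <= (1 / b) powr (a + 2) * (1 + y) powr (- (a + 2))" if y: "y > 0" for y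
	proof -
		have "b * y <= 1 * y" using b y by (intro mult_right_mono) auto
		hence "b * (1 + y) <= Re B + y"
			using b by (simp add: algebra_simps)
		also have "... <= cmod (B + of_real y)" using complex_Re_le_cmod[of "B + of_real y"] by simp
		finally have "1 + y <= (1 / b) * cmod (B + of_real y)" using b by (simp add: field_simps)
		thus ?thesis unfolding cmod_powr_of_real using b y a by (intro powr_neg_le_cmult) auto
	qed
	have eq: "(%y. (indicator {0<..} y * y powr a) *\<^sub>R (B + of_real y) powr of_real (- (a + 2))) = (%y. indicator {0<..} y *\<^sub>R g y)"
		by (simp add: g_def scaleR_conv_of_real fun_eq_iff)
	have gc: "isCont g y" if "y > 0" for y
		unfolding g_def using that nonpos[OF that] by (intro continuous_intros) auto
	have gm: "(%y. indicator {0<..} y *\<^sub>R g y) : borel_measurable lborel"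
		using borel_measurable_continuous_on_indicator[of "{0<..}" g] gc
		by (simp add: continuous_at_imp_continuous_on)
	show int: "integrable lborel (%y. (indicator {0<..} y * y powr a) *\<^sub>R (B + of_real y) powr of_real (- (a + 2)))"
		unfolding eq
	proof (rule integrableI_bounded[OF gm])
		have "(NI lborel (%y. ennreal (norm (indicator {0<..} y *\<^sub>R g y))))
				<= (NI lborel (%y. ennreal ((1 / b) powr (a + 2)) * ennreal (indicator {0<..} y * y powr a * (1 + y) powr (- (a + 1 + 1)))))"
		proof (rule nn_integral_mono)
			fix y :: real
			show "ennreal (norm (indicator {0<..} y *\<^sub>R g y)) <= ennreal ((1 / b) powr (a + 2)) * ennreal (indicator {0<..} y * y powr a * (1 + y) powr (- (a + 1 + 1)))"
			proof (cases "y > 0")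
				case True
				have "norm (g y) = y powr a * cmod ((B + of_real y) powr of_real (- (a + 2)))"
					by (simp add: g_def norm_mult)
				also have "... <= y powr a * ((1 / b) powr (a + 2) * (1 + y) powr (- (a + 2)))"
					by (intro mult_left_mono bd True) auto
				also have "- (a + 2) = - (a + 1 + 1)" by simp
				finally have "norm (g y) <= (1 / b) powr (a + 2) * (y powr a * (1 + y) powr (- (a + 1 + 1)))"
					by (simp only: mult_ac)
				thus ?thesis using True by (simp add: ennreal_mult[symmetric] ennreal_leI)
			qed simp
		qed
		also have "... = ennreal ((1 / b) powr (a + 2)) * (NI lborel (%y. ennreal (indicator {0<..} y * y powr a * (1 + y) powr (- (a + 1 + 1)))))"
			by (rule nn_integral_cmult) measurable
		also have "... < \<infinity>"
			using nn_integral_powr_one_plus_finite[of 1 a] a by (simp add: ennreal_mult_less_top)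
		finally show "(NI lborel (%y. ennreal (norm (indicator {0<..} y *\<^sub>R g y)))) < \<infinity>" .
	qed
	define F where "F = (%y. of_real (y powr (a + 1)) * (B + of_real y) powr of_real (- (a + 1)) / (of_real (a + 1) * B))"
	have Bn: "B ~= 0" using B by auto
	have a1: "of_real (a + 1) ~= (0 :: complex)" using a by (simp only: of_real_eq_0_iff)
	have "(LBINT y=0..\<infinity>. g y) = 1 / (of_real (a + 1) * B) - 0"
	proof (rule interval_integral_FTC_integrable[where F=F])
		fix y assume "0 < ereal y"
		hence y: "y > 0" by (simp add: zero_ereal_def)
		have 1: "((%y. complex_of_real (y powr (a + 1))) has_vector_derivative of_real ((a + 1) * y powr a)) (at y)"
		proof -
			have "((%y. y powr (a + 1)) has_real_derivative (a + 1) * y powr (a + 1 - 1)) (at y)"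
				using y by (rule has_real_derivative_powr)
			hence d: "((%y. y powr (a + 1)) has_real_derivative (a + 1) * y powr a) (at y)" by simp
			show ?thesis
				by (rule has_vector_derivative_of_real) (use d in \<open>simp add: has_real_derivative_iff_has_vector_derivative\<close>)
		qed
		have 2: "((%y. (B + of_real y) powr of_real (- (a + 1))) has_vector_derivative
				(of_real (- (a + 1)) * (B + of_real y) powr (of_real (- (a + 1)) - 1))) (at y)"
		proof -
			have "((%z. (B + z) powr of_real (- (a + 1))) has_field_derivative
				(of_real (- (a + 1)) * (B + of_real y) powr (of_real (- (a + 1)) - 1))) (at (of_real y))"
				using nonpos[OF y] by (auto intro!: derivative_eq_intros)
			thus ?thesis by (rule has_vector_derivative_real_field)
		qed
		have p1: "(B + of_real y) powr (of_real (- (a + 1)) - 1) = (B + of_real y) powr of_real (- (a + 2))"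
			by (rule arg_cong[where f="%e. (B + of_real y) powr e"]) (simp add: complex_eq_iff)
		have ny: "B + of_real y ~= 0" using nonpos[OF y] by auto
		have p2: "(B + of_real y) powr of_real (- (a + 1)) = (B + of_real y) powr of_real (- (a + 2)) * (B + of_real y)"
		proof -
			have "(B + of_real y) powr (of_real (- (a + 2)) + 1) = (B + of_real y) powr of_real (- (a + 2)) * (B + of_real y)"
				by (simp only: powr_add powr_to_1)
			moreover have "of_real (- (a + 2)) + 1 = (of_real (- (a + 1)) :: complex)" by (simp add: complex_eq_iff)
			ultimately show ?thesis by (simp only:)
		qed
		have p3: "y powr (a + 1) = y powr a * y" using y by (simp add: powr_add)
		have "((%y. of_real (y powr (a + 1)) * (B + of_real y) powr of_real (- (a + 1)) / (of_real (a + 1) * B)) has_vector_derivative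
			 (of_real (y powr (a + 1)) * (of_real (- (a + 1)) * (B + of_real y) powr (of_real (- (a + 1)) - 1))
				 + of_real ((a + 1) * y powr a) * (B + of_real y) powr of_real (- (a + 1))) / (of_real (a + 1) * B)) (at y)"
			by (intro has_vector_derivative_divide has_vector_derivative_mult 1 2)
		also have "(of_real (y powr (a + 1)) * (of_real (- (a + 1)) * (B + of_real y) powr (of_real (- (a + 1)) - 1))
				 + of_real ((a + 1) * y powr a) * (B + of_real y) powr of_real (- (a + 1))) / (of_real (a + 1) * B) = g y"
		proof -
			define X where "X = (B + of_real y) powr of_real (- (a + 2))"
			define c where "c = (of_real (a + 1) :: complex)"
			have c: "c ~= 0" using a1 by (simp add: c_def)
			have m: "of_real (- (a + 1)) = - c" by (simp add: c_def)
			show ?thesis unfolding p1 p2 p3 g_def X_def[symmetric]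
				unfolding m of_real_mult c_def[symmetric]
				using Bn c by (simp add: field_simps)
		qed
		finally show "(F has_vector_derivative g y) (at y)" unfolding F_def .
		show "isCont g y" by (rule gc[OF y])
	next
		show "set_integrable lborel (einterval 0 \<infinity>) g"
			using int unfolding eq e set_integrable_def .
		have "((%y. of_real (y powr (a + 1)) * (B + of_real y) powr of_real (- (a + 1)) / (of_real (a + 1) * B)) \<longlongrightarrow>
			 of_real 0 * (B + of_real 0) powr of_real (- (a + 1)) / (of_real (a + 1) * B)) (at_right 0)"
		proof (intro tendsto_divide tendsto_mult tendsto_const tendsto_of_real)
			show "((%y::real. y powr (a + 1)) \<longlongrightarrow> 0) (at_right 0)" using a by real_asymp
			have "isCont (%y. (B + of_real y) powr of_real (- (a + 1))) (0::real)"
				using B by (intro continuous_intros) (auto simp: complex_nonpos_Reals_iff)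
			thus "((%y::real. (B + of_real y) powr of_real (- (a + 1))) \<longlongrightarrow> (B + of_real 0) powr of_real (- (a + 1))) (at_right 0)"
				unfolding continuous_at by (rule filterlim_mono) (auto simp: at_le)
		qed (use a1 Bn in auto)
		hence "(F \<longlongrightarrow> 0) (at_right 0)" by (simp add: F_def)
		thus "((F \<circ> real_of_ereal) \<longlongrightarrow> 0) (at_right 0)"
			by (simp add: zero_ereal_def ereal_tendsto_simps)
		have "(F \<longlongrightarrow> 1 / (of_real (a + 1) * B)) at_top"
		proof -
			\<comment> \<open>Near infinity the positive factor \<open>y\<close> is taken out of the complex
			  power, which leaves a base tending to 1.\<close>
			have l: "((%y. (B * of_real (1 / y) + 1) powr of_real (- (a + 1)) / (of_real (a + 1) * B)) \<longlongrightarrow>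
				 (B * of_real 0 + 1) powr of_real (- (a + 1)) / (of_real (a + 1) * B)) at_top"
			proof (intro tendsto_divide tendsto_const)
				have "isCont (%x. (B * of_real x + 1) powr of_real (- (a + 1))) (0::real)"
					by (intro continuous_intros) (auto simp: complex_nonpos_Reals_iff)
				moreover have "((%y::real. 1 / y) \<longlongrightarrow> 0) at_top" by real_asymp
				ultimately show "((%y. (B * of_real (1 / y) + 1) powr of_real (- (a + 1))) \<longlongrightarrow> (B * of_real 0 + 1) powr of_real (- (a + 1))) at_top"
					by (rule isCont_tendsto_compose)
			qed (use a1 Bn in auto)
			have "\<forall>\<^sub>F y in at_top. (B * of_real (1 / y) + 1) powr of_real (- (a + 1)) / (of_real (a + 1) * B) = F y"
				using eventually_gt_at_top[of 0]
			proof eventually_elim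
				case (elim y)
				have "(B + of_real y) = of_real y * (B * of_real (1 / y) + 1)" using elim by (simp add: field_simps)
				then have "(B + of_real y) powr of_real (- (a + 1)) = of_real (y powr (- (a + 1))) * (B * of_real (1 / y) + 1) powr of_real (- (a + 1))" (is "?l = ?r")
				proof -
					assume e: "B + of_real y = of_real y * (B * of_real (1 / y) + 1)"
					have "(of_real y * (B * of_real (1 / y) + 1)) powr of_real (- (a + 1))
							= of_real y powr of_real (- (a + 1)) * (B * of_real (1 / y) + 1) powr of_real (- (a + 1))"
						using elim by (intro powr_times_real_left) auto
					also have "of_real y powr of_real (- (a + 1)) = (of_real (y powr (- (a + 1))) :: complex)"
						using elim by (intro powr_of_real) auto
					finally show ?thesis unfolding e .
				qed
				moreover have "y powr (a + 1) * y powr (- (a + 1)) = 1" using elim by (simp flip: powr_add)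
				hence "of_real (y powr (a + 1)) * of_real (y powr (- (a + 1))) = (1 :: complex)" by (simp only: of_real_mult[symmetric] of_real_1)
				ultimately show ?case by (simp add: F_def mult.assoc[symmetric])
			qed
			from Lim_transform_eventually[OF l this] show ?thesis by simp
		qed
		thus "((F \<circ> real_of_ereal) \<longlongrightarrow> 1 / (of_real (a + 1) * B)) (at_left \<infinity>)"
			by (simp add: ereal_tendsto_simps)
	qed simp
	thus "(LINT y|lborel. (indicator {0<..} y * y powr a) *\<^sub>R (B + of_real y) powr of_real (- (a + 2))) = 1 / (of_real (a + 1) * B)"
		unfolding eq by (simp add: interval_lebesgue_integral_def e set_lebesgue_integral_def)
qed

lemma lborel_complex_eq: "distr (lborel \<Otimes>\<^sub>M lborel) borel (%(x, y). Complex x y) = (lborel :: complex measure)"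
proof (rule lborel_eqI[symmetric])
	fix l u :: complex
	assume lu: "!!b. b : Basis ==> l \<bullet> b <= u \<bullet> b"
	have m: "(%(x, y). Complex x y) : borel_measurable (lborel \<Otimes>\<^sub>M lborel)"
		unfolding Complex_eq by measurable
	have le: "Re l <= Re u" "Im l <= Im u" using lu[of 1] lu[of \<i>] by (auto simp: Basis_complex_def inner_complex_def)
	have "(%(x, y). Complex x y) -` box l u \<inter> space (lborel \<Otimes>\<^sub>M lborel) = {Re l<..<Re u} \<times> {Im l<..<Im u}"
		by (auto simp: box_def Basis_complex_def inner_complex_def space_pair_measure)
	hence "emeasure (distr (lborel \<Otimes>\<^sub>M lborel) borel (%(x, y). Complex x y)) (box l u)
			= emeasure (lborel \<Otimes>\<^sub>M lborel) ({Re l<..<Re u} \<times> {Im l<..<Im u})"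
		by (subst emeasure_distr[OF m]) auto
	also have "... = ennreal (Re u - Re l) * ennreal (Im u - Im l)"
		by (subst lborel.emeasure_pair_measure_Times) (use le in auto)
	finally show "emeasure (distr (lborel \<Otimes>\<^sub>M lborel) borel (%(x, y). Complex x y)) (box l u) = ennreal (\<Prod>b\<in>Basis. (u - l) \<bullet> b)"
		using le by (simp add: Basis_complex_def inner_complex_def ennreal_mult[symmetric])
qed simp

text \<open>Powers on the right half plane, extended by \<open>0\<close> to a Borel function.\<close>

definition rpowr :: "complex => real => complex" where
	"rpowr z c = (if Re z > 0 then z powr of_real c else 0)"

lemma rpowr_measurable [measurable (raw)]:
	assumes "f : borel_measurable M"
	shows "(%x. rpowr (f x) c) : borel_measurable M"
proof -
	have "(%z. rpowr z c) = (%z. indicator {z. Re z > 0} z *\<^sub>R (z powr of_real c))"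
		by (auto simp: rpowr_def indicator_def)
	also have "... : BM"
		by (rule borel_measurable_continuous_on_indicator)
			 (auto intro!: continuous_intros simp: complex_nonpos_Reals_iff open_halfspace_Re_gt)
	finally show ?thesis by (rule measurable_compose[OF assms])
qed

lemma cmod_rpowr: "Re z > 0 ==> cmod (rpowr z c) = cmod z powr c"
	by (simp add: rpowr_def cmod_powr_of_real)

text \<open>On the line \<open>Im u = y\<close> the conjugate of \<open>u\<close> is
  \<open>u - 2 * \<i> * y\<close>. There the antiholomorphic kernel is a holomorphic function of
  \<open>u\<close>, and the line can be moved to the fixed height \<open>1/2\<close>. The integral
  over \<open>y\<close> is then \<open>integral_powr_power\<close>, and what remains is Cauchy's
  formula.\<close>

lemma half_plane_reproducing:
	fixes h :: "complex => complex" and a K :: real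
	assumes a: "a > -1" and hol: "h holomorphic_on {u. 0 < Im u}"
		and bd: "!!u. 0 < Im u ==> cmod (h u) <= K / (1 + (cmod u)^2)"
		and int: "integrable lborel (%u. (indicator {u. 0 < Im u} u * Im u powr a) *\<^sub>R (h u * rpowr (cnj ((u + \<i>) / (2 * \<i>))) (- (a + 2))))"
	shows "(LINT u|lborel. (indicator {u. 0 < Im u} u * Im u powr a) *\<^sub>R (h u * rpowr (cnj ((u + \<i>) / (2 * \<i>))) (- (a + 2))))
		 = of_real (4 * pi / (a + 1)) * h \<i>"
proof -
	define f where "f = (%u. (indicator {u. 0 < Im u} u * Im u powr a) *\<^sub>R (h u * rpowr (cnj ((u + \<i>) / (2 * \<i>))) (- (a + 2))))"
	define e where "e = - (a + 2)"
	have K: "K >= 0" using order.trans[OF norm_ge_zero bd[of \<i>]] by (simp add: zero_le_divide_iff)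
	have bd': "cmod (h (Complex x y)) <= K / (1 + x\<^sup>2)" if "y > 0" for x y
	proof -
		have "cmod (h (Complex x y)) <= K / (1 + (cmod (Complex x y))^2)" using that by (intro bd) simp
		also have "... <= K / (1 + x\<^sup>2)" using K by (intro divide_left_mono mult_pos_pos) (auto simp: cmod_power2 add_pos_nonneg)
		finally show ?thesis .
	qed
	define G where "G = (%x y. (indicator {0<..} y * y powr a) *\<^sub>R (h (Complex x (1/2)) * rpowr (Complex (1/4) (x/2) + of_real y) e))"
	have arg: "cnj ((Complex x y + \<i>) / (2 * \<i>)) = (1 + 2 * of_real y + \<i> * Complex x y) / 2" for x y
		by (simp add: complex_eq_iff Re_divide Im_divide)
	have arg': "(1 + 2 * of_real y + \<i> * Complex x (1/2)) / 2 = Complex (1/4) (x/2) + of_real y" for x y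
		by (simp add: complex_eq_iff)
	have line: "(LINT x|lborel. f (Complex x y)) = (LINT x|lborel. G x y)" for y
	proof (cases "y > 0")
		case False
		thus ?thesis by (simp add: f_def G_def)
	next
		case y: True
		define F where "F = (%u. h u * ((1 + 2 * of_real y + \<i> * u) / 2) powr of_real e)"
		\<comment> \<open>The base of the power has positive real part on the strip
		  \<open>Im u < 1 + 2 * y\<close>, which contains both heights \<open>y\<close> and
		  \<open>1/2\<close>.\<close>
		have Re: "Re ((1 + 2 * of_real y + \<i> * u) / 2) = (1 + 2 * y - Im u) / 2" for u by simp
		have Fhol: "F holomorphic_on {u. 0 < Im u \<and> Im u < 1 + 2 * y}"
			unfolding F_def
			by (intro holomorphic_intros holomorphic_on_subset[OF hol]) (auto simp: complex_nonpos_Reals_iff)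
		have Fbd: "cmod (F (Complex x y')) <= (K * ((1 + 2 * y - d) / 2) powr e) / (1 + x\<^sup>2)"
			if y': "0 < y'" "y' <= d" "d < 1 + 2 * y" for x y' d
		proof -
			have "(1 + 2 * y - d) / 2 <= Re ((1 + 2 * of_real y + \<i> * Complex x y') / 2)" using y' by simp
			also have "... <= cmod ((1 + 2 * of_real y + \<i> * Complex x y') / 2)" by (rule complex_Re_le_cmod)
			finally have "cmod ((1 + 2 * of_real y + \<i> * Complex x y') / 2) powr e <= ((1 + 2 * y - d) / 2) powr e"
				using y' a by (intro powr_mono2') (auto simp: e_def)
			hence "cmod (h (Complex x y')) * cmod ((1 + 2 * of_real y + \<i> * Complex x y') / 2) powr e <= K / (1 + x\<^sup>2) * ((1 + 2 * y - d) / 2) powr e"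
				using bd'[OF y'(1), of x] K by (intro mult_mono) auto
			thus ?thesis by (simp add: F_def norm_mult cmod_powr_of_real)
		qed
		have "(LINT x|lborel. F (Complex x y)) = (LINT x|lborel. F (Complex x (1/2)))"
		proof (cases "y <= 1/2")
			case True
			show ?thesis
				by (rule integral_horizontal_line_shift(3)[OF Fhol y True _ Fbd[of _ "1/2"]]) (use y in auto)
		next
			case False
			show ?thesis
				by (rule integral_horizontal_line_shift(3)[OF Fhol _ _ _ Fbd[of _ y], symmetric]) (use y False in auto)
		qed
		moreover have "f (Complex x y) = y powr a *\<^sub>R F (Complex x y)" for x
		proof -
			have "Re (cnj ((Complex x y + \<i>) / (2 * \<i>))) > 0" unfolding arg using y by simp
			thus ?thesis using y unfolding f_def F_def rpowr_def e_def arg[symmetric] by simp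
		qed
		moreover have "G x y = y powr a *\<^sub>R F (Complex x (1/2))" for x
			using y unfolding G_def F_def arg' by (simp add: rpowr_def)
		ultimately show ?thesis by simp
	qed
	have mC: "(%(x, y). Complex x y) : (lborel \<Otimes>\<^sub>M lborel) \<rightarrow>\<^sub>M (borel :: complex measure)"
		unfolding Complex_eq by measurable
	have fi: "integrable lborel f" using int by (simp add: f_def)
	hence fm: "f : BM" by auto
	have fpi: "integrable (lborel \<Otimes>\<^sub>M lborel) (%(x, y). f (Complex x y))"
	proof -
		have "integrable (distr (lborel \<Otimes>\<^sub>M lborel) borel (%(x, y). Complex x y)) f"
			using fi unfolding lborel_complex_eq .
		thus ?thesis by (subst (asm) integrable_distr_eq[OF mC fm]) (simp add: split_def)
	qed
	have "integral\<^sup>L lborel f = integral\<^sup>L (distr (lborel \<Otimes>\<^sub>M lborel) borel (%(x, y). Complex x y)) f"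
		unfolding lborel_complex_eq ..
	also have "... = integral\<^sup>L (lborel \<Otimes>\<^sub>M lborel) (%(x, y). f (Complex x y))"
		by (subst integral_distr[OF mC fm]) (simp add: split_def)
	also have "... = (LINT y|lborel. (LINT x|lborel. f (Complex x y)))"
		using lborel_pair.integral_snd[of "%x y. f (Complex x y)"] fpi by simp
	also have "... = (LINT y|lborel. (LINT x|lborel. G x y))" by (simp only: line)
	also have "... = (LINT x|lborel. (LINT y|lborel. G x y))"
	proof (rule lborel_pair.Fubini_integral)
		have "continuous_on UNIV (%x. h (Complex x (1/2)))"
		proof (rule continuous_on_compose2[OF holomorphic_on_imp_continuous_on[OF hol]])
			show "continuous_on UNIV (%x. Complex x (1/2))" unfolding Complex_eq by (intro continuous_intros)
		qed auto
		hence hm[measurable]: "(%x. h (Complex x (1/2))) : BM"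
			by (rule borel_measurable_continuous_onI)
		have [measurable]: "(%p. Complex (1/4) (fst p / 2)) : borel_measurable (lborel \<Otimes>\<^sub>M (lborel :: real measure))"
			unfolding Complex_eq by measurable
		have "(%p. h (Complex (fst p) (1/2))) : borel_measurable (lborel \<Otimes>\<^sub>M (lborel :: real measure))"
			by (rule measurable_compose[OF _ hm]) measurable
		note [measurable] = this
		have Gm: "case_prod G : borel_measurable (lborel \<Otimes>\<^sub>M lborel)"
			unfolding G_def case_prod_beta by measurable
		\<comment> \<open>At height \<open>1/2\<close> the bound is a product of a function of
		  \<open>x\<close> and one of \<open>y\<close>, both integrable; this permits Fubini.\<close>
		have Gb: "norm (G x y) <= K / (1 + x\<^sup>2) * (4 powr (a + 2) * (indicator {0<..} y * y powr a * (1 + y) powr (- (a + 1 + 1))))" for x y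
		proof (cases "y > 0")
			case True
			define B where "B = Complex (1/4) (x/2) + of_real y"
			have B: "Re B > 0" "1 + y <= 4 * cmod B"
				using True complex_Re_le_cmod[of B] by (auto simp: B_def)
			have "cmod B powr e <= 4 powr (a + 2) * (1 + y) powr (- (a + 2))"
				unfolding e_def using B True a by (intro powr_neg_le_cmult) auto
			moreover have "norm (G x y) = y powr a * (cmod (h (Complex x (1/2))) * cmod B powr e)"
				using True B(1) by (simp add: G_def norm_mult cmod_rpowr flip: B_def)
			moreover have "... <= y powr a * (K / (1 + x\<^sup>2) * (4 powr (a + 2) * (1 + y) powr (- (a + 2))))"
				using calculation(1) bd'[of "1/2" x] K by (intro mult_left_mono mult_mono) auto
			moreover have "- (a + 1 + 1) = - (a + 2)" by simp
			ultimately show ?thesis using True by (simp only: indicator_simps greaterThan_iff mult_1_left) (simp add: mult_ac)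
		qed (simp add: G_def)
		show "integrable (lborel \<Otimes>\<^sub>M lborel) (case_prod G)"
		proof (rule integrableI_bounded[OF Gm])
			define J where "J = (NI lborel (%y. ennreal (indicator {0<..} y * y powr a * (1 + y) powr (- (a + 1 + 1)))))"
			have J: "J < \<infinity>" unfolding J_def using nn_integral_powr_one_plus_finite[of 1 a] a by simp
			have "(NI (lborel \<Otimes>\<^sub>M lborel) (%p. ennreal (norm (case_prod G p)))) = (NI lborel (%x. (NI lborel (%y. ennreal (norm (G x y))))))"
				using Gm by (subst lborel.nn_integral_fst[symmetric]) auto
			also have "... <= (NI lborel (%x. (NI lborel (%y. ennreal (K / (1 + x\<^sup>2)) * (ennreal (4 powr (a + 2)) * ennreal (indicator {0<..} y * y powr a * (1 + y) powr (- (a + 1 + 1))))))))"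
				using Gb K by (intro nn_integral_mono) (auto simp: ennreal_mult[symmetric] add_nonneg_nonneg intro!: ennreal_leI)
			also have "... = (NI lborel (%x. ennreal (K * (1 / (1 + x\<^sup>2))) * (ennreal (4 powr (a + 2)) * J)))"
				unfolding J_def by (simp add: nn_integral_cmult)
			also have "... = (NI lborel (%x. ennreal (K * (1 / (1 + x\<^sup>2))))) * (ennreal (4 powr (a + 2)) * J)"
				by (rule nn_integral_multc) measurable
			also have "(NI lborel (%x. ennreal (K * (1 / (1 + x\<^sup>2))))) = ennreal (LINT x|lborel. K * (1 / (1 + x\<^sup>2)))"
				using K by (intro nn_integral_eq_integral integrable_mult_right inverse_one_plus_square) (auto simp: add_nonneg_nonneg)
			finally show "(NI (lborel \<Otimes>\<^sub>M lborel) (%p. ennreal (norm (case_prod G p)))) < \<infinity>"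
				using J by (auto simp: ennreal_mult_less_top intro: le_less_trans)
		qed
	qed
	also have "(%x. (LINT y|lborel. G x y)) = (%x. (- 2 * \<i> / of_real (a + 1)) * (h (Complex x (1/2)) / (Complex x (1/2) - \<i>)))"
	proof
		fix x :: real
		define B where "B = Complex (1/4) (x/2)"
		have B: "Re B > 0" by (simp add: B_def)
		have "(LINT y|lborel. G x y) = (LINT y|lborel. h (Complex x (1/2)) * ((indicator {0<..} y * y powr a) *\<^sub>R (B + of_real y) powr of_real e))"
			by (rule Bochner_Integration.integral_cong) (auto simp: G_def B_def rpowr_def indicator_def)
		also have "... = h (Complex x (1/2)) * (LINT y|lborel. (indicator {0<..} y * y powr a) *\<^sub>R (B + of_real y) powr of_real e)"
			by (rule integral_mult_right_zero)
		also have "(LINT y|lborel. (indicator {0<..} y * y powr a) *\<^sub>R (B + of_real y) powr of_real e) = 1 / (of_real (a + 1) * B)"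
			unfolding e_def by (rule integral_powr_power(2)[OF B a])
		\<comment> \<open>The value of the inner integral is thus a multiple of a Cauchy kernel with pole
		  at \<open>\<i>\<close>.\<close>
		also have "B = (Complex x (1/2) - \<i>) * \<i> / 2" by (simp add: B_def complex_eq_iff)
		also have "h (Complex x (1/2)) * (1 / (of_real (a + 1) * ((Complex x (1/2) - \<i>) * \<i> / 2)))
			= (- 2 * \<i> / of_real (a + 1)) * (h (Complex x (1/2)) / (Complex x (1/2) - \<i>))"
		proof -
			have "Complex x (1/2) - \<i> ~= 0" by (auto simp: complex_eq_iff)
			moreover have "of_real (a + 1) ~= (0::complex)" using a by (simp only: of_real_eq_0_iff)
			ultimately show ?thesis by (simp add: divide_simps del: of_real_add) (simp add: algebra_simps)
		qed
		finally show "(LINT y|lborel. G x y) = (- 2 * \<i> / of_real (a + 1)) * (h (Complex x (1/2)) / (Complex x (1/2) - \<i>))" .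
	qed
	also have "(LINT x|lborel. (- 2 * \<i> / of_real (a + 1)) * (h (Complex x (1/2)) / (Complex x (1/2) - \<i>)))
		 = (- 2 * \<i> / of_real (a + 1)) * (2 * of_real pi * \<i> * h \<i>)"
		using cauchy_formula_horizontal_line(1)[OF hol bd] by (subst integral_mult_right_zero) simp
	also have "... = (- \<i> * \<i>) * (of_real (4 * pi) / of_real (a + 1)) * h \<i>" by (simp add: algebra_simps)
	also have "... = of_real (4 * pi / (a + 1)) * h \<i>" by simp
	finally show ?thesis unfolding f_def .
qed

subsection \<open>Holomorphic functions on the tube\<close>

lemma has_derivative_cvec:
	fixes f :: "'a::real_normed_vector => 'n::finite cvec"
	assumes "!!j. ((%t. f t $ j) has_derivative (%h. f' h $ j)) F"
	shows "(f has_derivative f') F"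
proof -
	have 1: "f = (%t. \<Sum>j\<in>UNIV. axis j (f t $ j))" "f' = (%h. \<Sum>j\<in>UNIV. axis j (f' h $ j))"
		by (auto simp: fun_eq_iff vec_eq_iff axis_def)
	have bl: "bounded_linear (axis j :: complex => 'n cvec)" for j
		by (rule linear_conv_bounded_linear[THEN iffD1], rule linearI) (auto simp: axis_def vec_eq_iff)
	show ?thesis
		by (subst 1(1), subst 1(2)) (intro has_derivative_sum bounded_linear.has_derivative[OF bl] assms)
qed

lemma holomorphic_Cn_compose:
	fixes c :: "complex => 'n::finite cvec"
	assumes f: "holomorphic_Cn f S" and c: "!!j. (%s. c s $ j) holomorphic_on T"
		and T: "open T" and sub: "c ` T <= S"
	shows "(%s. f (c s)) holomorphic_on T"
	unfolding holomorphic_on_open[OF T]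
proof
	fix s assume s: "s : T"
	define c' :: "'n cvec" where "c' = (\<chi> j. deriv (%s. c s $ j) s)"
	have "((%s. c s $ j) has_field_derivative c' $ j) (at s)" for j
		using holomorphic_derivI[OF c T s] by (simp add: c'_def)
	hence dc: "(c has_derivative (%h. h *s c')) (at s)"
		by (intro has_derivative_cvec) (simp add: has_field_derivative_def mult.commute[of _ "c' $ _"])
	obtain D where D: "(f has_derivative D) (at (c s))" "!!a v. D (a *s v) = a * D v"
		using f s sub unfolding holomorphic_Cn_def by blast
	have "((%s. f (c s)) has_derivative (%h. D (h *s c'))) (at s)"
		using has_derivative_compose[OF dc D(1)] .
	hence "((%s. f (c s)) has_field_derivative D c') (at s)"
		unfolding has_field_derivative_def D(2) mult_commute_abs .
	thus "\<exists>f'. ((%s. f (c s)) has_field_derivative f') (at s)" ..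
qed

lemma holomorphic_Cn_imp_continuous_on:
	assumes "holomorphic_Cn f S"
	shows "continuous_on S f"
	using assms unfolding holomorphic_Cn_def
	by (meson continuous_at_imp_continuous_on has_derivative_continuous)

text \<open>Cauchy's formula at the centre, put as a Lebesgue integral over \<open>[0, 2 pi]\<close>
  so that Fubini can be applied to families of circles.\<close>

lemma circle_mean_value:
	fixes g :: "complex => complex"
	assumes g: "g holomorphic_on T" and T: "cball 0 1 <= T"
	shows "integrable lborel (%t. indicator {0..2*pi} t *\<^sub>R g (cis t))"
		and "(LINT t|lborel. indicator {0..2*pi} t *\<^sub>R g (cis t)) = 2 * of_real pi * g 0"
proof -
	have gh: "g holomorphic_on cball 0 1" using g T holomorphic_on_subset by blast
	have "continuous_on {0..2*pi} (%t. g (cis t))"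
		by (rule continuous_on_compose2[OF holomorphic_on_imp_continuous_on[OF gh]])
			 (auto intro!: continuous_intros)
	hence int: "set_integrable lborel {0..2*pi} (%t. g (cis t))"
		by (rule borel_integrable_atLeastAtMost')
	thus "integrable lborel (%t. indicator {0..2*pi} t *\<^sub>R g (cis t))" by (simp add: set_integrable_def)
	have "((%u. g u / (u - 0)) has_contour_integral (2 * of_real pi * \<i> * g 0)) (circlepath 0 1)"
		by (rule Cauchy_integral_circlepath_simple[OF gh]) simp
	hence "((%t. g (0 + of_real 1 * cis t) / (0 + of_real 1 * cis t - 0) * of_real 1 * \<i> * cis t) has_integral (2 * of_real pi * \<i> * g 0)) {0..2*pi}"
		unfolding circlepath_def by (subst (asm) has_contour_integral_part_circlepath_iff) auto
	hence "((%t. \<i> * g (cis t)) has_integral (2 * of_real pi * \<i> * g 0)) {0..2*pi}"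
		by (rule has_integral_eq[rotated]) simp
	hence "((%t. (- \<i>) * (\<i> * g (cis t))) has_integral (- \<i>) * (2 * of_real pi * \<i> * g 0)) {0..2*pi}"
		by (rule has_integral_mult_right)
	moreover have "(- \<i>) * (2 * of_real pi * \<i> * g 0) = 2 * of_real pi * g 0" "(- \<i>) * (\<i> * x) = x" for x
		by (simp_all add: algebra_simps)
	ultimately have "((%t. g (cis t)) has_integral (2 * of_real pi * g 0)) {0..2*pi}"
		by (simp only:)
	thus "(LINT t|lborel. indicator {0..2*pi} t *\<^sub>R g (cis t)) = 2 * of_real pi * g 0"
		using set_borel_integral_eq_integral(2)[OF int] by (simp add: set_lebesgue_integral_def integral_unique)
qed

subsection \<open>The reproducing formula\<close>

text \<open>
	In the coordinates \<open>u\<close> with \<open>u\<^sub>n = w\<^sub>n + \<i>/2 \<Sum> w\<^sub>j\<^sup>2\<close> the tube is a Siegel domain which is invariant under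
	rotations of the first \<open>n - 1\<close> variables, and the kernel at \<open>bpt\<close> depends on \<open>u\<^sub>n\<close> only.
\<close>

definition siegel_inv :: "'n::{finite,linorder} cvec => 'n cvec" where
	"siegel_inv u = u + axis lx (- \<i> / 2 * (\<Sum>j\<in>init_idx. (u $ j)^2))"

definition siegel_height :: "'n::{finite,linorder} cvec => real" where
	"siegel_height u = Im (u $ lx) - (\<Sum>j\<in>init_idx. (cmod (u $ j))^2) / 2"

definition siegel_measure :: "real => ('n::{finite,linorder} cvec) measure" where
	"siegel_measure al = density lborel (%u. ennreal (indicator {0<..} (siegel_height u) * siegel_height u powr al))"

lemma siegel_inv_nth:
	"siegel_inv u $ j = (if j = lx then u $ j - \<i> / 2 * (\<Sum>j\<in>init_idx. (u $ j)^2) else u $ j)"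
	by (auto simp: siegel_inv_def axis_def)

lemma rho_siegel_inv: "rho (siegel_inv u) = siegel_height u"
proof -
	have "(\<Sum>j\<in>init_idx. (Im (siegel_inv u $ j))^2) = (\<Sum>j\<in>init_idx. (Im (u $ j))^2)"
		by (rule sum.cong) (auto simp: siegel_inv_nth)
	moreover have "Im (\<i> / 2 * (\<Sum>j\<in>init_idx. (u $ j)^2)) = (\<Sum>j\<in>init_idx. ((Re (u $ j))^2 - (Im (u $ j))\<^sup>2)) / 2"
		by (simp add: power2_eq_square)
	ultimately show ?thesis
		unfolding rho_def siegel_height_def cmod_power2
		by (simp add: siegel_inv_nth sum.distrib sum_subtractf field_simps)
qed

lemma siegel_inv_in_tube: "siegel_inv u : tube \<longleftrightarrow> 0 < siegel_height u"
	by (simp add: tube_iff rho_siegel_inv)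

lemma rho_ker_siegel_inv: "rho_ker (siegel_inv u) bpt = (u $ lx + \<i>) / (2 * \<i>)"
proof -
	have 1: "(\<Sum>j\<in>init_idx. (siegel_inv u $ j)^2) = (\<Sum>j\<in>init_idx. (u $ j)^2)"
		by (rule sum.cong) (auto simp: siegel_inv_nth)
	show ?thesis unfolding rho_ker_base 1 by (simp add: siegel_inv_nth)
qed

lemma siegel_inv_measurable [measurable]: "siegel_inv : BM"
	unfolding siegel_inv_def by measurable

lemma siegel_height_measurable [measurable]: "siegel_height : BM"
	unfolding siegel_height_def by measurable

lemma sets_siegel_measure [simp, measurable_cong]: "sets (siegel_measure al) = sets borel"
	by (simp add: siegel_measure_def)

lemma space_siegel_measure [simp]: "space (siegel_measure al) = UNIV"
	by (simp add: siegel_measure_def)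

lemma nn_integral_siegel_measure:
	assumes [measurable]: "f : BM"
	shows "(NI (siegel_measure al) (%u. f u))
		= (NI lborel (%u. ennreal (indicator {0<..} (siegel_height u) * siegel_height u powr al) * f u))"
	unfolding siegel_measure_def by (subst nn_integral_density) auto

lemma sigma_finite_siegel_measure: "sigma_finite_measure (siegel_measure al)"
	unfolding siegel_measure_def
	by (rule sigma_finite_measure.sigma_finite_iff_density_finite[THEN iffD2]) (auto intro: sigma_finite_lborel)

lemma AE_siegel_measure: "AE u in siegel_measure al. 0 < siegel_height u"
	unfolding siegel_measure_def by (subst AE_density) (auto simp: indicator_def)

lemma nn_integral_distr_eqI:
	assumes "T : M \<rightarrow>\<^sub>M L" "sets L = sets N"
		and "!!A. A : sets N ==> (NI M (%x. indicator A (T x))) = (NI N (%x. indicator A x))"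
	shows "distr M L T = N"
proof (rule measure_eqI)
	fix A assume A: "A : sets (distr M L T)"
	have "emeasure (distr M L T) A = (NI (distr M L T) (%x. indicator A x))" using A by simp
	also have "... = (NI M (%x. indicator A (T x)))" using A by (subst nn_integral_distr[OF assms(1)]) auto
	finally show "emeasure (distr M L T) A = emeasure N A" using assms(3)[of A] assms(2) A by simp
qed (simp add: assms(2))

lemma distr_siegel_measure: "distr (siegel_measure al) (W al) siegel_inv = W al"
proof (rule nn_integral_distr_eqI)
	fix A :: "'a cvec set" assume "A : sets (W al)"
	hence [measurable]: "A : sets borel" by simp
	have "(NI (siegel_measure al) (%u. indicator A (siegel_inv u)))
		 = (NI lborel (%u. ennreal (indicator tube (siegel_inv u) * rho (siegel_inv u) powr al) * indicator A (siegel_inv u)))"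
		by (subst nn_integral_siegel_measure) (auto simp: rho_siegel_inv indicator_def siegel_inv_in_tube intro!: nn_integral_cong)
	also have "... = (NI lborel (%w. ennreal (indicator tube w * rho w powr al) * indicator A w))"
		unfolding siegel_inv_def
		by (rule nn_integral_cvec_shear[where f="%w. ennreal (indicator tube w * rho w powr al) * indicator A w"])
			 (auto simp: axis_def intro!: sum.cong arg_cong2[where f="(*)"])
	also have "... = (NI (W al) (%w. indicator A w))" by (subst nn_integral_W) auto
	finally show "(NI (siegel_measure al) (%u. indicator A (siegel_inv u))) = (NI (W al) (%w. indicator A w))" .
qed (simp_all add: borel_measurable_W cong: measurable_cong_sets)

definition rotate_init :: "real => 'n::{finite,linorder} cvec => 'n cvec" where
	"rotate_init t u = (\<chi> j. if j = lx then u $ j else cis t * u $ j)"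

lemma siegel_height_rotate: "siegel_height (rotate_init t u) = siegel_height u"
	by (simp add: siegel_height_def rotate_init_def norm_mult)

lemma norm_cvec: "norm (u :: 'n::finite cvec) = sqrt (\<Sum>j\<in>UNIV. (cmod (u $ j))^2)"
	by (simp add: norm_vec_def L2_set_def)

text \<open>The rotation is a linear isometry and leaves the density unchanged, since
  \<open>siegel_height\<close> sees only the moduli of the rotated coordinates.\<close>

lemma distr_rotate_siegel_measure: "distr (siegel_measure al) (siegel_measure al) (rotate_init t) = siegel_measure al"
proof (rule nn_integral_distr_eqI)
	have lin: "linear (rotate_init t)"
		by (rule linearI) (auto simp: rotate_init_def vec_eq_iff algebra_simps)
	have nrm: "norm (rotate_init t u) = norm u" for u
		unfolding norm_cvec by (intro arg_cong[where f=sqrt] sum.cong) (auto simp: rotate_init_def norm_mult)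
	have rm[measurable]: "rotate_init t : BM"
		by (intro borel_measurable_continuous_onI linear_continuous_on) (use lin in \<open>simp add: linear_conv_bounded_linear\<close>)
	thus "rotate_init t : siegel_measure al \<rightarrow>\<^sub>M siegel_measure al" by (simp cong: measurable_cong_sets)
	fix A :: "'a cvec set" assume "A : sets (siegel_measure al)"
	hence [measurable]: "A : sets borel" by simp
	let ?d = "%u. ennreal (indicator {0<..} (siegel_height u) * siegel_height u powr al) * indicator A u"
	have "(NI (siegel_measure al) (%u. indicator A (rotate_init t u))) = (NI lborel (%u. ?d (rotate_init t u)))"
		using rm by (subst nn_integral_siegel_measure) (auto simp: siegel_height_rotate)
	also have "... = (NI lborel (%u. ?d u))"
		by (rule nn_integral_lborel_isometry[OF lin nrm]) measurable
	also have "... = (NI (siegel_measure al) (%u. indicator A u))" by (subst nn_integral_siegel_measure) auto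
	finally show "(NI (siegel_measure al) (%u. indicator A (rotate_init t u))) = (NI (siegel_measure al) (%u. indicator A u))" .
qed simp

lemma nn_integral_gaussian: "(NI lborel (%x. ennreal (exp (- x\<^sup>2 / 2)))) = ennreal (sqrt (2 * pi))"
proof -
	interpret prob_space "density lborel (normal_density 0 1)" by (rule prob_space_normal_density) simp
	have "1 = (NI lborel (%x. ennreal (normal_density 0 1 x)))"
		using emeasure_space_1 by (simp add: emeasure_density)
	hence "ennreal (sqrt (2 * pi)) * 1 = ennreal (sqrt (2 * pi)) * (NI lborel (%x. ennreal (normal_density 0 1 x)))"
		by simp
	also have "... = (NI lborel (%x. ennreal (sqrt (2 * pi)) * ennreal (normal_density 0 1 x)))"
		by (rule nn_integral_cmult[symmetric]) measurable
	also have "(%x. ennreal (sqrt (2 * pi)) * ennreal (normal_density 0 1 x)) = (%x. ennreal (exp (- x\<^sup>2 / 2)))"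
		by (auto simp: fun_eq_iff normal_density_def ennreal_mult[symmetric] simp del: ennreal_mult)
	finally show ?thesis by simp
qed

lemma nn_integral_gamma:
	assumes "(a::real) > -1"
	shows "(NI lborel (%x. ennreal (indicator {0<..} x * x powr a * exp (- x)))) = ennreal (Gamma (a + 1))"
proof -
	have "((%t. t powr (a + 1 - 1) / exp t) has_integral Gamma (a + 1)) {0..}"
		using assms by (intro Gamma_integral_real) auto
	hence "((%t. if t : {0..} then t powr a / exp t else 0) has_integral Gamma (a + 1)) UNIV"
		unfolding has_integral_restrict_UNIV by simp
	also have "(%t. if t : {0..} then t powr a / exp t else 0) = (%x. indicator {0<..} x * x powr a * exp (- x))"
		by (auto simp: fun_eq_iff indicator_def exp_minus divide_inverse)
	finally show ?thesis by (intro nn_integral_has_integral_lborel) auto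
qed

lemma nn_integral_gaussian_cvec:
	"(NI (lborel :: 'n::finite cvec measure) (%u. ennreal (exp (- (\<Sum>j\<in>UNIV. (cmod (u $ j))^2) / 2)))) = ennreal ((2 * pi) ^ CARD('n))"
proof -
	have "(NI (lborel :: 'n cvec measure) (%u. ennreal (exp (- (\<Sum>j\<in>UNIV. (cmod (u $ j))^2) / 2))))
		 = (NI (lborel :: 'n cvec measure) (%u. (\<Prod>b\<in>Basis. ennreal (exp (- (u \<bullet> b)\<^sup>2 / 2)))))"
	proof (rule nn_integral_cong)
		fix u :: "'n cvec"
		have "(\<Prod>b\<in>Basis. ennreal (exp (- (u \<bullet> b)\<^sup>2 / 2)))
			 = (\<Prod>j\<in>UNIV. ennreal (exp (- (Re (u $ j))\<^sup>2 / 2)) * ennreal (exp (- (Im (u $ j))\<^sup>2 / 2)))"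
			unfolding prod_Basis_cvec by (simp add: inner_axis inner_complex_def)
		also have "... = (\<Prod>j\<in>UNIV. ennreal (exp (- (cmod (u $ j))\<^sup>2 / 2)))"
			by (rule prod.cong) (simp_all add: ennreal_mult[symmetric] cmod_power2 add_divide_distrib diff_divide_distrib flip: exp_add)
		also have "... = ennreal (exp (\<Sum>j\<in>UNIV. - (cmod (u $ j))\<^sup>2 / 2))"
			by (simp add: prod_ennreal exp_sum)
		also have "(\<Sum>j\<in>UNIV. - (cmod (u $ j))\<^sup>2 / 2) = - (\<Sum>j\<in>UNIV. (cmod (u $ j))^2) / 2"
			by (simp add: sum_divide_distrib sum_negf)
		finally show "ennreal (exp (- (\<Sum>j\<in>UNIV. (cmod (u $ j))^2) / 2)) = (\<Prod>b\<in>Basis. ennreal (exp (- (u \<bullet> b)\<^sup>2 / 2)))" ..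
	qed
	also have "... = (\<Prod>b\<in>(Basis :: 'n cvec set). (NI lborel (%x. ennreal (exp (- x\<^sup>2 / 2)))))"
		by (rule nn_integral_lborel_prod) auto
	also have "... = (\<Prod>j\<in>(UNIV::'n set). ennreal (2 * pi))"
		unfolding prod_Basis_cvec nn_integral_gaussian by (simp add: ennreal_mult[symmetric])
	finally show ?thesis by (simp add: ennreal_power)
qed

lemma nn_integral_gaussian_complex:
	"(NI lborel (%c. ennreal (exp (- (cmod c)\<^sup>2 / 2) / (2 * pi)))) = 1"
proof -
	have "(NI lborel (%c. ennreal (exp (- (cmod c)\<^sup>2 / 2) / (2 * pi))))
		 = (NI (lborel :: complex measure) (%c. ennreal (1 / (2 * pi)) * (\<Prod>b\<in>Basis. ennreal (exp (- (c \<bullet> b)\<^sup>2 / 2)))))"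
	proof (rule nn_integral_cong)
		fix c :: complex
		have "(\<Prod>b\<in>Basis. ennreal (exp (- (c \<bullet> b)\<^sup>2 / 2))) = ennreal (exp (- (Re c)\<^sup>2 / 2)) * ennreal (exp (- (Im c)\<^sup>2 / 2))"
			by (simp add: Basis_complex_def inner_complex_def)
		also have "... = ennreal (exp (- (cmod c)\<^sup>2 / 2))"
			by (simp add: ennreal_mult[symmetric] cmod_power2 add_divide_distrib diff_divide_distrib flip: exp_add)
		finally show "ennreal (exp (- (cmod c)\<^sup>2 / 2) / (2 * pi)) = ennreal (1 / (2 * pi)) * (\<Prod>b\<in>Basis. ennreal (exp (- (c \<bullet> b)\<^sup>2 / 2)))"
			by (simp only:) (simp add: ennreal_mult[symmetric])
	qed
	also have "... = ennreal (1 / (2 * pi)) * (NI (lborel :: complex measure) (%c. (\<Prod>b\<in>Basis. ennreal (exp (- (c \<bullet> b)\<^sup>2 / 2)))))"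
		by (rule nn_integral_cmult) measurable
	also have "(NI (lborel :: complex measure) (%c. (\<Prod>b\<in>Basis. ennreal (exp (- (c \<bullet> b)\<^sup>2 / 2))))) = ennreal (2 * pi)"
	proof -
		have "(NI (lborel :: complex measure) (%c. (\<Prod>b\<in>Basis. ennreal (exp (- (c \<bullet> b)\<^sup>2 / 2)))))
			 = (\<Prod>b\<in>(Basis :: complex set). (NI lborel (%x. ennreal (exp (- x\<^sup>2 / 2)))))"
			by (rule nn_integral_lborel_prod) auto
		thus ?thesis unfolding nn_integral_gaussian by (simp add: Basis_complex_def ennreal_mult[symmetric])
	qed
	finally show ?thesis by (simp add: ennreal_mult[symmetric])
qed

text \<open>
	The constant is found by integrating the fibre volumes against \<open>e\<^sup>-\<^sup>y\<close>, which turns them into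
	Gaussian integrals.
\<close>

lemma siegel_fibre_volume:
	fixes al y :: real
	assumes al: "al > -1"
	defines "k \<equiv> %c. ennreal (exp (- (cmod c)\<^sup>2 / 2) / (2 * pi))"
	defines "n \<equiv> real CARD('n)"
	defines "H \<equiv> %y. (NI (lborel :: 'n::{finite,linorder} cvec measure) (%u. k (u $ lx) *
			ennreal (indicator {0<..} (y - (\<Sum>j\<in>init_idx. (cmod (u $ j))^2) / 2) * (y - (\<Sum>j\<in>init_idx. (cmod (u $ j))^2) / 2) powr al)))"
	shows "H y = ennreal ((2 * pi) ^ (CARD('n) - 1) * Gamma (al + 1) / Gamma (al + n) * (indicator {0<..} y * y powr (al + n - 1)))"
proof -
	have n1: "n >= 1" by (simp add: n_def Suc_leI)
	define S where "S = (%u::'n cvec. (\<Sum>j\<in>init_idx. (cmod (u $ j))^2) / 2)"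
	define D where "D = (%t::real. ennreal (indicator {0<..} t * t powr al))"
	have S0: "S u >= 0" for u by (simp add: S_def sum_nonneg)
	have [measurable]: "S : BM" "D : BM" "k : BM"
		unfolding S_def D_def k_def by measurable
	have H: "H y = (NI lborel (%u. k (u $ lx) * D (y - S u)))" for y
		by (simp add: H_def D_def S_def)
	have Hneg: "H y = 0" if "y <= 0" for y
	proof -
		have "D (y - S u) = 0" for u using S0[of u] that by (simp add: D_def)
		thus ?thesis by (simp add: H)
	qed
	\<comment> \<open>Scaling the first \<open>n - 1\<close> coordinates by \<open>sqrt y\<close> gives
	  \<open>y powr (n - 1)\<close> from the Jacobian and \<open>y powr al\<close> from the density.
	  The last coordinate keeps its scale, because \<open>k\<close> is tied to it.\<close>
	have Hscale: "H y = ennreal (y powr (al + n - 1)) * H 1" if y: "y > 0" for y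
	proof -
		define c where "c = (%b::'n cvec. if b : {axis lx 1, axis lx \<i>} then 1 else sqrt y)"
		define T where "T = (%u::'n cvec. 0 + (\<Sum>b\<in>Basis. (c b * (u \<bullet> b)) *\<^sub>R b))"
		have [measurable]: "T : BM" unfolding T_def by measurable
		have ax: "(axis j a :: 'n cvec) : {axis lx 1, axis lx \<i>} \<longleftrightarrow> j = lx" if "a : {1,\<i>}" for j a
			using that by (auto simp: axis_eq_axis)
		have cc: "c (axis j 1) = (if j = lx then 1 else sqrt y)"
				"c (axis j \<i>) = (if j = lx then 1 else sqrt y)" for j
			unfolding c_def by (subst ax; simp)+
		have Tn: "T u $ j = (if j = lx then u $ j else of_real (sqrt y) * u $ j)" for u j
			unfolding T_def add_0 cvec_sum_Basis cc by (auto simp: complex_eq_iff)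
		have prodc: "(\<Prod>b\<in>Basis. \<bar>c b\<bar>) = y powr (n - 1)"
		proof -
			have "(\<Prod>b\<in>Basis. \<bar>c b\<bar>) = (\<Prod>j\<in>UNIV. \<bar>c (axis j 1)\<bar> * \<bar>c (axis j \<i>)\<bar>)"
				by (rule prod_Basis_cvec)
			also have "... = (\<Prod>j\<in>(UNIV::'n set). if j = lx then 1 else y)"
				using y by (intro prod.cong) (auto simp: cc)
			also have "... = (\<Prod>j\<in>(init_idx::'n set). y)"
				by (subst prod.remove[of _ lx]) auto
			also have "... = y ^ (CARD('n) - 1)" by (simp add: card_Diff_singleton_if)
			also have "... = y powr (n - 1)"
				using y by (subst powr_realpow[symmetric]) (auto simp: n_def of_nat_diff Suc_leI)
			finally show ?thesis .
		qed
		have "(lborel :: 'n cvec measure) = density (distr lborel borel T) (%_. (\<Prod>b\<in>Basis. \<bar>c b\<bar>))"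
			unfolding T_def by (rule lborel_affine_euclidean) (use y in \<open>auto simp: c_def\<close>)
		hence "H y = (NI (density (distr lborel borel T) (%_. (\<Prod>b\<in>Basis. \<bar>c b\<bar>))) (%u. k (u $ lx) * D (y - S u)))"
			unfolding H by simp
		also have "... = (NI lborel (%u. ennreal (y powr (n - 1)) * (k (T u $ lx) * D (y - S (T u)))))"
			by (simp add: nn_integral_density nn_integral_distr prodc)
		also have "... = (NI lborel (%u. ennreal (y powr (al + n - 1)) * (k (u $ lx) * D (1 - S u))))"
		proof (rule nn_integral_cong)
			fix u
			have "S (T u) = (\<Sum>j\<in>init_idx. y * (cmod (u $ j))^2) / 2"
				unfolding S_def using y by (intro arg_cong2[where f="(/)"] sum.cong) (auto simp: Tn norm_mult power_mult_distrib)
			hence ST: "y - S (T u) = y * (1 - S u)" by (simp add: S_def sum_distrib_left algebra_simps)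
			have "indicator {0<..} (y * (1 - S u)) = (indicator {0<..} (1 - S u) :: real)"
				using y by (auto simp: indicator_def zero_less_mult_iff)
			hence DT: "D (y - S (T u)) = ennreal (y powr al) * D (1 - S u)"
				unfolding ST D_def using y
				by (cases "1 - S u > 0") (auto simp: powr_mult ennreal_mult[symmetric])
			have "ennreal (y powr (n - 1)) * ennreal (y powr al) = ennreal (y powr (al + n - 1))"
				by (simp add: ennreal_mult[symmetric] algebra_simps flip: powr_add)
			note e = this
			show "ennreal (y powr (n - 1)) * (k (T u $ lx) * D (y - S (T u)))
					= ennreal (y powr (al + n - 1)) * (k (u $ lx) * D (1 - S u))"
				unfolding DT Tn e[symmetric] by (simp add: mult_ac)
		qed
		also have "... = ennreal (y powr (al + n - 1)) * H 1"
			unfolding H by (rule nn_integral_cmult) measurable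
		finally show ?thesis .
	qed
	define C where "C = (2 * pi) ^ (CARD('n) - 1) * Gamma (al + 1)"
	have C: "C > 0" using al by (simp add: C_def Gamma_real_pos)
	have G: "Gamma (al + n) > 0" using al n1 by (intro Gamma_real_pos) simp
	have "H 1 * ennreal (Gamma (al + n)) = (NI lborel (%y. H 1 * ennreal (indicator {0<..} y * y powr (al + n - 1) * exp (- y))))"
		using nn_integral_gamma[of "al + n - 1"] al n1 by (subst nn_integral_cmult) auto
	also have "... = (NI lborel (%y. H y * ennreal (exp (- y))))"
	proof (rule nn_integral_cong)
		fix y :: real
		show "H 1 * ennreal (indicator {0<..} y * y powr (al + n - 1) * exp (- y)) = H y * ennreal (exp (- y))"
		proof (cases "y > 0")
			case True
			show ?thesis by (subst Hscale[OF True]) (use True in \<open>simp add: ennreal_mult mult_ac\<close>)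
		qed (simp add: Hneg)
	qed
	also have "... = (NI lborel (%y. (NI lborel (%u. k (u $ lx) * D (y - S u) * ennreal (exp (- y))))))"
		unfolding H by (intro nn_integral_cong nn_integral_multc[symmetric]) measurable
	also have "... = (NI lborel (%u. (NI lborel (%y. k (u $ lx) * D (y - S u) * ennreal (exp (- y))))))"
		by (rule lborel_pair.Fubini') measurable
	also have "... = (NI (lborel :: 'n cvec measure) (%u. ennreal (Gamma (al + 1) / (2 * pi)) * ennreal (exp (- (\<Sum>j\<in>UNIV. (cmod (u $ j))^2) / 2))))"
	proof (rule nn_integral_cong)
		fix u :: "'n cvec"
		have "(NI lborel (%y. k (u $ lx) * D (y - S u) * ennreal (exp (- y))))
			 = (NI lborel (%y. k (u $ lx) * (ennreal (exp (- S u)) * ennreal (indicator {0<..} y * y powr al * exp (- y)))))"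
		proof (subst nn_integral_lborel_translate[where c="S u", symmetric])
			show "(NI lborel (%y. k (u $ lx) * D (y + S u - S u) * ennreal (exp (- (y + S u)))))
			 = (NI lborel (%y. k (u $ lx) * (ennreal (exp (- S u)) * ennreal (indicator {0<..} y * y powr al * exp (- y)))))"
				by (intro nn_integral_cong) (simp add: D_def ennreal_mult[symmetric] exp_add exp_diff exp_minus field_simps)
		qed measurable
		also have "... = k (u $ lx) * (ennreal (exp (- S u)) * ennreal (Gamma (al + 1)))"
			using al by (simp add: nn_integral_cmult nn_integral_gamma)
		also have "... = ennreal (Gamma (al + 1) / (2 * pi) * (exp (- (cmod (u $ lx))\<^sup>2 / 2) * exp (- S u)))"
			using al by (simp add: k_def ennreal_mult[symmetric] Gamma_real_nonneg mult_ac)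
		also have "exp (- (cmod (u $ lx))\<^sup>2 / 2) * exp (- S u) = exp (- (\<Sum>j\<in>UNIV. (cmod (u $ j))^2) / 2)"
			unfolding S_def exp_add[symmetric] by (subst (2) sum.remove[of _ lx]) (auto simp: field_simps)
		finally show "(NI lborel (%y. k (u $ lx) * D (y - S u) * ennreal (exp (- y))))
			 = ennreal (Gamma (al + 1) / (2 * pi)) * ennreal (exp (- (\<Sum>j\<in>UNIV. (cmod (u $ j))^2) / 2))"
			using al by (simp add: ennreal_mult[symmetric] Gamma_real_nonneg)
	qed
	also have "... = ennreal (Gamma (al + 1) / (2 * pi)) * ennreal ((2 * pi) ^ CARD('n))"
		by (subst nn_integral_cmult, simp, simp only: nn_integral_gaussian_cvec)
	also have "... = ennreal C"
	proof -
		have "(2 * pi) ^ CARD('n) = (2 * pi) * (2 * pi) ^ (CARD('n) - 1)"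
			using power_Suc[of "2 * pi" "CARD('n) - 1"] by simp
		thus ?thesis using al by (simp add: C_def ennreal_mult[symmetric] Gamma_real_nonneg)
	qed
	also have "... = ennreal (C / Gamma (al + n)) * ennreal (Gamma (al + n))"
		using G C by (simp add: ennreal_mult[symmetric])
	finally have H1: "H 1 = ennreal (C / Gamma (al + n))"
		using G by (simp add: mult.commute[of _ "ennreal (Gamma _)"] ennreal_mult_cancel_left)
	show ?thesis
	proof (cases "y > 0")
		case True
		thus ?thesis using C G unfolding Hscale[OF True] H1 C_def[symmetric]
			by (simp add: ennreal_mult[symmetric] mult.commute)
	qed (simp add: Hneg)
qed

text \<open>Integration over the fibres turns the weight exponent \<open>al\<close> into
  \<open>al + n - 1\<close> on the half plane; with this exponent the formula in one variable has to
  be used.\<close>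

lemma distr_siegel_measure_last:
	fixes al :: real
	assumes al: "al > -1"
	shows "distr (siegel_measure al :: 'n::{finite,linorder} cvec measure) borel (%u. u $ lx)
		= density lborel (%c. ennreal ((2 * pi) ^ (CARD('n) - 1) * Gamma (al + 1) / Gamma (al + real CARD('n))
				* (indicator {c. 0 < Im c} c * Im c powr (al + real CARD('n) - 1))))"
proof (rule nn_integral_distr_eqI)
	let ?C = "(2 * pi) ^ (CARD('n) - 1) * Gamma (al + 1) / Gamma (al + real CARD('n))"
	let ?e = "al + real CARD('n) - 1"
	define k where "k = (%c::complex. ennreal (exp (- (cmod c)\<^sup>2 / 2) / (2 * pi)))"
	define S where "S = (%u::'n cvec. (\<Sum>j\<in>init_idx. (cmod (u $ j))^2) / 2)"
	define D where "D = (%t::real. ennreal (indicator {0<..} t * t powr al))"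
	have [measurable]: "S : BM" "D : BM" "k : BM"
		unfolding S_def D_def k_def by measurable
	show "(%u. u $ lx) : borel_measurable (siegel_measure al :: 'n cvec measure)"
		by (simp cong: measurable_cong_sets)
	fix A :: "complex set" assume "A : sets (density lborel (%c. ennreal (?C * (indicator {c. 0 < Im c} c * Im c powr ?e))))"
	hence [measurable]: "A : sets borel" by simp
	have "(NI (siegel_measure al :: 'n cvec measure) (%u. indicator A (u $ lx)))
		 = (NI lborel (%u. D (Im (u $ lx) - S u) * indicator A (u $ lx)))"
		by (subst nn_integral_siegel_measure) (auto simp: D_def S_def siegel_height_def)
	also have "... = (NI lborel (%u. k (u $ lx) * (NI lborel (%c. D (Im c - S u) * indicator A c))))"
	proof -
		have "S (u + axis lx c) = S u" for u c
			unfolding S_def by (intro arg_cong2[where f="(/)"] sum.cong) (auto simp: axis_def)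
		moreover have "(u + axis lx (c - u $ lx)) $ lx = c" for u :: "'n cvec" and c
			by (simp add: axis_def)
		ultimately show ?thesis
			by (subst nn_integral_cvec_coordinate[where k=k and l=lx])
				 (use nn_integral_gaussian_complex[folded k_def] in \<open>auto simp del: vector_add_component\<close>)
	qed
	also have "... = (NI lborel (%u. (NI lborel (%c. k (u $ lx) * D (Im c - S u) * indicator A c))))"
		by (intro nn_integral_cong) (simp add: nn_integral_cmult[symmetric] mult.assoc)
	also have "... = (NI lborel (%c. (NI lborel (%u. k (u $ lx) * D (Im c - S u) * indicator A c))))"
		by (rule lborel_pair.Fubini') measurable
	also have "... = (NI lborel (%c. ennreal (?C * (indicator {c. 0 < Im c} c * Im c powr ?e)) * indicator A c))"
	proof (rule nn_integral_cong)
		fix c :: complex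
		have "(NI lborel (%u. k (u $ lx) * D (Im c - S u) * indicator A c))
			 = (NI lborel (%u. k (u $ lx) * D (Im c - S u))) * indicator A c"
			by (rule nn_integral_multc) measurable
		also have "(NI lborel (%u. k (u $ lx) * D (Im c - S u))) = ennreal (?C * (indicator {0<..} (Im c) * Im c powr ?e))"
			unfolding k_def D_def S_def by (rule siegel_fibre_volume[OF al])
		finally show "(NI lborel (%u. k (u $ lx) * D (Im c - S u) * indicator A c))
			 = ennreal (?C * (indicator {c. 0 < Im c} c * Im c powr ?e)) * indicator A c"
			by (simp add: indicator_def)
	qed
	also have "... = (NI (density lborel (%c. ennreal (?C * (indicator {c. 0 < Im c} c * Im c powr ?e)))) (%c. indicator A c))"
		by (subst nn_integral_density) auto
	finally show "(NI (siegel_measure al :: 'n cvec measure) (%u. indicator A (u $ lx))) = ..." .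
qed simp

lemma cnj_measurable [measurable (raw)]:
	assumes "f : borel_measurable M"
	shows "(%x. cnj (f x)) : borel_measurable M"
	by (rule measurable_compose[OF assms]) (intro borel_measurable_continuous_onI continuous_intros)

lemma one_plus_sq_le_cmod_add_i: "0 < Im c ==> 1 + (cmod c)^2 <= (cmod (c + \<i>))^2"
	unfolding cmod_power2 by (simp add: power2_eq_square algebra_simps)

text \<open>The mean over rotations replaces \<open>g\<close> by its values on the complex line
  where the first coordinates vanish, without touching the kernel. On that line
  \<open>half_plane_reproducing\<close> applies. The decay of \<open>g\<close> makes both the
  integral over the tube and the Cauchy integral converge absolutely.\<close>

lemma reproducing_base_decay:
	fixes g :: "'n::{finite,linorder} cvec => complex"
	assumes al: "al > -1" and hol: "holomorphic_Cn g tube" and gm[measurable]: "g : BM"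
		and bd: "!!w. w : tube ==> cmod (g w) <= K / (1 + (cmod (rho_ker w bpt))^2)"
	shows "of_real (Gamma (real CARD('n) + 1 + al) / (2 ^ (CARD('n) + 1) * pi ^ CARD('n) * Gamma (al + 1))) *
		 (LINT w|W al. g w * rpowr (rho_ker bpt w) (- (real CARD('n) + 1 + al))) = g bpt"
proof -
	define n where "n = real CARD('n)"
	have n1: "n >= 1" by (simp add: n_def Suc_leI)
	define N where "N = n + 1 + al"
	define C where "C = (2 * pi) ^ (CARD('n) - 1) * Gamma (al + 1) / Gamma (al + n)"
	have K: "K >= 0" using order.trans[OF norm_ge_zero bd[OF bpt_in_tube]] by (simp add: zero_le_divide_iff rho_ker_diag)
	define ka where "ka = (%c. rpowr (cnj ((c + \<i>) / (2 * \<i>))) (- N))"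
	have [measurable]: "ka : BM" unfolding ka_def by measurable
	define Ph where "Ph = (%u::'n cvec. g (siegel_inv u) * ka (u $ lx))"
	have [measurable]: "Ph : BM" unfolding Ph_def by measurable
	have ker: "rho_ker bpt (siegel_inv u) = cnj ((u $ lx + \<i>) / (2 * \<i>))" for u :: "'n cvec"
		by (subst rho_ker_commute) (simp only: rho_ker_siegel_inv)
	let ?M = "siegel_measure al :: 'n cvec measure"
	let ?f = "%w. g w * rpowr (rho_ker bpt w) (- N)"
	have fm: "?f : borel_measurable (W al)" unfolding borel_measurable_W by measurable
	have sm: "siegel_inv : ?M \<rightarrow>\<^sub>M W al" by (simp add: borel_measurable_W cong: measurable_cong_sets)
	have fint: "integrable (W al) ?f"
	proof (rule integrableI_bounded[OF fm])
		\<comment> \<open>The decay of \<open>g\<close> supplies one more power of \<open>1 / X\<close>,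
		  which puts the exponent \<open>N + 1\<close> strictly above the critical one.\<close>
		have "(NI (W al) (%w. ennreal (norm (?f w)))) <= (NI (W al :: 'n cvec measure) (%w. ennreal K * ennreal (cmod (rho_ker w bpt) powr (- (N + 1)))))"
		proof (rule nn_integral_mono_AE, use AE_W_tube[of al] in eventually_elim)
			case (elim w)
			define X where "X = cmod (rho_ker w bpt)"
			have X: "X > 0" unfolding X_def by (rule cmod_rho_ker_pos[OF elim bpt_in_tube])
			have "X <= 1 + X\<^sup>2" using zero_le_power2[of "X - 1/2"] by (simp add: power2_eq_square algebra_simps)
			hence "K / (1 + X\<^sup>2) <= K / X" using K X by (intro divide_left_mono mult_pos_pos) auto
			hence "cmod (g w) <= K / X" using bd[OF elim] by (simp add: X_def)
			moreover have "cmod (rpowr (rho_ker bpt w) (- N)) = X powr (- N)"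
				using Re_rho_ker_pos[OF bpt_in_tube elim] by (simp add: cmod_rpowr X_def cmod_rho_ker_commute[of bpt])
			ultimately have "norm (?f w) <= K / X * X powr (- N)"
				using mult_right_mono[of "cmod (g w)" "K / X" "X powr - N"] by (simp add: norm_mult)
			also have "... = K * X powr (- (N + 1))"
			proof -
				have "- (N + 1) = - N - 1" by simp
				hence "X powr (- (N + 1)) = X powr (- N) / X" using X powr_diff[of X "- N" 1] by simp
				thus ?thesis by simp
			qed
			finally show ?case using K by (simp add: X_def ennreal_mult[symmetric] ennreal_leI)
		qed
		also have "... = ennreal K * (NI (W al :: 'n cvec measure) (%w. ennreal (cmod (rho_ker w bpt) powr (- (N + 1)))))"
			by (rule nn_integral_cmult) (simp add: borel_measurable_W)
		also have "... < \<infinity>"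
			using forelli_rudin_base_finite[where 'n='n, of al "N + 1"] al
			by (simp add: N_def n_def ennreal_mult_less_top)
		finally show "(NI (W al) (%w. ennreal (norm (?f w)))) < \<infinity>" .
	qed
	have Phf: "Ph u = ?f (siegel_inv u)" for u by (simp add: Ph_def ka_def ker)
	have Phint: "integrable ?M Ph"
		using fint unfolding Phf by (subst (asm) distr_siegel_measure[symmetric], subst (asm) integrable_distr_eq[OF sm fm])
	have "(LINT w|W al. ?f w) = (LINT w|distr ?M (W al) siegel_inv. ?f w)" by (simp only: distr_siegel_measure)
	also have "... = (LINT u|?M. Ph u)" unfolding Phf by (rule integral_distr[OF sm fm])
	finally have 1: "(LINT w|W al. ?f w) = (LINT u|?M. Ph u)" .
	define h where "h = (%c. g (siegel_inv (axis lx c :: 'n cvec)))"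
	have [measurable]: "h : BM" unfolding h_def by measurable
	have height_axis: "siegel_height (axis lx c :: 'n cvec) = Im c" for c
		by (simp add: siegel_height_def axis_def)
	define curve where "curve = (%(u::'n cvec) (s::complex). (\<chi> j. if j = lx then u $ j else s * u $ j))"
	have curve_rot: "curve u (cis t) = rotate_init t u" for u t by (simp add: curve_def rotate_init_def)
	\<comment> \<open>The circle \<open>s = cis t\<close> bounds a disc inside the Siegel domain,
	  because shrinking the first coordinates does not lower the height. The centre
	  \<open>s = 0\<close> has first coordinates 0, and the kernel is constant along the disc.\<close>
	have circ: "(LINT t|lborel. indicator {0..2*pi} t *\<^sub>R Ph (rotate_init t u)) = 2 * of_real pi * (h (u $ lx) * ka (u $ lx))"
		if u: "0 < siegel_height u" for u
	proof -
		define Y where "Y = (\<Sum>j\<in>init_idx. (cmod (u $ j))^2) / 2"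
		have Y0: "Y >= 0" by (simp add: Y_def sum_nonneg)
		have hc: "siegel_height (curve u s) = Im (u $ lx) - (cmod s)\<^sup>2 * Y" for s
			by (simp add: siegel_height_def curve_def Y_def norm_mult power_mult_distrib sum_distrib_left)
		define T where "T = {s. 0 < Im (u $ lx) - (cmod s)\<^sup>2 * Y}"
		have To: "open T" unfolding T_def by (intro open_Collect_less continuous_intros)
		have Tc: "cball 0 1 <= T"
		proof
			fix s :: complex assume "s : cball 0 1"
			hence "(cmod s)^2 <= 1" by (simp add: power_le_one)
			hence "(cmod s)^2 * Y <= 1 * Y" using Y0 by (intro mult_right_mono) auto
			thus "s : T" using u by (simp add: T_def siegel_height_def Y_def)
		qed
		have "(%s. g (siegel_inv (curve u s))) holomorphic_on T"
		proof (rule holomorphic_Cn_compose[OF hol _ To])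
			show "(%s. siegel_inv (curve u s) $ j) holomorphic_on T" for j
			proof (cases "j = lx")
				case True
				have e: "(\<Sum>i\<in>init_idx. (curve u s $ i)^2) = (\<Sum>i\<in>init_idx. (s * u $ i)^2)" for s
					by (rule sum.cong) (auto simp: curve_def)
				show ?thesis unfolding siegel_inv_nth e by (auto simp: True curve_def intro!: holomorphic_intros)
			next
				case False
				thus ?thesis by (auto simp: siegel_inv_nth curve_def intro!: holomorphic_intros)
			qed
			show "(%s. siegel_inv (curve u s)) ` T <= tube"
				by (auto simp: siegel_inv_in_tube hc T_def)
		qed
		from circle_mean_value[OF this Tc]
		have "(LINT t|lborel. indicator {0..2*pi} t *\<^sub>R g (siegel_inv (curve u (cis t)))) = 2 * of_real pi * g (siegel_inv (curve u 0))"
			by simp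
		moreover have "curve u 0 = axis lx (u $ lx)"
			by (simp add: curve_def vec_eq_iff axis_def)
		moreover have "(LINT t|lborel. indicator {0..2*pi} t *\<^sub>R Ph (rotate_init t u))
				= (LINT t|lborel. indicator {0..2*pi} t *\<^sub>R g (siegel_inv (curve u (cis t)))) * ka (u $ lx)"
			unfolding integral_mult_left_zero[symmetric] Ph_def curve_rot by (simp add: rotate_init_def)
		ultimately show ?thesis by (simp add: h_def)
	qed
	interpret SM: sigma_finite_measure ?M by (rule sigma_finite_siegel_measure)
	interpret LS: pair_sigma_finite "lborel :: real measure" ?M ..
	have rotm: "(%p. rotate_init (fst p) (snd p)) : borel_measurable (lborel \<Otimes>\<^sub>M ?M)"
	proof -
		have "continuous_on UNIV (%p::real \<times> 'n cvec. rotate_init (fst p) (snd p) $ j)" for j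
			by (cases "j = lx") (auto simp: rotate_init_def intro!: continuous_intros continuous_on_component)
		hence "continuous_on UNIV (%p::real \<times> 'n cvec. rotate_init (fst p) (snd p))"
			using continuous_on_vec_lambda[of UNIV "%j p. rotate_init (fst p) (snd p :: 'n cvec) $ j"] by simp
		hence "(%p::real \<times> 'n cvec. rotate_init (fst p) (snd p)) : BM"
			by (rule borel_measurable_continuous_onI)
		moreover have "sets (borel :: (real \<times> 'n cvec) measure) = sets (lborel \<Otimes>\<^sub>M ?M)"
			by (simp add: borel_prod[symmetric] cong: sets_pair_measure_cong)
		ultimately show ?thesis using measurable_cong_sets by blast
	qed
	let ?G = "%t u. indicator {0..2*pi} t *\<^sub>R Ph (rotate_init t u)"
	have Phrm: "(%p. Ph (rotate_init (fst p) (snd p))) : borel_measurable (lborel \<Otimes>\<^sub>M ?M)"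
		by (rule measurable_compose[OF rotm]) measurable
	note [measurable] = Phrm
	have Gm: "case_prod ?G : borel_measurable (lborel \<Otimes>\<^sub>M ?M)"
		unfolding split_def by measurable
	have rot1m: "rotate_init t : ?M \<rightarrow>\<^sub>M ?M" for t
	proof -
		have "rotate_init t : BM"
			by (intro borel_measurable_continuous_onI linear_continuous_on linear_conv_bounded_linear[THEN iffD1] linearI)
				 (auto simp: rotate_init_def vec_eq_iff algebra_simps)
		thus ?thesis by (simp cong: measurable_cong_sets)
	qed
	have Phm: "Ph : borel_measurable ?M" by (simp cong: measurable_cong_sets)
	have rot_int: "(LINT u|?M. Ph (rotate_init t u)) = (LINT u|?M. Ph u)" for t
		using integral_distr[OF rot1m Phm, of t] by (simp only: distr_rotate_siegel_measure)
	have rot_nn: "(NI ?M (%u. ennreal (norm (Ph (rotate_init t u))))) = (NI ?M (%u. ennreal (norm (Ph u))))" for t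
		using nn_integral_distr[OF rot1m, of "%u. ennreal (norm (Ph u))" t] Phm by (simp add: distr_rotate_siegel_measure)
	have Gint: "integrable (lborel \<Otimes>\<^sub>M ?M) (case_prod ?G)"
	proof (rule integrableI_bounded[OF Gm])
		have "(NI (lborel \<Otimes>\<^sub>M ?M) (%p. ennreal (norm (case_prod ?G p)))) = (NI lborel (%t. (NI ?M (%u. ennreal (norm (?G t u))))))"
			using Gm by (subst SM.nn_integral_fst[symmetric]) auto
		also have "... = (NI lborel (%t. indicator {0..2*pi} t * (NI ?M (%u. ennreal (norm (Ph u))))))"
			by (intro nn_integral_cong) (auto simp: indicator_def rot_nn)
		also have "... = ennreal (2 * pi) * (NI ?M (%u. ennreal (norm (Ph u))))"
			by (subst nn_integral_multc) auto
		also have "... < \<infinity>" using Phint by (simp add: integrable_iff_bounded ennreal_mult_less_top)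
		finally show "(NI (lborel \<Otimes>\<^sub>M ?M) (%p. ennreal (norm (case_prod ?G p)))) < \<infinity>" .
	qed
	have aeq: "AE u in ?M. (LINT t|lborel. ?G t u) = 2 * of_real pi * (h (u $ lx) * ka (u $ lx))"
		using AE_siegel_measure[of al] by eventually_elim (rule circ)
	have hkm: "(%u. 2 * of_real pi * (h (u $ lx) * ka (u $ lx))) : borel_measurable ?M"
		by (simp cong: measurable_cong_sets)
	have hk_int': "integrable ?M (%u. 2 * of_real pi * (h (u $ lx) * ka (u $ lx)))"
		by (rule integrable_cong_AE_imp[OF LS.integrable_snd[OF Gint] hkm]) (use aeq in eventually_elim, simp)
	have hk_int: "integrable ?M (%u. h (u $ lx) * ka (u $ lx))"
		using integrable_mult_right[OF hk_int', of "1 / (2 * of_real pi)"] by simp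
	have "2 * of_real pi * (LINT u|?M. Ph u) = (LINT t|lborel. (LINT u|?M. ?G t u))"
	proof -
		have "(LINT t|lborel. (LINT u|?M. ?G t u)) = (LINT t|lborel. indicator {0..2*pi} t *\<^sub>R (LINT u|?M. Ph u))"
			by (intro Bochner_Integration.integral_cong) (auto simp: indicator_def rot_int)
		also have "... = (2 * pi) *\<^sub>R (LINT u|?M. Ph u)" by (subst integral_scaleR_left) auto
		finally show ?thesis by (simp add: scaleR_conv_of_real)
	qed
	also have "... = (LINT u|?M. (LINT t|lborel. ?G t u))"
		by (rule LS.Fubini_integral[OF Gint, symmetric])
	also have "... = (LINT u|?M. 2 * of_real pi * (h (u $ lx) * ka (u $ lx)))"
		by (rule integral_cong_AE[OF _ hkm aeq]) (rule borel_measurable_integrable[OF LS.integrable_snd[OF Gint]])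
	also have "... = 2 * of_real pi * (LINT u|?M. h (u $ lx) * ka (u $ lx))"
		by (rule integral_mult_right_zero)
	finally have 2: "(LINT u|?M. Ph u) = (LINT u|?M. h (u $ lx) * ka (u $ lx))" by simp
	have lm: "(%u. u $ lx) : borel_measurable ?M" by (simp cong: measurable_cong_sets)
	have hkm': "(%c. h c * ka c) : BM" by measurable
	define d where "d = (%c. C * (indicator {c. 0 < Im c} c * Im c powr (al + n - 1)))"
	have C: "C > 0" using al n1 by (simp add: C_def Gamma_real_pos)
	have d0: "d c >= 0" for c using C by (simp add: d_def)
	have dm[measurable]: "d : BM" unfolding d_def by measurable
	have last: "distr ?M borel (%u. u $ lx) = density lborel (%c. ennreal (d c))"
		using distr_siegel_measure_last[OF al, where 'n='n] by (simp add: d_def C_def n_def)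
	have dint: "integrable lborel (%c. d c *\<^sub>R (h c * ka c))"
	proof -
		have "integrable (distr ?M borel (%u. u $ lx)) (%c. h c * ka c)"
			using hk_int by (subst integrable_distr_eq[OF lm hkm'])
		thus ?thesis unfolding last using hkm' d0 by (subst (asm) integrable_density) auto
	qed
	have "(LINT u|?M. h (u $ lx) * ka (u $ lx)) = (LINT c|distr ?M borel (%u. u $ lx). h c * ka c)"
		by (rule integral_distr[OF lm hkm', symmetric])
	also have "... = (LINT c|lborel. d c *\<^sub>R (h c * ka c))"
		unfolding last using hkm' d0 by (intro integral_density) auto
	also have "... = C *\<^sub>R (LINT c|lborel. (indicator {c. 0 < Im c} c * Im c powr (al + n - 1)) *\<^sub>R (h c * ka c))"
		unfolding d_def scaleR_scaleR[symmetric] by (rule integral_scaleR_right)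
	also have "(LINT c|lborel. (indicator {c. 0 < Im c} c * Im c powr (al + n - 1)) *\<^sub>R (h c * ka c))
		 = of_real (4 * pi / (al + n - 1 + 1)) * h \<i>"
	proof -
		have N: "- N = - (al + n - 1 + 2)" by (simp add: N_def)
		have hh: "h holomorphic_on {u. 0 < Im u}"
			unfolding h_def
		proof (rule holomorphic_Cn_compose[OF hol])
			show "(%s. siegel_inv (axis lx s) $ j) holomorphic_on {u. 0 < Im u}" for j :: 'n
			proof -
				have e: "(\<Sum>i\<in>(init_idx :: 'n set). (axis lx s $ i)^2) = (0::complex)" for s
					by (rule sum.neutral) (auto simp: axis_def)
				show ?thesis unfolding siegel_inv_nth e
					by (cases "j = lx") (auto simp: axis_def)
			qed
			show "open {u. 0 < Im u}" by (rule open_halfspace_Im_gt)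
			show "(%s. siegel_inv (axis lx s)) ` {u. 0 < Im u} <= (tube :: 'n cvec set)"
				by (auto simp: siegel_inv_in_tube height_axis)
		qed
		\<comment> \<open>The factor 4 stems from \<open>rho_ker = (c + \<i>) / (2 * \<i>)\<close> on this
		  line.\<close>
		have hb: "cmod (h c) <= (4 * K) / (1 + (cmod c)^2)" if c: "0 < Im c" for c
		proof -
			have "siegel_inv (axis lx c) : (tube :: 'n cvec set)" using c by (simp add: siegel_inv_in_tube height_axis)
			from bd[OF this] have "cmod (h c) <= K / (1 + (cmod (c + \<i>))^2 / 4)"
				by (simp add: h_def rho_ker_siegel_inv axis_def norm_divide norm_mult power_divide)
			also have "... <= K / ((1 + (cmod c)^2) / 4)"
				using one_plus_sq_le_cmod_add_i[OF c] K by (intro divide_left_mono mult_pos_pos) (auto simp: add_pos_nonneg)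
			finally show ?thesis by (simp add: mult.commute)
		qed
		have di: "integrable lborel (%u. (indicator {u. 0 < Im u} u * Im u powr (al + n - 1)) *\<^sub>R (h u * rpowr (cnj ((u + \<i>) / (2 * \<i>))) (- (al + n - 1 + 2))))"
		proof -
			have "integrable lborel (%c. (1 / C) *\<^sub>R (d c *\<^sub>R (h c * ka c)))" by (rule integrable_scaleR_right[OF dint])
			thus ?thesis using C by (simp add: d_def ka_def N)
		qed
		show ?thesis unfolding ka_def N
			by (rule half_plane_reproducing[OF _ hh hb di]) (use al n1 in auto)
	qed
	also have "h \<i> = g bpt"
	proof -
		have "siegel_inv (axis lx \<i>) = (bpt :: 'n cvec)"
			by (auto simp: vec_eq_iff siegel_inv_nth axis_def bpt_nth intro!: sum.neutral)
		thus ?thesis by (simp add: h_def)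
	qed
	finally have 3: "(LINT w|W al. ?f w) = of_real (C * (4 * pi / (al + n))) * g bpt"
		unfolding 1 2 by (simp add: scaleR_conv_of_real)
	\<comment> \<open>By \<open>Gamma (n + 1 + al) = (al + n) * Gamma (al + n)\<close> and
	  \<open>(2 * pi)^(n - 1) * (4 * pi) = 2^(n + 1) * pi^n\<close>, the fibre volume and the constant
	  of the half plane multiply to the reciprocal of the kernel constant.\<close>
	have "Gamma (n + 1 + al) / (2 ^ (CARD('n) + 1) * pi ^ CARD('n) * Gamma (al + 1)) * (C * (4 * pi / (al + n))) = 1"
	proof -
		have G: "Gamma (al + n) > 0" "Gamma (al + 1) > 0" using al n1 by (auto intro!: Gamma_real_pos)
		have "Gamma (n + 1 + al) = (al + n) * Gamma (al + n)"
			using Gamma_plus1[of "al + n"] al n1 by (simp add: nonpos_Ints_def add_ac)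
		moreover have "(2 * pi) ^ (CARD('n) - 1) * (4 * pi) = 2 ^ (CARD('n) + 1) * pi ^ CARD('n)"
		proof -
			obtain m where m: "CARD('n) = Suc m" using not0_implies_Suc[of "CARD('n)"] by auto
			show ?thesis unfolding m by (simp add: power_mult_distrib)
		qed
		moreover have "al + n ~= 0" using al n1 by simp
		moreover have "(2::real) ^ (CARD('n) + 1) * pi ^ CARD('n) > 0" by simp
		moreover have "x * a / (b * y) * (A * y / a * (4 * pi / x)) = 1"
			if "A * (4 * pi) = b" "x ~= 0" "a > 0" "y > 0" "b > 0" for x a b y A :: real
			using that by (simp add: field_simps)
		ultimately show ?thesis using G unfolding C_def by metis
	qed
	hence "of_real (Gamma (n + 1 + al) / (2 ^ (CARD('n) + 1) * pi ^ CARD('n) * Gamma (al + 1))) * of_real (C * (4 * pi / (al + n))) = (1 :: complex)"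
		by (simp only: of_real_mult[symmetric] of_real_1)
	thus ?thesis using 3 unfolding N_def n_def[symmetric] by (simp only: mult.assoc[symmetric]) simp
qed

lemma holomorphic_CnI:
	assumes "!!z. z : S ==> (f has_derivative D z) (at z)" "!!z c v. z : S ==> D z (c *s v) = c * D z v"
	shows "holomorphic_Cn f S"
	unfolding holomorphic_Cn_def using assms by blast

lemma holomorphic_Cn_mult:
	assumes "holomorphic_Cn f S" "holomorphic_Cn g S"
	shows "holomorphic_Cn (%z. f z * g z) S"
	unfolding holomorphic_Cn_def
proof
	fix z assume "z : S"
	then obtain D E where D: "(f has_derivative D) (at z)" "!!c v. D (c *s v) = c * D v"
		and E: "(g has_derivative E) (at z)" "!!c v. E (c *s v) = c * E v"
		using assms unfolding holomorphic_Cn_def by metis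
	have "((%z. f z * g z) has_derivative (%v. f z * E v + D v * g z)) (at z)"
		by (rule has_derivative_mult[OF D(1) E(1)])
	thus "\<exists>D. ((%z. f z * g z) has_derivative D) (at z) \<and> (\<forall>c v. D (c *s v) = c * D v)"
		by (intro exI[of _ "%v. f z * E v + D v * g z"]) (simp add: D(2) E(2) algebra_simps)
qed

lemma holomorphic_Cn_compose_left:
	assumes f: "holomorphic_Cn f S" and g: "g holomorphic_on T" "open T" "f ` S <= T"
	shows "holomorphic_Cn (%z. g (f z)) S"
	unfolding holomorphic_Cn_def
proof
	fix z assume z: "z : S"
	then obtain D where D: "(f has_derivative D) (at z)" "!!c v. D (c *s v) = c * D v"
		using f unfolding holomorphic_Cn_def by metis
	have "(g has_field_derivative deriv g (f z)) (at (f z))"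
		using holomorphic_derivI[OF g(1,2)] z g(3) by blast
	hence "((%z. g (f z)) has_derivative (%v. deriv g (f z) * D v)) (at z)"
		unfolding has_field_derivative_def by (rule has_derivative_compose[OF D(1)])
	thus "\<exists>D. ((%z. g (f z)) has_derivative D) (at z) \<and> (\<forall>c v. D (c *s v) = c * D v)"
		by (intro exI[of _ "%v. deriv g (f z) * D v"]) (simp add: D(2) algebra_simps)
qed

lemma vec_nth_has_derivative: "((%w. w $ j) has_derivative (%v. v $ j)) F"
	using bounded_linear_imp_has_derivative[OF bounded_linear_vec_nth] .

lemma holomorphic_Cn_rho_ker: "holomorphic_Cn (%w. rho_ker w z) S"
proof (rule holomorphic_CnI)
	fix w :: "'a cvec"
	have sq: "((%w. (w $ j - cnj (z $ j))^2) has_derivative (%v. 2 * (w $ j - cnj (z $ j)) * v $ j)) (at w)" for j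
		unfolding power2_eq_square
		by (rule has_derivative_eq_rhs[OF has_derivative_mult[OF has_derivative_diff[OF vec_nth_has_derivative has_derivative_const] has_derivative_diff[OF vec_nth_has_derivative has_derivative_const]]])
			 (simp add: fun_eq_iff algebra_simps)
	show "((%w. rho_ker w z) has_derivative
		 (%v. ((\<Sum>j\<in>init_idx. 2 * (w $ j - cnj (z $ j)) * v $ j) - 2 * \<i> * (v $ lx - 0)) / 4)) (at w)"
		unfolding rho_ker_def divide_inverse
		by (intro has_derivative_mult_left has_derivative_diff has_derivative_sum sq has_derivative_mult_right
				vec_nth_has_derivative has_derivative_const)
qed (simp add: sum_distrib_left algebra_simps)

lemma holomorphic_Cn_tube_aut:
	assumes "holomorphic_Cn g tube" "p : tube"
	shows "holomorphic_Cn (%w. g (tube_aut p w)) tube"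
	unfolding holomorphic_Cn_def
proof
	fix w :: "'a cvec" assume "w : tube"
	then obtain D where D: "(g has_derivative D) (at (tube_aut p w))" "!!c v. D (c *s v) = c * D v"
		using assms unfolding holomorphic_Cn_def by (metis tube_aut_in_tube)
	have "(tube_aut p has_derivative tube_aut_lin p) (at w)"
		unfolding tube_aut_def[abs_def]
		using has_derivative_add[OF bounded_linear_imp_has_derivative[OF bounded_linear_tube_aut_lin] has_derivative_const] by simp
	hence "((%w. g (tube_aut p w)) has_derivative (%v. D (tube_aut_lin p v))) (at w)"
		using has_derivative_compose[of "tube_aut p" _ w UNIV g D] D(1) by blast
	thus "\<exists>D. ((%w. g (tube_aut p w)) has_derivative D) (at w) \<and> (\<forall>c v. D (c *s v) = c * D v)"
		by (intro exI[of _ "%v. D (tube_aut_lin p v)"]) (simp add: D(2) tube_aut_lin_scale)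
qed

text \<open>The change of variables as an identity of measures, so that it serves Bochner integrals
  as well.\<close>

lemma W_tube_aut_density:
	assumes p: "p : tube"
	shows "(W s :: 'n::{finite,linorder} cvec measure)
		= density (distr (W s) borel (tube_aut p)) (%_. ennreal (rho p powr (real CARD('n) + 1 + s)))"
proof (rule measure_eqI)
	fix A :: "'n cvec set" assume "A : sets (W s)"
	hence A[measurable]: "A : sets borel" by simp
	have tm: "tube_aut p : W s \<rightarrow>\<^sub>M borel" by (simp add: borel_measurable_W)
	have "emeasure (W s) A = (NI (W s) (%u. indicator A u))" by simp
	also have "... = ennreal (rho p powr (real CARD('n) + 1 + s)) * (NI (W s) (%u. indicator A (tube_aut p u)))"
		by (rule nn_integral_W_tube_aut[OF p]) measurable
	also have "(NI (W s) (%u. indicator A (tube_aut p u))) = (NI (distr (W s) borel (tube_aut p)) (%u. indicator A u))"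
		by (subst nn_integral_distr[OF tm]) auto
	finally show "emeasure (W s) A = emeasure (density (distr (W s) borel (tube_aut p)) (%_. ennreal (rho p powr (real CARD('n) + 1 + s)))) A"
		by (simp add: emeasure_density nn_integral_cmult)
qed simp

lemma integral_W_tube_aut:
	fixes f :: "'n::{finite,linorder} cvec => complex"
	assumes p: "p : tube" and [measurable]: "f : BM"
	shows "integrable (W s) f \<longleftrightarrow> integrable (W s) (%w. f (tube_aut p w))"
		and "(LINT w|W s. f w) = of_real (rho p powr (real CARD('n) + 1 + s)) * (LINT w|W s. f (tube_aut p w))"
proof -
	let ?c = "rho p powr (real CARD('n) + 1 + s)"
	have c: "?c ~= 0" using p by (simp add: tube_iff)
	have tm: "tube_aut p : (W s :: 'n cvec measure) \<rightarrow>\<^sub>M borel" by (simp add: borel_measurable_W)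
	have "integrable (W s) f \<longleftrightarrow> integrable (distr (W s) borel (tube_aut p)) (%w. ?c *\<^sub>R f w)"
		by (subst W_tube_aut_density[OF p], subst integrable_density) auto
	also have "... \<longleftrightarrow> integrable (W s) (%w. ?c *\<^sub>R f (tube_aut p w))"
		by (rule integrable_distr_eq[OF tm]) measurable
	also have "... \<longleftrightarrow> integrable (W s) (%w. f (tube_aut p w))"
	proof
		assume "integrable (W s) (%w. ?c *\<^sub>R f (tube_aut p w))"
		hence "integrable (W s) (%w. (1 / ?c) *\<^sub>R (?c *\<^sub>R f (tube_aut p w)))" by (rule integrable_scaleR_right)
		thus "integrable (W s) (%w. f (tube_aut p w))" using c by simp
	qed (rule integrable_scaleR_right)
	finally show "integrable (W s) f \<longleftrightarrow> integrable (W s) (%w. f (tube_aut p w))" .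
	have "(LINT w|W s. f w) = (LINT w|distr (W s) borel (tube_aut p). ?c *\<^sub>R f w)"
		by (subst W_tube_aut_density[OF p], subst integral_density) auto
	also have "... = (LINT w|W s. ?c *\<^sub>R f (tube_aut p w))"
		by (rule integral_distr[OF tm]) measurable
	finally show "(LINT w|W s. f w) = of_real ?c * (LINT w|W s. f (tube_aut p w))"
		by (simp add: scaleR_conv_of_real)
qed

definition berg_const :: "real => nat => real" where
	"berg_const al n = Gamma (real n + 1 + al) / (2 ^ (n + 1) * pi ^ n * Gamma (al + 1))"

text \<open>Decay is supplied by the factors \<open>d m\<close>, which are holomorphic and bounded
  by 1 on the tube and tend to 1 pointwise; dominated convergence removes them again.\<close>

lemma reproducing_base:
	fixes g :: "'n::{finite,linorder} cvec => complex"
	assumes al: "al > -1" and hol: "holomorphic_Cn g tube" and gm[measurable]: "g : BM"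
		and bd: "!!w. w : tube ==> cmod (g w) <= M"
		and int: "integrable (W al) (%w. g w * rpowr (rho_ker bpt w) (- (real CARD('n) + 1 + al)))"
	shows "of_real (berg_const al CARD('n)) *
		 (LINT w|W al. g w * rpowr (rho_ker bpt w) (- (real CARD('n) + 1 + al))) = g bpt"
proof -
	let ?r = "%w. rpowr (rho_ker bpt w) (- (real CARD('n) + 1 + al))"
	define de where "de = (%m::nat. 1 / (real m + 1))"
	define d where "d = (%m (w::'n cvec). (1 / (1 + of_real (de m) * rho_ker w bpt))^2)"
	have M: "M >= 0" using order.trans[OF norm_ge_zero bd[OF bpt_in_tube]] .
	have de: "0 < de m" "de m <= 1" for m by (auto simp: de_def)
	have Re1: "1 <= Re (1 + of_real (de m) * rho_ker w bpt)" if "w : tube" for m w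
		using de[of m] Re_rho_ker_pos[OF that bpt_in_tube] by simp
	have n1: "1 <= cmod (1 + of_real (de m) * rho_ker w bpt)" if "w : tube" for m w
		using Re1[OF that, of m] complex_Re_le_cmod order.trans by blast
	have dle1: "cmod (d m w) <= 1" if "w : tube" for m w
		unfolding d_def norm_power norm_divide using n1[OF that, of m] by (intro power_le_one) (auto simp: divide_simps)
	have dbd: "cmod (d m w) <= (1 / (de m)^2) / (1 + (cmod (rho_ker w bpt))^2)" if w: "w : tube" for m w
	proof -
		define x where "x = rho_ker w bpt"
		have x: "Re x > 0" unfolding x_def by (rule Re_rho_ker_pos[OF w bpt_in_tube])
		have "(de m)^2 * (1 + (cmod x)^2) <= 1 + (de m)^2 * (cmod x)^2"
			using de[of m] power_le_one[of "de m" 2] by (simp add: algebra_simps)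
		also have "... <= (cmod (1 + of_real (de m) * x))^2"
			using de[of m] x unfolding cmod_power2 by (simp add: power2_eq_square algebra_simps)
		finally have le: "(de m)^2 * (1 + (cmod x)^2) <= (cmod (1 + of_real (de m) * x))^2" .
		have "cmod (d m w) = 1 / (cmod (1 + of_real (de m) * x))^2"
			by (simp add: d_def x_def norm_divide norm_power power_divide)
		also have "... <= 1 / ((de m)^2 * (1 + (cmod x)^2))"
			using le de[of m] n1[OF w, of m] by (intro divide_left_mono mult_pos_pos) (auto simp: x_def add_pos_nonneg)
		finally show ?thesis by (simp add: x_def)
	qed
	have [measurable]: "d m : BM" for m unfolding d_def by measurable
	have dhol: "holomorphic_Cn (d m) tube" for m
		unfolding d_def
	proof (rule holomorphic_Cn_compose_left[OF holomorphic_Cn_rho_ker, of _ "{x. 0 < Re x}"])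
		show "(%x. (1 / (1 + complex_of_real (de m) * x))^2) holomorphic_on {x. 0 < Re x}"
		proof (intro holomorphic_intros)
			fix x assume "x : {x. 0 < Re x}"
			hence "Re (1 + complex_of_real (de m) * x) > 0" using de[of m] by (simp add: add_pos_nonneg)
			thus "1 + complex_of_real (de m) * x ~= 0" by (metis less_irrefl zero_complex.simps(1))
		qed
	qed (auto simp: open_halfspace_Re_gt Re_rho_ker_pos)
	have rep: "of_real (berg_const al CARD('n)) * (LINT w|W al. g w * d m w * ?r w) = g bpt * d m bpt" for m
		unfolding berg_const_def
	proof (rule reproducing_base_decay[OF al])
		show "holomorphic_Cn (%w. g w * d m w) tube" by (rule holomorphic_Cn_mult[OF hol dhol])
		fix w :: "'n cvec" assume w: "w : tube"
		have "cmod (g w * d m w) <= M * ((1 / (de m)^2) / (1 + (cmod (rho_ker w bpt))^2))"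
			unfolding norm_mult using bd[OF w] dbd[OF w] M by (intro mult_mono) auto
		thus "cmod (g w * d m w) <= (M / (de m)^2) / (1 + (cmod (rho_ker w bpt))^2)" by simp
	qed measurable
	have dlim: "(%m. d m w) \<longlonglongrightarrow> 1" for w
	proof -
		have "de \<longlonglongrightarrow> 0" unfolding de_def by real_asymp
		hence "(%m. (1 / (1 + of_real (de m) * rho_ker w bpt))^2) \<longlonglongrightarrow> (1 / (1 + of_real 0 * rho_ker w bpt))\<^sup>2"
			by (intro tendsto_intros) auto
		thus ?thesis by (simp add: d_def)
	qed
	have "(%m. (LINT w|W al. g w * d m w * ?r w)) \<longlonglongrightarrow> (LINT w|W al. g w * ?r w)"
	proof (rule integral_dominated_convergence[where w="%w. norm (g w * ?r w)"])
		show "AE w in W al. (%m. g w * d m w * ?r w) \<longlonglongrightarrow> g w * ?r w"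
		proof (rule AE_I2)
			fix w
			have "(%m. g w * d m w * ?r w) \<longlonglongrightarrow> g w * 1 * ?r w" by (intro tendsto_intros dlim)
			thus "(%m. g w * d m w * ?r w) \<longlonglongrightarrow> g w * ?r w" by simp
		qed
		show "AE w in W al. norm (g w * d m w * ?r w) <= norm (g w * ?r w)" for m
			using AE_W_tube[of al]
		proof eventually_elim
			case (elim w)
			have "norm (g w * ?r w) * cmod (d m w) <= norm (g w * ?r w) * 1" by (intro mult_left_mono dle1 elim) auto
			thus ?case by (simp add: norm_mult mult_ac)
		qed
	qed (use int in \<open>simp_all add: borel_measurable_W\<close>)
	hence "(%m. g bpt * d m bpt) \<longlonglongrightarrow> of_real (berg_const al CARD('n)) * (LINT w|W al. g w * ?r w)"
		unfolding rep[symmetric] by (intro tendsto_intros)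
	moreover have "(%m. g bpt * d m bpt) \<longlonglongrightarrow> g bpt * 1" by (intro tendsto_intros dlim)
	ultimately show ?thesis using LIMSEQ_unique by fastforce
qed

lemma rpowr_of_real_mult:
	assumes "t > 0"
	shows "rpowr (of_real t * z) c = of_real (t powr c) * rpowr z c"
proof (cases "Re z > 0")
	case True
	have "(of_real t * z) powr of_real c = of_real t powr of_real c * z powr of_real c"
		using assms by (intro powr_times_real_left) auto
	thus ?thesis using True assms by (simp add: rpowr_def powr_of_real)
qed (use assms in \<open>simp add: rpowr_def zero_less_mult_iff\<close>)

text \<open>Transport from \<open>bpt\<close> to \<open>z\<close>: the kernel contributes
  \<open>rho z powr (- N)\<close> and the measure \<open>rho z powr N\<close>, which cancel.\<close>

lemma reproducing:
	fixes g :: "'n::{finite,linorder} cvec => complex"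
	assumes al: "al > -1" and hol: "holomorphic_Cn g tube" and gm[measurable]: "g : BM"
		and bd: "!!w. w : tube ==> cmod (g w) <= M" and z: "z : tube"
		and int: "integrable (W al) (%w. g w * rpowr (rho_ker z w) (- (real CARD('n) + 1 + al)))"
	shows "of_real (berg_const al CARD('n)) *
		 (LINT w|W al. g w * rpowr (rho_ker z w) (- (real CARD('n) + 1 + al))) = g z"
proof -
	define N where "N = real CARD('n) + 1 + al"
	have r: "rho z > 0" using z by (simp add: tube_iff)
	let ?f = "%w. g w * rpowr (rho_ker z w) (- N)"
	let ?G = "%w. g (tube_aut z w)"
	have eq: "?f (tube_aut z w) = of_real (rho z powr (- N)) * (?G w * rpowr (rho_ker bpt w) (- N))" for w
		using rho_ker_tube_aut[OF z, of bpt w] z r by (simp add: rpowr_of_real_mult)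
	have "integrable (W al) (%w. ?f (tube_aut z w))"
		using int unfolding N_def by (subst (asm) integral_W_tube_aut(1)[OF z]) auto
	hence "integrable (W al) (%w. of_real (rho z powr N) * (of_real (rho z powr (- N)) * (?G w * rpowr (rho_ker bpt w) (- N))))"
		unfolding eq by (rule integrable_mult_right)
	moreover have c: "complex_of_real (rho z powr N) * (of_real (rho z powr (- N)) * x) = x" for x
		using r by (simp add: mult.assoc[symmetric] powr_minus flip: of_real_mult)
	ultimately have int': "integrable (W al) (%w. ?G w * rpowr (rho_ker bpt w) (- N))" by simp
	have "(LINT w|W al. ?f w) = of_real (rho z powr N) * (LINT w|W al. ?f (tube_aut z w))"
		unfolding N_def by (rule integral_W_tube_aut(2)[OF z]) measurable
	also have "... = (LINT w|W al. ?G w * rpowr (rho_ker bpt w) (- N))"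
		unfolding eq integral_mult_right_zero c ..
	finally show ?thesis
		using reproducing_base[OF al holomorphic_Cn_tube_aut[OF hol z] _ _ int'[unfolded N_def], of M] bd z
		by (simp add: N_def)
qed

subsection \<open>Mean value estimates\<close>

text \<open>A local bound for the integrand itself suffices: Cauchy's inequality on discs of radius
  \<open>r\<close> turns it into the bound \<open>G x / r\<close> for difference quotients.\<close>

lemma holomorphic_on_integral:
	fixes k :: "complex => 'b => complex"
	assumes T: "open T" and hol: "!!x. (%s. k s x) holomorphic_on T"
		and meas: "!!s. s : T ==> k s : borel_measurable M"
		and dom: "!!s0. s0 : T ==> \<exists>r>0. \<exists>G. integrable M G \<and> (\<forall>s\<in>ball s0 r. \<forall>x. cmod (k s x) <= G x)"
	shows "(%s. (LINT x|M. k s x)) holomorphic_on T"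
	unfolding holomorphic_on_open[OF T]
proof
	fix s0 assume s0: "s0 : T"
	obtain r1 G where r1: "r1 > 0" "integrable M G" "!!s x. s : ball s0 r1 ==> cmod (k s x) <= G x"
		using dom[OF s0] by blast
	obtain r2 where r2: "r2 > 0" "cball s0 r2 <= T" using T s0 open_contains_cball by blast
	define r where "r = min (r1 / 2) r2 / 2"
	have r: "r > 0" "2 * r < r1" "2 * r <= r2" using r1 r2 by (auto simp: r_def)
	have sub: "ball s0 (2 * r) <= T" "ball s0 (2 * r) <= ball s0 r1"
		using r r2 by (auto simp: subset_iff)
	have int: "integrable M (k s)" if "s : ball s0 (2 * r)" for s
		by (rule Bochner_Integration.integrable_bound[OF r1(2)])
			 (use that sub meas in \<open>auto intro!: AE_I2 order.trans[OF r1(3) abs_ge_self]\<close>)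
	have lip: "cmod (k s x - k s0 x) <= G x / r * cmod (s - s0)" if "s : ball s0 r" for s x
	proof (rule field_differentiable_bound[of "ball s0 r" "%s. k s x" "%s. deriv (%s. k s x) s"])
		fix u assume u: "u : ball s0 r"
		have uT: "u : T" using u sub r by auto
		show "((%s. k s x) has_field_derivative deriv (%s. k s x) u) (at u within ball s0 r)"
			using holomorphic_derivI[OF hol T uT] has_field_derivative_at_within by blast
		have bu: "cball u r <= ball s0 (2 * r)"
		proof
			fix y assume "y : cball u r"
			thus "y : ball s0 (2 * r)" using u dist_triangle[of s0 y u] by (simp add: dist_commute)
		qed
		have "cmod ((deriv ^^ 1) (%s. k s x) u) <= fact 1 * G x / r ^ 1"
		proof (rule Cauchy_inequality)
			show "(%s. k s x) holomorphic_on ball u r" using hol bu sub ball_subset_cball holomorphic_on_subset by (metis subset_trans)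
			show "continuous_on (cball u r) (%s. k s x)"
				using holomorphic_on_imp_continuous_on[OF hol] bu sub continuous_on_subset by (metis subset_trans)
			show "0 < r" by (rule r(1))
			fix y assume "cmod (u - y) = r"
			hence "y : cball u r" by (simp add: dist_norm)
			thus "cmod (k y x) <= G x" using bu sub r1(3) by blast
		qed
		thus "cmod (deriv (%s. k s x) u) <= G x / r" by simp
	qed (use that r in auto)
	define D where "D = (LINT x|M. deriv (%s. k s x) s0)"
	have "((%s. ((LINT x|M. k s x) - (LINT x|M. k s0 x)) / (s - s0)) \<longlongrightarrow> D) (at s0)"
		unfolding tendsto_at_iff_sequentially
	proof (intro allI impI)
		fix X :: "nat => complex" assume X: "\<forall>i. X i : UNIV - {s0}" "X \<longlonglongrightarrow> s0"
		\<comment> \<open>Dominated convergence asks for the bound at every index; the finitely many terms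
		  outside the ball are replaced by a fixed point of it other than \<open>s0\<close>.\<close>
		define X' where "X' = (%i. if X i : ball s0 r then X i else s0 + of_real (r / 2))"
		have X'b: "X' i : ball s0 r" for i using r by (auto simp: X'_def dist_norm)
		have X'n: "X' i ~= s0" for i using X r by (auto simp: X'_def)
		have ev: "\<forall>\<^sub>F i in sequentially. X' i = X i"
			using topological_tendstoD[OF X(2), of "ball s0 r"] r by (auto simp: X'_def elim: eventually_mono)
		have X'lim: "X' \<longlonglongrightarrow> s0" using X(2) ev tendsto_cong[of X' X sequentially s0] by simp
		have dq: "(%i. (k (X' i) x - k s0 x) / (X' i - s0)) \<longlonglongrightarrow> deriv (%s. k s x) s0" for x
		proof -
			have "((%s. (k s x - k s0 x) / (s - s0)) \<longlongrightarrow> deriv (%s. k s x) s0) (at s0)"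
				using holomorphic_derivI[OF hol T s0] by (simp add: has_field_derivative_iff)
			thus ?thesis using X'n X'lim unfolding tendsto_at_iff_sequentially by (auto simp: o_def)
		qed
		have X'2: "X' i : ball s0 (2 * r)" for i using X'b[of i] r by auto
		have s02: "s0 : ball s0 (2 * r)" using r by simp
		have mq: "(%x. (k (X' i) x - k s0 x) / (X' i - s0)) : borel_measurable M" for i
			using int[OF X'2[of i]] int[OF s02] by (intro borel_measurable_divide borel_measurable_diff) auto
		have "(%i. (LINT x|M. (k (X' i) x - k s0 x) / (X' i - s0))) \<longlonglongrightarrow> D"
			unfolding D_def
		proof (rule integral_dominated_convergence[where w="%x. G x / r"])
			show "(%x. deriv (%s. k s x) s0) : borel_measurable M"
				by (rule borel_measurable_LIMSEQ_metric[OF mq dq])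
			show "AE x in M. norm ((k (X' i) x - k s0 x) / (X' i - s0)) <= G x / r" for i
				using lip[OF X'b[of i]] X'n[of i] by (intro AE_I2) (simp add: norm_divide pos_divide_le_eq)
		qed (use r1(2) mq dq in auto)
		moreover have "(LINT x|M. (k (X' i) x - k s0 x) / (X' i - s0)) = ((LINT x|M. k (X' i) x) - (LINT x|M. k s0 x)) / (X' i - s0)" for i
			using int[OF X'2[of i]] int[OF s02] by simp
		ultimately have "(%i. ((LINT x|M. k (X' i) x) - (LINT x|M. k s0 x)) / (X' i - s0)) \<longlonglongrightarrow> D" by (simp only:)
		moreover have "\<forall>\<^sub>F i in sequentially. ((LINT x|M. k (X' i) x) - (LINT x|M. k s0 x)) / (X' i - s0)
				= ((%s. ((LINT x|M. k s x) - (LINT x|M. k s0 x)) / (s - s0)) \<circ> X) i"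
			using ev by eventually_elim simp
		ultimately show "((%s. ((LINT x|M. k s x) - (LINT x|M. k s0 x)) / (s - s0)) \<circ> X) \<longlonglongrightarrow> D"
			by (rule Lim_transform_eventually)
	qed
	thus "\<exists>f'. ((%s. (LINT x|M. k s x)) has_field_derivative f') (at s0)"
		unfolding has_field_derivative_iff by blast
qed

text \<open>The mean value arguments use only restrictions to complex lines. For \<open>Pk\<close>
  this weaker notion follows by differentiating the integral in a single variable.\<close>

definition line_hol :: "('n::finite cvec => complex) => 'n cvec set => bool" where
	"line_hol h S \<longleftrightarrow> (\<forall>a v. (%s. h (a + s *s v)) holomorphic_on {s. a + s *s v : S})"

lemma continuous_line: "continuous_on UNIV (%s::complex. a + s *s (v :: 'n::finite cvec))"
proof -
	have "continuous_on UNIV (%s::complex. (\<chi> j. a $ j + s * v $ j))"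
		by (intro continuous_on_vec_lambda continuous_intros)
	thus ?thesis by (rule continuous_on_eq) (simp add: vec_eq_iff)
qed

lemma open_line: "open S ==> open {s::complex. a + s *s (v :: 'n::finite cvec) : S}"
	using open_vimage[OF _ continuous_line] by (simp add: vimage_def)

lemma holomorphic_Cn_imp_line_hol:
	assumes "holomorphic_Cn h S" "open S"
	shows "line_hol h S"
	unfolding line_hol_def
proof (intro allI)
	fix a v :: "'a cvec"
	show "(%s. h (a + s *s v)) holomorphic_on {s. a + s *s v : S}"
		by (rule holomorphic_Cn_compose[OF assms(1) _ open_line[OF assms(2)]]) (auto intro!: holomorphic_intros)
qed

lemma norm_scale_cvec: "norm (c *s (v :: 'n::finite cvec)) = cmod c * norm v"
	unfolding norm_vec_def by (simp add: norm_mult L2_set_right_distrib)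

text \<open>Average the mean value property over circles through \<open>a + v\<close>, for all \<open>v\<close> in the ball.\<close>

lemma pluriharmonic_submean:
	fixes h1 h2 :: "'n::finite cvec => complex"
	assumes h: "line_hol h1 S" "line_hol h2 S"
		and [measurable]: "h1 : BM" "h2 : BM"
		and B: "ball a d <= S"
	shows "ennreal (cmod (h1 a - cnj (h2 a))) * emeasure lborel (ball (0::'n cvec) d)
		<= (NI lborel (%v. indicator (ball 0 d) v * ennreal (cmod (h1 (a + v) - cnj (h2 (a + v))))))"
proof -
	define ps where "ps = (%w. h1 w - cnj (h2 w))"
	have [measurable]: "ps : BM" unfolding ps_def by measurable
	have circ: "ennreal (2 * pi) * ennreal (cmod (ps a)) <= (NI lborel (%t. indicator {0..2*pi} t * ennreal (cmod (ps (a + cis t *s v)))))"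
		if v: "v : ball 0 d" for v
	proof -
		have cb: "cball 0 1 <= {s. a + s *s v : S}"
		proof
			fix s :: complex assume "s : cball 0 1"
			hence "cmod s * norm v <= 1 * norm v" by (intro mult_right_mono) auto
			hence "a + s *s v : ball a d" using v by (simp add: dist_norm norm_scale_cvec)
			thus "s : {s. a + s *s v : S}" using B by blast
		qed
		have m: "integrable lborel (%t. indicator {0..2*pi} t *\<^sub>R h (a + cis t *s v))"
				"(LINT t|lborel. indicator {0..2*pi} t *\<^sub>R h (a + cis t *s v)) = 2 * of_real pi * h a"
			if "line_hol h S" for h
			using circle_mean_value[of "%s. h (a + s *s v)", OF _ cb] that by (auto simp: line_hol_def)
		have c: "indicator {0..2*pi} t *\<^sub>R cnj (h2 (a + cis t *s v)) = cnj (indicator {0..2*pi} t *\<^sub>R h2 (a + cis t *s v))" for t :: real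
			by simp
		have i2: "integrable lborel (%t. indicator {0..2*pi} t *\<^sub>R cnj (h2 (a + cis t *s v)))"
			unfolding c by (rule integrable_cnj[OF m(1)[OF h(2)]])
		have "(LINT t|lborel. indicator {0..2*pi} t *\<^sub>R ps (a + cis t *s v))
			= (LINT t|lborel. indicator {0..2*pi} t *\<^sub>R h1 (a + cis t *s v)) - (LINT t|lborel. indicator {0..2*pi} t *\<^sub>R cnj (h2 (a + cis t *s v)))"
			unfolding ps_def scaleR_diff_right by (rule Bochner_Integration.integral_diff[OF m(1)[OF h(1)] i2])
		also have "(LINT t|lborel. indicator {0..2*pi} t *\<^sub>R cnj (h2 (a + cis t *s v))) = cnj (LINT t|lborel. indicator {0..2*pi} t *\<^sub>R h2 (a + cis t *s v))"
			unfolding c by (rule integral_bounded_linear[OF bounded_linear_cnj m(1)[OF h(2)]])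
		also have "(LINT t|lborel. indicator {0..2*pi} t *\<^sub>R h1 (a + cis t *s v)) - cnj (LINT t|lborel. indicator {0..2*pi} t *\<^sub>R h2 (a + cis t *s v))
				= 2 * of_real pi * ps a"
			unfolding m(2)[OF h(1)] m(2)[OF h(2)] by (simp add: ps_def algebra_simps)
		finally have e: "(LINT t|lborel. indicator {0..2*pi} t *\<^sub>R ps (a + cis t *s v)) = 2 * of_real pi * ps a" .
		have "integrable lborel (%t. indicator {0..2*pi} t *\<^sub>R ps (a + cis t *s v))"
			unfolding ps_def scaleR_diff_right by (intro Bochner_Integration.integrable_diff m(1)[OF h(1)] i2)
		from integral_norm_bound_ennreal[OF this]
		have "ennreal (norm (2 * of_real pi * ps a)) <= (NI lborel (%t. ennreal (norm (indicator {0..2*pi} t *\<^sub>R ps (a + cis t *s v)))))"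
			unfolding e .
		also have "... = (NI lborel (%t. indicator {0..2*pi} t * ennreal (cmod (ps (a + cis t *s v)))))"
			by (intro nn_integral_cong) (auto simp: indicator_def)
		finally show ?thesis by (simp add: norm_mult ennreal_mult[symmetric])
	qed
	have rotc: "continuous_on UNIV (%p::'n cvec \<times> real. a + cis (snd p) *s fst p)"
	proof -
		have "continuous_on UNIV (%p::'n cvec \<times> real. (\<chi> j. a $ j + cis (snd p) * fst p $ j))"
			by (intro continuous_on_vec_lambda continuous_intros continuous_on_component continuous_on_fst continuous_on_snd)
		thus ?thesis by (rule continuous_on_eq) (simp add: vec_eq_iff)
	qed
	have rotm: "(%p::'n cvec \<times> real. a + cis (snd p) *s fst p) : borel_measurable (lborel \<Otimes>\<^sub>M lborel)"
		unfolding lborel_prod using borel_measurable_continuous_onI[OF rotc] by simp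
	have psrm: "(%p. ps (a + cis (snd p) *s fst p)) : borel_measurable (lborel \<Otimes>\<^sub>M lborel)"
		by (rule measurable_compose[OF rotm]) measurable
	have bmi: "(indicator (ball 0 d) :: 'n cvec => ennreal) : BM"
		by (intro borel_measurable_indicator) simp
	have "ennreal (2 * pi) * (ennreal (cmod (ps a)) * emeasure lborel (ball (0::'n cvec) d))
		 = (NI (lborel::'n cvec measure) (%v. indicator (ball 0 d) v * (ennreal (2 * pi) * ennreal (cmod (ps a)))))"
		by (subst nn_integral_multc) (auto simp: mult_ac bmi)
	also have "... <= (NI lborel (%v. (NI lborel (%t. indicator (ball 0 d) v * (indicator {0..2*pi} t * ennreal (cmod (ps (a + cis t *s v))))))))"
	proof (rule nn_integral_mono)
		fix v :: "'n cvec"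
		show "indicator (ball 0 d) v * (ennreal (2 * pi) * ennreal (cmod (ps a)))
			 <= (NI lborel (%t. indicator (ball 0 d) v * (indicator {0..2*pi} t * ennreal (cmod (ps (a + cis t *s v))))))"
			using circ[of v] by (cases "v : ball 0 d") auto
	qed
	also have "... = (NI lborel (%t. (NI lborel (%v. indicator (ball 0 d) v * (indicator {0..2*pi} t * ennreal (cmod (ps (a + cis t *s v))))))))"
	proof (rule lborel_pair.Fubini'[symmetric])
		have f: "fst : (lborel \<Otimes>\<^sub>M lborel) \<rightarrow>\<^sub>M (borel :: 'n cvec measure)" and g: "snd : ((lborel :: 'n cvec measure) \<Otimes>\<^sub>M lborel) \<rightarrow>\<^sub>M (borel :: real measure)"
			by measurable
		have i: "(indicator {0..2*pi} :: real => ennreal) : BM" by (intro borel_measurable_indicator) simp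
		show "(%(v, t). indicator (ball 0 d) v * (indicator {0..2*pi} t * ennreal (cmod (ps (a + cis t *s v)))))
			 : borel_measurable (lborel \<Otimes>\<^sub>M lborel)"
			unfolding split_def
			by (intro borel_measurable_times_ennreal measurable_compose[OF f bmi] measurable_compose[OF g i] measurable_compose[OF psrm, of "%x. ennreal (cmod x)"]) measurable
	qed
	also have "... = (NI lborel (%t. indicator {0..2*pi} t * (NI lborel (%v. indicator (ball 0 d) v * ennreal (cmod (ps (a + v)))))))"
	proof (rule nn_integral_cong)
		fix t :: real
		have lin: "linear (%v::'n cvec. cis t *s v)" by (rule linearI) (auto simp: vec_eq_iff algebra_simps)
		have nrm: "norm (cis t *s v) = norm v" for v :: "'n cvec" by (simp add: norm_scale_cvec)
		have Qm: "(%v. indicator (ball 0 d) v * ennreal (cmod (ps (a + v)))) : BM"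
			by (intro borel_measurable_times_ennreal bmi) measurable
		have rm: "(%v::'n cvec. cis t *s v) : BM"
			by (intro borel_measurable_continuous_onI linear_continuous_on) (use lin in \<open>simp add: linear_conv_bounded_linear\<close>)
		have "(NI (lborel::'n cvec measure) (%v. indicator (ball 0 d) v * (indicator {0..2*pi} t * ennreal (cmod (ps (a + cis t *s v))))))
			 = (NI (lborel::'n cvec measure) (%v. indicator {0..2*pi} t * (indicator (ball 0 d) (cis t *s v) * ennreal (cmod (ps (a + cis t *s v))))))"
			by (intro nn_integral_cong) (auto simp: indicator_def nrm)
		also have "... = indicator {0..2*pi} t * (NI (lborel::'n cvec measure) (%v. indicator (ball 0 d) (cis t *s v) * ennreal (cmod (ps (a + cis t *s v)))))"
			by (rule nn_integral_cmult) (use measurable_compose[OF rm Qm] in simp)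
		also have "(NI (lborel::'n cvec measure) (%v. indicator (ball 0 d) (cis t *s v) * ennreal (cmod (ps (a + cis t *s v)))))
			 = (NI (lborel::'n cvec measure) (%v. indicator (ball 0 d) v * ennreal (cmod (ps (a + v)))))"
			by (rule nn_integral_lborel_isometry[OF lin nrm Qm])
		finally show "(NI (lborel::'n cvec measure) (%v. indicator (ball 0 d) v * (indicator {0..2*pi} t * ennreal (cmod (ps (a + cis t *s v))))))
			 = indicator {0..2*pi} t * (NI lborel (%v. indicator (ball 0 d) v * ennreal (cmod (ps (a + v)))))" .
	qed
	also have "... = ennreal (2 * pi) * (NI (lborel::'n cvec measure) (%v. indicator (ball 0 d) v * ennreal (cmod (ps (a + v)))))"
		by (subst nn_integral_multc) auto
	finally show ?thesis
		by (subst (asm) ennreal_mult_le_mult_iff) (auto simp: ps_def)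
qed

subsection \<open>Metric balls\<close>

definition tball :: "'n::{finite,linorder} cvec => real => 'n cvec set" where
	"tball z r = {w : tube. tdist z w < r}"

lemma cosh_tdist: "z : tube ==> w : tube ==> (cosh (tdist z w))\<^sup>2 = FF z w"
	using FF_ge_1[of z w] by (simp add: tdist_def cosh_arcosh_real)

lemma tball_subset_tube: "tball z r <= tube"
	by (auto simp: tball_def)

lemma tball_in_tube: "w : tball z r ==> w : tube"
	by (simp add: tball_def)

lemma tball_commute: "w : tball z r ==> z : tube ==> z : tball w r"
	by (simp add: tball_def tdist_commute[of w z])

lemma center_in_tball: "z : tube ==> r > 0 ==> z : tball z r"
	by (simp add: tball_def)

lemma tball_radius_pos: "w : tball z r ==> z : tube ==> r > 0"
	using tdist_nonneg[of z w] by (auto simp: tball_def)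

lemma tball_subset:
	assumes "z : tube" "w : tube" "tdist z w + r <= R"
	shows "tball w r <= tball z R"
proof
	fix u assume "u : tball w r"
	thus "u : tball z R" using tdist_triangle[OF assms(1,2), of u] assms(3) by (auto simp: tball_def)
qed

lemma tball_mono: "r <= R ==> tball z r <= tball z R"
	by (auto simp: tball_def)

lemma tball_iff: "z : tube ==> r > 0 ==> w : tball z r \<longleftrightarrow> w : tube \<and> FF z w < (cosh r)^2"
	using tdist_less_iff[of z w r] by (auto simp: tball_def)

lemma tube_aut_in_tball:
	assumes "p : tube"
	shows "tube_aut p w : tball p r \<longleftrightarrow> w : tball bpt r"
	using tdist_tube_aut[OF assms, of bpt w] assms by (simp add: tball_def)

lemma continuous_FF:
	assumes "z : tube"
	shows "continuous_on tube (FF z)"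
	unfolding FF_def using assms by (intro continuous_intros) (auto simp: tube_iff)

lemma open_tball:
	assumes "z : tube"
	shows "open (tball z r)"
proof (cases "r > 0")
	case True
	have "tball z r = FF z -` {..<(cosh r)\<^sup>2} \<inter> tube" using assms True by (auto simp: tball_iff)
	thus ?thesis using continuous_on_open_vimage[THEN iffD1, OF open_tube continuous_FF[OF assms], rule_format, of "{..<(cosh r)\<^sup>2}"] by simp
next
	case False
	hence "tball z r = {}" using tball_radius_pos[OF _ assms] by blast
	thus ?thesis by simp
qed

lemma tball_borel: "z : tube ==> tball z r : sets borel"
	by (simp add: open_tball)

text \<open>Combine \<open>rho z / 2 \<le> |rho_ker z w|\<close> with
  \<open>|rho_ker z w|^2 < cosh^2 r * rho z * rho w\<close>; one factor \<open>rho z\<close>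
  cancels.\<close>

lemma rho_tball_le:
	assumes w: "w : tball z r" and z: "z : tube"
	shows "rho z <= 4 * (cosh r)^2 * rho w"
proof -
	have r: "r > 0" using tball_radius_pos[OF assms] .
	have p: "rho z > 0" "rho w > 0" using z tball_in_tube[OF w] by (auto simp: tube_iff)
	have "(cmod (rho_ker z w))^2 / (rho z * rho w) < (cosh r)^2" using w tball_iff[OF z r] by (simp add: FF_def)
	hence 1: "(cmod (rho_ker z w))^2 < (cosh r)^2 * (rho z * rho w)" using p by (simp add: pos_divide_less_eq)
	have "((rho z + rho w) / 2)^2 <= (cmod (rho_ker z w))^2"
		using p by (intro power_mono cmod_rho_ker_ge) auto
	moreover have "(rho z / 2)^2 <= ((rho z + rho w) / 2)^2" using p by (intro power_mono) auto
	ultimately have "rho z * rho z <= rho z * (4 * (cosh r)^2 * rho w)" using 1 by (simp add: power2_eq_square algebra_simps)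
	thus ?thesis using p by (simp add: mult_le_cancel_left)
qed

text \<open>The triangle inequality for \<open>tdist\<close> and
  \<open>cosh (r + d) \<le> exp r * cosh d\<close> compare the values of \<open>FF\<close>;
  \<open>rho_tball_le\<close> converts this into a comparison of \<open>|rho_ker|\<close>.\<close>

lemma cmod_rho_ker_tball_le:
	assumes z: "z : tball z0 r" and z0: "z0 : tube" and w: "w : tube"
	shows "cmod (rho_ker z0 w) <= 2 * exp r * cosh r * cmod (rho_ker z w)"
proof -
	have r: "r > 0" using tball_radius_pos[OF z z0] .
	have zt: "z : tube" using z tball_subset_tube by auto
	have p: "rho z > 0" "rho w > 0" "rho z0 > 0" using assms zt by (auto simp: tube_iff)
	let ?d = "tdist z w"
	have d0: "?d >= 0" by (rule tdist_nonneg[OF zt w])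
	have "tdist z0 w <= r + ?d" using tdist_triangle[OF z0 zt w] z by (simp add: tball_def)
	hence "cosh (tdist z0 w) <= cosh (r + ?d)" using tdist_nonneg[OF z0 w] r d0 by (simp add: cosh_real_nonneg_le_iff)
	also have "... <= exp r * cosh ?d"
	proof -
		have "exp (- (r + ?d)) <= exp (r - ?d)" using r by simp
		moreover have "exp r * cosh ?d = (exp (r + ?d) + exp (r - ?d)) / 2"
			by (simp add: cosh_field_def exp_add exp_diff exp_minus field_simps)
		ultimately show ?thesis by (simp add: cosh_field_def)
	qed
	finally have "(cosh (tdist z0 w))^2 <= (exp r * cosh ?d)^2" by (intro power_mono) auto
	hence "FF z0 w <= (exp r)^2 * FF z w" by (simp add: power_mult_distrib cosh_tdist[OF z0 w] cosh_tdist[OF zt w])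
	hence "(cmod (rho_ker z0 w))^2 * rho z <= (exp r)^2 * (cmod (rho_ker z w))^2 * rho z0"
		using p by (simp add: FF_def divide_simps mult_ac split: if_splits)
	also have "... <= (exp r)^2 * (cmod (rho_ker z w))^2 * (4 * (cosh r)^2 * rho z)"
		by (intro mult_left_mono rho_tball_le[OF z z0]) auto
	finally have "(cmod (rho_ker z0 w))^2 * rho z <= (2 * exp r * cosh r * cmod (rho_ker z w))^2 * rho z"
		by (simp add: power_mult_distrib mult_ac)
	hence "(cmod (rho_ker z0 w))^2 <= (2 * exp r * cosh r * cmod (rho_ker z w))^2" using p by simp
	thus ?thesis by (rule power2_le_imp_le) simp
qed

lemma cmod_rho_ker_tball_le_rho:
	assumes w: "w : tball z r" and z: "z : tube"
	shows "cmod (rho_ker z w) <= 2 * (cosh r)^2 * rho z"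
proof -
	have r: "r > 0" using tball_radius_pos[OF assms] .
	have p: "rho z > 0" "rho w > 0" using z tball_in_tube[OF w] by (auto simp: tube_iff)
	have "(cmod (rho_ker z w))^2 / (rho z * rho w) < (cosh r)^2" using w tball_iff[OF z r] by (simp add: FF_def)
	hence "(cmod (rho_ker z w))^2 <= (cosh r)^2 * (rho z * rho w)" using p by (simp add: pos_divide_less_eq)
	also have "... <= (cosh r)^2 * (rho z * (4 * (cosh r)^2 * rho z))"
		using rho_tball_le[OF tball_commute[OF w z]] w tball_subset_tube p by (intro mult_left_mono) auto
	also have "... = (2 * (cosh r)^2 * rho z)^2" by (simp add: power2_eq_square)
	finally show ?thesis by (rule power2_le_imp_le) (use p in simp)
qed

text \<open>\<open>|rho_ker|\<close> is bounded on the ball, so its power \<open>- b\<close>,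
  integrable because \<open>b\<close> exceeds the critical exponent by 1, dominates the indicator up
  to a constant.\<close>

lemma emeasure_tball_base_finite:
	assumes s: "s > -1"
	shows "emeasure (W s) (tball (bpt :: 'n::{finite,linorder} cvec) r) < \<infinity>"
proof -
	define b where "b = real CARD('n) + 2 + s"
	define K where "K = (2 * (cosh r)^2) powr b"
	have "emeasure (W s) (tball (bpt :: 'n cvec) r) = (NI (W s :: 'n cvec measure) (%w. indicator (tball bpt r) w))"
		by (simp add: tball_borel)
	also have "... <= (NI (W s :: 'n cvec measure) (%w. ennreal K * ennreal (cmod (rho_ker w bpt) powr (- b))))"
	proof (rule nn_integral_mono)
		fix w :: "'n cvec"
		show "indicator (tball bpt r) w <= ennreal K * ennreal (cmod (rho_ker w bpt) powr (- b))"
		proof (cases "w : tball bpt r")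
			case True
			let ?X = "cmod (rho_ker w bpt)"
			have X: "?X > 0" using True tball_subset_tube by (intro cmod_rho_ker_pos) auto
			have "?X <= 2 * (cosh r)^2" using cmod_rho_ker_tball_le_rho[OF True] by (simp add: cmod_rho_ker_commute[of bpt])
			hence "?X powr b <= K" unfolding K_def using s by (intro powr_mono2) (auto simp: b_def)
			hence "?X powr b * ?X powr (- b) <= K * ?X powr (- b)" by (rule mult_right_mono) simp
			moreover have "?X powr b * ?X powr (- b) = 1" using X by (simp add: powr_minus)
			ultimately show ?thesis using True by (simp add: K_def ennreal_mult[symmetric])
		qed simp
	qed
	also have "... = ennreal K * (NI (W s :: 'n cvec measure) (%w. ennreal (cmod (rho_ker w bpt) powr (- b))))"
		by (rule nn_integral_cmult) (simp add: borel_measurable_W)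
	also have "... < \<infinity>"
		using forelli_rudin_base_finite[OF s, of b, where 'n='n] by (simp add: b_def ennreal_mult_less_top)
	finally show ?thesis .
qed

text \<open>The volume is finite at the base point, positive because the ball contains a Euclidean
  ball, and known elsewhere by invariance.\<close>

lemma emeasure_tball:
	assumes s: "s > -1" and r: "r > 0"
	obtains v where "v > 0" "!!z :: 'n::{finite,linorder} cvec. z : tube ==>
		emeasure (W s) (tball z r) = ennreal (v * rho z powr (real CARD('n) + 1 + s))"
proof -
	let ?T = "tball (bpt :: 'n cvec) r"
	define v where "v = measure (W s) ?T"
	have ve: "emeasure (W s) ?T = ennreal v"
		unfolding v_def using emeasure_tball_base_finite[OF s, of r, where 'n='n] by (intro emeasure_eq_ennreal_measure) auto
	have v0: "v > 0"
	proof (rule ccontr)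
		assume "\<not> v > 0"
		hence "emeasure (W s) ?T = 0" using ve by (simp add: ennreal_neg)
		hence "?T : null_sets (W s)" by (simp add: null_sets_def tball_borel)
		hence "AE w in W s. w \<notin> ?T" by (rule AE_not_in)
		moreover have [measurable]: "?T : sets borel" by (rule tball_borel[OF bpt_in_tube])
		have "Measurable.pred borel (%w. w \<notin> ?T)" by measurable
		ultimately have "AE w in lborel. w : tube --> w \<notin> ?T" using AE_W_iff by blast
		hence ae: "AE w in lborel. w \<notin> ?T" by eventually_elim (use tball_subset_tube in auto)
		obtain d where d: "d > 0" "ball bpt d <= ?T"
			using open_tball[OF bpt_in_tube] center_in_tball[OF bpt_in_tube r] open_contains_ball by blast
		from ae have "AE w in lborel. w \<notin> ball (bpt :: 'n cvec) d" by eventually_elim (use d(2) in blast)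
		hence "emeasure lborel (ball (bpt :: 'n cvec) d) = 0" by (subst (asm) AE_iff_measurable[OF _ refl]) (auto simp: ball_def)
		thus False using content_ball_pos[OF d(1), of "bpt :: 'n cvec"] by (simp add: measure_def)
	qed
	show ?thesis
	proof (rule that[OF v0])
		fix z :: "'n cvec" assume z: "z : tube"
		have [measurable]: "tball z r : sets borel" by (rule tball_borel[OF z])
		have "emeasure (W s) (tball z r) = (NI (W s) (%w. indicator (tball z r) w))" by simp
		also have "... = ennreal (rho z powr (real CARD('n) + 1 + s)) * (NI (W s) (%w. indicator (tball z r) (tube_aut z w)))"
			by (rule nn_integral_W_tube_aut[OF z]) measurable
		also have "(NI (W s) (%w. indicator (tball z r) (tube_aut z w))) = (NI (W s) (%w. indicator ?T w))"
			by (intro nn_integral_cong) (simp add: indicator_def tube_aut_in_tball[OF z])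
		also have "... = ennreal v" by (simp add: tball_borel ve)
		finally show "emeasure (W s) (tball z r) = ennreal (v * rho z powr (real CARD('n) + 1 + s))"
			using v0 by (simp add: ennreal_mult[symmetric] mult.commute)
	qed
qed

lemma ex_ball_subset_tball:
	assumes "r > 0"
	obtains d where "d > 0" "ball (bpt :: 'n::{finite,linorder} cvec) d <= tball bpt r"
	using open_tball[OF bpt_in_tube, of r] center_in_tball[OF bpt_in_tube assms] open_contains_ball by blast

text \<open>With \<open>R = rho_ker w bpt\<close>, the difference \<open>|R|^2 - rho w\<close>
  dominates the sum of \<open>((rho w - 1) / 2)^2\<close>, \<open>S / 4\<close> and
  \<open>(Im R)^2\<close>. When \<open>FF\<close> is close to 1 all three are small, and
  \<open>w\<close> is recovered from \<open>R\<close> and the first coordinates.\<close>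

lemma ex_tball_subset_ball:
	assumes d: "d > 0"
	obtains r where "r > 0" "tball (bpt :: 'n::{finite,linorder} cvec) r <= ball bpt d"
proof -
	\<comment> \<open>The last coordinate will be within \<open>8 * t\<close> of \<open>\<i>\<close>
	  and the others contribute at most \<open>4 * t^2\<close> to the squared distance; 9 works since
	  \<open>64 + 4 < 81\<close>. The minimum with 1 gives \<open>t^2 \<le> t\<close>.\<close>
	define t where "t = min 1 (d / 9)"
	have t: "t > 0" "t <= 1" "9 * t <= d" using d by (auto simp: t_def)
	have "((%r::real. ((cosh r)^2 - 1) * (4 * (cosh r)^2)) \<longlongrightarrow> ((cosh 0)^2 - 1) * (4 * (cosh 0)^2)) (at_right 0)"
		by (intro tendsto_intros)
	hence "\<forall>\<^sub>F r::real in at_right 0. ((cosh r)^2 - 1) * (4 * (cosh r)^2) < t\<^sup>2"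
		using t by (intro order_tendstoD) auto
	hence "\<forall>\<^sub>F r::real in at_right 0. ((cosh r)^2 - 1) * (4 * (cosh r)^2) < t\<^sup>2 \<and> 0 < r"
		by (intro eventually_conj eventually_at_right_less)
	then obtain r where r: "((cosh r)^2 - 1) * (4 * (cosh r)^2) < t\<^sup>2" "(0::real) < r"
		using eventually_happens'[OF trivial_limit_at_right_real] by blast
	show ?thesis
	proof (rule that[OF r(2)], rule subsetI)
		fix w :: "'n cvec" assume w: "w : tball bpt r"
		have wt: "w : tube" using w tball_subset_tube by auto
		define R where "R = rho_ker w bpt"
		define S where "S = (\<Sum>j\<in>init_idx. (cmod (w $ j))^2)"
		define x where "x = rho w"
		have S0: "S >= 0" and x0: "x > 0" using wt by (auto simp: S_def x_def tube_iff intro: sum_nonneg)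
		have Re: "Re R = S / 4 + (x + 1) / 2"
			unfolding R_def Re_rho_ker S_def x_def by (simp add: bpt_nth)
		have c1: "cosh r >= 1" by (rule cosh_real_ge_1)
		have "FF bpt w < (cosh r)^2" using w tball_iff[OF bpt_in_tube r(2)] by blast
		hence "(cmod R)^2 / x < (cosh r)^2"
			by (simp add: FF_def R_def x_def cmod_rho_ker_commute[of bpt])
		hence "(cmod R)^2 < (cosh r)^2 * x" using x0 by (simp add: pos_divide_less_eq)
		hence "(cmod R)^2 - x < ((cosh r)^2 - 1) * x" by (simp add: algebra_simps)
		also have "... <= ((cosh r)^2 - 1) * (4 * (cosh r)^2)"
			using rho_tball_le[OF tball_commute[OF w] wt] c1 one_le_power[OF c1, of 2] by (intro mult_left_mono) (auto simp: x_def)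
		finally have "(Re R)^2 + (Im R)^2 - x < t\<^sup>2" using r(1) by (simp add: cmod_power2)
		moreover have "(Re R)^2 - x = ((x - 1) / 2)^2 + S / 4 + (S * x / 4 + (S / 4)^2)"
			unfolding Re by (simp add: power2_eq_square field_simps)
		moreover have "S * x / 4 + (S / 4)^2 >= 0" using S0 x0 by simp
		ultimately have b: "((x - 1) / 2)^2 + S / 4 + (Im R)^2 < t\<^sup>2" by linarith
		have S4: "S <= 4 * t\<^sup>2" using b zero_le_power2[of "(x - 1) / 2"] zero_le_power2[of "Im R"] by linarith
		have "((x - 1) / 2)^2 <= t\<^sup>2" "(Im R)^2 <= t\<^sup>2"
			using b S0 zero_le_power2[of "(x - 1) / 2"] zero_le_power2[of "Im R"] by linarith+
		hence b2: "\<bar>(x - 1) / 2\<bar> <= t" "\<bar>Im R\<bar> <= t"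
			using abs_le_square_iff[of "(x - 1) / 2" t] abs_le_square_iff[of "Im R" t] t(1) by linarith+
		have tt: "t\<^sup>2 <= t" using t by (simp add: power2_eq_square mult_left_le)
		have "cmod (R - 1) <= \<bar>Re (R - 1)\<bar> + \<bar>Im (R - 1)\<bar>" by (rule cmod_le)
		also have "... <= \<bar>(x - 1) / 2\<bar> + S / 4 + \<bar>Im R\<bar>" unfolding minus_complex.simps Re using S0 by (simp add: abs_if field_simps)
		also have "... <= 3 * t" using b2 S4 tt by linarith
		finally have R1: "cmod (R - 1) <= 3 * t" .
		have "w $ lx - \<i> = 2 * \<i> * (R - 1) - \<i> / 2 * (\<Sum>j\<in>init_idx. (w $ j)^2)"
			unfolding R_def rho_ker_base by (simp add: field_simps)
		hence "cmod (w $ lx - \<i>) <= cmod (2 * \<i> * (R - 1)) + cmod (\<i> / 2 * (\<Sum>j\<in>init_idx. (w $ j)^2))"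
			by (metis norm_triangle_ineq4)
		also have "... = 2 * cmod (R - 1) + cmod (\<Sum>j\<in>init_idx. (w $ j)^2) / 2" by (simp add: norm_mult norm_divide)
		also have "cmod (\<Sum>j\<in>init_idx. (w $ j)^2) <= S"
			unfolding S_def by (rule order.trans[OF norm_sum]) (simp add: norm_power)
		finally have l: "cmod (w $ lx - \<i>) <= 8 * t" using R1 S4 tt by linarith
		have "(norm (w - bpt))^2 = (\<Sum>j\<in>UNIV. (cmod ((w - bpt) $ j))^2)"
			by (simp add: norm_vec_def L2_set_def sum_nonneg)
		also have "... = (cmod (w $ lx - \<i>))^2 + S"
			unfolding S_def by (subst sum.remove[of _ lx]) (auto simp: bpt_nth intro!: sum.cong)
		also have "... <= (8 * t)^2 + 4 * t\<^sup>2" using l S4 by (intro add_mono power_mono) auto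
		also have "... < (9 * t)^2" using t by (simp add: power2_eq_square)
		finally have "norm (w - bpt) < 9 * t" by (rule power2_less_imp_less) (use t in simp)
		thus "w : ball bpt d" using t by (simp add: dist_norm norm_minus_commute)
	qed
qed

text \<open>Each bisection by a midpoint doubles the bound. The local hypothesis concerns only
  points of the large ball about \<open>u\<close>, so the lemma also serves estimates that are
  available near \<open>u\<close> alone.\<close>

lemma tdist_chain:
	fixes f :: "'n::{finite,linorder} cvec => complex"
	assumes "u : tube" "v : tball u (2 ^ k * r)"
		and "!!x y. x : tball u (2 ^ k * r) ==> y : tball x r ==> cmod (f x - f y) <= M"
	shows "cmod (f u - f v) <= 2 ^ k * M"
	using assms
proof (induction k arbitrary: u v)
	case 0
	thus ?case using center_in_tball[of u r] tball_radius_pos[of v u r] by auto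
next
	case (Suc k)
	have v: "v : tube" using Suc.prems tball_subset_tube by blast
	obtain m where m: "m : tube" "tdist u m = tdist u v / 2" "tdist m v <= tdist u v / 2"
		using tdist_midpoint[OF Suc.prems(1) v] by blast
	have d: "tdist u v < 2 * (2 ^ k * r)" using Suc.prems(2) by (simp add: tball_def mult_ac)
	have "2 * (2 ^ k * r) > 0" using d tdist_nonneg[OF Suc.prems(1) v] by linarith
	hence "2 ^ k * r <= 2 ^ Suc k * r" and "tdist u m + 2 ^ k * r <= 2 ^ Suc k * r"
		using d m(2) unfolding power_Suc mult.assoc by linarith+
	hence sub: "tball u (2 ^ k * r) <= tball u (2 ^ Suc k * r)" "tball m (2 ^ k * r) <= tball u (2 ^ Suc k * r)"
		by (auto intro!: tball_mono tball_subset[OF Suc.prems(1) m(1)] simp del: power_Suc)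
	have "cmod (f u - f m) <= 2 ^ k * M"
		by (rule Suc.IH[OF Suc.prems(1)]) (use m d sub Suc.prems(3) in \<open>auto simp: tball_def\<close>)
	moreover have "cmod (f m - f v) <= 2 ^ k * M"
		by (rule Suc.IH[OF m(1)]) (use v m d sub Suc.prems(3) in \<open>auto simp: tball_def\<close>)
	ultimately show ?case using norm_triangle_ineq[of "f u - f m" "f m - f v"] by simp
qed

text \<open>The factor \<open>2^k\<close> lost along a chain from \<open>z\<close> to
  \<open>w\<close> is at most \<open>1 + 2 * d / r\<close>, and the distance \<open>d\<close> is
  bounded by a multiple of any positive power of \<open>cosh^2 d = FF z w\<close>.\<close>

lemma bounded_oscillation_growth:
	fixes f :: "'n::{finite,linorder} cvec => complex"
	assumes r: "r > 0" and M: "!!x y. x : tube ==> y : tball x r ==> cmod (f x - f y) <= M" and e: "ep > 0"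
	obtains C where "C >= 0" "!!z w. z : tube ==> w : tube ==> cmod (f z - f w) <= C * FF z w powr ep"
proof -
	have M0: "M >= 0" using M[OF bpt_in_tube center_in_tball[OF bpt_in_tube r]] by simp
	define B where "B = 4 powr ep / (2 * ep)"
	have B0: "B >= 0" using e by (simp add: B_def)
	show ?thesis
	proof (rule that[of "M * (1 + 2 * B / r)"])
		show "M * (1 + 2 * B / r) >= 0" using M0 B0 r by simp
		fix z w :: "'n cvec" assume z: "z : tube" and w: "w : tube"
		let ?d = "tdist z w"
		have d0: "?d >= 0" by (rule tdist_nonneg[OF z w])
		have F1: "FF z w >= 1" by (rule FF_ge_1[OF z w])
		have "\<exists>k::nat. ?d < 2 ^ k * r"
			using real_arch_pow[of 2 "?d / r"] r by (auto simp: pos_divide_less_eq)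
		moreover define k where "k = (LEAST k::nat. ?d < 2 ^ k * r)"
		ultimately have k: "?d < 2 ^ k * r" "!!j. j < k ==> \<not> ?d < 2 ^ j * r"
			using LeastI_ex[of "%k::nat. ?d < 2 ^ k * r"] not_less_Least[of _ "%k::nat. ?d < 2 ^ k * r"] by blast+
		have k2: "2 ^ k <= 1 + 2 * ?d / r"
		proof (cases k)
			case (Suc j)
			hence "2 ^ j * r <= ?d" using k(2)[of j] by simp
			thus ?thesis using r Suc by (simp add: field_simps)
		qed (use d0 r in simp)
		have "cmod (f z - f w) <= 2 ^ k * M"
			by (rule tdist_chain[OF z, of _ k r]) (use w k tball_subset_tube in \<open>auto simp: tball_def intro!: M\<close>)
		also have "... <= (1 + 2 * ?d / r) * M" using k2 M0 by (rule mult_right_mono)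
		also have "?d <= B * FF z w powr ep"
		proof -
			\<comment> \<open>The constant \<open>B\<close> arises from \<open>x \<le> exp x\<close> at
			  \<open>x = 2 * ep * d\<close> together with \<open>exp d \<le> 2 * cosh d\<close>.\<close>
			have "2 * ep * ?d <= exp (2 * ep * ?d)" using exp_ge_add_one_self[of "2 * ep * ?d"] by linarith
			also have "... = (exp ?d) powr (2 * ep)" by (simp add: powr_def mult_ac)
			also have "... <= (2 * cosh ?d) powr (2 * ep)"
				using e by (intro powr_mono2) (auto simp: cosh_field_def)
			also have "... = ((2 * cosh ?d) powr 2) powr ep" by (simp only: powr_powr)
			also have "(2 * cosh ?d) powr 2 = 4 * FF z w" by (simp add: power_mult_distrib cosh_tdist[OF z w])
			also have "(4 * FF z w) powr ep = 4 powr ep * FF z w powr ep" using F1 by (simp add: powr_mult)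
			finally show ?thesis using e by (simp add: B_def field_simps)
		qed
		finally have "cmod (f z - f w) <= (1 + 2 * (B * FF z w powr ep) / r) * M"
			using r M0 by (simp add: divide_right_mono mult_right_mono)
		also have "1 <= FF z w powr ep" using F1 e by (simp add: ge_one_powr_ge_zero)
		finally show "cmod (f z - f w) <= M * (1 + 2 * B / r) * FF z w powr ep"
			using M0 by (simp add: algebra_simps mult_right_mono)
	qed
qed

subsection \<open>Local estimates for pluriharmonic functions\<close>

text \<open>Takes the place of Hoelder's inequality: the integral of \<open>x\<close> over a set of
  finite measure is bounded through that of \<open>x powr p\<close>, with \<open>t\<close> free to
  balance the two terms.\<close>

lemma le_add_powr:
	fixes x t p :: real
	assumes "x >= 0" "t > 0" "p >= 1"
	shows "x <= t + t powr (1 - p) * x powr p"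
proof (cases "x <= t")
	case True
	have "0 <= t powr (1 - p) * x powr p" by simp
	thus ?thesis using True by linarith
next
	case False
	have "x = x powr (1 - p) * x powr p" using False assms by (simp flip: powr_add)
	also have "... <= t powr (1 - p) * x powr p" using False assms by (intro mult_right_mono powr_mono2') auto
	finally show ?thesis using assms by linarith
qed

lemma line_hol_tube_aut:
	assumes h: "line_hol h tube" and p: "p : tube"
	shows "line_hol (%w. h (tube_aut p w)) tube"
	unfolding line_hol_def
proof (intro allI)
	fix a v :: "'a cvec"
	have eq: "tube_aut p (a + s *s v) = tube_aut p a + s *s tube_aut_lin p v" for s
		by (simp add: tube_aut_add tube_aut_lin_scale)
	have "a + s *s v : tube \<longleftrightarrow> tube_aut p a + s *s tube_aut_lin p v : tube" for s
		by (simp only: eq[symmetric] tube_aut_in_tube[OF p])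
	thus "(%s. h (tube_aut p (a + s *s v))) holomorphic_on {s. a + s *s v : tube}"
		using h unfolding line_hol_def eq by simp
qed

lemma nn_integral_tball_tube_aut:
	fixes F :: "'n::{finite,linorder} cvec => ennreal"
	assumes z: "z : tube" and [measurable]: "F : BM"
	shows "(NI (W s) (%w. indicator (tball z r) w * F w))
		= ennreal (rho z powr (real CARD('n) + 1 + s)) * (NI (W s) (%w. indicator (tball bpt r) w * F (tube_aut z w)))"
proof -
	have [measurable]: "tball z r : sets borel" by (rule tball_borel[OF z])
	have "(NI (W s) (%w. indicator (tball z r) w * F w))
		= ennreal (rho z powr (real CARD('n) + 1 + s)) * (NI (W s) (%w. indicator (tball z r) (tube_aut z w) * F (tube_aut z w)))"
		by (rule nn_integral_W_tube_aut[OF z]) measurable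
	thus ?thesis by (simp add: indicator_def tube_aut_in_tball[OF z])
qed

text \<open>The mean value inequality on a Euclidean ball inside the metric ball, where the weight
  \<open>rho powr s\<close> is at least \<open>1 / K\<close>.\<close>

lemma pluriharmonic_pointwise_base:
	assumes s: "s > -1" and r: "r > 0" and p: "p >= 1"
	obtains C where "C >= 0" "!!h1 h2 I. line_hol h1 tube ==> line_hol h2 tube ==>
		h1 : BM ==> h2 : BM ==> I > 0 ==>
		(NI (W s :: 'n::{finite,linorder} cvec measure) (%w. indicator (tball bpt r) w * ennreal (cmod (h1 w - cnj (h2 w)) powr p))) <= ennreal I ==>
		cmod (h1 bpt - cnj (h2 bpt)) <= C * I powr (1 / p)"
proof -
	let ?e = "bpt :: 'n cvec"
	let ?T = "tball ?e r"
	have [measurable]: "?T : sets borel" by (rule tball_borel[OF bpt_in_tube])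
	obtain d where d: "d > 0" "ball ?e d <= ?T" by (rule ex_ball_subset_tball[OF r])
	obtain v where v: "v > 0" "!!z :: 'n cvec. z : tube ==> emeasure (W s) (tball z r) = ennreal (v * rho z powr (real CARD('n) + 1 + s))"
		using emeasure_tball[OF s r, where 'n='n] by blast
	have vT: "emeasure (W s) ?T = ennreal v" using v(2)[OF bpt_in_tube] by simp
	define c where "c = 4 * (cosh r)^2"
	have c0: "c > 0" by (simp add: c_def)
	define K where "K = c powr \<bar>s\<bar>"
	have K0: "K > 0" using c0 by (simp add: K_def)
	have K: "1 <= K * rho w powr s" if w: "w : ?T" for w
	proof -
		have x: "rho w <= c" "1 <= c * rho w" "rho w > 0"
			using rho_tball_le[OF w] rho_tball_le[OF tball_commute[OF w]] tball_in_tube[OF w] by (auto simp: c_def tube_iff)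
		show ?thesis
		proof (cases "s >= 0")
			case True
			have "1 <= (c * rho w) powr s" using x(2) True by (rule ge_one_powr_ge_zero)
			thus ?thesis using True c0 x by (simp add: K_def powr_mult)
		next
			case False
			hence "c powr s <= rho w powr s" using x by (intro powr_mono2') auto
			hence "c powr (- s) * c powr s <= c powr (- s) * rho w powr s" by (rule mult_left_mono) simp
			thus ?thesis using False c0 by (simp add: K_def flip: powr_add)
		qed
	qed
	define b where "b = measure lborel (ball (0::'n cvec) d)"
	have b0: "b > 0" using content_ball_pos[OF d(1), of "0::'n cvec"] by (simp add: b_def)
	have be: "emeasure lborel (ball (0::'n cvec) d) = ennreal b"
		unfolding b_def using emeasure_lborel_ball_finite[of "0::'n cvec" d] by (intro emeasure_eq_ennreal_measure) auto
	show ?thesis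
	proof (rule that[of "K * (v + 1) / b"])
		show "K * (v + 1) / b >= 0" using K0 v b0 by simp
		fix h1 h2 :: "'n cvec => complex" and I :: real
		assume h: "line_hol h1 tube" "line_hol h2 tube"
			and hm[measurable]: "h1 : BM" "h2 : BM" and I: "I > 0"
			and le: "(NI (W s) (%w. indicator ?T w * ennreal (cmod (h1 w - cnj (h2 w)) powr p))) <= ennreal I"
		\<comment> \<open>With this \<open>t\<close> both terms of \<open>le_add_powr\<close> contribute
		  multiples of \<open>t\<close>, since \<open>t powr (1 - p) * I = t\<close>.\<close>
		define t where "t = I powr (1 / p)"
		have t: "t > 0" using I by (simp add: t_def)
		have It: "t powr (1 - p) * I = t"
		proof -
			have "I = t powr p" using I p by (simp add: t_def powr_powr)
			thus ?thesis using t by (simp flip: powr_add)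
		qed
		define ps where "ps = (%w. cmod (h1 w - cnj (h2 w)))"
		have [measurable]: "ps : BM" unfolding ps_def by measurable
		have ps0: "ps w >= 0" for w by (simp add: ps_def)
		have bm: "(indicator (ball ?e d) :: 'n cvec => ennreal) : BM"
			by (intro borel_measurable_indicator) simp
		have Tm: "(indicator ?T :: 'n cvec => ennreal) : BM"
			by (intro borel_measurable_indicator) simp
		have "ennreal (ps ?e) * ennreal b <= (NI lborel (%v. indicator (ball 0 d) v * ennreal (ps (?e + v))))"
			using pluriharmonic_submean[OF h hm subset_trans[OF d(2) tball_subset_tube]] unfolding ps_def be .
		also have "... = (NI lborel (%v. indicator (ball ?e d) (v + ?e) * ennreal (ps (v + ?e))))"
			by (intro nn_integral_cong) (auto simp: indicator_def dist_norm add.commute)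
		also have "... = (NI lborel (%w. indicator (ball ?e d) w * ennreal (ps w)))"
			by (rule nn_integral_lborel_translate) (intro borel_measurable_times_ennreal bm, measurable)
		also have "... <= (NI lborel (%w. ennreal (indicator tube w * rho w powr s) * (indicator ?T w * ennreal (K * (t + t powr (1 - p) * ps w powr p)))))"
		proof (rule nn_integral_mono)
			fix w :: "'n cvec"
			show "indicator (ball ?e d) w * ennreal (ps w) <= ennreal (indicator tube w * rho w powr s) * (indicator ?T w * ennreal (K * (t + t powr (1 - p) * ps w powr p)))"
			proof (cases "w : ball ?e d")
				case True
				hence w: "w : ?T" "w : tube" using d(2) tball_in_tube by blast+
				have "1 * ps w <= (K * rho w powr s) * (t + t powr (1 - p) * ps w powr p)"
					using K[OF w(1)] le_add_powr[OF ps0 t p] K0 ps0 by (intro mult_mono) auto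
				thus ?thesis using w True K0 t by (simp add: ennreal_mult[symmetric] ennreal_leI mult_ac)
			qed simp
		qed
		also have "... = (NI (W s) (%w. indicator ?T w * ennreal (K * (t + t powr (1 - p) * ps w powr p))))"
			by (rule nn_integral_W[symmetric]) (intro borel_measurable_times_ennreal Tm, measurable)
		also have "... = (NI (W s) (%w. ennreal (K * t) * indicator ?T w + ennreal (K * t powr (1 - p)) * (indicator ?T w * ennreal (ps w powr p))))"
			using K0 t by (intro nn_integral_cong) (auto simp: indicator_def ennreal_mult[symmetric] ennreal_plus[symmetric] algebra_simps simp del: ennreal_plus)
		also have "... = ennreal (K * t) * emeasure (W s) ?T + ennreal (K * t powr (1 - p)) * (NI (W s) (%w. indicator ?T w * ennreal (ps w powr p)))"
		proof -
			have m: "(%w. indicator ?T w * ennreal (ps w powr p)) : borel_measurable (W s)"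
				unfolding borel_measurable_W by (intro borel_measurable_times_ennreal Tm) measurable
			have Tm': "(indicator ?T :: 'n cvec => ennreal) : borel_measurable (W s)" unfolding borel_measurable_W by (rule Tm)
			show ?thesis by (subst nn_integral_add) (use m Tm' in \<open>auto simp: nn_integral_cmult\<close>)
		qed
		also have "... <= ennreal (K * t) * ennreal v + ennreal (K * t powr (1 - p)) * ennreal I"
			using le unfolding vT ps_def by (intro add_mono mult_left_mono) auto
		also have "... = ennreal (K * (v + 1) * t)"
		proof -
			have "K * t powr (1 - p) * I = K * t" using It by (simp add: mult.assoc)
			thus ?thesis using K0 t v I by (simp add: ennreal_mult[symmetric] ennreal_plus[symmetric] algebra_simps del: ennreal_plus)
		qed
		finally have "ps ?e * b <= K * (v + 1) * t"
			using K0 v t b0 ps0 by (simp add: ennreal_mult[symmetric])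
		thus "cmod (h1 ?e - cnj (h2 ?e)) <= K * (v + 1) / b * I powr (1 / p)"
			using b0 by (simp add: ps_def t_def pos_le_divide_eq)
	qed
qed

lemma pluriharmonic_pointwise:
	assumes s: "s > -1" and r: "r > 0" and p: "p >= 1"
	obtains C where "C > 0" "!!h1 h2 z I. line_hol h1 tube ==> line_hol h2 tube ==>
		h1 : BM ==> h2 : BM ==> z : tube ==> I > 0 ==>
		(NI (W s :: 'n::{finite,linorder} cvec measure) (%w. indicator (tball z r) w * ennreal (cmod (h1 w - cnj (h2 w)) powr p)))
			<= ennreal (I * rho z powr (real CARD('n) + 1 + s)) ==>
		cmod (h1 z - cnj (h2 z)) <= C * I powr (1 / p)"
proof -
	obtain C where C: "C >= 0" "!!h1 h2 I. line_hol h1 tube ==> line_hol h2 tube ==>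
		h1 : BM ==> h2 : BM ==> I > 0 ==>
		(NI (W s :: 'n cvec measure) (%w. indicator (tball bpt r) w * ennreal (cmod (h1 w - cnj (h2 w)) powr p))) <= ennreal I ==>
		cmod (h1 bpt - cnj (h2 bpt)) <= C * I powr (1 / p)"
		by (rule pluriharmonic_pointwise_base[OF s r p]) blast
	show ?thesis
	proof (rule that[of "C + 1"])
		show "C + 1 > 0" using C by simp
		fix h1 h2 :: "'n cvec => complex" and I :: real and z
		assume h: "line_hol h1 tube" "line_hol h2 tube"
			and hm[measurable]: "h1 : BM" "h2 : BM" and z: "z : tube" and I: "I > 0"
			and le: "(NI (W s) (%w. indicator (tball z r) w * ennreal (cmod (h1 w - cnj (h2 w)) powr p))) <= ennreal (I * rho z powr (real CARD('n) + 1 + s))"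
		let ?N = "rho z powr (real CARD('n) + 1 + s)"
		have N: "?N > 0" using z by (simp add: tube_iff)
		have "ennreal ?N * (NI (W s) (%w. indicator (tball bpt r) w * ennreal (cmod (h1 (tube_aut z w) - cnj (h2 (tube_aut z w))) powr p))) <= ennreal ?N * ennreal I"
			using le I N by (subst (asm) nn_integral_tball_tube_aut[OF z]) (simp_all add: ennreal_mult[symmetric] mult.commute)
		hence "(NI (W s) (%w. indicator (tball bpt r) w * ennreal (cmod (h1 (tube_aut z w) - cnj (h2 (tube_aut z w))) powr p))) <= ennreal I"
			by (subst (asm) ennreal_mult_le_mult_iff) (use N in auto)
		hence "cmod (h1 z - cnj (h2 z)) <= C * I powr (1 / p)"
			using C(2)[OF line_hol_tube_aut[OF h(1) z] line_hol_tube_aut[OF h(2) z], of I] I z by simp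
		also have "... <= (C + 1) * I powr (1 / p)" by (intro mult_right_mono) auto
		finally show "cmod (h1 z - cnj (h2 z)) <= (C + 1) * I powr (1 / p)" .
	qed
qed

lemma line_hol_zero: "line_hol (%_. 0) S"
	by (simp add: line_hol_def)

text \<open>The case \<open>h2 = 0\<close>, with the integral itself in place of a bound for it; in
  this form it can be integrated over \<open>z\<close>.\<close>

lemma holomorphic_pointwise:
	assumes s: "s > -1" and r: "r > 0" and p: "p >= 1"
	obtains C where "C > 0" "!!(g :: 'n::{finite,linorder} cvec => complex) z. line_hol g tube ==> g : BM ==> z : tube ==>
		ennreal (cmod (g z) powr p * rho z powr (real CARD('n) + 1 + s))
			<= ennreal C * (NI (W s) (%w. indicator (tball z r) w * ennreal (cmod (g w) powr p)))"
proof -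
	obtain C where C: "C > 0" "!!h1 h2 z I. line_hol h1 tube ==> line_hol h2 tube ==>
		h1 : BM ==> h2 : BM ==> z : tube ==> I > 0 ==>
		(NI (W s :: 'n cvec measure) (%w. indicator (tball z r) w * ennreal (cmod (h1 w - cnj (h2 w)) powr p)))
			<= ennreal (I * rho z powr (real CARD('n) + 1 + s)) ==>
		cmod (h1 z - cnj (h2 z)) <= C * I powr (1 / p)"
		by (rule pluriharmonic_pointwise[OF s r p]) blast
	have Cp: "C powr p > 0" using C(1) by simp
	show ?thesis
	proof (rule that[OF Cp])
		fix g :: "'n cvec => complex" and z :: "'n cvec"
		assume g: "line_hol g tube" "g : BM" and z: "z : tube"
		let ?N = "rho z powr (real CARD('n) + 1 + s)"
		have N: "?N > 0" using z by (simp add: tube_iff)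
		let ?X = "(NI (W s) (%w. indicator (tball z r) w * ennreal (cmod (g w) powr p)))"
		show "ennreal (cmod (g z) powr p * ?N) <= ennreal (C powr p) * ?X"
		proof (cases ?X)
			case (real x)
			\<comment> \<open>The pointwise bound is available for \<open>I > 0\<close> only; taking every
			  \<open>I\<close> above \<open>x / ?N\<close> includes the case \<open>x = 0\<close>.\<close>
			have "cmod (g z) powr p / C powr p <= x / ?N"
			proof (rule dense_ge)
				fix I assume I: "x / ?N < I"
				hence I0: "I > 0" using real N by (meson divide_nonneg_pos le_less_trans)
				have "?X <= ennreal (I * ?N)" unfolding real(2) using I N by (intro ennreal_leI) (simp add: pos_divide_less_eq)
				hence "cmod (g z) <= C * I powr (1 / p)"
					using C(2)[OF g(1) line_hol_zero g(2) _ z I0] by simp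
				hence "cmod (g z) powr p <= (C * I powr (1 / p)) powr p" using p by (intro powr_mono2) auto
				also have "... = C powr p * I" using C(1) I0 p by (simp add: powr_mult powr_powr)
				finally show "cmod (g z) powr p / C powr p <= I" using Cp by (simp add: pos_divide_le_eq mult.commute)
			qed
			hence "cmod (g z) powr p * ?N <= C powr p * x" using Cp N by (simp add: field_simps)
			thus ?thesis unfolding real(2) using real(1) by (simp add: ennreal_mult[symmetric] ennreal_leI)
		next
			case top
			thus ?thesis using Cp by (simp add: ennreal_mult_top)
		qed
	qed
qed

text \<open>On the unit circle dividing by \<open>u\<close> is multiplying by \<open>cnj u\<close>.
  The mean of \<open>(ph1 u - ph1 0) / u\<close> is the derivative, while the antiholomorphic part
  becomes the conjugate of \<open>G u = u * (ph2 u - cnj (ph1 0))\<close>, whose mean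
  \<open>G 0\<close> is 0. The difference of the two integrands has modulus
  \<open>|ph1 - cnj ph2|\<close>.\<close>

lemma deriv_le_pluriharmonic:
	fixes ph1 ph2 :: "complex => complex"
	assumes h: "ph1 holomorphic_on T" "ph2 holomorphic_on T" and T: "open T" "cball 0 1 <= T"
		and B: "!!u. u : cball 0 1 ==> cmod (ph1 u - cnj (ph2 u)) <= B"
	shows "cmod (deriv ph1 0) <= B"
proof -
	define q where "q = (%u. if u = 0 then deriv ph1 0 else (ph1 u - ph1 0) / (u - 0))"
	have q: "q holomorphic_on T" unfolding q_def by (rule pole_lemma_open[OF h(1) T(1)])
	define G where "G = (%u. u * (ph2 u - cnj (ph1 0)))"
	have G: "G holomorphic_on T" unfolding G_def using h(2) by (intro holomorphic_intros)
	let ?i = "indicator {0..2*pi} :: real => real"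
	note mq = circle_mean_value[OF q T(2)] and mG = circle_mean_value[OF G T(2)]
	have iG: "integrable lborel (%t. cnj (?i t *\<^sub>R G (cis t)))" by (rule integrable_cnj[OF mG(1)])
	have pt: "cmod (?i t *\<^sub>R q (cis t) - cnj (?i t *\<^sub>R G (cis t))) <= ?i t * B" for t
	proof -
		have e1: "q (cis t) = cis (- t) * (ph1 (cis t) - ph1 0)"
			by (simp add: q_def cis_divide[symmetric] flip: cis_inverse) (simp add: field_simps)
		have e2: "cnj (G (cis t)) = cis (- t) * (cnj (ph2 (cis t)) - ph1 0)"
			by (simp add: G_def cis_cnj)
		have "q (cis t) - cnj (G (cis t)) = cis (- t) * (ph1 (cis t) - cnj (ph2 (cis t)))"
			unfolding e1 e2 by (simp add: algebra_simps)
		hence "cmod (q (cis t) - cnj (G (cis t))) = cmod (ph1 (cis t) - cnj (ph2 (cis t)))" by (simp add: norm_mult)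
		also have "... <= B" by (rule B) simp
		finally show ?thesis by (auto simp: indicator_def)
	qed
	have "(LINT t|lborel. ?i t *\<^sub>R q (cis t) - cnj (?i t *\<^sub>R G (cis t))) = 2 * of_real pi * q 0 - cnj (2 * of_real pi * G 0)"
		unfolding Bochner_Integration.integral_diff[OF mq(1) iG] mq(2)
		using integral_bounded_linear[OF bounded_linear_cnj mG(1)] mG(2) by simp
	also have "... = 2 * of_real pi * deriv ph1 0" by (simp add: q_def G_def)
	finally have "cmod (2 * of_real pi * deriv ph1 0) = cmod (LINT t|lborel. ?i t *\<^sub>R q (cis t) - cnj (?i t *\<^sub>R G (cis t)))" by simp
	also have "... <= (LINT t|lborel. ?i t * B)"
		by (rule Bochner_Integration.integral_norm_bound_integral[OF Bochner_Integration.integrable_diff[OF mq(1) iG]]) (use pt in auto)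
	also have "... = 2 * pi * B" by simp
	finally show ?thesis by (simp add: norm_mult)
qed

text \<open>\<open>pluriharmonic_pointwise\<close> at every point of a small Euclidean ball bounds
  \<open>h1 - cnj h2\<close> there; \<open>deriv_le_pluriharmonic\<close> then bounds the derivative
  of \<open>h1\<close> along the line from \<open>bpt\<close> to \<open>w\<close>. Automorphisms
  carry the estimate to other centres.\<close>

lemma pluriharmonic_local_oscillation:
	assumes s: "s > -1" and r: "r > 0" and p: "p >= 1"
	obtains C r0 where "C >= 0" "r0 > 0" "!!h1 h2 z w I. line_hol h1 tube ==> line_hol h2 tube ==>
		h1 : BM ==> h2 : BM ==> z : tube ==> I > 0 ==>
		(NI (W s :: 'n::{finite,linorder} cvec measure) (%w. indicator (tball z r) w * ennreal (cmod (h1 w - cnj (h2 w)) powr p)))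
			<= ennreal (I * rho z powr (real CARD('n) + 1 + s)) ==> w : tball z r0 ==>
		cmod (h1 w - h1 z) <= C * I powr (1 / p)"
proof -
	let ?e = "bpt :: 'n cvec"
	have r2: "r / 2 > 0" using r by simp
	obtain C where C: "C > 0" "!!h1 h2 z I. line_hol h1 tube ==> line_hol h2 tube ==>
		h1 : BM ==> h2 : BM ==> z : tube ==> I > 0 ==>
		(NI (W s :: 'n cvec measure) (%w. indicator (tball z (r / 2)) w * ennreal (cmod (h1 w - cnj (h2 w)) powr p)))
			<= ennreal (I * rho z powr (real CARD('n) + 1 + s)) ==>
		cmod (h1 z - cnj (h2 z)) <= C * I powr (1 / p)"
		by (rule pluriharmonic_pointwise[OF s r2 p]) blast
	obtain d where d: "d > 0" "ball ?e d <= tball ?e (r / 2)" by (rule ex_ball_subset_tball[OF r2])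
	obtain r0 where r0: "r0 > 0" "tball ?e r0 <= ball ?e (d / 4)" using ex_tball_subset_ball[of "d / 4"] d by auto
	define N where "N = real CARD('n) + 1 + s"
	have N: "N > 0" using s by (simp add: N_def add_pos_pos)
	define c where "c = (4 * (cosh (r / 2))^2) powr N"
	have c0: "c > 0" by (simp add: c_def)
	have base: "cmod (h1 w - h1 ?e) <= C * c powr (1 / p) * I powr (1 / p)"
		if h: "line_hol h1 tube" "line_hol h2 tube"
			and hm: "h1 : BM" "h2 : BM" and I: "I > 0"
			and le: "(NI (W s) (%w. indicator (tball ?e r) w * ennreal (cmod (h1 w - cnj (h2 w)) powr p))) <= ennreal I"
			and w: "w : tball ?e r0" for h1 h2 :: "'n cvec => complex" and I w
	proof -
		define B where "B = C * (I * c) powr (1 / p)"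
		have B: "cmod (h1 x - cnj (h2 x)) <= B" if x: "x : ball ?e d" for x
		proof -
			have xt: "x : tball ?e (r / 2)" "x : tube" using x d(2) tball_in_tube by blast+
			have sub: "tball x (r / 2) <= tball ?e r"
				using xt by (intro tball_subset) (auto simp: tball_def)
			have le1: "(NI (W s) (%w. indicator (tball x (r / 2)) w * ennreal (cmod (h1 w - cnj (h2 w)) powr p))) <= ennreal I"
				by (rule order.trans[OF nn_integral_mono le]) (use sub in \<open>auto simp: indicator_def\<close>)
			have le2: "I * 1 <= I * (c * rho x powr N)"
			proof (rule mult_left_mono)
				have "1 <= 4 * (cosh (r / 2))^2 * rho x" using rho_tball_le[OF xt(1)] by simp
				hence "1 <= (4 * (cosh (r / 2))^2 * rho x) powr N" using N by (intro ge_one_powr_ge_zero) auto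
				thus "1 <= c * rho x powr N" using xt(2) by (simp add: c_def powr_mult tube_iff)
			qed (use I in simp)
			have "(NI (W s) (%w. indicator (tball x (r / 2)) w * ennreal (cmod (h1 w - cnj (h2 w)) powr p))) <= ennreal (I * c * rho x powr N)"
				using order.trans[OF le1 ennreal_leI[OF le2[unfolded mult_1_right]]] by (simp add: mult.assoc)
			thus ?thesis using C(2)[OF h hm xt(2), of "I * c"] I c0 by (simp add: B_def N_def)
		qed
		\<comment> \<open>\<open>w\<close> sits at the parameter \<open>1/2\<close>. Unit discs about
		  parameters of modulus below \<open>3/4\<close> stay inside the disc of radius 2, which maps into
		  the ball of radius \<open>d\<close>.\<close>
		define V where "V = 2 *\<^sub>R (w - ?e)"
		have nV: "norm V < d / 2" using w r0(2) by (auto simp: V_def dist_norm norm_minus_commute)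
		define T where "T = {u. ?e + u *s V : tube}"
		have T: "open T" unfolding T_def by (rule open_line[OF open_tube])
		have inb: "?e + u *s V : ball ?e d" if "cmod u < 2" for u
		proof -
			have "cmod u * norm V <= 2 * norm V" using that by (intro mult_right_mono) auto
			thus ?thesis using nV by (simp add: dist_norm norm_scale_cvec)
		qed
		hence bT: "ball 0 2 <= T" using d(2) tball_subset_tube by (force simp: T_def)
		define ph1 where "ph1 = (%u. h1 (?e + u *s V))"
		define ph2 where "ph2 = (%u. h2 (?e + u *s V))"
		have ph: "ph1 holomorphic_on T" "ph2 holomorphic_on T"
			using h by (auto simp: line_hol_def ph1_def ph2_def T_def)
		have db: "cmod (deriv ph1 u0) <= B" if u0: "u0 : ball 0 (3/4)" for u0
		proof -
			let ?T = "(%u. u + u0) -` T"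
			have "open ?T" using T by (intro open_vimage continuous_intros)
			moreover have in2: "u + u0 : ball 0 2" if "u : cball 0 1" for u
				using that u0 norm_triangle_ineq[of u u0] by simp
			have "cball 0 1 <= ?T"
			proof
				fix u :: complex assume "u : cball 0 1"
				from in2[OF this] bT show "u : ?T" by blast
			qed
			moreover have hh: "(%u. ph1 (u + u0)) holomorphic_on ?T" "(%u. ph2 (u + u0)) holomorphic_on ?T"
			proof -
				have sh: "(%u. u + u0) holomorphic_on ?T" by (intro holomorphic_intros)
				have im: "(%u. u + u0) ` ?T <= T" by auto
				show "(%u. ph1 (u + u0)) holomorphic_on ?T"
					using holomorphic_on_compose_gen[OF sh ph(1) im] unfolding o_def .
				show "(%u. ph2 (u + u0)) holomorphic_on ?T"
					using holomorphic_on_compose_gen[OF sh ph(2) im] unfolding o_def .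
			qed
			moreover have "cmod (ph1 (u + u0) - cnj (ph2 (u + u0))) <= B" if "u : cball 0 1" for u
				using B[OF inb[of "u + u0"]] in2[OF that] by (simp add: ph1_def ph2_def)
			ultimately have "cmod (deriv (%u. ph1 (u + u0)) 0) <= B" using deriv_le_pluriharmonic[of "%u. ph1 (u + u0)" ?T "%u. ph2 (u + u0)" B] by blast
			moreover have "deriv (%u. ph1 (u + u0)) 0 = deriv ph1 u0"
				using deriv_shift_0[of ph1 u0] by (simp add: o_def add.commute)
			ultimately show ?thesis by simp
		qed
		have "cmod (ph1 (1/2) - ph1 0) <= B * cmod (1/2 - 0)"
		proof (rule field_differentiable_bound[of "ball 0 (3/4)" ph1 "deriv ph1"])
			fix u :: complex assume u: "u : ball 0 (3/4)"
			hence "u : T" using bT by auto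
			thus "(ph1 has_field_derivative deriv ph1 u) (at u within ball 0 (3/4))"
				using holomorphic_derivI[OF ph(1) T] has_field_derivative_at_within by blast
		qed (use db in auto)
		moreover have "ph1 (1/2) = h1 w"
		proof -
			have "?e + (1/2) *s V = w" by (simp add: V_def vec_eq_iff scaleR_conv_of_real)
			thus ?thesis by (simp add: ph1_def)
		qed
		moreover have "B >= 0" using order.trans[OF norm_ge_zero B[of ?e]] d by simp
		ultimately have "cmod (h1 w - h1 ?e) <= B" by (simp add: ph1_def)
		also have "B = C * c powr (1 / p) * I powr (1 / p)" using I c0 by (simp add: B_def powr_mult)
		finally show ?thesis .
	qed
	show ?thesis
	proof (rule that[of "C * c powr (1 / p)" r0])
		fix h1 h2 :: "'n cvec => complex" and I :: real and z w
		assume h: "line_hol h1 tube" "line_hol h2 tube"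
			and hm[measurable]: "h1 : BM" "h2 : BM" and z: "z : tube" and I: "I > 0"
			and le: "(NI (W s) (%w. indicator (tball z r) w * ennreal (cmod (h1 w - cnj (h2 w)) powr p))) <= ennreal (I * rho z powr (real CARD('n) + 1 + s))"
			and w: "w : tball z r0"
		let ?N = "rho z powr (real CARD('n) + 1 + s)"
		have N: "?N > 0" using z by (simp add: tube_iff)
		have "ennreal ?N * (NI (W s) (%w. indicator (tball bpt r) w * ennreal (cmod (h1 (tube_aut z w) - cnj (h2 (tube_aut z w))) powr p))) <= ennreal ?N * ennreal I"
			using le I N by (subst (asm) nn_integral_tball_tube_aut[OF z]) (simp_all add: ennreal_mult[symmetric] mult.commute)
		hence le': "(NI (W s) (%w. indicator (tball bpt r) w * ennreal (cmod (h1 (tube_aut z w) - cnj (h2 (tube_aut z w))) powr p))) <= ennreal I"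
			by (subst (asm) ennreal_mult_le_mult_iff) (use N in auto)
		obtain w' where w': "tube_aut z w' = w" by (rule tube_aut_surj[OF z])
		hence "w' : tball ?e r0" using w tube_aut_in_tball[OF z] by blast
		from base[OF line_hol_tube_aut[OF h(1) z] line_hol_tube_aut[OF h(2) z] _ _ I le' this]
		show "cmod (h1 w - h1 z) <= C * c powr (1 / p) * I powr (1 / p)" using w' z by simp
	qed (use C r0 in auto)
qed

text \<open>A chain of steps shorter than \<open>r0\<close> reaches any prescribed radius. The
  integral is assumed over the ball of radius \<open>R + 1\<close>, which contains the unit balls
  about all points of the chain.\<close>

lemma pluriharmonic_oscillation:
	assumes s: "s > -1" and r: "r > 0" and p: "p >= 1"
	obtains C R where "C >= 0" "R > 0" "!!h1 h2 z w I. line_hol h1 tube ==> line_hol h2 tube ==>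
		h1 : BM ==> h2 : BM ==> z : tube ==> I > 0 ==>
		(NI (W s :: 'n::{finite,linorder} cvec measure) (%w. indicator (tball z R) w * ennreal (cmod (h1 w - cnj (h2 w)) powr p)))
			<= ennreal (I * rho z powr (real CARD('n) + 1 + s)) ==> w : tball z r ==>
		cmod (h1 w - h1 z) <= C * I powr (1 / p)"
proof -
	obtain C r0 where C: "C >= 0" "r0 > 0" "!!h1 h2 z w I. line_hol h1 tube ==> line_hol h2 tube ==>
		h1 : BM ==> h2 : BM ==> z : tube ==> I > 0 ==>
		(NI (W s :: 'n cvec measure) (%w. indicator (tball z 1) w * ennreal (cmod (h1 w - cnj (h2 w)) powr p)))
			<= ennreal (I * rho z powr (real CARD('n) + 1 + s)) ==> w : tball z r0 ==>
		cmod (h1 w - h1 z) <= C * I powr (1 / p)"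
		by (rule pluriharmonic_local_oscillation[OF s zero_less_one p]) blast
	obtain k :: nat where k: "r / r0 < 2 ^ k" using real_arch_pow[of 2 "r / r0"] by auto
	hence rk: "r <= 2 ^ k * r0" using C(2) by (simp add: pos_divide_less_eq)
	define R where "R = 2 ^ k * r0"
	define N where "N = real CARD('n) + 1 + s"
	have N: "N > 0" using s by (simp add: N_def add_pos_pos)
	define c where "c = (4 * (cosh R)^2) powr N"
	have c0: "c > 0" by (simp add: c_def)
	show ?thesis
	proof (rule that[of "2 ^ k * (C * c powr (1 / p))" "R + 1"])
		show "R + 1 > 0" using C(2) by (simp add: R_def add_pos_pos)
		fix h1 h2 :: "'n cvec => complex" and I :: real and z w
		assume h: "line_hol h1 tube" "line_hol h2 tube"
			and hm: "h1 : BM" "h2 : BM" and z: "z : tube" and I: "I > 0"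
			and le: "(NI (W s) (%w. indicator (tball z (R + 1)) w * ennreal (cmod (h1 w - cnj (h2 w)) powr p))) <= ennreal (I * rho z powr (real CARD('n) + 1 + s))"
			and w: "w : tball z r"
		have "cmod (h1 z - h1 w) <= 2 ^ k * (C * (I * c) powr (1 / p))"
		proof (rule tdist_chain[OF z, of _ k r0])
			show "w : tball z (2 ^ k * r0)" using w rk by (auto simp: tball_def)
			fix x y assume x: "x : tball z (2 ^ k * r0)" and y: "y : tball x r0"
			have xt: "x : tube" by (rule tball_in_tube[OF x])
			have sub: "tball x 1 <= tball z (R + 1)"
				using x by (intro tball_subset[OF z xt]) (auto simp: tball_def R_def)
			have le1: "(NI (W s) (%w. indicator (tball x 1) w * ennreal (cmod (h1 w - cnj (h2 w)) powr p))) <= ennreal (I * rho z powr N)"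
				unfolding N_def by (rule order.trans[OF nn_integral_mono le]) (use sub in \<open>auto simp: indicator_def\<close>)
			have le2: "I * rho z powr N <= I * (c * rho x powr N)"
			proof (rule mult_left_mono)
				have "rho z powr N <= (4 * (cosh R)^2 * rho x) powr N"
					using rho_tball_le[OF x[folded R_def] z] z N by (intro powr_mono2) (auto simp: tube_iff)
				thus "rho z powr N <= c * rho x powr N" using xt by (simp add: c_def powr_mult tube_iff)
			qed (use I in simp)
			have "(NI (W s) (%w. indicator (tball x 1) w * ennreal (cmod (h1 w - cnj (h2 w)) powr p))) <= ennreal (I * c * rho x powr N)"
				using order.trans[OF le1 ennreal_leI[OF le2]] by (simp add: mult.assoc)
			from C(3)[OF h hm xt _ this[unfolded N_def] y] I c0
			show "cmod (h1 x - h1 y) <= C * (I * c) powr (1 / p)" by (simp add: norm_minus_commute)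
		qed
		thus "cmod (h1 w - h1 z) <= 2 ^ k * (C * c powr (1 / p)) * I powr (1 / p)"
			using I c0 by (simp add: norm_minus_commute powr_mult mult_ac)
	qed (use C in auto)
qed

subsection \<open>The projection\<close>

text \<open>The form of \<open>bergman_proj\<close> used for Borel functions. Its kernel
  \<open>rpowr\<close> is Borel in both variables, so \<open>Pk al k\<close> is Borel on the whole
  space; on the tube the two kernels agree.\<close>

definition Pk :: "real => ('n::{finite,linorder} cvec => complex) => 'n cvec => complex" where
	"Pk al k z = of_real (berg_const al CARD('n)) *
		 (LINT w|W al. rpowr (rho_ker z w) (- (real CARD('n) + 1 + al)) * k w)"

lemma Pk_measurable [measurable]:
	assumes [measurable]: "k : BM"
	shows "Pk al k : BM"
proof -
	interpret sigma_finite_measure "W al :: 'a cvec measure" by (rule sigma_finite_W)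
	have "(%z. (LINT w|W al. rpowr (rho_ker z w) (- (real CARD('a) + 1 + al)) * k w)) : BM"
		by (rule borel_measurable_lebesgue_integral) (simp add: split_def)
	thus ?thesis unfolding Pk_def[abs_def] by measurable
qed

lemma cmod_kernel_le_schur_ker:
	fixes z w :: "'n::{finite,linorder} cvec"
	assumes "z : tube" "w : tube" "ep >= 0"
	shows "cmod (rpowr (rho_ker z w) (- (real CARD('n) + 1 + al))) <= schur_ker al ep z w"
proof -
	have "1 <= FF z w powr ep" using FF_ge_1[OF assms(1,2)] assms(3) by (rule ge_one_powr_ge_zero)
	hence "cmod (rho_ker z w) powr (- (real CARD('n) + 1 + al)) * 1 <= schur_ker al ep z w"
		unfolding schur_ker_def by (rule mult_left_mono) simp
	thus ?thesis using Re_rho_ker_pos[OF assms(1,2)] by (simp add: cmod_rpowr)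
qed

text \<open>Kernels at points of a metric ball are comparable by
  \<open>cmod_rho_ker_tball_le\<close>, which yields an integrable bound that is uniform near each
  parameter.\<close>

lemma line_hol_Pk:
	fixes k :: "'n::{finite,linorder} cvec => complex"
	assumes al: "al > -1" and [measurable]: "k : BM"
		and int: "!!z. z : tube ==> integrable (W al) (%w. rpowr (rho_ker z w) (- (real CARD('n) + 1 + al)) * k w)"
	shows "line_hol (Pk al k) tube"
	unfolding line_hol_def
proof (intro allI)
	fix a v :: "'n cvec"
	define N where "N = real CARD('n) + 1 + al"
	have N: "N > 0" using al by (simp add: N_def add_pos_pos)
	define T where "T = {s. a + s *s v : tube}"
	have T: "open T" unfolding T_def by (rule open_line[OF open_tube])
	define kk where "kk = (%s w. indicator tube w *\<^sub>R (rpowr (rho_ker (a + s *s v) w) (- N) * k w))"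
	have "(%s. (LINT w|W al. kk s w)) holomorphic_on T"
	proof (rule holomorphic_on_integral[OF T])
		fix s show "kk s : borel_measurable (W al)" unfolding kk_def borel_measurable_W by measurable
	next
		fix w :: "'n cvec"
		show "(%s. kk s w) holomorphic_on T"
		proof (cases "w : tube")
			case True
			have Re: "Re (rho_ker (a + s *s v) w) > 0" if "s : T" for s
				using that True by (auto simp: T_def intro!: Re_rho_ker_pos)
			have nn: "rho_ker (a + s *s v) w \<notin> \<real>\<^sub>\<le>\<^sub>0" if "s : T" for s
				using Re[OF that] by (auto simp: complex_nonpos_Reals_iff)
			have "(%s. rho_ker (a + s *s v) w) holomorphic_on T"
				by (rule holomorphic_Cn_compose[OF holomorphic_Cn_rho_ker[of w tube] _ T]) (auto simp: T_def intro!: holomorphic_intros)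
			hence "(%s. rho_ker (a + s *s v) w powr of_real (- N) * k w) holomorphic_on T"
				by (intro holomorphic_intros nn)
			thus ?thesis
				by (rule holomorphic_transform) (use Re True in \<open>auto simp: kk_def rpowr_def\<close>)
		qed (simp add: kk_def)
	next
		fix s0 assume s0: "s0 : T"
		define z0 where "z0 = a + s0 *s v"
		have z0: "z0 : tube" using s0 by (simp add: T_def z0_def)
		have "open {s. a + s *s v : tball z0 1}" by (rule open_line[OF open_tball[OF z0]])
		moreover have "s0 : {s. a + s *s v : tball z0 1}" using center_in_tball[OF z0] by (simp add: z0_def)
		ultimately obtain r where r: "r > 0" "ball s0 r <= {s. a + s *s v : tball z0 1}"
			using open_contains_ball by blast
		define c where "c = 2 * exp 1 * cosh (1::real)"
		have c: "c > 0" by (simp add: c_def)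
		let ?G = "%w. c powr N * cmod (rpowr (rho_ker z0 w) (- N) * k w)"
		have "integrable (W al) ?G" using int[OF z0] by (simp add: N_def)
		moreover have "cmod (kk s w) <= ?G w" if s: "s : ball s0 r" for s w
		proof (cases "w : tube")
			case True
			have z: "a + s *s v : tball z0 1" using r(2) s by blast
			have zt: "a + s *s v : tube" by (rule tball_in_tube[OF z])
			have "cmod (rho_ker (a + s *s v) w) powr (- N) <= c powr N * cmod (rho_ker z0 w) powr (- N)"
				using cmod_rho_ker_tball_le[OF z z0 True] cmod_rho_ker_pos[OF z0 True] c N
				by (intro powr_neg_le_cmult) (auto simp: c_def)
			hence "cmod (rho_ker (a + s *s v) w) powr (- N) * cmod (k w) <= c powr N * cmod (rho_ker z0 w) powr (- N) * cmod (k w)"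
				by (rule mult_right_mono) simp
			thus ?thesis
				using True Re_rho_ker_pos[OF zt True] Re_rho_ker_pos[OF z0 True] by (simp add: kk_def norm_mult cmod_rpowr mult.assoc)
		qed (simp add: kk_def)
		ultimately show "\<exists>r>0. \<exists>G. integrable (W al) G \<and> (\<forall>s\<in>ball s0 r. \<forall>x. cmod (kk s x) <= G x)"
			using r(1) by blast
	qed
	moreover have "(LINT w|W al. kk s w) = (LINT w|W al. rpowr (rho_ker (a + s *s v) w) (- N) * k w)" for s
	proof (rule integral_cong_AE)
		show "AE w in W al. kk s w = rpowr (rho_ker (a + s *s v) w) (- N) * k w"
			using AE_W_tube[of al] by eventually_elim (simp add: kk_def)
	qed (simp_all add: kk_def borel_measurable_W)
	ultimately show "(%s. Pk al k (a + s *s v)) holomorphic_on {s. a + s *s v : tube}"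
		unfolding Pk_def N_def[symmetric] T_def[symmetric] by (auto intro!: holomorphic_intros)
qed

lemma Pk_reproducing:
	fixes g :: "'n::{finite,linorder} cvec => complex"
	assumes "al > -1" "holomorphic_Cn g tube" "g : BM"
		and "!!w. w : tube ==> cmod (g w) <= M" "z : tube"
		and "integrable (W al) (%w. rpowr (rho_ker z w) (- (real CARD('n) + 1 + al)) * g w)"
	shows "Pk al g z = g z"
	using reproducing[OF assms(1-5)] assms(6) by (simp add: Pk_def mult.commute)

subsection \<open>Carleson embedding\<close>

text \<open>Bound \<open>|g z|^p\<close> by its mean over the ball at \<open>z\<close> and exchange
  the integrals. The inner integral then runs over a ball about \<open>w\<close>, where the
  hypothesis on \<open>f2\<close> applies and \<open>rho z\<close> is comparable to
  \<open>rho w\<close>.\<close>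

lemma carleson_embedding:
	fixes f2 :: "'n::{finite,linorder} cvec => complex"
	assumes s: "s > -1" and r: "r > 0" and p: "p >= 1" and [measurable]: "f2 : BM" and M0: "M >= 0"
		and M: "!!z. z : tube ==> (NI (W s) (%w. indicator (tball z r) w * ennreal (cmod (f2 w) powr p)))
			 <= ennreal (M * rho z powr (real CARD('n) + 1 + s))"
	obtains C where "C >= 0" "!!g. line_hol g tube ==> g : BM ==>
		(NI (W s) (%w. ennreal (cmod (f2 w * g w) powr p))) <= ennreal C * (NI (W s) (%w. ennreal (cmod (g w) powr p)))"
proof -
	obtain C0 where C0: "C0 > 0" "!!(g :: 'n cvec => complex) z. line_hol g tube ==> g : BM ==> z : tube ==>
		ennreal (cmod (g z) powr p * rho z powr (real CARD('n) + 1 + s))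
			<= ennreal C0 * (NI (W s) (%w. indicator (tball z r) w * ennreal (cmod (g w) powr p)))"
		using holomorphic_pointwise[OF s r p, where 'n='n] by blast
	define N where "N = real CARD('n) + 1 + s"
	have N: "N > 0" using s by (simp add: N_def add_pos_pos)
	define K where "K = (4 * (cosh r)^2) powr N"
	have K: "K > 0" by (simp add: K_def)
	\<comment> \<open>The indicator of \<open>tdist z w < r\<close> on the tube, written through
	  \<open>FF\<close> so that it is visibly symmetric and Borel in both variables.\<close>
	define X where "X = (%z w :: 'n cvec. indicator tube z * indicator tube w * indicator {..<(cosh r)\<^sup>2} (FF z w) :: ennreal)"
	have X1: "X z w = indicator (tball z r) w" if "z : tube" for z w
		using tball_iff[OF that r, of w] that by (auto simp: X_def indicator_def)
	have Xc: "X z w = X w z" for z w by (simp add: X_def FF_commute[of z w] mult_ac)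
	interpret P: pair_sigma_finite "W s :: 'n cvec measure" "W s :: 'n cvec measure"
		unfolding pair_sigma_finite_def by (simp add: sigma_finite_W)
	have inner: "(NI (W s) (%z. X z w * ennreal (cmod (f2 z) powr p * rho z powr (- N)))) <= ennreal (K * M)" if w: "w : tube" for w
	proof -
		have "(NI (W s) (%z. X z w * ennreal (cmod (f2 z) powr p * rho z powr (- N))))
			<= (NI (W s) (%z. ennreal (K * rho w powr (- N)) * (indicator (tball w r) z * ennreal (cmod (f2 z) powr p))))"
		proof (rule nn_integral_mono)
			fix z
			show "X z w * ennreal (cmod (f2 z) powr p * rho z powr (- N))
				<= ennreal (K * rho w powr (- N)) * (indicator (tball w r) z * ennreal (cmod (f2 z) powr p))"
			proof (cases "z : tball w r")
				case True
				have "rho z powr (- N) <= K * rho w powr (- N)"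
					unfolding K_def using rho_tball_le[OF True w] w N by (intro powr_neg_le_cmult) (auto simp: tube_iff)
				hence "cmod (f2 z) powr p * rho z powr (- N) <= K * rho w powr (- N) * cmod (f2 z) powr p"
					using mult_left_mono[of "rho z powr (- N)" "K * rho w powr (- N)" "cmod (f2 z) powr p"] by (simp add: mult_ac)
				thus ?thesis using True K by (simp add: Xc[of z] X1[OF w] ennreal_mult[symmetric] ennreal_leI)
			qed (simp add: Xc[of z] X1[OF w])
		qed
		also have "... = ennreal (K * rho w powr (- N)) * (NI (W s) (%z. indicator (tball w r) z * ennreal (cmod (f2 z) powr p)))"
		proof (rule nn_integral_cmult)
			have [measurable]: "tball w r : sets borel" by (rule tball_borel[OF w])
			show "(%z. indicator (tball w r) z * ennreal (cmod (f2 z) powr p)) : borel_measurable (W s)"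
				unfolding borel_measurable_W by measurable
		qed
		also have "... <= ennreal (K * rho w powr (- N)) * ennreal (M * rho w powr N)"
			unfolding N_def by (intro mult_left_mono M[OF w]) simp
		also have "... = ennreal (K * M)"
		proof -
			have "rho w powr (- N) * rho w powr N = 1" using w by (simp add: powr_minus tube_iff)
			hence "K * rho w powr (- N) * (M * rho w powr N) = K * M" by (simp add: mult_ac)
			thus ?thesis using K M0 by (simp add: ennreal_mult[symmetric])
		qed
		finally show ?thesis .
	qed
	show ?thesis
	proof (rule that[of "C0 * (K * M)"])
		show "C0 * (K * M) >= 0" using C0 K M0 by simp
		fix g :: "'n cvec => complex" assume g: "line_hol g tube" and [measurable]: "g : BM"
		let ?F = "%z w. ennreal C0 * (X z w * ennreal (cmod (f2 z) powr p * rho z powr (- N)) * ennreal (cmod (g w) powr p))"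
		have [measurable]: "(%z. X z w) : BM" "(%w. X z w) : BM" for z w
			unfolding X_def by measurable
		have "(NI (W s) (%z. ennreal (cmod (f2 z * g z) powr p))) <= (NI (W s) (%z. (NI (W s) (%w. ?F z w))))"
		proof (rule nn_integral_mono_AE, use AE_W_tube[of s] in eventually_elim)
			case (elim z)
			have e: "cmod (f2 z * g z) powr p = (cmod (f2 z) powr p * rho z powr (- N)) * (cmod (g z) powr p * rho z powr N)"
			proof -
				have "rho z powr (- N) * rho z powr N = 1" using elim by (simp add: powr_minus tube_iff)
				thus ?thesis by (simp add: norm_mult powr_mult)
			qed
			have "ennreal (cmod (f2 z * g z) powr p) <= ennreal (cmod (f2 z) powr p * rho z powr (- N)) *
					(ennreal C0 * (NI (W s) (%w. indicator (tball z r) w * ennreal (cmod (g w) powr p))))"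
				unfolding e N_def by (subst ennreal_mult) (auto intro!: mult_left_mono C0(2) g elim)
			also have "... = (NI (W s) (%w. (ennreal (cmod (f2 z) powr p * rho z powr (- N)) * ennreal C0) * (X z w * ennreal (cmod (g w) powr p))))"
				by (subst nn_integral_cmult) (auto simp: X1[OF elim, symmetric] mult.assoc borel_measurable_W)
			also have "... = (NI (W s) (%w. ?F z w))" by (simp only: mult_ac)
			finally show ?case .
		qed
		also have "... = (NI (W s) (%w. (NI (W s) (%z. ?F z w))))"
			by (rule P.Fubini'[symmetric]) (simp add: split_def X_def)
		also have "... <= (NI (W s) (%w. ennreal (C0 * (K * M)) * ennreal (cmod (g w) powr p)))"
		proof (rule nn_integral_mono_AE, use AE_W_tube[of s] in eventually_elim)
			case (elim w)
			have "(NI (W s) (%z. ?F z w)) = (NI (W s) (%z. (ennreal C0 * ennreal (cmod (g w) powr p)) * (X z w * ennreal (cmod (f2 z) powr p * rho z powr (- N)))))"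
				by (simp only: mult_ac)
			also have "... = (ennreal C0 * ennreal (cmod (g w) powr p)) * (NI (W s) (%z. X z w * ennreal (cmod (f2 z) powr p * rho z powr (- N))))"
				by (rule nn_integral_cmult) (simp add: borel_measurable_W)
			also have "... <= (ennreal C0 * ennreal (cmod (g w) powr p)) * ennreal (K * M)"
				by (intro mult_left_mono inner elim) simp
			also have "... = ennreal (C0 * (K * M)) * ennreal (cmod (g w) powr p)"
				using C0 K M0 by (simp add: ennreal_mult[symmetric] mult_ac)
			finally show ?case .
		qed
		also have "... = ennreal (C0 * (K * M)) * (NI (W s) (%w. ennreal (cmod (g w) powr p)))"
			by (rule nn_integral_cmult) (simp add: borel_measurable_W)
		finally show "(NI (W s) (%w. ennreal (cmod (f2 w * g w) powr p))) <= ennreal (C0 * (K * M)) * (NI (W s) (%w. ennreal (cmod (g w) powr p)))" .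
	qed
qed

subsection \<open>Mean oscillation\<close>

text \<open>\<open>rho z powr (n + 1 + s)\<close> stands for the volume of the ball, by
  \<open>emeasure_tball\<close>. The constant \<open>c\<close> is left free instead of being the
  mean value, which makes the condition easier to verify from an approximation of
  \<open>f\<close>.\<close>

definition mean_osc :: "real => real => real => ('n::{finite,linorder} cvec => complex) => bool" where
	"mean_osc s p r f \<longleftrightarrow> (\<exists>M\<ge>0. \<forall>z\<in>tube. \<exists>c.
		 (NI (W s) (%w. indicator (tball z r) w * ennreal (cmod (f w - c) powr p))) <= ennreal (M * rho z powr (real CARD('n) + 1 + s)))"

lemma powr_add_le:
	fixes a b p :: real
	assumes "a >= 0" "b >= 0" "p >= 0"
	shows "(a + b) powr p <= 2 powr p * (a powr p + b powr p)"
proof -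
	have "(a + b) powr p <= (2 * max a b) powr p" using assms by (intro powr_mono2) auto
	also have "... = 2 powr p * (max a b) powr p" by (rule powr_mult)
	also have "(max a b) powr p <= a powr p + b powr p" by (simp add: max_def)
	finally show ?thesis by simp
qed

lemma indicator_tball_measurable:
	assumes "z : tube"
	shows "(indicator (tball z r) :: 'n::{finite,linorder} cvec => ennreal) : BM"
	using tball_borel[OF assms] by (intro borel_measurable_indicator)

lemma nn_integral_tball_add:
	fixes F :: "'n::{finite,linorder} cvec => real"
	assumes z: "z : tube" and [measurable]: "F : BM" and F0: "!!w. F w >= 0" and ab: "a >= 0" "b >= 0"
	shows "(NI (W s) (%w. indicator (tball z r) w * ennreal (a + b * F w)))
		= ennreal a * emeasure (W s) (tball z r) + ennreal b * (NI (W s) (%w. indicator (tball z r) w * ennreal (F w)))"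
proof -
	note T = indicator_tball_measurable[OF z, of r]
	have [simp]: "tball z r : sets borel" by (rule tball_borel[OF z])
	have m: "(%w. indicator (tball z r) w * ennreal (F w)) : borel_measurable (W s)"
		unfolding borel_measurable_W by (intro borel_measurable_times_ennreal T) measurable
	have T': "(indicator (tball z r) :: 'n cvec => ennreal) : borel_measurable (W s)" unfolding borel_measurable_W by (rule T)
	have "(NI (W s) (%w. indicator (tball z r) w * ennreal (a + b * F w)))
		= (NI (W s) (%w. ennreal a * indicator (tball z r) w + ennreal b * (indicator (tball z r) w * ennreal (F w))))"
		using F0 ab by (intro nn_integral_cong) (auto simp: indicator_def ennreal_mult[symmetric] ennreal_plus[symmetric] simp del: ennreal_plus)
	also have "... = (NI (W s) (%w. ennreal a * indicator (tball z r) w)) + (NI (W s) (%w. ennreal b * (indicator (tball z r) w * ennreal (F w))))"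
		using m T' by (intro nn_integral_add) auto
	also have "... = ennreal a * emeasure (W s) (tball z r) + ennreal b * (NI (W s) (%w. indicator (tball z r) w * ennreal (F w)))"
		using m T' by (simp add: nn_integral_cmult)
	finally show ?thesis .
qed

lemma integrable_tball:
	fixes f :: "'n::{finite,linorder} cvec => complex"
	assumes s: "s > -1" and p: "p >= 1" and z: "z : tube" and fm[measurable]: "f : BM"
		and fi: "integrable (W s) (%w. cmod (f w) powr p)"
	shows "integrable (W s) (%w. indicator (tball z r) w * cmod (f w))"
proof (cases "r > 0")
	case True
	obtain v where v: "v > 0" "!!z :: 'n cvec. z : tube ==> emeasure (W s) (tball z r) = ennreal (v * rho z powr (real CARD('n) + 1 + s))"
		using emeasure_tball[OF s True, where 'n='n] by blast
	have [measurable]: "tball z r : sets borel" by (rule tball_borel[OF z])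
	show ?thesis
	proof (rule integrableI_bounded)
		show "(%w. indicator (tball z r) w * cmod (f w)) : borel_measurable (W s)" unfolding borel_measurable_W by measurable
		have "(NI (W s) (%w. ennreal (norm (indicator (tball z r) w * cmod (f w)))))
			<= (NI (W s) (%w. indicator (tball z r) w * ennreal (1 + 1 * cmod (f w) powr p)))"
		proof (rule nn_integral_mono)
			fix w show "ennreal (norm (indicator (tball z r) w * cmod (f w))) <= indicator (tball z r) w * ennreal (1 + 1 * cmod (f w) powr p)"
				using le_add_powr[of "cmod (f w)" 1 p] p by (auto simp: indicator_def intro!: ennreal_leI simp del: ennreal_plus)
		qed
		also have "... = ennreal 1 * emeasure (W s) (tball z r) + ennreal 1 * (NI (W s) (%w. indicator (tball z r) w * ennreal (cmod (f w) powr p)))"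
			by (rule nn_integral_tball_add[OF z]) auto
		also have "... <= emeasure (W s) (tball z r) + (NI (W s) (%w. ennreal (cmod (f w) powr p)))"
			by (intro add_mono) (auto simp: indicator_def intro!: nn_integral_mono)
		also have "... < \<infinity>" using fi by (simp add: v(2)[OF z] integrable_iff_bounded)
		finally show "(NI (W s) (%w. ennreal (norm (indicator (tball z r) w * cmod (f w))))) < \<infinity>" .
	qed
next
	case False
	hence "tball z r = {}" using tball_radius_pos[OF _ z] by blast
	thus ?thesis by simp
qed

text \<open>A cut-off for the ball of radius \<open>r\<close> about \<open>z\<close> that, unlike
  the indicator, is continuous in \<open>z\<close> on the tube; so are the averages against
  it.\<close>

definition bump :: "real => 'n::{finite,linorder} cvec => 'n cvec => real" where
	"bump r z w = (if z : tube \<and> w : tube then max 0 ((cosh r)^2 - FF z w) else 0)"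

lemma bump_bounds: "0 <= bump r z w" "z : tube ==> r > 0 ==> bump r z w <= (cosh r)^2 * indicator (tball z r) w"
proof -
	show "0 <= bump r z w" by (simp add: bump_def)
	assume z: "z : tube" and r: "r > 0"
	show "bump r z w <= (cosh r)^2 * indicator (tball z r) w"
		using z FF_ge_1[OF z, of w] tball_iff[OF z r, of w] by (auto simp: bump_def indicator_def)
qed

lemma bump_measurable [measurable (raw)]:
	assumes [measurable]: "f : borel_measurable M" "g : borel_measurable M"
	shows "(%x. bump r (f x) (g x)) : borel_measurable M"
	unfolding bump_def by measurable

text \<open>Dominated convergence along sequences: once \<open>z\<close> is within distance 1 of
  \<open>a\<close>, all bumps live in the ball of radius \<open>1 + r\<close> about
  \<open>a\<close>.\<close>

lemma continuous_bump_integral: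
	fixes k :: "'n::{finite,linorder} cvec => complex"
	assumes r: "r > 0" and km[measurable]: "k : BM"
		and loc: "!!z R. z : tube ==> integrable (W s) (%w. indicator (tball z R) w * cmod (k w))"
	shows "continuous_on tube (%z. (LINT w|W s. of_real (bump r z w) * k w))"
	unfolding continuous_on_sequentially
proof (intro allI ballI impI, elim conjE)
	fix x :: "nat => 'n cvec" and a assume a: "a : tube" and x: "\<forall>n. x n : tube" "x \<longlonglongrightarrow> a"
	define x' where "x' = (%n. if x n : tball a 1 then x n else a)"
	have x'b: "x' n : tball a 1" for n using center_in_tball[OF a] by (simp add: x'_def)
	have x't: "x' n : tube" for n by (rule tball_in_tube[OF x'b])
	have ev: "\<forall>\<^sub>F n in sequentially. x' n = x n"
		using topological_tendstoD[OF x(2) open_tball[OF a, of 1]] center_in_tball[OF a] by (auto simp: x'_def elim: eventually_mono)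
	have x'l: "x' \<longlonglongrightarrow> a" using x(2) ev tendsto_cong[of x' x sequentially a] by simp
	have "(%n. (LINT w|W s. of_real (bump r (x' n) w) * k w)) \<longlonglongrightarrow> (LINT w|W s. of_real (bump r a w) * k w)"
	proof (rule integral_dominated_convergence[where w="%w. (cosh r)^2 * (indicator (tball a (1 + r)) w * cmod (k w))"])
		show "AE w in W s. (%n. of_real (bump r (x' n) w) * k w) \<longlonglongrightarrow> of_real (bump r a w) * k w"
			using AE_W_tube[of s]
		proof eventually_elim
			case (elim w)
			have "isCont (FF w) a" using continuous_FF[OF elim] a by (simp add: continuous_on_eq_continuous_at)
			hence "(%n. FF w (x' n)) \<longlonglongrightarrow> FF w a" by (rule isCont_tendsto_compose[OF _ x'l])
			hence "(%n. max 0 ((cosh r)^2 - FF w (x' n))) \<longlonglongrightarrow> max 0 ((cosh r)^2 - FF w a)"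
				by (intro tendsto_intros)
			hence "(%n. bump r (x' n) w) \<longlonglongrightarrow> bump r a w"
				using elim a x't by (simp add: bump_def FF_commute[of w])
			thus ?case by (intro tendsto_intros)
		qed
		fix n
		show "AE w in W s. norm (of_real (bump r (x' n) w) * k w) <= (cosh r)^2 * (indicator (tball a (1 + r)) w * cmod (k w))"
		proof (rule AE_I2)
			fix w
			have "tball (x' n) r <= tball a (1 + r)" using x'b[of n] by (intro tball_subset[OF a x't]) (auto simp: tball_def)
			hence "(indicator (tball (x' n) r) w :: real) <= indicator (tball a (1 + r)) w" by (auto simp: indicator_def)
			hence "bump r (x' n) w <= (cosh r)^2 * indicator (tball a (1 + r)) w"
				using bump_bounds(2)[OF x't[of n] r, of w] by (meson mult_left_mono order.trans zero_le_power2)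
			hence "bump r (x' n) w * cmod (k w) <= (cosh r)^2 * indicator (tball a (1 + r)) w * cmod (k w)" by (rule mult_right_mono) simp
			thus "norm (of_real (bump r (x' n) w) * k w) <= (cosh r)^2 * (indicator (tball a (1 + r)) w * cmod (k w))"
				by (simp add: norm_mult bump_bounds(1) mult.assoc)
		qed
		show "(%w. complex_of_real (bump r (x' n) w) * k w) : borel_measurable (W s)"
			unfolding borel_measurable_W by measurable
	next
		show "(%w. complex_of_real (bump r a w) * k w) : borel_measurable (W s)"
			unfolding borel_measurable_W by measurable
		show "integrable (W s) (%w. (cosh r)^2 * (indicator (tball a (1 + r)) w * cmod (k w)))"
			using loc[OF a] by simp
	qed
	moreover have "\<forall>\<^sub>F n in sequentially. (LINT w|W s. of_real (bump r (x' n) w) * k w) = ((%z. (LINT w|W s. of_real (bump r z w) * k w)) \<circ> x) n"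
		using ev by eventually_elim simp
	ultimately show "((%z. (LINT w|W s. of_real (bump r z w) * k w)) \<circ> x) \<longlonglongrightarrow> (LINT w|W s. of_real (bump r a w) * k w)"
		by (rule Lim_transform_eventually)
qed

text \<open>\<open>f1\<close> is the average \<open>A / D\<close> against the bump. Such an average
  is close to any constant that approximates \<open>f\<close> in the mean on the ball, and all balls
  of radius \<open>h = r / 2\<close> about points of \<open>tball z h\<close> lie in
  \<open>tball z r\<close>, so they share one constant.\<close>

lemma mean_osc_imp_decomposition:
	fixes f :: "'n::{finite,linorder} cvec => complex"
	assumes s: "s > -1" and r: "r > 0" and p: "p >= 1" and fm[measurable]: "f : BM"
		and fi: "integrable (W s) (%w. cmod (f w) powr p)" and mo: "mean_osc s p r f"
	obtains f1 M1 M2 where "continuous_on tube f1" "f1 : BM" "M2 >= 0"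
		"!!x y. x : tube ==> y : tball x r ==> cmod (f1 x - f1 y) <= M1"
		"!!z. z : tube ==> (NI (W s) (%w. indicator (tball z r) w * ennreal (cmod (f w - f1 w) powr p)))
			 <= ennreal (M2 * rho z powr (real CARD('n) + 1 + s))"
proof -
	define N where "N = real CARD('n) + 1 + s"
	have N: "N > 0" using s by (simp add: N_def add_pos_pos)
	define h where "h = r / 2"
	have h: "h > 0" "h / 2 > 0" using r by (auto simp: h_def)
	obtain v where v: "v > 0" "!!z :: 'n cvec. z : tube ==> emeasure (W s) (tball z r) = ennreal (v * rho z powr N)"
		unfolding N_def using emeasure_tball[OF s r, where 'n='n] by blast
	obtain v2 where v2: "v2 > 0" "!!z :: 'n cvec. z : tube ==> emeasure (W s) (tball z h) = ennreal (v2 * rho z powr N)"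
		unfolding N_def using emeasure_tball[OF s h(1), where 'n='n] by blast
	obtain v4 where v4: "v4 > 0" "!!z :: 'n cvec. z : tube ==> emeasure (W s) (tball z (h / 2)) = ennreal (v4 * rho z powr N)"
		unfolding N_def using emeasure_tball[OF s h(2), where 'n='n] by blast
	obtain M where M: "M >= 0" "!!z :: 'n cvec. z : tube ==> \<exists>c. (NI (W s) (%w. indicator (tball z r) w * ennreal (cmod (f w - c) powr p))) <= ennreal (M * rho z powr N)"
		using mo unfolding mean_osc_def N_def by blast
	define de where "de = (cosh h)^2 - (cosh (h / 2))\<^sup>2"
	have "cosh (h / 2) < cosh h" using h cosh_real_strict_mono[of "h / 2" h] by simp
	hence de: "de > 0" using power_strict_mono[of "cosh (h / 2)" "cosh h" 2] by (simp add: de_def)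
	have rN: "rho z powr N > 0" if "z : tube" for z :: "'n cvec" using that by (simp add: tube_iff)
	have locf: "integrable (W s) (%w. indicator (tball z R) w * cmod (f w))" if "z : tube" for z R
		by (rule integrable_tball[OF s p that fm fi])
	have loc1: "integrable (W s) (%w. indicator (tball z R) w * cmod (1 :: complex))" if "z : tube" for z :: "'n cvec" and R
	proof (cases "R > 0")
		case True
		obtain u where u: "!!z :: 'n cvec. z : tube ==> emeasure (W s) (tball z R) = ennreal (u * rho z powr (real CARD('n) + 1 + s))"
			by (rule emeasure_tball[OF s True, where 'n='n]) blast
		thus ?thesis using tball_borel[OF that] u[OF that] by (simp add: integrable_indicator_iff)
	next
		case False
		hence "tball z R = {}" using tball_radius_pos[OF _ that] by blast
		thus ?thesis by simp
	qed
	have bint: "integrable (W s) (%w. of_real (bump h z w) * k w)"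
		if z: "z : tube" and km[measurable]: "k : BM" and l: "integrable (W s) (%w. indicator (tball z h) w * cmod (k w))"
		for z and k :: "'n cvec => complex"
	proof (rule Bochner_Integration.integrable_bound[OF integrable_mult_right[OF l, of "(cosh h)^2"]])
		show "(%w. of_real (bump h z w) * k w) : borel_measurable (W s)" unfolding borel_measurable_W by measurable
		show "AE w in W s. norm (of_real (bump h z w) * k w) <= norm ((cosh h)^2 * (indicator (tball z h) w * cmod (k w)))"
		proof (rule AE_I2)
			fix w
			have "bump h z w * cmod (k w) <= (cosh h)^2 * indicator (tball z h) w * cmod (k w)"
				by (rule mult_right_mono[OF bump_bounds(2)[OF z h(1)]]) simp
			thus "norm (of_real (bump h z w) * k w) <= norm ((cosh h)^2 * (indicator (tball z h) w * cmod (k w)))"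
				by (simp add: norm_mult mult.assoc abs_mult bump_bounds(1))
		qed
	qed
	define D where "D = (%z :: 'n cvec. (LINT w|W s. of_real (bump h z w) * (1 :: complex)))"
	define A where "A = (%z. (LINT w|W s. of_real (bump h z w) * f w))"
	\<comment> \<open>On the ball of radius \<open>h / 2\<close> the bump is at least
	  \<open>de\<close>, which bounds the normalising factor from below.\<close>
	have Dlow: "cmod (D z) >= de * v4 * rho z powr N" if z: "z : tube" for z
	proof -
		have i: "integrable (W s) (bump h z)" using integrable_Re[OF bint[OF z _ loc1[OF z]]] by simp
		have "ennreal (de * v4 * rho z powr N) = ennreal de * emeasure (W s) (tball z (h / 2))"
			unfolding v4(2)[OF z] using de v4(1) rN[OF z] by (simp add: ennreal_mult[symmetric] mult.assoc)
		also have "... = (NI (W s) (%w. ennreal de * indicator (tball z (h / 2)) w))"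
			by (rule nn_integral_cmult_indicator[symmetric]) (simp add: tball_borel[OF z])
		also have "... <= (NI (W s) (%w. ennreal (bump h z w)))"
		proof (rule nn_integral_mono)
			fix w show "ennreal de * indicator (tball z (h / 2)) w <= ennreal (bump h z w)"
				using z tball_iff[OF z h(2), of w] by (auto simp: indicator_def bump_def de_def intro!: ennreal_leI)
		qed
		also have "... = ennreal (LINT w|W s. bump h z w)" by (rule nn_integral_eq_integral[OF i]) (simp add: bump_bounds(1))
		finally have "de * v4 * rho z powr N <= (LINT w|W s. bump h z w)"
			by (subst (asm) ennreal_le_iff) (auto intro!: integral_nonneg_AE simp: bump_bounds(1))
		moreover have "D z = of_real (LINT w|W s. bump h z w)" by (simp add: D_def)
		ultimately show ?thesis by simp
	qed
	have Dn: "D z ~= 0" if "z : tube" for z using Dlow[OF that] mult_pos_pos[OF mult_pos_pos[OF de v4(1)] rN[OF that]] by auto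
	define f1 where "f1 = (%z. if z : tube then A z / D z else 0)"
	have cA: "continuous_on tube A" unfolding A_def by (rule continuous_bump_integral[OF h(1) fm locf])
	have cD: "continuous_on tube D" unfolding D_def by (rule continuous_bump_integral[OF h(1) _ loc1]) auto
	have "continuous_on tube (%z. A z / D z)" using cA cD Dn by (intro continuous_intros) auto
	hence c1: "continuous_on tube f1" by (rule continuous_on_eq) (simp add: f1_def)
	have m1[measurable]: "f1 : BM"
	proof -
		have "(%z. indicator tube z *\<^sub>R f1 z) : BM"
			by (rule borel_measurable_continuous_on_indicator[OF _ c1]) simp
		moreover have "(%z. indicator tube z *\<^sub>R f1 z) = f1" by (auto simp: f1_def indicator_def)
		ultimately show ?thesis by simp
	qed
	define B where "B = (%M. (cosh h)^2 * (v2 + M) / (de * v4))"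
	have B: "cmod (f1 z - c) <= B M" if z: "z : tube" and M: "M >= 0"
		and le: "(NI (W s) (%w. indicator (tball z h) w * ennreal (cmod (f w - c) powr p))) <= ennreal (M * rho z powr N)" for z c M
	proof -
		have lc: "integrable (W s) (%w. indicator (tball z h) w * cmod (f w - c))"
		proof (rule Bochner_Integration.integrable_bound[OF Bochner_Integration.integrable_add[OF locf[OF z, of h] integrable_mult_right[OF loc1[OF z, of h], of "cmod c"]]])
			have [measurable]: "tball z h : sets borel" by (rule tball_borel[OF z])
			show "(%w. indicator (tball z h) w * cmod (f w - c)) : borel_measurable (W s)" unfolding borel_measurable_W by measurable
		qed (auto intro!: AE_I2 simp: indicator_def norm_triangle_ineq4)
		have ifc: "integrable (W s) (%w. of_real (bump h z w) * (f w - c))" by (rule bint[OF z _ lc]) measurable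
		have "A z - c * D z = (LINT w|W s. of_real (bump h z w) * (f w - c))"
		proof -
			have "(LINT w|W s. of_real (bump h z w) * (f w - c)) = (LINT w|W s. of_real (bump h z w) * f w - c * (of_real (bump h z w) * 1))"
				by (simp add: algebra_simps)
			also have "... = A z - c * D z"
				unfolding A_def D_def
				using bint[OF z fm locf[OF z]] integrable_mult_right[OF bint[OF z _ loc1[OF z]], of c] by (subst Bochner_Integration.integral_diff) auto
			finally show ?thesis by simp
		qed
		hence "ennreal (cmod (A z - c * D z)) <= (NI (W s) (%w. ennreal (norm (of_real (bump h z w) * (f w - c)))))"
			using integral_norm_bound_ennreal[OF ifc] by simp
		also have "... <= (NI (W s) (%w. indicator (tball z h) w * ennreal ((cosh h)^2 + (cosh h)^2 * cmod (f w - c) powr p)))"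
		proof (rule nn_integral_mono)
			fix w
			have "bump h z w * cmod (f w - c) <= (cosh h)^2 * indicator (tball z h) w * (1 + 1 * cmod (f w - c) powr p)"
				using bump_bounds(1)[of h z w] bump_bounds(2)[OF z h(1), of w] le_add_powr[of "cmod (f w - c)" 1 p] p by (intro mult_mono) auto
			thus "ennreal (norm (of_real (bump h z w) * (f w - c))) <= indicator (tball z h) w * ennreal ((cosh h)^2 + (cosh h)^2 * cmod (f w - c) powr p)"
			proof -
				assume le: "bump h z w * cmod (f w - c) <= (cosh h)^2 * indicator (tball z h) w * (1 + 1 * cmod (f w - c) powr p)"
				have eq: "norm (of_real (bump h z w) * (f w - c)) = bump h z w * cmod (f w - c)" by (simp only: norm_mult norm_of_real abs_of_nonneg[OF bump_bounds(1)])
				show ?thesis unfolding eq using le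
					by (cases "w : tball z h") (simp_all add: ennreal_leI ennreal_neg distrib_left del: ennreal_plus)
			qed
		qed
		also have "... = ennreal ((cosh h)^2) * emeasure (W s) (tball z h) + ennreal ((cosh h)^2) * (NI (W s) (%w. indicator (tball z h) w * ennreal (cmod (f w - c) powr p)))"
			by (rule nn_integral_tball_add[OF z]) auto
		also have "... <= ennreal ((cosh h)^2) * ennreal (v2 * rho z powr N) + ennreal ((cosh h)^2) * ennreal (M * rho z powr N)"
			unfolding v2(2)[OF z] using le by (intro add_mono mult_left_mono) auto
		also have "... = ennreal ((cosh h)^2 * (v2 + M) * rho z powr N)"
			using v2(1) M rN[OF z] by (simp add: ennreal_mult[symmetric] ennreal_plus[symmetric] algebra_simps del: ennreal_plus)
		finally have le1: "cmod (A z - c * D z) <= (cosh h)^2 * (v2 + M) * rho z powr N" using v2(1) M rN[OF z] by simp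
		have "f1 z - c = (A z - c * D z) / D z" using z Dn[OF z] by (simp add: f1_def field_simps)
		hence "cmod (f1 z - c) = cmod (A z - c * D z) / cmod (D z)" by (simp add: norm_divide)
		also have "... <= ((cosh h)^2 * (v2 + M) * rho z powr N) / (de * v4 * rho z powr N)"
			using le1 Dlow[OF z] de v4(1) v2(1) M rN[OF z] by (intro frac_le mult_pos_pos) auto
		also have "... = B M" using rN[OF z] by (simp add: B_def)
		finally show ?thesis .
	qed
	define c where "c = (4 * (cosh h)^2) powr N"
	have c0: "c > 0" by (simp add: c_def)
	define B1 where "B1 = B (M * c)"
	have near: "\<exists>b. (NI (W s) (%w. indicator (tball z r) w * ennreal (cmod (f w - b) powr p))) <= ennreal (M * rho z powr N)
		 \<and> (\<forall>u\<in>tball z h. cmod (f1 u - b) <= B1)" if z: "z : tube" for z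
	proof -
		obtain b where b: "(NI (W s) (%w. indicator (tball z r) w * ennreal (cmod (f w - b) powr p))) <= ennreal (M * rho z powr N)"
			using M(2)[OF z] by blast
		have "cmod (f1 u - b) <= B1" if u: "u : tball z h" for u
		proof -
			have ut: "u : tube" by (rule tball_in_tube[OF u])
			have sub: "tball u h <= tball z r" using u by (intro tball_subset[OF z ut]) (auto simp: tball_def h_def)
			have le1: "(NI (W s) (%w. indicator (tball u h) w * ennreal (cmod (f w - b) powr p))) <= ennreal (M * rho z powr N)"
				by (rule order.trans[OF nn_integral_mono b]) (use sub in \<open>auto simp: indicator_def\<close>)
			have "rho z powr N <= (4 * (cosh h)^2 * rho u) powr N"
				using rho_tball_le[OF u z] z N by (intro powr_mono2) (auto simp: tube_iff)
			hence "rho z powr N <= c * rho u powr N" using ut by (simp add: c_def powr_mult tube_iff)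
			hence "M * rho z powr N <= M * c * rho u powr N" using M(1) mult_left_mono[of _ _ M] by (simp add: mult.assoc)
			from order.trans[OF le1 ennreal_leI[OF this]] show ?thesis
				unfolding B1_def using M(1) c0 by (intro B[OF ut]) auto
		qed
		thus ?thesis using b by blast
	qed
	have near2: "cmod (f1 x - f1 y) <= 2 * B1" if x: "x : tube" and y: "y : tball x h" for x y
	proof -
		obtain b where "\<forall>u\<in>tball x h. cmod (f1 u - b) <= B1" using near[OF x] by blast
		hence "cmod (f1 x - b) <= B1" "cmod (f1 y - b) <= B1" using y center_in_tball[OF x h(1)] by auto
		thus ?thesis using norm_triangle_ineq4[of "f1 x - b" "f1 y - b"] by simp
	qed
	\<comment> \<open>\<open>near2\<close> covers distances below \<open>h = r / 2\<close>; one
	  midpoint doubles this range.\<close>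
	have osc: "cmod (f1 x - f1 y) <= 4 * B1" if x: "x : tube" and y: "y : tball x r" for x y
	proof -
		have "cmod (f1 x - f1 y) <= 2 ^ 1 * (2 * B1)"
		proof (rule tdist_chain[OF x, of _ 1 h])
			show "y : tball x (2 ^ 1 * h)" using y by (simp add: h_def)
		qed (auto intro: near2 tball_in_tube)
		thus ?thesis by simp
	qed
	have B10: "B1 >= 0" using near2[OF bpt_in_tube center_in_tball[OF bpt_in_tube h(1)]] by simp
	\<comment> \<open>\<open>5 * B1\<close> is \<open>B1\<close> for \<open>f1 z - b\<close> plus
	  \<open>4 * B1\<close> for the oscillation of \<open>f1\<close>; \<open>v\<close> comes from the
	  volume of the ball.\<close>
	define M2 where "M2 = 2 powr p * (5 * B1) powr p * v + 2 powr p * M"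
	show ?thesis
	proof (rule that[OF c1 m1 _ osc])
		show "M2 >= 0" using v(1) M(1) by (simp add: M2_def)
		fix z :: "'n cvec" assume z: "z : tube"
		obtain b where b: "(NI (W s) (%w. indicator (tball z r) w * ennreal (cmod (f w - b) powr p))) <= ennreal (M * rho z powr N)"
			"\<forall>u\<in>tball z h. cmod (f1 u - b) <= B1" using near[OF z] by blast
		have bz: "cmod (f1 z - b) <= B1" using b(2) center_in_tball[OF z h(1)] by blast
		have "(NI (W s) (%w. indicator (tball z r) w * ennreal (cmod (f w - f1 w) powr p)))
			<= (NI (W s) (%w. indicator (tball z r) w * ennreal (2 powr p * (5 * B1) powr p + 2 powr p * cmod (f w - b) powr p)))"
		proof (rule nn_integral_mono)
			fix w
			show "indicator (tball z r) w * ennreal (cmod (f w - f1 w) powr p)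
				<= indicator (tball z r) w * ennreal (2 powr p * (5 * B1) powr p + 2 powr p * cmod (f w - b) powr p)"
			proof (cases "w : tball z r")
				case True
				have "cmod (f w - f1 w) <= cmod (f w - b) + cmod (f1 z - b) + cmod (f1 z - f1 w)"
					using norm_triangle_ineq4[of "f w - b" "f1 z - b"] norm_triangle_ineq[of "f w - f1 z" "f1 z - f1 w"] by simp
				hence "cmod (f w - f1 w) <= 5 * B1 + cmod (f w - b)" using bz osc[OF z True] by linarith
				hence "cmod (f w - f1 w) powr p <= (5 * B1 + cmod (f w - b)) powr p" using p by (intro powr_mono2) auto
				also have "... <= 2 powr p * ((5 * B1) powr p + cmod (f w - b) powr p)" using p B10 by (intro powr_add_le) auto
				finally show ?thesis using True by (auto simp: algebra_simps intro!: ennreal_leI simp del: ennreal_plus)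
			qed simp
		qed
		also have "... = ennreal (2 powr p * (5 * B1) powr p) * emeasure (W s) (tball z r) + ennreal (2 powr p) * (NI (W s) (%w. indicator (tball z r) w * ennreal (cmod (f w - b) powr p)))"
			by (rule nn_integral_tball_add[OF z]) auto
		also have "... <= ennreal (2 powr p * (5 * B1) powr p) * ennreal (v * rho z powr N) + ennreal (2 powr p) * ennreal (M * rho z powr N)"
			unfolding v(2)[OF z] using b(1) by (intro add_mono mult_left_mono) auto
		also have "... = ennreal (M2 * rho z powr N)"
			using v(1) M(1) rN[OF z] by (simp add: M2_def ennreal_mult[symmetric] ennreal_plus[symmetric] algebra_simps del: ennreal_plus)
		finally show "(NI (W s) (%w. indicator (tball z r) w * ennreal (cmod (f w - f1 w) powr p))) <= ennreal (M2 * rho z powr (real CARD('n) + 1 + s))"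
			by (simp add: N_def)
	qed
qed

subsection \<open>Boundedness of Hankel operators\<close>

lemma norm_integral_le_AE:
	fixes f :: "'a => 'b::{banach,second_countable_topology}"
	assumes "integrable M f" "integrable M g" "AE x in M. norm (f x) <= g x"
	shows "norm (integral\<^sup>L M f) <= integral\<^sup>L M g"
proof -
	have "norm (integral\<^sup>L M f) <= (LINT x|M. norm (f x))" by (rule Bochner_Integration.integral_norm_bound)
	also have "... <= integral\<^sup>L M g" by (rule integral_mono_AE) (use assms in auto)
	finally show ?thesis .
qed

text \<open>Since \<open>P g = g\<close>, the Hankel function at \<open>z\<close> is
  \<open>(f - f1) * g + P ((f1 z - f1) * g) - P ((f - f1) * g)\<close>. The Carleson embedding
  treats the first term, the Schur kernel with its factor \<open>FF powr ep\<close> the second, and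
  both together the third.\<close>

lemma hankel_estimate:
	fixes f f1 :: "'n::{finite,linorder} cvec => complex"
	assumes al: "al > -1" and s: "s > -1" and r: "r > 0" and p: "1 <= p" and ps: "p * (al + 1) > s + 1"
		and fm[measurable]: "f : BM" and f1m[measurable]: "f1 : BM"
		and osc: "!!x y. x : tube ==> y : tball x r ==> cmod (f1 x - f1 y) <= M1" and M2: "M2 >= 0"
		and f2: "!!z. z : tube ==> (NI (W s) (%w. indicator (tball z r) w * ennreal (cmod (f w - f1 w) powr p)))
			 <= ennreal (M2 * rho z powr (real CARD('n) + 1 + s))"
	obtains C where "C >= 0" "!!g K. holomorphic_Cn g tube ==> g : BM ==> (!!w. w : tube ==> cmod (g w) <= K) ==>
		 integrable (W s) (%w. cmod (g w) powr p) ==>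
		 (NI (W s) (%z. ennreal (cmod (f z * g z - Pk al (%w. f w * g w) z) powr p))) <= ennreal C * (NI (W s) (%z. ennreal (cmod (g z) powr p)))"
proof -
	obtain ep Cs where eps: "ep > 0" and Cs0: "Cs >= 0"
		and si: "!!(h :: 'n cvec => real) z. h : BM ==> (!!w. h w >= 0) ==>
			 integrable (W s) (%w. h w powr p) ==> z : tube ==> integrable (W al) (%w. schur_ker al ep z w * h w)"
		and sb: "!!(h :: 'n cvec => real). h : BM ==> (!!w. h w >= 0) ==>
			 integrable (W s) (%w. h w powr p) ==>
			 (NI (W s) (%z. ennreal ((LINT w|W al. schur_ker al ep z w * h w) powr p))) <= ennreal Cs * (NI (W s) (%w. ennreal (h w powr p)))"
		using schur_test[OF al s p ps, where 'n='n] by blast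
	have "\<exists>Cg\<ge>0. \<forall>z\<in>tube. \<forall>w\<in>tube. cmod (f1 z - f1 w) <= Cg * FF z w powr ep"
		by (rule bounded_oscillation_growth[OF r osc eps]) (auto simp: Bex_def)
	then obtain Cg where Cg: "Cg >= 0" "!!z w. z : tube ==> w : tube ==> cmod (f1 z - f1 w) <= Cg * FF z w powr ep"
		by blast
	have f2m: "(%w. f w - f1 w) : BM" by measurable
	have "\<exists>Cc\<ge>0. \<forall>g. line_hol g tube --> g : BM -->
		(NI (W s) (%w. ennreal (cmod ((f w - f1 w) * g w) powr p))) <= ennreal Cc * (NI (W s) (%w. ennreal (cmod (g w) powr p)))"
		by (rule carleson_embedding[OF s r p f2m M2 f2]) auto
	then obtain Cc where Cc: "Cc >= 0" "!!g. line_hol g tube ==> g : BM ==>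
		(NI (W s) (%w. ennreal (cmod ((f w - f1 w) * g w) powr p))) <= ennreal Cc * (NI (W s) (%w. ennreal (cmod (g w) powr p)))"
		by blast
	define ka where "ka = \<bar>berg_const al CARD('n)\<bar>"
	have ka0: "ka >= 0" by (simp add: ka_def)
	\<comment> \<open>One summand for each of the three terms; \<open>3 powr p\<close> is the price for
	  the power of a sum.\<close>
	define C where "C = 3 powr p * (Cc + (ka * Cg) powr p * Cs + ka powr p * (Cs * Cc))"
	show ?thesis
	proof (rule that[of C])
		show "C >= 0" using Cc(1) Cs0 by (simp add: C_def)
		fix g :: "'n cvec => complex" and K assume gh: "holomorphic_Cn g tube" and gm[measurable]: "g : BM"
			and gK: "!!w. w : tube ==> cmod (g w) <= K" and gi: "integrable (W s) (%w. cmod (g w) powr p)"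
		let ?G = "(NI (W s) (%z. ennreal (cmod (g z) powr p)))"
		have Gfin: "?G < \<infinity>" using gi by (simp add: integrable_iff_bounded)
		define a where "a = (%w. cmod (g w))"
		define b where "b = (%w. cmod ((f w - f1 w) * g w))"
		have am[measurable]: "a : BM" and bm[measurable]: "b : BM"
			unfolding a_def b_def by measurable
		have a0: "a w >= 0" and b0: "b w >= 0" for w by (auto simp: a_def b_def)
		have bG: "(NI (W s) (%w. ennreal (b w powr p))) <= ennreal Cc * ?G"
			unfolding b_def by (rule Cc(2)[OF holomorphic_Cn_imp_line_hol[OF gh open_tube] gm])
		have ai: "integrable (W s) (%w. a w powr p)" using gi by (simp add: a_def)
		have bi: "integrable (W s) (%w. b w powr p)"
		proof (rule integrableI_bounded)
			show "(%w. b w powr p) : borel_measurable (W s)" unfolding borel_measurable_W by measurable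
			have "ennreal Cc * ?G < \<infinity>" using Gfin by (simp add: ennreal_mult_less_top)
			thus "(NI (W s) (%w. ennreal (norm (b w powr p)))) < \<infinity>" using bG by (simp add: le_less_trans)
		qed
		define Sa where "Sa = (%z. (LINT w|W al. schur_ker al ep z w * a w))"
		define Sb where "Sb = (%z. (LINT w|W al. schur_ker al ep z w * b w))"
		interpret sigma_finite_measure "W al :: 'n cvec measure" by (rule sigma_finite_W)
		have [measurable]: "Sa : BM" "Sb : BM"
			unfolding Sa_def Sb_def by (rule borel_measurable_lebesgue_integral, simp add: split_def)+
		have Sa0: "Sa z >= 0" and Sb0: "Sb z >= 0" for z
			unfolding Sa_def Sb_def using a0 b0 by (auto intro!: integral_nonneg_AE)
		have pt: "cmod (f z * g z - Pk al (%w. f w * g w) z) <= b z + ka * Cg * Sa z + ka * Sb z" if z: "z : tube" for z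
		proof -
			define rr where "rr = (%w. rpowr (rho_ker z w) (- (real CARD('n) + 1 + al)))"
			have [measurable]: "rr : BM" unfolding rr_def by measurable
			have rrle: "cmod (rr w) <= cmod (rho_ker z w) powr (- (real CARD('n) + 1 + al))" if "w : tube" for w
				unfolding rr_def using Re_rho_ker_pos[OF z that] by (simp add: cmod_rpowr)
			have rrs: "cmod (rr w) <= schur_ker al ep z w" if "w : tube" for w
				unfolding rr_def using eps by (intro cmod_kernel_le_schur_ker[OF z that]) simp
			have sia: "integrable (W al) (%w. schur_ker al ep z w * a w)" by (rule si[OF am a0 ai z])
			have sib: "integrable (W al) (%w. schur_ker al ep z w * b w)" by (rule si[OF bm b0 bi z])
			have bd1: "AE w in W al. norm (rr w * g w) <= norm (schur_ker al ep z w * a w)"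
				using AE_W_tube[of al] by eventually_elim (use rrs in \<open>auto simp: norm_mult a_def intro!: mult_right_mono\<close>)
			have bd2: "AE w in W al. norm (rr w * ((f w - f1 w) * g w)) <= schur_ker al ep z w * b w"
				using AE_W_tube[of al]
			proof eventually_elim
				case (elim w)
				show ?case unfolding norm_mult[of "rr w"] b_def by (rule mult_right_mono[OF rrs[OF elim]]) simp
			qed
			have bd3: "AE w in W al. norm (rr w * ((f1 z - f1 w) * g w)) <= Cg * (schur_ker al ep z w * a w)"
				using AE_W_tube[of al]
			proof eventually_elim
				case (elim w)
				have "cmod (rr w) * cmod (f1 z - f1 w) <= cmod (rho_ker z w) powr (- (real CARD('n) + 1 + al)) * (Cg * FF z w powr ep)"
					using rrle[OF elim] Cg(2)[OF z elim] by (intro mult_mono) auto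
				hence "cmod (rr w) * cmod (f1 z - f1 w) * a w <= Cg * schur_ker al ep z w * a w"
					by (intro mult_right_mono a0) (simp add: schur_ker_def mult_ac)
				thus ?case by (simp add: norm_mult a_def mult.assoc)
			qed
			have i1: "integrable (W al) (%w. rr w * g w)"
				by (rule Bochner_Integration.integrable_bound[OF sia _ bd1]) (simp add: borel_measurable_W)
			have i2: "integrable (W al) (%w. rr w * ((f w - f1 w) * g w))"
				by (rule Bochner_Integration.integrable_bound[OF sib]) (use bd2 in \<open>auto simp: borel_measurable_W elim!: eventually_mono\<close>)
			have i3: "integrable (W al) (%w. rr w * ((f1 z - f1 w) * g w))"
				by (rule Bochner_Integration.integrable_bound[OF integrable_mult_right[OF sia, of Cg]]) (use bd3 in \<open>auto simp: borel_measurable_W elim!: eventually_mono\<close>)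
			let ?c = "complex_of_real (berg_const al CARD('n))"
			have "(LINT w|W al. rr w * (f w * g w)) = (LINT w|W al. f1 z * (rr w * g w) - rr w * ((f1 z - f1 w) * g w) + rr w * ((f w - f1 w) * g w))"
				by (intro Bochner_Integration.integral_cong) (auto simp: algebra_simps)
			also have "... = f1 z * (LINT w|W al. rr w * g w) - (LINT w|W al. rr w * ((f1 z - f1 w) * g w)) + (LINT w|W al. rr w * ((f w - f1 w) * g w))"
				using i1 i2 i3 by (simp add: integrable_mult_right)
			finally have e: "(LINT w|W al. rr w * (f w * g w)) = f1 z * (LINT w|W al. rr w * g w) - (LINT w|W al. rr w * ((f1 z - f1 w) * g w)) + (LINT w|W al. rr w * ((f w - f1 w) * g w))" .
			have Pk_rr: "Pk al k z = ?c * (LINT w|W al. rr w * k w)" for k by (simp add: Pk_def rr_def)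
			have rep: "?c * (LINT w|W al. rr w * g w) = g z"
				using Pk_reproducing[OF al gh gm gK z] i1 by (simp add: Pk_def rr_def)
			have "f z * g z - Pk al (%w. f w * g w) z = (f z - f1 z) * g z + ?c * (LINT w|W al. rr w * ((f1 z - f1 w) * g w)) - ?c * (LINT w|W al. rr w * ((f w - f1 w) * g w))"
			proof -
				have "Pk al (%w. f w * g w) z = f1 z * (?c * (LINT w|W al. rr w * g w)) - ?c * (LINT w|W al. rr w * ((f1 z - f1 w) * g w)) + ?c * (LINT w|W al. rr w * ((f w - f1 w) * g w))"
					unfolding Pk_rr e by (simp only: distrib_left right_diff_distrib mult.left_commute[of ?c])
				thus ?thesis unfolding rep by (simp only: left_diff_distrib) simp
			qed
			hence "cmod (f z * g z - Pk al (%w. f w * g w) z) <= b z + cmod (?c * (LINT w|W al. rr w * ((f1 z - f1 w) * g w))) + cmod (?c * (LINT w|W al. rr w * ((f w - f1 w) * g w)))"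
				unfolding b_def by (simp only:) (rule order.trans[OF norm_triangle_ineq4 add_right_mono[OF norm_triangle_ineq]])
			also have "cmod (?c * (LINT w|W al. rr w * ((f1 z - f1 w) * g w))) <= ka * (Cg * Sa z)"
			proof -
				have "cmod (LINT w|W al. rr w * ((f1 z - f1 w) * g w)) <= (LINT w|W al. Cg * (schur_ker al ep z w * a w))"
					by (rule norm_integral_le_AE[OF i3 integrable_mult_right[OF sia] bd3])
				thus ?thesis unfolding norm_mult by (intro mult_mono) (auto simp: ka_def Sa_def)
			qed
			also have "cmod (?c * (LINT w|W al. rr w * ((f w - f1 w) * g w))) <= ka * Sb z"
			proof -
				have "cmod (LINT w|W al. rr w * ((f w - f1 w) * g w)) <= (LINT w|W al. schur_ker al ep z w * b w)"
					by (rule norm_integral_le_AE[OF i2 sib bd2])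
				thus ?thesis unfolding norm_mult by (intro mult_mono) (auto simp: ka_def Sb_def)
			qed
			finally show ?thesis by (simp add: mult.assoc)
		qed
		have three: "(x + y + t) powr p <= 3 powr p * (x powr p + y powr p + t powr p)" if "x >= 0" "y >= 0" "t >= 0" for x y t :: real
		proof -
			have "(x + y + t) powr p <= (3 * max x (max y t)) powr p" using that p by (intro powr_mono2) auto
			also have "... = 3 powr p * (max x (max y t)) powr p" by (rule powr_mult)
			also have "(max x (max y t)) powr p <= x powr p + y powr p + t powr p" by (simp add: max_def add_nonneg_nonneg)
			finally show ?thesis by simp
		qed
		have "(NI (W s) (%z. ennreal (cmod (f z * g z - Pk al (%w. f w * g w) z) powr p)))
			<= (NI (W s) (%z. ennreal (3 powr p) * (ennreal (b z powr p) + ennreal ((ka * Cg) powr p) * ennreal (Sa z powr p) + ennreal (ka powr p) * ennreal (Sb z powr p))))"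
		proof (rule nn_integral_mono_AE, use AE_W_tube[of s] in eventually_elim)
			case (elim z)
			have "cmod (f z * g z - Pk al (%w. f w * g w) z) powr p <= (b z + ka * Cg * Sa z + ka * Sb z) powr p"
				using pt[OF elim] p by (intro powr_mono2) auto
			also have "... <= 3 powr p * (b z powr p + (ka * Cg * Sa z) powr p + (ka * Sb z) powr p)"
				using b0 Sa0 Sb0 ka0 Cg(1) by (intro three) auto
			also have "... = 3 powr p * (b z powr p + (ka * Cg) powr p * Sa z powr p + ka powr p * Sb z powr p)"
				using Sa0 Sb0 ka0 Cg(1) by (simp add: powr_mult)
			finally show ?case by (simp add: ennreal_mult[symmetric] ennreal_plus[symmetric] ennreal_leI del: ennreal_plus)
		qed
		also have "... = ennreal (3 powr p) * ((NI (W s) (%z. ennreal (b z powr p))) + ennreal ((ka * Cg) powr p) * (NI (W s) (%z. ennreal (Sa z powr p)))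
			 + ennreal (ka powr p) * (NI (W s) (%z. ennreal (Sb z powr p))))"
			by (simp add: nn_integral_cmult nn_integral_add borel_measurable_W)
		also have "... <= ennreal (3 powr p) * (ennreal Cc * ?G + ennreal ((ka * Cg) powr p) * (ennreal Cs * ?G) + ennreal (ka powr p) * (ennreal Cs * (ennreal Cc * ?G)))"
		proof (intro mult_left_mono add_mono bG)
			show "(NI (W s) (%z. ennreal (Sa z powr p))) <= ennreal Cs * ?G" using sb[OF am a0 ai] by (simp add: Sa_def a_def)
			have "(NI (W s) (%z. ennreal (Sb z powr p))) <= ennreal Cs * (NI (W s) (%w. ennreal (b w powr p)))" using sb[OF bm b0 bi] by (simp add: Sb_def)
			also have "... <= ennreal Cs * (ennreal Cc * ?G)" by (intro mult_left_mono bG) simp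
			finally show "(NI (W s) (%z. ennreal (Sb z powr p))) <= ennreal Cs * (ennreal Cc * ?G)" .
		qed auto
		also have "... = ennreal C * ?G"
		proof -
			have "ennreal C = ennreal (3 powr p) * (ennreal Cc + ennreal ((ka * Cg) powr p) * ennreal Cs + ennreal (ka powr p) * (ennreal Cs * ennreal Cc))"
				unfolding C_def using Cc(1) Cs0 by (simp add: ennreal_mult ennreal_plus)
			thus ?thesis by (simp only: distrib_left distrib_right mult.assoc)
		qed
		finally show "(NI (W s) (%z. ennreal (cmod (f z * g z - Pk al (%w. f w * g w) z) powr p))) <= ennreal C * ?G" .
	qed
qed

section \<open>From bounded Hankel operators to mean oscillation\<close>

lemma line_hol_mult:
	"line_hol f S ==> line_hol g S ==> line_hol (%w. f w * g w) S"
	unfolding line_hol_def by (auto intro!: holomorphic_intros)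

lemma holomorphic_Cn_rpowr_rho_ker:
	assumes "z : tube"
	shows "holomorphic_Cn (%w. rpowr (rho_ker w z) c) tube"
proof (rule holomorphic_Cn_compose_left[OF holomorphic_Cn_rho_ker, of _ "{x. 0 < Re x}"])
	have "(%x. x powr of_real c) holomorphic_on {x. 0 < Re x}"
		by (intro holomorphic_intros) (auto simp: complex_nonpos_Reals_iff)
	thus "(%x. rpowr x c) holomorphic_on {x. 0 < Re x}"
		by (rule holomorphic_transform) (auto simp: rpowr_def)
qed (use assms in \<open>auto simp: open_halfspace_Re_gt Re_rho_ker_pos\<close>)

lemma rpowr_mult_inverse:
	assumes "Re x > 0"
	shows "rpowr x (- c) * rpowr x c = 1"
proof -
	have "x ~= 0" using assms by auto
	thus ?thesis using assms by (simp add: rpowr_def powr_minus)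
qed

text \<open>The test function \<open>g\<close> is a negative power of \<open>rho_ker w z\<close> and
  \<open>q\<close> its inverse. Thus \<open>h k\<close>, the projection of \<open>k * g\<close>
  times \<open>q\<close>, is holomorphic on lines, and \<open>k - h k\<close> is the Hankel function
  times \<open>q\<close>. On balls about \<open>z\<close> the factor \<open>q\<close> is at most a
  power of \<open>rho z\<close>, which matches the norm of \<open>g\<close>.\<close>

lemma hankel_bound_imp_mean_osc:
	fixes f :: "'n::{finite,linorder} cvec => complex"
	assumes al: "al > -1" and s: "s > -1" and r: "r > 0" and p: "1 <= p" and ps: "p * (al + 1) > s + 1"
		and fm[measurable]: "f : BM" and fi: "integrable (W s) (%w. cmod (f w) powr p)" and C0: "C >= 0"
		and H: "!!k g K. k = f \<or> k = (%w. cnj (f w)) ==> holomorphic_Cn g tube ==> g : BM ==> (!!w. w : tube ==> cmod (g w) <= K) ==>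
		 integrable (W s) (%w. cmod (g w) powr p) ==>
		 (NI (W s) (%z. ennreal (cmod (k z * g z - Pk al (%w. k w * g w) z) powr p))) <= ennreal C * (NI (W s) (%z. ennreal (cmod (g z) powr p)))"
	shows "mean_osc s p r f"
proof -
	define N where "N = real CARD('n) + 1 + s"
	have N: "N > 0" using s by (simp add: N_def add_pos_pos)
	obtain CL R0 where CL: "CL >= 0" "R0 > 0" "!!h1 h2 z w I. line_hol h1 tube ==> line_hol h2 tube ==>
		h1 : BM ==> h2 : BM ==> z : tube ==> I > 0 ==>
		(NI (W s :: 'n cvec measure) (%w. indicator (tball z R0) w * ennreal (cmod (h1 w - cnj (h2 w)) powr p)))
			<= ennreal (I * rho z powr N) ==> w : tball z r ==> cmod (h1 w - h1 z) <= CL * I powr (1 / p)"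
		unfolding N_def by (rule pluriharmonic_oscillation[OF s r p, where 'n='n]) blast
	\<comment> \<open>The approximation is needed both on the ball of the conclusion and on the one
	  that the oscillation lemma asks for.\<close>
	define R where "R = max r R0"
	have R: "R > 0" "r <= R" "R0 <= R" using r by (auto simp: R_def)
	\<comment> \<open>\<open>|g|^p\<close> becomes \<open>|rho_ker|\<close> to the power
	  \<open>- (N + 1)\<close>, one above the critical exponent \<open>N\<close>, so its integral is
	  \<open>Cf / rho z\<close>.\<close>
	define m where "m = (N + 1) / p"
	have m: "m > 0" "m * p = N + 1" using N p by (auto simp: m_def)
	have N1: "N + 1 > real CARD('n) + 1 + s" by (simp add: N_def)
	obtain Cf where Cf: "Cf >= 0" "!!z::'n cvec. z : tube ==>
		 (NI (W s) (%w. ennreal (cmod (rho_ker z w) powr (- (N + 1))))) = ennreal (Cf * rho z powr (real CARD('n) + 1 + s - (N + 1)))"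
		by (rule forelli_rudin[OF s N1]) (rule that)
	have ex: "real CARD('n) + 1 + s - (N + 1) = - 1" by (simp add: N_def)
	\<comment> \<open>Invoked for the absolute convergence of the integrals that define
	  \<open>h k\<close>.\<close>
	obtain ep Cs where eps: "ep > 0" and "Cs >= 0"
		and si: "!!(h :: 'n cvec => real) z. h : BM ==> (!!w. h w >= 0) ==>
			 integrable (W s) (%w. h w powr p) ==> z : tube ==> integrable (W al) (%w. schur_ker al ep z w * h w)"
		and "!!(h :: 'n cvec => real). h : BM ==> (!!w. h w >= 0) ==>
			 integrable (W s) (%w. h w powr p) ==>
			 (NI (W s) (%z. ennreal ((LINT w|W al. schur_ker al ep z w * h w) powr p))) <= ennreal Cs * (NI (W s) (%w. ennreal (h w powr p)))"
		using schur_test[OF al s p ps, where 'n='n] by blast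
	obtain v where v: "v > 0" "!!z :: 'n cvec. z : tube ==> emeasure (W s) (tball z r) = ennreal (v * rho z powr N)"
		unfolding N_def using emeasure_tball[OF s r, where 'n='n] by blast
	define c where "c = 2 * (cosh R)^2"
	have c0: "c > 0" by (simp add: c_def)
	define I1 where "I1 = c powr (N + 1) * (C * Cf)"
	have I10: "I1 >= 0" using C0 Cf(1) by (simp add: I1_def)
	define I where "I = 2 powr p * (2 * I1) + 1"
	have I: "I > 0" using I10 by (simp add: I_def add_nonneg_pos)
	define B where "B = CL * I powr (1 / p)"
	have B0: "B >= 0" using CL(1) by (simp add: B_def)
	define M where "M = 2 powr p * B powr p * v + 2 powr p * I1"
	have M0: "M >= 0" using I10 v(1) by (simp add: M_def)
	show ?thesis
		unfolding mean_osc_def N_def[symmetric]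
	proof (intro exI[of _ M] conjI M0 ballI)
		fix z :: "'n cvec" assume z: "z : tube"
		have rz: "rho z > 0" using z by (simp add: tube_iff)
		define g where "g = (%w. rpowr (rho_ker w z) (- m))"
		have gm[measurable]: "g : BM" unfolding g_def by measurable
		have gh: "holomorphic_Cn g tube" unfolding g_def by (rule holomorphic_Cn_rpowr_rho_ker[OF z])
		have gn: "cmod (g w) = cmod (rho_ker z w) powr (- m)" if "w : tube" for w
			using Re_rho_ker_pos[OF that z] by (simp add: g_def cmod_rpowr cmod_rho_ker_commute[of w])
		have gK: "cmod (g w) <= (rho z / 2) powr (- m)" if w: "w : tube" for w
		proof -
			have "rho z / 2 <= cmod (rho_ker z w)" using cmod_rho_ker_ge[of z w] w by (simp add: tube_iff)
			thus ?thesis unfolding gn[OF w] using rz m by (intro powr_mono2') auto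
		qed
		have gp: "cmod (g w) powr p = cmod (rho_ker z w) powr (- (N + 1))" if "w : tube" for w
			unfolding gn[OF that] using m(2) by (simp add: powr_powr)
		have gint: "(NI (W s) (%w. ennreal (cmod (g w) powr p))) = ennreal (Cf * rho z powr (- 1))"
		proof -
			have "(NI (W s) (%w. ennreal (cmod (g w) powr p))) = (NI (W s) (%w. ennreal (cmod (rho_ker z w) powr (- (N + 1)))))"
				by (rule nn_integral_cong_AE, use AE_W_tube[of s] in eventually_elim) (simp add: gp)
			thus ?thesis using Cf(2)[OF z] unfolding ex by simp
		qed
		have gi: "integrable (W s) (%w. cmod (g w) powr p)"
			by (rule integrableI_bounded) (auto simp: gint borel_measurable_W)
		define q where "q = (%w. rpowr (rho_ker w z) m)"
		have qm[measurable]: "q : BM" unfolding q_def by measurable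
		have gq: "g w * q w = 1" if "w : tube" for w
			unfolding g_def q_def by (rule rpowr_mult_inverse[OF Re_rho_ker_pos[OF that z]])
		have qh: "line_hol q tube"
			unfolding q_def by (rule holomorphic_Cn_imp_line_hol[OF holomorphic_Cn_rpowr_rho_ker[OF z] open_tube])
		have qle: "cmod (q w) <= (c * rho z) powr m" if w: "w : tball z R" for w
		proof -
			have "cmod (q w) = cmod (rho_ker z w) powr m"
				using Re_rho_ker_pos[OF tball_in_tube[OF w] z] by (simp add: q_def cmod_rpowr cmod_rho_ker_commute[of w])
			also have "... <= (c * rho z) powr m"
				using cmod_rho_ker_tball_le_rho[OF w z] m by (intro powr_mono2) (auto simp: c_def)
			finally show ?thesis .
		qed
		define h where "h = (%k w. Pk al (%w. k w * g w) w * q w)"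
		have hm: "h k : BM" if km: "k : BM" for k
		proof -
			have "(%w. k w * g w) : BM" using km by measurable
			thus ?thesis unfolding h_def by measurable
		qed
		have hh: "line_hol (h k) tube" if km[measurable]: "k : BM" and ki: "integrable (W s) (%w. cmod (k w) powr p)" for k
			unfolding h_def
		proof (rule line_hol_mult[OF line_hol_Pk[OF al] qh])
			show kgm[measurable]: "(%w. k w * g w) : BM" by measurable
			have kgi: "integrable (W s) (%w. cmod (k w * g w) powr p)"
			proof (rule Bochner_Integration.integrable_bound[OF integrable_mult_right[OF ki, of "((rho z / 2) powr (- m)) powr p"]])
				show "(%w. cmod (k w * g w) powr p) : borel_measurable (W s)" unfolding borel_measurable_W by measurable
				show "AE w in W s. norm (cmod (k w * g w) powr p) <= norm (((rho z / 2) powr (- m)) powr p * cmod (k w) powr p)"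
					using AE_W_tube[of s]
				proof eventually_elim
					case (elim w)
					have "cmod (k w * g w) powr p = cmod (g w) powr p * cmod (k w) powr p" by (simp add: norm_mult powr_mult)
					also have "... <= ((rho z / 2) powr (- m)) powr p * cmod (k w) powr p"
						using gK[OF elim] p by (intro mult_right_mono powr_mono2) auto
					finally show ?case by simp
				qed
			qed
			fix u :: "'n cvec" assume u: "u : tube"
			have "integrable (W al) (%w. schur_ker al ep u w * cmod (k w * g w))"
			proof (rule si[OF _ _ kgi u])
				show "(%w. cmod (k w * g w)) : BM" by measurable
			qed simp
			thus "integrable (W al) (%w. rpowr (rho_ker u w) (- (real CARD('n) + 1 + al)) * (k w * g w))"
			proof (rule Bochner_Integration.integrable_bound)
				show "(%w. rpowr (rho_ker u w) (- (real CARD('n) + 1 + al)) * (k w * g w)) : borel_measurable (W al)"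
					unfolding borel_measurable_W by measurable
				show "AE w in W al. norm (rpowr (rho_ker u w) (- (real CARD('n) + 1 + al)) * (k w * g w)) <= norm (schur_ker al ep u w * cmod (k w * g w))"
					using AE_W_tube[of al]
				proof eventually_elim
					case (elim w)
					have "cmod (rpowr (rho_ker u w) (- (real CARD('n) + 1 + al))) <= schur_ker al ep u w"
						using eps by (intro cmod_kernel_le_schur_ker[OF u elim]) simp
					hence "cmod (rpowr (rho_ker u w) (- (real CARD('n) + 1 + al))) * cmod (k w * g w) <= schur_ker al ep u w * cmod (k w * g w)"
						by (rule mult_right_mono) simp
					thus ?case by (simp add: norm_mult abs_mult)
				qed
			qed
		qed
		have hb: "(NI (W s) (%w. indicator (tball z R) w * ennreal (cmod (k w - h k w) powr p))) <= ennreal (I1 * rho z powr N)"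
			if k: "k = f \<or> k = (%w. cnj (f w))" for k
		proof -
			have km[measurable]: "k : BM" using k by (auto intro: cnj_measurable[OF fm])
			let ?D = "%w. k w * g w - Pk al (%w. k w * g w) w"
			have [measurable]: "?D : BM" by measurable
			have "(NI (W s) (%w. indicator (tball z R) w * ennreal (cmod (k w - h k w) powr p)))
				<= (NI (W s) (%w. ennreal ((c * rho z) powr (N + 1)) * ennreal (cmod (?D w) powr p)))"
			proof (rule nn_integral_mono)
				fix w
				show "indicator (tball z R) w * ennreal (cmod (k w - h k w) powr p) <= ennreal ((c * rho z) powr (N + 1)) * ennreal (cmod (?D w) powr p)"
				proof (cases "w : tball z R")
					case True
					have "k w - h k w = ?D w * q w" using gq[OF tball_in_tube[OF True]] by (simp add: h_def algebra_simps)
					hence "cmod (k w - h k w) powr p = cmod (q w) powr p * cmod (?D w) powr p" by (simp add: norm_mult powr_mult)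
					also have "... <= ((c * rho z) powr m) powr p * cmod (?D w) powr p"
						using qle[OF True] p by (intro mult_right_mono powr_mono2) auto
					also have "((c * rho z) powr m) powr p = (c * rho z) powr (N + 1)" using m(2) by (simp add: powr_powr)
					finally show ?thesis using True by (simp add: ennreal_mult[symmetric] ennreal_leI)
				qed simp
			qed
			also have "... = ennreal ((c * rho z) powr (N + 1)) * (NI (W s) (%w. ennreal (cmod (?D w) powr p)))"
				by (rule nn_integral_cmult) (simp add: borel_measurable_W)
			also have "... <= ennreal ((c * rho z) powr (N + 1)) * (ennreal C * ennreal (Cf * rho z powr (- 1)))"
				using H[OF k gh gm gK gi] unfolding gint by (intro mult_left_mono) auto
			also have "... = ennreal (I1 * rho z powr N)"
			proof -
				have "(c * rho z) powr (N + 1) * (C * (Cf * rho z powr (- 1))) = I1 * (rho z powr (N + 1) * rho z powr (- 1))"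
					using rz c0 by (simp add: I1_def powr_mult mult_ac)
				also have "rho z powr (N + 1) * rho z powr (- 1) = rho z powr N" by (simp only: powr_add[symmetric]) simp
				finally show ?thesis using C0 Cf(1) rz by (simp add: ennreal_mult[symmetric])
			qed
			finally show ?thesis .
		qed
		let ?cf = "%w. cnj (f w)"
		have cfm[measurable]: "?cf : BM" by (rule cnj_measurable[OF fm])
		have cfi: "integrable (W s) (%w. cmod (?cf w) powr p)" using fi by simp
		note h1m[measurable] = hm[OF fm] and h2m[measurable] = hm[OF cfm]
		note h1h = hh[OF fm fi] and h2h = hh[OF cfm cfi]
		have TR: "(indicator (tball z R) :: 'n cvec => ennreal) : BM" by (rule indicator_tball_measurable[OF z])
		\<comment> \<open>\<open>h f\<close> approximates \<open>f\<close>, and so does the conjugate of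
		  \<open>h ?cf\<close>, because conjugation preserves the distance. Hence their difference is
		  small in the mean, although neither has been compared with a constant yet.\<close>
		have "(NI (W s) (%w. indicator (tball z R0) w * ennreal (cmod (h f w - cnj (h ?cf w)) powr p)))
			<= (NI (W s) (%w. ennreal (2 powr p) * (indicator (tball z R) w * ennreal (cmod (f w - h f w) powr p)) + ennreal (2 powr p) * (indicator (tball z R) w * ennreal (cmod (?cf w - h ?cf w) powr p))))"
		proof (rule nn_integral_mono)
			fix w
			show "indicator (tball z R0) w * ennreal (cmod (h f w - cnj (h ?cf w)) powr p)
				<= ennreal (2 powr p) * (indicator (tball z R) w * ennreal (cmod (f w - h f w) powr p)) + ennreal (2 powr p) * (indicator (tball z R) w * ennreal (cmod (?cf w - h ?cf w) powr p))"
			proof (cases "w : tball z R0")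
				case True
				hence wR: "w : tball z R" using R tball_mono by blast
				have e: "cmod (?cf w - h ?cf w) = cmod (f w - cnj (h ?cf w))"
					using complex_mod_cnj[of "f w - cnj (h ?cf w)"] by simp
				have "cmod (h f w - cnj (h ?cf w)) <= cmod (f w - h f w) + cmod (?cf w - h ?cf w)"
					unfolding e using norm_triangle_ineq4[of "f w - cnj (h ?cf w)" "f w - h f w"] by simp
				hence "cmod (h f w - cnj (h ?cf w)) powr p <= (cmod (f w - h f w) + cmod (?cf w - h ?cf w)) powr p"
					using p by (intro powr_mono2) auto
				also have "... <= 2 powr p * (cmod (f w - h f w) powr p + cmod (?cf w - h ?cf w) powr p)"
					using p by (intro powr_add_le) auto
				finally show ?thesis using True wR
					by (simp add: ennreal_mult[symmetric] ennreal_plus[symmetric] ennreal_leI distrib_left del: ennreal_plus)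
			qed simp
		qed
		also have "... = ennreal (2 powr p) * (NI (W s) (%w. indicator (tball z R) w * ennreal (cmod (f w - h f w) powr p))) + ennreal (2 powr p) * (NI (W s) (%w. indicator (tball z R) w * ennreal (cmod (?cf w - h ?cf w) powr p)))"
		proof -
			have m1: "(%w. indicator (tball z R) w * ennreal (cmod (f w - h f w) powr p)) : borel_measurable (W s)"
				unfolding borel_measurable_W by (intro borel_measurable_times_ennreal TR) measurable
			have m2: "(%w. indicator (tball z R) w * ennreal (cmod (?cf w - h ?cf w) powr p)) : borel_measurable (W s)"
				unfolding borel_measurable_W by (intro borel_measurable_times_ennreal TR) measurable
			show ?thesis
				unfolding nn_integral_cmult[OF m1, symmetric] nn_integral_cmult[OF m2, symmetric]
				using m1 m2 by (intro nn_integral_add) auto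
		qed
		also have "... <= ennreal (2 powr p) * ennreal (I1 * rho z powr N) + ennreal (2 powr p) * ennreal (I1 * rho z powr N)"
			by (intro add_mono mult_left_mono hb) auto
		also have "... = ennreal (2 powr p * (2 * I1) * rho z powr N)"
			using I10 by (simp add: ennreal_mult[symmetric] ennreal_plus[symmetric] del: ennreal_plus)
		also have "... <= ennreal (I * rho z powr N)"
			by (intro ennreal_leI mult_right_mono) (auto simp: I_def)
		finally have le: "(NI (W s) (%w. indicator (tball z R0) w * ennreal (cmod (h f w - cnj (h ?cf w)) powr p))) <= ennreal (I * rho z powr N)" .
		have osc: "cmod (h f w - h f z) <= B" if "w : tball z r" for w
			unfolding B_def by (rule CL(3)[OF h1h h2h h1m h2m z I le that])
		\<comment> \<open>As \<open>h f\<close> is almost constant on the ball, its value at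
		  \<open>z\<close> can serve as the constant for \<open>f\<close>.\<close>
		have "(NI (W s) (%w. indicator (tball z r) w * ennreal (cmod (f w - h f z) powr p)))
			<= (NI (W s) (%w. indicator (tball z r) w * ennreal (2 powr p * B powr p + 2 powr p * cmod (f w - h f w) powr p)))"
		proof (rule nn_integral_mono)
			fix w
			show "indicator (tball z r) w * ennreal (cmod (f w - h f z) powr p) <= indicator (tball z r) w * ennreal (2 powr p * B powr p + 2 powr p * cmod (f w - h f w) powr p)"
			proof (cases "w : tball z r")
				case True
				have "cmod (f w - h f z) <= B + cmod (f w - h f w)"
					using osc[OF True] norm_triangle_ineq[of "f w - h f w" "h f w - h f z"] by simp
				hence "cmod (f w - h f z) powr p <= (B + cmod (f w - h f w)) powr p" using p by (intro powr_mono2) auto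
				also have "... <= 2 powr p * (B powr p + cmod (f w - h f w) powr p)" using p B0 by (intro powr_add_le) auto
				finally show ?thesis using True by (auto simp: algebra_simps intro!: ennreal_leI simp del: ennreal_plus)
			qed simp
		qed
		also have "... = ennreal (2 powr p * B powr p) * emeasure (W s) (tball z r) + ennreal (2 powr p) * (NI (W s) (%w. indicator (tball z r) w * ennreal (cmod (f w - h f w) powr p)))"
			by (rule nn_integral_tball_add[OF z]) auto
		also have "... <= ennreal (2 powr p * B powr p) * ennreal (v * rho z powr N) + ennreal (2 powr p) * ennreal (I1 * rho z powr N)"
		proof (intro add_mono mult_left_mono)
			have "(NI (W s) (%w. indicator (tball z r) w * ennreal (cmod (f w - h f w) powr p))) <= (NI (W s) (%w. indicator (tball z R) w * ennreal (cmod (f w - h f w) powr p)))"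
				using tball_mono[OF R(2), of z] by (intro nn_integral_mono) (auto simp: indicator_def)
			also have "... <= ennreal (I1 * rho z powr N)" by (rule hb) simp
			finally show "(NI (W s) (%w. indicator (tball z r) w * ennreal (cmod (f w - h f w) powr p))) <= ennreal (I1 * rho z powr N)" .
		qed (auto simp: v(2)[OF z])
		also have "... = ennreal (M * rho z powr N)"
			using v(1) I10 by (simp add: M_def ennreal_mult[symmetric] ennreal_plus[symmetric] algebra_simps del: ennreal_plus)
		finally show "\<exists>c. (NI (W s) (%w. indicator (tball z r) w * ennreal (cmod (f w - c) powr p))) <= ennreal (M * rho z powr N)" by blast
	qed
qed

subsection \<open>Borel representatives\<close>

text \<open>The functions of the theorem are Lebesgue measurable on the tube and arbitrary
  elsewhere, whereas the estimates concern Borel functions on the whole space. No weight is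
  mentioned, so that one representative serves both \<open>V s\<close> and
  \<open>V al\<close>.\<close>

definition borel_rep :: "('n::{finite,linorder} cvec => complex) => ('n cvec => complex) => bool" where
	"borel_rep f f' \<longleftrightarrow> f : borel_measurable (lebesgue_on tube) \<and> f' : BM
		 \<and> (AE w in lebesgue_on tube. f w = f' w)"

lemma borel_measurable_V: "borel_measurable (V s) = borel_measurable (lebesgue_on tube)"
	by (rule measurable_cong_sets) (simp_all add: sets_V)

lemma borel_imp_V:
	assumes "f : BM"
	shows "f : borel_measurable (V s)"
	using measurable_compose[OF measurable_id_V assms] by simp

lemma AE_lebesgue_on_imp_V:
	assumes "AE w in lebesgue_on tube. P w"
	shows "AE w in V s. P w"
	unfolding V_def AE_density[OF rho_powr_measurable_lebesgue_on] using assms by eventually_elim simp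

lemma ex_borel_rep:
	fixes f :: "'n::{finite,linorder} cvec => complex"
	assumes "f : borel_measurable (V s)"
	obtains f' where "borel_rep f f'"
proof -
	have f: "f : borel_measurable (lebesgue_on tube)" using assms by (simp add: borel_measurable_V)
	define F where "F = (%x. if x : tube then f x else 0)"
	have F: "F : borel_measurable (completion lborel)" unfolding F_def by (rule borel_measurable_if_I[OF f]) simp
	have "(%x. Re (F x)) : borel_measurable (completion lborel)" "(%x. Im (F x)) : borel_measurable (completion lborel)"
		using F by measurable
	from this[THEN completion_ex_borel_measurable_real] obtain a b where
		ab: "a : borel_measurable lborel" "b : borel_measurable lborel"
		and ae: "AE x in lborel. Re (F x) = a x" "AE x in lborel. Im (F x) = b x" by blast
	have [measurable]: "a : BM" "b : BM" using ab by auto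
	define f' where "f' = (%x. of_real (a x) + \<i> * of_real (b x))"
	have "f' : BM" unfolding f'_def by measurable
	moreover have "AE x in lborel. x : tube --> f x = f' x"
		using ae by eventually_elim (auto simp: F_def f'_def complex_eq_iff)
	hence "AE x in lebesgue. x : tube --> f x = f' x" by (rule AE_completion)
	hence "AE x in lebesgue_on tube. f x = f' x" by (simp add: AE_restrict_space_iff)
	ultimately show ?thesis using that f by (simp add: borel_rep_def)
qed

lemma borel_rep_cnj: "borel_rep f f' ==> borel_rep (%w. cnj (f w)) (%w. cnj (f' w))"
	unfolding borel_rep_def by (auto intro: cnj_measurable elim: eventually_mono)

text \<open>\<open>F\<close> may depend on the point besides the value, so that kernels, indicators
  and Borel factors can be carried along.\<close>

lemma nn_integral_V_rep:
	assumes f: "borel_rep f f'" and F[measurable]: "case_prod F : borel_measurable (borel \<Otimes>\<^sub>M borel)"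
	shows "(NI (V s) (%w. F w (f w))) = (NI (W s) (%w. F w (f' w)))"
proof -
	have [measurable]: "f' : BM" using f by (simp add: borel_rep_def)
	have "AE w in V s. F w (f w) = F w (f' w)"
		by (rule AE_lebesgue_on_imp_V) (use f in \<open>auto simp: borel_rep_def elim!: eventually_mono\<close>)
	hence "(NI (V s) (%w. F w (f w))) = (NI (V s) (%w. F w (f' w)))" by (rule nn_integral_cong_AE)
	also have "... = (NI (W s) (%w. F w (f' w)))" by (rule emeasure_V_lborel) measurable
	finally show ?thesis .
qed

lemma integral_V_rep:
	fixes F :: "'n::{finite,linorder} cvec => complex => 'b::{banach,second_countable_topology}"
	assumes f: "borel_rep f f'" and F[measurable]: "case_prod F : borel_measurable (borel \<Otimes>\<^sub>M borel)"
	shows "(LINT w|V s. F w (f w)) = (LINT w|W s. F w (f' w))"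
		and "integrable (V s) (%w. F w (f w)) \<longleftrightarrow> integrable (W s) (%w. F w (f' w))"
		and "(%w. F w (f w)) : borel_measurable (V s)"
proof -
	have f'[measurable]: "f' : BM" and fm: "f : borel_measurable (V s)"
		using f by (auto simp: borel_rep_def borel_measurable_V)
	have "(%w. (w, f w)) : V s \<rightarrow>\<^sub>M borel \<Otimes>\<^sub>M borel" by (rule measurable_Pair[OF measurable_id_V fm])
	from measurable_compose[OF this F] show m: "(%w. F w (f w)) : borel_measurable (V s)" by simp
	have B: "(%w. F w (f' w)) : BM" by measurable
	have ae: "AE w in V s. F w (f w) = F w (f' w)"
		by (rule AE_lebesgue_on_imp_V) (use f in \<open>auto simp: borel_rep_def elim!: eventually_mono\<close>)
	show "(LINT w|V s. F w (f w)) = (LINT w|W s. F w (f' w))"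
		using integral_cong_AE[OF m borel_imp_V[OF B] ae] integral_V(1)[OF B] by simp
	show "integrable (V s) (%w. F w (f w)) \<longleftrightarrow> integrable (W s) (%w. F w (f' w))"
		using integrable_cong_AE[OF m borel_imp_V[OF B] ae] integral_V(2)[OF B] by simp
qed

lemma emeasure_V_tball:
	assumes "z : tube"
	shows "tball z r : sets (V s)" "emeasure (V s) (tball z r) = emeasure (W s) (tball z r)"
proof -
	have T[measurable]: "tball z r : sets borel" by (rule tball_borel[OF assms])
	show S: "tball z r : sets (V s)"
		unfolding sets_V sets_restrict_space using tball_subset_tube by (intro image_eqI[of _ _ "tball z r"]) auto
	have "emeasure (V s) (tball z r) = (NI (V s) (%w. indicator (tball z r) w))" using S by simp
	also have "... = (NI (W s) (%w. indicator (tball z r) w))" by (rule emeasure_V_lborel) measurable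
	finally show "emeasure (V s) (tball z r) = emeasure (W s) (tball z r)" by simp
qed

lemma mean_osc_cnj: "mean_osc s p r f ==> mean_osc s p r (%w. cnj (f w))"
proof -
	assume "mean_osc s p r f"
	then obtain M where M: "M >= 0" "\<forall>z\<in>tube. \<exists>c. (NI (W s) (%w. indicator (tball z r) w * ennreal (cmod (f w - c) powr p))) <= ennreal (M * rho z powr (real CARD('a) + 1 + s))"
		unfolding mean_osc_def by blast
	show ?thesis
		unfolding mean_osc_def
	proof (intro exI[of _ M] conjI M(1) ballI)
		fix z :: "'a cvec" assume "z : tube"
		then obtain c where c: "(NI (W s) (%w. indicator (tball z r) w * ennreal (cmod (f w - c) powr p))) <= ennreal (M * rho z powr (real CARD('a) + 1 + s))"
			using M(2) by blast
		have "cmod (cnj (f w) - cnj c) = cmod (f w - c)" for w using complex_mod_cnj[of "f w - c"] by simp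
		thus "\<exists>c. (NI (W s) (%w. indicator (tball z r) w * ennreal (cmod (cnj (f w) - c) powr p))) <= ennreal (M * rho z powr (real CARD('a) + 1 + s))"
			using c by (intro exI[of _ "cnj c"]) simp
	qed
qed

text \<open>A constant that is good in the mean lies within \<open>1 + M / v\<close> of the average
  over the ball. The free constant of \<open>mean_osc\<close> may therefore be replaced by the
  average, with a larger bound.\<close>

lemma BMO_iff_mean_osc:
	fixes f f' :: "'n::{finite,linorder} cvec => complex"
	assumes al: "al > -1" and s: "s > -1" and r: "r > 0" and p: "p >= 1" and f: "f : Lp s p" and rep: "borel_rep f f'"
	shows "f : BMO al s p r \<longleftrightarrow> mean_osc s p r f'"
proof -
	define N where "N = real CARD('n) + 1 + s"
	have f'[measurable]: "f' : BM" using rep by (simp add: borel_rep_def)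
	have f'i: "integrable (W s) (%w. cmod (f' w) powr p)"
		using f integral_V_rep(2)[OF rep, of "%_ x. cmod x powr p" s] by (simp add: Lp_def split_def)
	obtain v where v: "v > 0" "!!z :: 'n cvec. z : tube ==> emeasure (W s) (tball z r) = ennreal (v * rho z powr N)"
		unfolding N_def using emeasure_tball[OF s r, where 'n='n] by blast
	have rN: "rho z powr N > 0" if "z : tube" for z :: "'n cvec" using that by (simp add: tube_iff)
	have mV: "measure (V s) (tball z r) = v * rho z powr N" if z: "z : tube" for z :: "'n cvec"
		using v(1) rN[OF z] by (simp add: measure_def emeasure_V_tball(2)[OF z] v(2)[OF z])
	define X where "X = (%z c. (NI (W s) (%w. indicator (tball z r) w * ennreal (cmod (f' w - c) powr p))))"
	have Xadd: "X z c <= ennreal (2 powr p * cmod (b - c) powr p) * ennreal (v * rho z powr N) + ennreal (2 powr p) * X z b"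
		if z: "z : tube" for z b c
	proof -
		have "X z c <= (NI (W s) (%w. indicator (tball z r) w * ennreal (2 powr p * cmod (b - c) powr p + 2 powr p * cmod (f' w - b) powr p)))"
			unfolding X_def
		proof (intro nn_integral_mono mult_left_mono ennreal_leI)
			fix w
			have "cmod (f' w - c) <= cmod (b - c) + cmod (f' w - b)" using norm_triangle_ineq[of "f' w - b" "b - c"] by simp
			hence "cmod (f' w - c) powr p <= (cmod (b - c) + cmod (f' w - b)) powr p" using p by (intro powr_mono2) auto
			also have "... <= 2 powr p * (cmod (b - c) powr p + cmod (f' w - b) powr p)" using p by (intro powr_add_le) auto
			finally show "cmod (f' w - c) powr p <= 2 powr p * cmod (b - c) powr p + 2 powr p * cmod (f' w - b) powr p"
				by (simp add: distrib_left)
		qed simp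
		also have "... = ennreal (2 powr p * cmod (b - c) powr p) * emeasure (W s) (tball z r) + ennreal (2 powr p) * X z b"
			unfolding X_def by (rule nn_integral_tball_add[OF z]) auto
		finally show ?thesis by (simp add: v(2)[OF z])
	qed
	have X0: "X z 0 < \<infinity>" for z
	proof -
		have "X z 0 <= (NI (W s) (%w. ennreal (cmod (f' w) powr p)))"
			unfolding X_def by (intro nn_integral_mono) (auto simp: indicator_def)
		also have "... < \<infinity>" using f'i by (simp add: integrable_iff_bounded)
		finally show ?thesis .
	qed
	\<comment> \<open>Finiteness lets the Bochner integral in \<open>MO\<close>, which would be 0 for a
	  nonintegrable function, stand for the value of \<open>X\<close>.\<close>
	have Xfin: "X z c < \<infinity>" if z: "z : tube" for z c
		using Xadd[OF z, of c 0] X0[of z] by (auto simp: ennreal_mult_less_top intro: le_less_trans)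
	define avg where "avg = ball_avg al s r f"
	have avg: "avg z = (LINT w|W s. indicator (tball z r) w *\<^sub>R f' w) / of_real (v * rho z powr N)" if z: "z : tube" for z
	proof -
		have [measurable]: "tball z r : sets borel" by (rule tball_borel[OF z])
		have "(LINT w|V s. indicator (tball z r) w *\<^sub>R f w) = (LINT w|W s. indicator (tball z r) w *\<^sub>R f' w)"
			by (rule integral_V_rep(1)[OF rep, of "%w x. indicator (tball z r) w *\<^sub>R x"]) measurable
		thus ?thesis by (simp add: avg_def ball_avg_def set_lebesgue_integral_def bergman_ball_eq[OF al z] tball_def[symmetric] mV[OF z])
	qed
	have MO: "MO al s p r f z = (enn2real (X z (avg z)) / (v * rho z powr N)) powr (1 / p)" if z: "z : tube" for z
	proof -
		have [measurable]: "tball z r : sets borel" by (rule tball_borel[OF z])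
		have "(LINT w|V s. indicator (tball z r) w *\<^sub>R cmod (f w - avg z) powr p) = (LINT w|W s. indicator (tball z r) w *\<^sub>R cmod (f' w - avg z) powr p)"
			by (rule integral_V_rep(1)[OF rep, of "%w x. indicator (tball z r) w *\<^sub>R cmod (x - avg z) powr p"]) measurable
		also have "... = enn2real (NI (W s) (%w. ennreal (indicator (tball z r) w *\<^sub>R cmod (f' w - avg z) powr p)))"
			by (rule integral_eq_nn_integral) (auto simp: borel_measurable_W)
		also have "(NI (W s) (%w. ennreal (indicator (tball z r) w *\<^sub>R cmod (f' w - avg z) powr p))) = X z (avg z)"
			unfolding X_def by (intro nn_integral_cong) (auto simp: indicator_def)
		finally show ?thesis
			by (simp add: MO_def set_lebesgue_integral_def bergman_ball_eq[OF al z] tball_def[symmetric] mV[OF z] avg_def)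
	qed
	show ?thesis
	proof
		assume "f : BMO al s p r"
		then obtain K where K: "!!z. z : tube ==> MO al s p r f z <= K" by (auto simp: BMO_def bdd_above_def)
		define M where "M = (max K 0) powr p * v"
		show "mean_osc s p r f'"
			unfolding mean_osc_def N_def[symmetric]
		proof (intro exI[of _ M] conjI ballI)
			show "M >= 0" using v(1) by (simp add: M_def)
			fix z :: "'n cvec" assume z: "z : tube"
			define x where "x = enn2real (X z (avg z))"
			have x: "x >= 0" "X z (avg z) = ennreal x" using Xfin[OF z, of "avg z"] by (auto simp: x_def)
			have "(x / (v * rho z powr N)) powr (1 / p) <= max K 0" using K[OF z] unfolding MO[OF z] x_def by simp
			hence "((x / (v * rho z powr N)) powr (1 / p)) powr p <= (max K 0) powr p" using p by (intro powr_mono2) auto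
			hence "x / (v * rho z powr N) <= (max K 0) powr p" using p x v(1) rN[OF z] by (simp add: powr_powr)
			hence "x <= M * rho z powr N" using v(1) rN[OF z] by (simp add: M_def pos_divide_le_eq mult.assoc)
			thus "\<exists>c. (NI (W s) (%w. indicator (tball z r) w * ennreal (cmod (f' w - c) powr p))) <= ennreal (M * rho z powr N)"
				using x(2) unfolding X_def by (intro exI[of _ "avg z"]) (simp add: ennreal_leI)
		qed
	next
		assume "mean_osc s p r f'"
		then obtain M where M: "M >= 0" "!!z. z : tube ==> \<exists>c. X z c <= ennreal (M * rho z powr N)"
			unfolding mean_osc_def N_def[symmetric] X_def by blast
		define K where "K = (2 powr p * (1 + M / v) powr p + 2 powr p * M / v) powr (1 / p)"
		have "MO al s p r f z <= K" if z: "z : tube" for z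
		proof -
			obtain c where c: "X z c <= ennreal (M * rho z powr N)" using M(2)[OF z] by blast
			have T[measurable]: "tball z r : sets borel" by (rule tball_borel[OF z])
			have vr: "v * rho z powr N > 0" using v(1) rN[OF z] by simp
			have i1: "integrable (W s) (%w. indicator (tball z r) w *\<^sub>R f' w)"
			proof (rule Bochner_Integration.integrable_bound[OF integrable_tball[OF s p z f' f'i]])
				show "(%w. indicator (tball z r) w *\<^sub>R f' w) : borel_measurable (W s)" unfolding borel_measurable_W by measurable
			qed (auto simp: indicator_def)
			have i2: "integrable (W s) (%w. indicator (tball z r) w *\<^sub>R c)"
				using v(2)[OF z] by (intro integrable_scaleR_left) (simp add: integrable_indicator_iff)
			have "(LINT w|W s. indicator (tball z r) w *\<^sub>R f' w - indicator (tball z r) w *\<^sub>R c)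
					= (LINT w|W s. indicator (tball z r) w *\<^sub>R f' w) - (measure (W s) (tball z r)) *\<^sub>R c"
				using i1 i2 v(2)[OF z] by (simp add: Bochner_Integration.integral_diff)
			note J = this
			have mW: "measure (W s) (tball z r) = v * rho z powr N" using vr by (simp add: measure_def v(2)[OF z])
			have gen: "(x / of_real m - b) * of_real m = x - m *\<^sub>R b" if "m > 0" for x b :: complex and m :: real
				using that by (simp add: scaleR_conv_of_real field_simps)
			have e: "(avg z - c) * of_real (v * rho z powr N) = (LINT w|W s. indicator (tball z r) w *\<^sub>R f' w - indicator (tball z r) w *\<^sub>R c)"
				unfolding avg[OF z] gen[OF vr] by (simp only: J mW)
			have "ennreal (cmod (avg z - c) * (v * rho z powr N)) = ennreal (cmod ((avg z - c) * of_real (v * rho z powr N)))"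
				using vr by (simp only: norm_mult norm_of_real abs_of_pos)
			also have "... <= (NI (W s) (%w. ennreal (norm (indicator (tball z r) w *\<^sub>R f' w - indicator (tball z r) w *\<^sub>R c))))"
				unfolding e by (rule integral_norm_bound_ennreal[OF Bochner_Integration.integrable_diff[OF i1 i2]])
			also have "... <= (NI (W s) (%w. indicator (tball z r) w * ennreal (1 + 1 * cmod (f' w - c) powr p)))"
			proof (rule nn_integral_mono)
				fix w
				show "ennreal (norm (indicator (tball z r) w *\<^sub>R f' w - indicator (tball z r) w *\<^sub>R c)) <= indicator (tball z r) w * ennreal (1 + 1 * cmod (f' w - c) powr p)"
					using le_add_powr[of "cmod (f' w - c)" 1 p] p by (auto simp: indicator_def intro!: ennreal_leI simp del: ennreal_plus)
			qed
			also have "... = ennreal 1 * emeasure (W s) (tball z r) + ennreal 1 * X z c"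
				unfolding X_def by (rule nn_integral_tball_add[OF z]) auto
			also have "... <= ennreal (v * rho z powr N) + ennreal (M * rho z powr N)"
				using c by (intro add_mono) (simp_all add: v(2)[OF z])
			also have "... = ennreal ((v + M) * rho z powr N)"
				using v(1) M(1) by (simp add: ennreal_plus[symmetric] distrib_right del: ennreal_plus)
			finally have "cmod (avg z - c) * (v * rho z powr N) <= (v + M) * rho z powr N"
				using v(1) M(1) by simp
			hence "cmod (avg z - c) * v <= v + M" using rN[OF z] by (simp flip: mult.assoc)
			hence ac: "cmod (avg z - c) <= 1 + M / v" using v(1) by (simp add: field_simps)
			have "X z (avg z) <= ennreal (2 powr p * cmod (c - avg z) powr p) * ennreal (v * rho z powr N) + ennreal (2 powr p) * ennreal (M * rho z powr N)"
				using Xadd[OF z, of "avg z" c] add_left_mono[OF mult_left_mono[OF c, of "ennreal (2 powr p)"]] by (meson order.trans zero_le)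
			also have "... = ennreal ((2 powr p * cmod (c - avg z) powr p + 2 powr p * M / v) * (v * rho z powr N))"
				using v(1) M(1) by (simp add: ennreal_mult[symmetric] ennreal_plus[symmetric] distrib_right del: ennreal_plus)
			finally have "enn2real (X z (avg z)) <= (2 powr p * cmod (c - avg z) powr p + 2 powr p * M / v) * (v * rho z powr N)"
				using v(1) M(1) by (intro enn2real_leI) auto
			hence "enn2real (X z (avg z)) / (v * rho z powr N) <= 2 powr p * cmod (c - avg z) powr p + 2 powr p * M / v"
				using vr by (simp add: pos_divide_le_eq)
			also have "... <= 2 powr p * (1 + M / v) powr p + 2 powr p * M / v"
				using ac p by (intro add_right_mono mult_left_mono powr_mono2) (auto simp: norm_minus_commute)
			finally show ?thesis
				unfolding MO[OF z] K_def using p vr by (intro powr_mono2) (auto intro!: divide_nonneg_pos)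
		qed
		hence "bdd_above (MO al s p r f ` tube)" by (intro bdd_aboveI2)
		thus "f : BMO al s p r" using f by (simp add: BMO_def)
	qed
qed

text \<open>In one direction the value \<open>f1 z\<close> serves as the constant on the ball about
  \<open>z\<close>. In the other, \<open>f1\<close> is built from \<open>f'\<close>, and the null
  set where \<open>f\<close> and \<open>f'\<close> differ is absorbed by
  \<open>f2 = f - f1\<close>.\<close>

lemma decomposition_iff_mean_osc:
	fixes f f' :: "'n::{finite,linorder} cvec => complex"
	assumes al: "al > -1" and s: "s > -1" and r: "r > 0" and p: "p >= 1" and f: "f : Lp s p" and rep: "borel_rep f f'"
	shows "(\<exists>f1\<in>BO al r. \<exists>f2\<in>BA al s p r. \<forall>z\<in>tube. f z = f1 z + f2 z) \<longleftrightarrow> mean_osc s p r f'"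
proof -
	define N where "N = real CARD('n) + 1 + s"
	have f'[measurable]: "f' : BM" using rep by (simp add: borel_rep_def)
	have f'i: "integrable (W s) (%w. cmod (f' w) powr p)"
		using f integral_V_rep(2)[OF rep, of "%_ x. cmod x powr p" s] by (simp add: Lp_def split_def)
	obtain v where v: "v > 0" "!!z :: 'n cvec. z : tube ==> emeasure (W s) (tball z r) = ennreal (v * rho z powr N)"
		unfolding N_def using emeasure_tball[OF s r, where 'n='n] by blast
	have rN: "rho z powr N > 0" if "z : tube" for z :: "'n cvec" using that by (simp add: tube_iff)
	have eV: "emeasure (V s) (tball z r) = ennreal (v * rho z powr N)" if "z : tube" for z :: "'n cvec"
		by (simp add: emeasure_V_tball(2)[OF that] v(2)[OF that])
	have ball: "bergman_ball al z r = tball z r" if "z : tube" for z :: "'n cvec"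
		by (simp add: bergman_ball_eq[OF al that] tball_def)
	show ?thesis
	proof
		assume "\<exists>f1\<in>BO al r. \<exists>f2\<in>BA al s p r. \<forall>z\<in>tube. f z = f1 z + f2 z"
		then obtain f1 f2 where f1: "f1 : BO al r" and f2: "f2 : BA al s p r" and eq: "!!z. z : tube ==> f z = f1 z + f2 z" by blast
		obtain M1 where M1: "!!z w. z : tube ==> w : tball z r ==> cmod (f1 z - f1 w) <= M1"
			using f1 ball unfolding BO_def by force
		have M10: "M1 >= 0" using M1[OF bpt_in_tube center_in_tball[OF bpt_in_tube r]] by simp
		have f2m: "f2 : borel_measurable (V s)" using f2 by (simp add: BA_def)
		obtain M2 where M2: "!!z. z : tube ==> (\<integral>\<^sup>+w\<in>tball z r. ennreal (cmod (f2 w) powr p) \<partial>V s) / ennreal (v * rho z powr N) <= ennreal M2"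
			using f2 ball eV unfolding BA_def by force
		define M where "M = 2 powr p * M1 powr p * v + 2 powr p * (max M2 0 * v)"
		show "mean_osc s p r f'"
			unfolding mean_osc_def N_def[symmetric]
		proof (intro exI[of _ M] conjI ballI)
			show "M >= 0" using v(1) by (simp add: M_def)
			fix z :: "'n cvec" assume z: "z : tube"
			have vr: "v * rho z powr N > 0" using v(1) rN[OF z] by simp
			have TV: "tball z r : sets (V s)" by (rule emeasure_V_tball(1)[OF z])
			have T[measurable]: "tball z r : sets borel" by (rule tball_borel[OF z])
			define Y where "Y = (\<integral>\<^sup>+w\<in>tball z r. ennreal (cmod (f2 w) powr p) \<partial>V s)"
			\<comment> \<open>The average in \<open>BA\<close> is an extended real; its finite bound rules
			  out the value infinity.\<close>
			have Y: "Y <= ennreal (max M2 0 * (v * rho z powr N))"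
			proof (cases Y)
				case (real y)
				have "ennreal (y / (v * rho z powr N)) <= ennreal M2"
					using M2[OF z] vr real(1) unfolding Y_def[symmetric] real(2) by (simp add: divide_ennreal)
				also have "... <= ennreal (max M2 0)" by (rule ennreal_leI) simp
				finally have "y / (v * rho z powr N) <= max M2 0" by simp
				hence "y <= max M2 0 * (v * rho z powr N)" using vr by (simp add: pos_divide_le_eq)
				thus ?thesis unfolding real(2) by (rule ennreal_leI)
			next
				case top
				thus ?thesis using M2[OF z] vr unfolding Y_def[symmetric] by (simp add: ennreal_top_divide top_unique)
			qed
			have m2: "(%w. ennreal (cmod (f2 w) powr p) * indicator (tball z r) w) : borel_measurable (V s)"
				using f2m TV by measurable
			have mi: "(%w. ennreal (2 powr p * M1 powr p) * indicator (tball z r) w) : borel_measurable (V s)"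
				using TV by measurable
			have "(NI (W s) (%w. indicator (tball z r) w * ennreal (cmod (f' w - f1 z) powr p)))
				= (NI (V s) (%w. indicator (tball z r) w * ennreal (cmod (f w - f1 z) powr p)))"
				by (rule nn_integral_V_rep[OF rep, of "%w x. indicator (tball z r) w * ennreal (cmod (x - f1 z) powr p)", symmetric]) measurable
			also have "... <= (NI (V s) (%w. ennreal (2 powr p * M1 powr p) * indicator (tball z r) w + ennreal (2 powr p) * (ennreal (cmod (f2 w) powr p) * indicator (tball z r) w)))"
			proof (rule nn_integral_mono)
				fix w
				show "indicator (tball z r) w * ennreal (cmod (f w - f1 z) powr p)
					<= ennreal (2 powr p * M1 powr p) * indicator (tball z r) w + ennreal (2 powr p) * (ennreal (cmod (f2 w) powr p) * indicator (tball z r) w)"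
				proof (cases "w : tball z r")
					case True
					have "cmod (f w - f1 z) <= M1 + cmod (f2 w)"
						using eq[OF tball_in_tube[OF True]] M1[OF z True] norm_triangle_ineq[of "f1 w - f1 z" "f2 w"]
						by (simp add: norm_minus_commute algebra_simps)
					hence "cmod (f w - f1 z) powr p <= (M1 + cmod (f2 w)) powr p" using p by (intro powr_mono2) auto
					also have "... <= 2 powr p * (M1 powr p + cmod (f2 w) powr p)" using p M10 by (intro powr_add_le) auto
					finally show ?thesis using True
						by (simp add: ennreal_mult[symmetric] ennreal_plus[symmetric] ennreal_leI distrib_left del: ennreal_plus)
				qed simp
			qed
			also have "... = ennreal (2 powr p * M1 powr p) * ennreal (v * rho z powr N) + ennreal (2 powr p) * Y"
				unfolding Y_def using m2 mi TV by (simp add: nn_integral_add nn_integral_cmult nn_integral_cmult_indicator eV[OF z])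
			also have "... <= ennreal (2 powr p * M1 powr p) * ennreal (v * rho z powr N) + ennreal (2 powr p) * ennreal (max M2 0 * (v * rho z powr N))"
				by (intro add_left_mono mult_left_mono Y) simp
			also have "... = ennreal (M * rho z powr N)"
				using v(1) by (simp add: M_def ennreal_mult[symmetric] ennreal_plus[symmetric] distrib_right mult.assoc del: ennreal_plus)
			finally show "\<exists>c. (NI (W s) (%w. indicator (tball z r) w * ennreal (cmod (f' w - c) powr p))) <= ennreal (M * rho z powr N)" by blast
		qed
	next
		assume mo: "mean_osc s p r f'"
		show "\<exists>f1\<in>BO al r. \<exists>f2\<in>BA al s p r. \<forall>z\<in>tube. f z = f1 z + f2 z"
		proof (rule mean_osc_imp_decomposition[OF s r p f' f'i mo])
			fix f1 M1 M2
			assume f1: "continuous_on tube f1" and f1m[measurable]: "f1 : BM" and M2: "M2 >= 0"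
				and osc: "!!x y. x : tube ==> y : tball x r ==> cmod (f1 x - f1 y) <= M1"
				and f2: "!!z. z : tube ==> (NI (W s) (%w. indicator (tball z r) w * ennreal (cmod (f' w - f1 w) powr p))) <= ennreal (M2 * rho z powr (real CARD('n) + 1 + s))"
		have "f1 : BO al r" using f1 osc ball by (force simp: BO_def)
		moreover have "(%w. f w - f1 w) : BA al s p r"
			unfolding BA_def
		proof (intro CollectI conjI exI[of _ "M2 / v"] ballI)
			show "(%w. f w - f1 w) : borel_measurable (V s)"
				by (rule integral_V_rep(3)[OF rep, of "%w x. x - f1 w"]) measurable
			fix z :: "'n cvec" assume z: "z : tube"
			have vr: "v * rho z powr N > 0" using v(1) rN[OF z] by simp
			have T[measurable]: "tball z r : sets borel" by (rule tball_borel[OF z])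
			have "(\<integral>\<^sup>+w\<in>tball z r. ennreal (cmod (f w - f1 w) powr p) \<partial>V s) = (NI (W s) (%w. ennreal (cmod (f' w - f1 w) powr p) * indicator (tball z r) w))"
				by (rule nn_integral_V_rep[OF rep, of "%w x. ennreal (cmod (x - f1 w) powr p) * indicator (tball z r) w"]) measurable
			also have "... <= ennreal (M2 * rho z powr N)" using f2[OF z] by (simp add: N_def mult.commute)
			finally have "(\<integral>\<^sup>+w\<in>tball z r. ennreal (cmod (f w - f1 w) powr p) \<partial>V s) / ennreal (v * rho z powr N) <= ennreal (M2 * rho z powr N) / ennreal (v * rho z powr N)"
				by (rule divide_right_mono_ennreal)
			also have "... = ennreal (M2 / v)" using M2 v(1) rN[OF z] vr by (simp add: divide_ennreal)
			finally show "(\<integral>\<^sup>+w\<in>bergman_ball al z r. ennreal (cmod (f w - f1 w) powr p) \<partial>V s) / emeasure (V s) (bergman_ball al z r) <= ennreal (M2 / v)"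
				by (simp add: ball[OF z] eV[OF z])
		qed
		ultimately show "\<exists>f1\<in>BO al r. \<exists>f2\<in>BA al s p r. \<forall>z\<in>tube. f z = f1 z + f2 z" by force
		qed
	qed
qed

section \<open>Hankel operators of Lebesgue measurable symbols\<close>

text \<open>A change of \<open>f\<close> on a null set affects the projection nowhere on the tube,
  and the product only on that null set.\<close>

lemma hankel_rep:
	fixes f f' g g1 :: "'n::{finite,linorder} cvec => complex"
	assumes rep: "borel_rep f f'" and g1[measurable]: "g1 : BM" and g: "!!w. w : tube ==> g w = g1 w"
	shows "borel_rep (hankel al f g) (%z. f' z * g1 z - Pk al (%w. f' w * g1 w) z)"
proof -
	have f'[measurable]: "f' : BM" using rep by (simp add: borel_rep_def)
	have proj: "bergman_proj al (%w. f w * g w) z = Pk al (%w. f' w * g1 w) z" if z: "z : tube" for z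
	proof -
		let ?r = "%w. rpowr (rho_ker z w) (- (real CARD('n) + 1 + al))"
		have "bergman_proj al (%w. f w * g w) z = (LINT w|V al. of_real (berg_const al CARD('n)) * (?r w * (f w * g1 w)))"
			unfolding bergman_proj_def
			by (intro Bochner_Integration.integral_cong refl)
				 (use Re_rho_ker_pos[OF z] in \<open>auto simp: g bergman_kernel_def berg_const_def rpowr_def\<close>)
		also have "... = (LINT w|W al. of_real (berg_const al CARD('n)) * (?r w * (f' w * g1 w)))"
			by (rule integral_V_rep(1)[OF rep, of "%w x. of_real (berg_const al CARD('n)) * (?r w * (x * g1 w))"]) measurable
		finally show ?thesis by (simp add: Pk_def)
	qed
	have e: "hankel al f g z = f z * g1 z - Pk al (%w. f' w * g1 w) z" if "z : tube" for z
		using that by (simp add: hankel_def g proj)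
	have [measurable]: "(%w. f' w * g1 w) : BM" by measurable
	have "(%z. f z * g1 z - Pk al (%w. f' w * g1 w) z) : borel_measurable (V al)"
		by (rule integral_V_rep(3)[OF rep, of "%z x. x * g1 z - Pk al (%w. f' w * g1 w) z"]) measurable
	hence "hankel al f g : borel_measurable (V al)"
		by (subst measurable_cong[where g="%z. f z * g1 z - Pk al (%w. f' w * g1 w) z"]) (auto simp: e)
	moreover have "AE z in lebesgue_on tube. z : space (lebesgue_on tube)" by (rule AE_space)
	hence "AE z in lebesgue_on tube. hankel al f g z = f' z * g1 z - Pk al (%w. f' w * g1 w) z"
		using rep[unfolded borel_rep_def, THEN conjunct2, THEN conjunct2]
		by eventually_elim (simp add: e space_restrict_space)
	ultimately show ?thesis by (simp add: borel_rep_def borel_measurable_V)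
qed

text \<open>Passage from the integral estimate for Borel functions to norms; the constant becomes
  its \<open>p\<close>-th root.\<close>

lemma mean_osc_imp_hankel_bounded:
	fixes f f' :: "'n::{finite,linorder} cvec => complex"
	assumes al: "al > -1" and s: "s > -1" and r: "r > 0" and p: "1 <= p" and ps: "p * (al + 1) > s + 1"
		and rep: "borel_rep f f'" and f'i: "integrable (W s) (%w. cmod (f' w) powr p)" and mo: "mean_osc s p r f'"
	shows "hankel_bounded al s p f"
proof -
	have f'[measurable]: "f' : BM" using rep by (simp add: borel_rep_def)
	show ?thesis
	proof (rule mean_osc_imp_decomposition[OF s r p f' f'i mo])
		fix f1 M1 M2
		assume f1: "continuous_on tube f1" and f1m[measurable]: "f1 : BM" and M2: "M2 >= 0"
			and osc: "!!x y. x : tube ==> y : tball x r ==> cmod (f1 x - f1 y) <= M1"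
			and f2: "!!z. z : tube ==> (NI (W s) (%w. indicator (tball z r) w * ennreal (cmod (f' w - f1 w) powr p))) <= ennreal (M2 * rho z powr (real CARD('n) + 1 + s))"
	show "hankel_bounded al s p f"
	proof (rule hankel_estimate[OF al s r p ps f' f1m osc M2 f2])
		fix C :: real
		assume C: "C >= 0" "!!g K. holomorphic_Cn g tube ==> g : BM ==> (!!w. w : tube ==> cmod (g w) <= K) ==>
		 integrable (W s) (%w. cmod (g w) powr p) ==>
		 (NI (W s) (%z. ennreal (cmod (f' z * g z - Pk al (%w. f' w * g w) z) powr p))) <= ennreal C * (NI (W s) (%z. ennreal (cmod (g z) powr p)))"
	show "hankel_bounded al s p f"
		unfolding hankel_bounded_def
	proof (intro exI[of _ "C powr (1 / p)"] ballI impI)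
		fix g :: "'n cvec => complex" assume gA: "g : Ap s p" and gb: "bounded (g ` tube)"
		have gh: "holomorphic_Cn g tube" and gi: "integrable (V s) (%z. cmod (g z) powr p)" using gA by (auto simp: Ap_def Lp_def)
		obtain K where K: "\<forall>w\<in>tube. cmod (g w) <= K" using gb by (auto simp: bounded_iff)
		\<comment> \<open>\<open>g\<close> is unconstrained outside the tube; cutting it off there makes
		  it Borel.\<close>
		define g1 where "g1 = (%z. indicator tube z *\<^sub>R g z)"
		have g1m[measurable]: "g1 : BM"
			unfolding g1_def by (rule borel_measurable_continuous_on_indicator[OF _ holomorphic_Cn_imp_continuous_on[OF gh]]) simp
		have eq: "g w = g1 w" if "w : tube" for w using that by (simp add: g1_def)
		have g1h: "holomorphic_Cn g1 tube"
			unfolding holomorphic_Cn_def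
		proof
			fix z :: "'n cvec" assume z: "z : tube"
			then obtain D where "(g has_derivative D) (at z)" "\<forall>c v. D (c *s v) = c * D v" using gh unfolding holomorphic_Cn_def by blast
			moreover from this(1) have "(g1 has_derivative D) (at z)"
				by (rule has_derivative_transform_within_open[OF _ open_tube z]) (rule eq)
			ultimately show "\<exists>D. (g1 has_derivative D) (at z) \<and> (\<forall>c v. D (c *s v) = c * D v)" by blast
		qed
		have pm: "(%z. cmod (g1 z) powr p) : BM" by measurable
		have gi1: "integrable (V s) (%z. cmod (g1 z) powr p)"
			using gi by (rule Bochner_Integration.integrable_cong[THEN iffD1, rotated -1]) (auto simp: eq)
		hence g1i: "integrable (W s) (%z. cmod (g1 z) powr p)" using integral_V(2)[OF pm] by blast
		have gint: "(LINT z|V s. cmod (g z) powr p) = (LINT z|W s. cmod (g1 z) powr p)"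
			unfolding integral_V(1)[OF pm, symmetric] by (intro Bochner_Integration.integral_cong) (auto simp: eq)
		have hr: "borel_rep (hankel al f g) (%z. f' z * g1 z - Pk al (%w. f' w * g1 w) z)"
			by (rule hankel_rep[OF rep g1m eq])
		let ?H = "%z. f' z * g1 z - Pk al (%w. f' w * g1 w) z"
		have Hm: "?H : BM" using hr by (simp add: borel_rep_def)
		have "(NI (W s) (%z. ennreal (cmod (?H z) powr p))) <= ennreal C * (NI (W s) (%z. ennreal (cmod (g1 z) powr p)))"
			by (rule C(2)[OF g1h g1m _ g1i, of K]) (use K eq in auto)
		also have "... = ennreal (C * (LINT z|W s. cmod (g1 z) powr p))"
			using C(1) by (simp add: nn_integral_eq_integral[OF g1i] ennreal_mult)
		finally have le: "(NI (W s) (%z. ennreal (cmod (?H z) powr p))) <= ennreal (C * (LINT z|W s. cmod (g1 z) powr p))" .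
		have Hi: "integrable (W s) (%z. cmod (?H z) powr p)"
		proof (rule integrableI_bounded)
			show "(%z. cmod (?H z) powr p) : borel_measurable (W s)" unfolding borel_measurable_W using Hm by measurable
			show "(NI (W s) (%z. ennreal (norm (cmod (?H z) powr p)))) < \<infinity>" using le by (simp add: le_less_trans)
		qed
		have I0: "(LINT z|W s. cmod (g1 z) powr p) >= 0" "(LINT z|W s. cmod (?H z) powr p) >= 0" by (auto intro!: integral_nonneg_AE)
		have Hle: "(LINT z|W s. cmod (?H z) powr p) <= C * (LINT z|W s. cmod (g1 z) powr p)"
			using le C(1) I0 by (simp add: nn_integral_eq_integral[OF Hi])
		have hl: "(LINT z|V s. cmod (hankel al f g z) powr p) = (LINT z|W s. cmod (?H z) powr p)"
			by (rule integral_V_rep(1)[OF hr, of "%_ x. cmod x powr p"]) (simp add: split_def)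
		have "integrable (V s) (%z. cmod (hankel al f g z) powr p)"
			using Hi integral_V_rep(2)[OF hr, of "%_ x. cmod x powr p"] by (simp add: split_def)
		moreover have "hankel al f g : borel_measurable (V s)" using hr by (simp add: borel_rep_def borel_measurable_V)
		ultimately have 1: "hankel al f g : Lp s p" by (simp add: Lp_def)
		have "Lp_norm s p (hankel al f g) <= (C * (LINT z|W s. cmod (g1 z) powr p)) powr (1 / p)"
			unfolding Lp_norm_def hl using Hle I0 p by (intro powr_mono2) auto
		also have "... = C powr (1 / p) * Lp_norm s p g" using C(1) I0 by (simp add: Lp_norm_def gint powr_mult)
		finally show "hankel al f g : Lp s p \<and> Lp_norm s p (hankel al f g) <= C powr (1 / p) * Lp_norm s p g" using 1 by blast
	qed
	qed
	qed
qed

lemma hankel_bounded_imp_bound: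
	fixes f f' :: "'n::{finite,linorder} cvec => complex"
	assumes p: "1 <= p" and rep: "borel_rep f f'" and hb: "hankel_bounded al s p f"
	obtains C where "C >= 0" "!!g K. holomorphic_Cn g tube ==> g : BM ==> (!!w. w : tube ==> cmod (g w) <= K) ==>
		 integrable (W s) (%w. cmod (g w) powr p) ==>
		 (NI (W s) (%z. ennreal (cmod (f' z * g z - Pk al (%w. f' w * g w) z) powr p))) <= ennreal C * (NI (W s) (%z. ennreal (cmod (g z) powr p)))"
proof -
	obtain C where C: "!!g. g : Ap s p ==> bounded (g ` tube) ==> hankel al f g : Lp s p \<and> Lp_norm s p (hankel al f g) <= C * Lp_norm s p g"
		using hb unfolding hankel_bounded_def by blast
	\<comment> \<open>The constant in \<open>hankel_bounded\<close> may be negative, hence the maximum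
	  with 0.\<close>
	show ?thesis
	proof (rule that[of "(max C 0) powr p"])
		fix g :: "'n cvec => complex" and K
		assume gh: "holomorphic_Cn g tube" and gm[measurable]: "g : BM"
			and K: "!!w. w : tube ==> cmod (g w) <= K" and gi: "integrable (W s) (%w. cmod (g w) powr p)"
		have pm: "(%z. cmod (g z) powr p) : BM" by measurable
		have "g : Ap s p" using gh gi borel_imp_V[OF gm] integral_V(2)[OF pm] by (simp add: Ap_def Lp_def)
		moreover have "bounded (g ` tube)" using K by (auto simp: bounded_iff)
		ultimately have H: "hankel al f g : Lp s p" "Lp_norm s p (hankel al f g) <= C * Lp_norm s p g" using C by auto
		let ?H = "%z. f' z * g z - Pk al (%w. f' w * g w) z"
		have hr: "borel_rep (hankel al f g) ?H" by (rule hankel_rep[OF rep gm refl])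
		define x where "x = (LINT z|W s. cmod (?H z) powr p)"
		define y where "y = (LINT z|W s. cmod (g z) powr p)"
		have x0: "x >= 0" "y >= 0" unfolding x_def y_def by (auto intro!: integral_nonneg_AE)
		have hl: "(LINT z|V s. cmod (hankel al f g z) powr p) = x"
			unfolding x_def by (rule integral_V_rep(1)[OF hr, of "%_ x. cmod x powr p"]) (simp add: split_def)
		have Hi: "integrable (W s) (%z. cmod (?H z) powr p)"
			using H(1) integral_V_rep(2)[OF hr, of "%_ x. cmod x powr p"] by (simp add: Lp_def split_def)
		have "x powr (1 / p) <= C * y powr (1 / p)"
			using H(2) by (simp add: Lp_norm_def hl y_def integral_V(1)[OF pm])
		also have "... <= max C 0 * y powr (1 / p)" by (intro mult_right_mono) auto
		finally have "(x powr (1 / p)) powr p <= (max C 0 * y powr (1 / p)) powr p" using p by (intro powr_mono2) auto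
		hence "x <= (max C 0) powr p * y" using p x0 by (simp add: powr_mult powr_powr)
		thus "(NI (W s) (%z. ennreal (cmod (?H z) powr p))) <= ennreal ((max C 0) powr p) * (NI (W s) (%z. ennreal (cmod (g z) powr p)))"
			using x0 by (simp add: nn_integral_eq_integral[OF Hi] nn_integral_eq_integral[OF gi] x_def[symmetric] y_def[symmetric] ennreal_mult[symmetric] ennreal_leI)
	qed simp
qed

theorem theoremA:
	fixes \<alpha> s r p :: real
		and f :: "'n::{finite,linorder} cvec \<Rightarrow> complex"
	assumes "\<alpha> > -1" and "s > -1" and "r > 0" and "1 \<le> p"
		and "p * (\<alpha> + 1) > s + 1"
		and "f \<in> Lp s p"
	shows "(f \<in> BMO \<alpha> s p r
						\<longleftrightarrow> (\<exists>f1\<in>BO \<alpha> r. \<exists>f2\<in>BA \<alpha> s p r. \<forall>z\<in>tube. f z = f1 z + f2 z))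
			 \<and> (f \<in> BMO \<alpha> s p r
						\<longleftrightarrow> hankel_bounded \<alpha> s p f \<and> hankel_bounded \<alpha> s p (\<lambda>z. cnj (f z)))"
proof -
	note al = assms(1) and s = assms(2) and r = assms(3) and p = assms(4) and ps = assms(5) and f = assms(6)
	obtain f' where rep: "borel_rep f f'"
		using f by (auto simp: Lp_def intro: ex_borel_rep)
	have f': "f' \<in> borel_measurable borel" using rep by (simp add: borel_rep_def)
	have f'i: "integrable (W s) (\<lambda>w. cmod (f' w) powr p)"
		using f integral_V_rep(2)[OF rep, of "\<lambda>_ x. cmod x powr p" s] by (simp add: Lp_def split_def)
	have "mean_osc s p r f'" if hb1: "hankel_bounded \<alpha> s p f" and hb2: "hankel_bounded \<alpha> s p (\<lambda>z. cnj (f z))"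
	proof (rule hankel_bounded_imp_bound[OF p rep hb1])
		fix C1 :: real
			assume C1: "C1 \<ge> 0" "\<And>g K. holomorphic_Cn g tube \<Longrightarrow> g \<in> borel_measurable borel \<Longrightarrow> (\<And>w. w \<in> tube \<Longrightarrow> cmod (g w) \<le> K) \<Longrightarrow>
		 integrable (W s) (\<lambda>w. cmod (g w) powr p) \<Longrightarrow>
		 (\<integral>\<^sup>+z. ennreal (cmod (f' z * g z - Pk \<alpha> (\<lambda>w. f' w * g w) z) powr p) \<partial>W s) \<le> ennreal C1 * (\<integral>\<^sup>+z. ennreal (cmod (g z) powr p) \<partial>W s)"
		show "mean_osc s p r f'"
		proof (rule hankel_bounded_imp_bound[OF p borel_rep_cnj[OF rep] hb2])
			fix C2 :: real
			assume C2: "C2 \<ge> 0" "\<And>g K. holomorphic_Cn g tube \<Longrightarrow> g \<in> borel_measurable borel \<Longrightarrow> (\<And>w. w \<in> tube \<Longrightarrow> cmod (g w) \<le> K) \<Longrightarrow>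
		 integrable (W s) (\<lambda>w. cmod (g w) powr p) \<Longrightarrow>
		 (\<integral>\<^sup>+z. ennreal (cmod (cnj (f' z) * g z - Pk \<alpha> (\<lambda>w. cnj (f' w) * g w) z) powr p) \<partial>W s) \<le> ennreal C2 * (\<integral>\<^sup>+z. ennreal (cmod (g z) powr p) \<partial>W s)"
		show "mean_osc s p r f'"
		proof (rule hankel_bound_imp_mean_osc[OF al s r p ps f' f'i, of "C1 + C2"])
			fix k g :: "'n cvec \<Rightarrow> complex" and K
			assume k: "k = f' \<or> k = (\<lambda>w. cnj (f' w))" and g: "holomorphic_Cn g tube" "g \<in> borel_measurable borel"
				"\<And>w. w \<in> tube \<Longrightarrow> cmod (g w) \<le> K" "integrable (W s) (\<lambda>w. cmod (g w) powr p)"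
			\<comment> \<open>A single constant has to serve \<open>f'\<close> and its conjugate.\<close>
			have "ennreal C1 * (\<integral>\<^sup>+z. ennreal (cmod (g z) powr p) \<partial>W s) \<le> ennreal (C1 + C2) * (\<integral>\<^sup>+z. ennreal (cmod (g z) powr p) \<partial>W s)"
				"ennreal C2 * (\<integral>\<^sup>+z. ennreal (cmod (g z) powr p) \<partial>W s) \<le> ennreal (C1 + C2) * (\<integral>\<^sup>+z. ennreal (cmod (g z) powr p) \<partial>W s)"
				using C1(1) C2(1) by (intro mult_right_mono ennreal_leI; simp)+
			thus "(\<integral>\<^sup>+z. ennreal (cmod (k z * g z - Pk \<alpha> (\<lambda>w. k w * g w) z) powr p) \<partial>W s) \<le> ennreal (C1 + C2) * (\<integral>\<^sup>+z. ennreal (cmod (g z) powr p) \<partial>W s)"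
				using k order.trans[OF C1(2)[OF g]] order.trans[OF C2(2)[OF g]] by auto
		qed (use C1(1) C2(1) in simp)
		qed
	qed
	moreover have "hankel_bounded \<alpha> s p f \<and> hankel_bounded \<alpha> s p (\<lambda>z. cnj (f z))" if mo: "mean_osc s p r f'"
		using mean_osc_imp_hankel_bounded[OF al s r p ps rep f'i mo]
			mean_osc_imp_hankel_bounded[OF al s r p ps borel_rep_cnj[OF rep] _ mean_osc_cnj[OF mo]] f'i by simp
	ultimately show ?thesis
		using BMO_iff_mean_osc[OF al s r p f rep] decomposition_iff_mean_osc[OF al s r p f rep] by blast
qed

end
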